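(* Let $A$ be a quadratic algebra over a field $\Bbbk$, endowed with a connected resolving datum with set of quadratic modules $\{M^0=\Bbbk,M^1,\dots,M^N\}$ and map $h:\{0,\dots,N\}^2\times\mathbb N^2\to\mathbb N_0^2$, and let $Q$ be the associated resolving quiver. For $i\in\{0,\dots,N\}$ let $\mathrm{Pa}_{M^i}$ be the set of all paths $\bar\alpha$ of $Q$ (including the path of length zero) with source $s(\bar\alpha)=M^i$. Then, for every $i\in\{0,\dots,N\}$, there exists a projective resolution $P^{M^i}_\bullet$ of $M^i$ in the category of bounded below graded right $A$-modules such that for all $n\in\mathbb N_0$ $$P^{M^i}_n=\bigoplus_{\substack{\bar\alpha\in \mathrm{Pa}_{M^i}\\ \mathrm{bideg}_1(\bar\alpha)\le n}}\bar\alpha.\,K^{\mathrm{mod}}_{n-\mathrm{bideg}_1(\bar\alpha)}\big(t(\bar\alpha)\big)\big(-\mathrm{bideg}_2(\bar\alpha)\big),$$ where the symbol $\bar\alpha$ on the left of each summand is only a formal bookkeeping label. Moreover, if $$\mathrm{dfdeg}(\bar\alpha)\neq \mathrm{dfdeg}(\bar\beta)-1$$ for all $\bar\alpha,\bar\beta\in \mathrm{Pa}_{M^i}$ such that $\bar\alpha<\bar\beta$ (for instance, if $\mathrm{dfdeg}(\alpha)$ is even for all arrows $\alpha$ of $Q$), then this projective resolution is minimal.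
   Context: $\mathbb N=\{1,2,\dots\}$, $\mathbb N_0=\mathbb N\cup\{0\}$; modules are right modules. Quadratic algebras and modules. A quadratic algebra is $A=T(V)/(R)$ with $V$ a finite-dimensional $\Bbbk$-vector space in degree $1$ and $R\subseteq V\otimes V$. Its quadratic dual is $A^!=T(V^* )/(R^\perp)$, where $R^\perp\subseteq V^*\otimes V^*$ is the orthogonal of $R$ for the pairing $(f\otimes g)(u\otimes v)=f(u)g(v)$; write $A^!=\bigoplus_{n\ge0}A^!_{-n}$. For a graded module $M$, $M(j)_i=M_{i+j}$; morphisms of graded modules are homogeneous of degree $0$. A graded $A$-module $M=\bigoplus_{n\ge 0}M_n$ is quadratic if the map $V_M\otimes A\to M$ given by the action, $V_M=M_0$ (finite-dimensional), is surjective with kernel generated as an $A$-module by a subspace $R_M\subseteq V_M\otimes V$. The trivial module $\Bbbk$ is quadratic. The quadratic dual of $M$ is the graded right $A^!$-module $M^!=(V_M^*\otimes A^!)/(R_M^\perp A^!)=\bigoplus_{n\ge 0}M^!_{-n}$, with $R_M^\perp\subseteq V_M^*\otimes V^*$ the orthogonal of $R_M$. The space $\bigoplus_n (M^!_{-n})^*$ is a left $A^!$-module via $(y\cdot f)(w)=f(wy)$. The Koszul complex of $M$ is $K^{\mathrm{mod}}_n(M)=(M^!_{-n})^*\otimes A$ for $n\in\mathbb N_0$ (zero for $n<0$), with $(M^!_{-n})^*$ in internal degree $n$, and differential $d_{n+1}:K^{\mathrm{mod}}_{n+1}(M)\to K^{\mathrm{mod}}_{n}(M)$, $d(f\otimes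 a)=\sum_i (y_i\cdot f)\otimes x_ia$, where $\{x_i\}$ is a basis of $V$ and $\{y_i\}$ the dual basis of $V^*$. Resolving datum. A resolving datum on $A$ is a finite set $\{M^0,\dots,M^N\}$ ($N\in\mathbb N_0$) of pairwise non-isomorphic quadratic $A$-modules with $M^0=\Bbbk$, and a map $h:\{0,\dots,N\}^2\times\mathbb N^2\to\mathbb N_0^2$, with components $\pi_1h,\pi_2h$, such that: (1) $h$ has finite support; (2) for all $(i,k)\in\{0,\dots,N\}\times\mathbb N$ there is a short exact sequence of graded $A$-modules $$0\to\bigoplus_{j=0}^N\bigoplus_{\ell\in\mathbb N}\big(M^j(-\ell)\big)^{\pi_1h(i,j,k,\ell)}\to H_k(K^{\mathrm{mod}}_\bullet(M^i))\to\bigoplus_{j=0}^N\bigoplus_{\ell\in\mathbb N}\big(M^j(-\ell)\big)^{\pi_2h(i,j,k,\ell)}\to0;$$ (3) if this sequence splits for some $(i_0,k_0)$, then $\pi_1h(i_0,j,k_0,\ell)=0$ for all $j,\ell$. Resolving quiver. The associated resolving quiver $Q$ is the bigraded quiver with vertices $M^0,\dots,M^N$ whose set of arrows of bidegree $(d',d'')$ from $M^i$ to $M^j$ is the disjoint union of a set $\mathrm{Ar}'_{i,j,d',d''}$ of cardinality $\pi_1h(i,j,d'-1,d'')$ and a set $\mathrm{Ar}''_{i,j,d',d''}$ of cardinality $\pi_2h(i,j,d'-1,d'')$ (so $d'\geq 2$). The resolving datum is connected if $Q$ is connected. The set of arrows $\alpha$ with $s(\alpha)=M^i$ and $\mathrm{bideg}_1(\alpha)=d'$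 has the strict partial order in which exactly every element of $\mathrm{Ar}''_{i,j,d',d''}$ is strictly less than every element of $\mathrm{Ar}'_{i,j',d',d'''}$ (all $j,j',d'',d'''$). Paths. A path of length $n\ge1$ is a tuple $(\alpha_1,\dots,\alpha_n)$ of arrows with $t(\alpha_l)=s(\alpha_{l+1})$; its source is $s(\alpha_1)$, its target $t(\alpha_n)$ and its bidegree $(\mathrm{bideg}_1,\mathrm{bideg}_2)$ is the sum of those of its arrows. Paths of length $0$ are vertices, of bidegree $(0,0)$, with source and target the vertex itself. $\mathrm{dfdeg}=\mathrm{bideg}_2-\mathrm{bideg}_1$ for arrows and paths. Order on $\mathrm{Pa}_{M^i}$. The length-zero path at $M^i$ is strictly greater than any other path in $\mathrm{Pa}_{M^i}$. For $\bar\alpha=(\alpha_1,\dots,\alpha_n)$, $\bar\beta=(\beta_1,\dots,\beta_m)$ in $\mathrm{Pa}_{M^i}$ with $n,m\ge1$, $\bar\alpha<\bar\beta$ if there is $j_0\in\{0,\dots,\min(n,m)\}$ with $\alpha_j=\beta_j$ for all $1\le j\le j_0$ and one of the following holds: $n,m>j_0$, $\mathrm{bideg}_1(\alpha_{j_0+1})=\mathrm{bideg}_1(\beta_{j_0+1})$ and $\alpha_{j_0+1}<\beta_{j_0+1}$; or $n,m>j_0$ and $\mathrm{bideg}_1(\alpha_{j_0+1})<\mathrm{bideg}_1(\beta_{j_0+1})$; or $j_0=m<n$. *)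

theory Defs
  imports
    "HOL-Algebra.AbelCoset"
    "Jordan_Normal_Form.Missing_VectorSpace"
    "Graph_Theory.Graph_Theory"
begin

text \<open>
  Everything graded is graded externally: a graded object is a family of vector spaces indexed by
  \<open>int\<close>, and products and actions take the degrees of their arguments as extra parameters. Vector
  spaces are \<open>module\<close> records satisfying \<open>vectorspace\<close>; their ring-multiplication fields carry no
  meaning.
\<close>

section \<open>Linear algebra\<close>

definition ground_vs :: "'k ring \<Rightarrow> ('k, 'k) module" where
  "ground_vs K = \<lparr>carrier = carrier K, monoid.mult = monoid.mult K, one = one K, zero = zero K, add = add K,
     smult = monoid.mult K\<rparr>"

definition free_vs :: "'k ring \<Rightarrow> 's set \<Rightarrow> ('k, 's \<Rightarrow> 'k) module" where
  "free_vs K S =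
     \<lparr>carrier = {f \<in> UNIV \<rightarrow> carrier K. finite {s. f s \<noteq> \<zero>\<^bsub>K\<^esub>} \<and> {s. f s \<noteq> \<zero>\<^bsub>K\<^esub>} \<subseteq> S},
      monoid.mult = undefined, one = undefined, zero = (\<lambda>s. \<zero>\<^bsub>K\<^esub>), add = (\<lambda>f g s. f s \<oplus>\<^bsub>K\<^esub> g s),
      smult = (\<lambda>c f s. c \<otimes>\<^bsub>K\<^esub> f s)\<rparr>"

definition free_gen :: "'k ring \<Rightarrow> 's \<Rightarrow> 's \<Rightarrow> 'k" where
  "free_gen K s = (\<lambda>t. if t = s then \<one>\<^bsub>K\<^esub> else \<zero>\<^bsub>K\<^esub>)"

definition quot_vs :: "('k, 'u) module \<Rightarrow> 'u set \<Rightarrow> ('k, 'u set) module" where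
  "quot_vs U W =
     \<lparr>carrier = a_rcosets\<^bsub>U\<^esub> W, monoid.mult = undefined, one = undefined, zero = W,
      add = (\<lambda>X Y. X <+>\<^bsub>U\<^esub> Y), smult = (\<lambda>c X. \<Union>x\<in>X. W +>\<^bsub>U\<^esub> (c \<odot>\<^bsub>U\<^esub> x))\<rparr>"

definition rep :: "'u set \<Rightarrow> 'u" where
  "rep X = (SOME x. x \<in> X)"

definition dual_vs :: "'k ring \<Rightarrow> ('k, 'v) module \<Rightarrow> ('k, 'v \<Rightarrow> 'k) module" where
  "dual_vs K V =
     (ring.func_space K (carrier V))
       \<lparr>carrier := LinearCombinations.module_hom K V (ground_vs K) \<inter> extensional (carrier V)\<rparr>"

text \<open>
  Tensor products and tensor powers are quotients of free vector spaces by the multilinearity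
  relations. \<open>lift K P \<phi>\<close> is the linear map into \<open>P\<close> given by \<open>\<phi>\<close> on generators; it is only applied
  to \<open>\<phi>\<close> that respect the relations, so the choice of representative is immaterial.
\<close>

definition lift :: "'k ring \<Rightarrow> ('k, 'p) module \<Rightarrow> ('s \<Rightarrow> 'p) \<Rightarrow> ('s \<Rightarrow> 'k) set \<Rightarrow> 'p" where
  "lift K P \<phi> X = (\<Oplus>\<^bsub>P\<^esub>s\<in>{s. rep X s \<noteq> \<zero>\<^bsub>K\<^esub>}. rep X s \<odot>\<^bsub>P\<^esub> \<phi> s)"

definition tensor_rels ::
    "'k ring \<Rightarrow> ('k, 'u) module \<Rightarrow> ('k, 'w) module \<Rightarrow> ('u \<times> 'w \<Rightarrow> 'k) set" where
  "tensor_rels K U W = (let F = free_vs K (carrier U \<times> carrier W); g = free_gen K in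
       {g (u \<oplus>\<^bsub>U\<^esub> u', w) \<ominus>\<^bsub>F\<^esub> (g (u, w) \<oplus>\<^bsub>F\<^esub> g (u', w)) | u u' w.
          u \<in> carrier U \<and> u' \<in> carrier U \<and> w \<in> carrier W}
     \<union> {g (u, w \<oplus>\<^bsub>W\<^esub> w') \<ominus>\<^bsub>F\<^esub> (g (u, w) \<oplus>\<^bsub>F\<^esub> g (u, w')) | u w w'.
          u \<in> carrier U \<and> w \<in> carrier W \<and> w' \<in> carrier W}
     \<union> {g (c \<odot>\<^bsub>U\<^esub> u, w) \<ominus>\<^bsub>F\<^esub> (c \<odot>\<^bsub>F\<^esub> g (u, w)) | c u w.
          c \<in> carrier K \<and> u \<in> carrier U \<and> w \<in> carrier W}
     \<union> {g (u, c \<odot>\<^bsub>W\<^esub> w) \<ominus>\<^bsub>F\<^esub> (c \<odot>\<^bsub>F\<^esub> g (u, w)) | c u w.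
          c \<in> carrier K \<and> u \<in> carrier U \<and> w \<in> carrier W})"

definition tensor_null ::
    "'k ring \<Rightarrow> ('k, 'u) module \<Rightarrow> ('k, 'w) module \<Rightarrow> ('u \<times> 'w \<Rightarrow> 'k) set" where
  "tensor_null K U W =
     LinearCombinations.module.span K (free_vs K (carrier U \<times> carrier W)) (tensor_rels K U W)"

definition tensor ::
    "'k ring \<Rightarrow> ('k, 'u) module \<Rightarrow> ('k, 'w) module \<Rightarrow> ('k, ('u \<times> 'w \<Rightarrow> 'k) set) module" where
  "tensor K U W = quot_vs (free_vs K (carrier U \<times> carrier W)) (tensor_null K U W)"

definition tens ::
    "'k ring \<Rightarrow> ('k, 'u) module \<Rightarrow> ('k, 'w) module \<Rightarrow> 'u \<Rightarrow> 'w \<Rightarrow> ('u \<times> 'w \<Rightarrow> 'k) set" where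
  "tens K U W u w =
     tensor_null K U W +>\<^bsub>free_vs K (carrier U \<times> carrier W)\<^esub> free_gen K (u, w)"

text \<open>For \<open>n < 0\<close> there are no words of length \<open>n\<close>, so \<open>tensor_power K V n\<close> is the zero space.\<close>

definition words :: "('k, 'v) module \<Rightarrow> int \<Rightarrow> 'v list set" where
  "words V n = {vs. set vs \<subseteq> carrier V \<and> int (length vs) = n}"

definition word_rels :: "'k ring \<Rightarrow> ('k, 'v) module \<Rightarrow> int \<Rightarrow> ('v list \<Rightarrow> 'k) set" where
  "word_rels K V n = (let F = free_vs K (words V n); g = free_gen K in
       {g (us @ [v \<oplus>\<^bsub>V\<^esub> v'] @ ws) \<ominus>\<^bsub>F\<^esub> (g (us @ [v] @ ws) \<oplus>\<^bsub>F\<^esub> g (us @ [v'] @ ws)) | us v v' ws.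
          us @ [v] @ ws \<in> words V n \<and> v' \<in> carrier V}
     \<union> {g (us @ [c \<odot>\<^bsub>V\<^esub> v] @ ws) \<ominus>\<^bsub>F\<^esub> (c \<odot>\<^bsub>F\<^esub> g (us @ [v] @ ws)) | c us v ws.
          c \<in> carrier K \<and> us @ [v] @ ws \<in> words V n})"

definition word_null :: "'k ring \<Rightarrow> ('k, 'v) module \<Rightarrow> int \<Rightarrow> ('v list \<Rightarrow> 'k) set" where
  "word_null K V n = LinearCombinations.module.span K (free_vs K (words V n)) (word_rels K V n)"

definition tensor_power ::
    "'k ring \<Rightarrow> ('k, 'v) module \<Rightarrow> int \<Rightarrow> ('k, ('v list \<Rightarrow> 'k) set) module" where
  "tensor_power K V n = quot_vs (free_vs K (words V n)) (word_null K V n)"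

definition word_tens :: "'k ring \<Rightarrow> ('k, 'v) module \<Rightarrow> 'v list \<Rightarrow> ('v list \<Rightarrow> 'k) set" where
  "word_tens K V vs =
     word_null K V (int (length vs)) +>\<^bsub>free_vs K (words V (int (length vs)))\<^esub> free_gen K vs"


section \<open>Quadratic algebras\<close>

record ('k, 'a) galg =
  acomp :: "int \<Rightarrow> ('k, 'a) module"
  amult :: "int \<Rightarrow> int \<Rightarrow> 'a \<Rightarrow> 'a \<Rightarrow> 'a"
  aone :: 'a

definition tensor_alg :: "'k ring \<Rightarrow> ('k, 'v) module \<Rightarrow> ('k, ('v list \<Rightarrow> 'k) set) galg" where
  "tensor_alg K V =
     \<lparr>acomp = tensor_power K V,
      amult = (\<lambda>m n X Y. lift K (tensor_power K V (m + n))
        (\<lambda>us. lift K (tensor_power K V (m + n)) (\<lambda>vs. word_tens K V (us @ vs)) Y) X),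
      aone = word_tens K V []\<rparr>"

text \<open>The degree-\<open>n\<close> part of the two-sided ideal generated by a set \<open>R\<close> of elements of degree 2.\<close>

definition ideal2 :: "'k ring \<Rightarrow> ('k, 'a) galg \<Rightarrow> 'a set \<Rightarrow> int \<Rightarrow> 'a set" where
  "ideal2 K A R n = LinearCombinations.module.span K (acomp A n)
     {amult A (i + 2) j (amult A i 2 u r) w | i j u r w.
        i + 2 + j = n \<and> u \<in> carrier (acomp A i) \<and> r \<in> R \<and> w \<in> carrier (acomp A j)}"

definition galg_quot :: "('k, 'a) galg \<Rightarrow> (int \<Rightarrow> 'a set) \<Rightarrow> ('k, 'a set) galg" where
  "galg_quot A I =
     \<lparr>acomp = (\<lambda>n. quot_vs (acomp A n) (I n)),
      amult = (\<lambda>m n X Y. I (m + n) +>\<^bsub>acomp A (m + n)\<^esub> amult A m n (rep X) (rep Y)),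
      aone = I 0 +>\<^bsub>acomp A 0\<^esub> aone A\<rparr>"

text \<open>\<open>T(V)/(R)\<close>, with \<open>V \<otimes> V\<close> taken to be \<open>tensor_power K V 2\<close>.\<close>

definition quad_alg ::
    "'k ring \<Rightarrow> ('k, 'v) module \<Rightarrow> ('v list \<Rightarrow> 'k) set set \<Rightarrow> ('k, ('v list \<Rightarrow> 'k) set set) galg" where
  "quad_alg K V R = galg_quot (tensor_alg K V) (ideal2 K (tensor_alg K V) R)"

text \<open>The canonical map from \<open>V\<close> to the degree-1 component of \<open>T(V)/(R)\<close>.\<close>

definition quad_gen ::
    "'k ring \<Rightarrow> ('k, 'v) module \<Rightarrow> ('v list \<Rightarrow> 'k) set set \<Rightarrow> 'v \<Rightarrow> ('v list \<Rightarrow> 'k) set set" where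
  "quad_gen K V R v = ideal2 K (tensor_alg K V) R 1 +>\<^bsub>tensor_power K V 1\<^esub> word_tens K V [v]"

definition pairing2 ::
    "'k ring \<Rightarrow> (('v \<Rightarrow> 'k) list \<Rightarrow> 'k) set \<Rightarrow> ('v list \<Rightarrow> 'k) set \<Rightarrow> 'k" where
  "pairing2 K \<rho> r = lift K (ground_vs K)
     (\<lambda>fs. lift K (ground_vs K) (\<lambda>vs. (fs ! 0) (vs ! 0) \<otimes>\<^bsub>K\<^esub> (fs ! 1) (vs ! 1)) r) \<rho>"

definition perp ::
    "'k ring \<Rightarrow> ('k, 'v) module \<Rightarrow> ('v list \<Rightarrow> 'k) set set \<Rightarrow> (('v \<Rightarrow> 'k) list \<Rightarrow> 'k) set set" where
  "perp K V R =
     {\<rho> \<in> carrier (tensor_power K (dual_vs K V) 2). \<forall>r\<in>R. pairing2 K \<rho> r = \<zero>\<^bsub>K\<^esub>}"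

text \<open>
  \<open>A\<^sup>!\<close>, and below \<open>M\<^sup>!\<close>, are indexed by \<open>n\<close> where the customary (negative) grading has \<open>-n\<close>.
\<close>

definition quad_dual ::
    "'k ring \<Rightarrow> ('k, 'v) module \<Rightarrow> ('v list \<Rightarrow> 'k) set set
      \<Rightarrow> ('k, (('v \<Rightarrow> 'k) list \<Rightarrow> 'k) set set) galg" where
  "quad_dual K V R = quad_alg K (dual_vs K V) (perp K V R)"


section \<open>Graded right modules\<close>

record ('k, 'a, 'm) gmod =
  mcomp :: "int \<Rightarrow> ('k, 'm) module"
  mact :: "int \<Rightarrow> int \<Rightarrow> 'm \<Rightarrow> 'a \<Rightarrow> 'm"

definition graded_module :: "'k ring \<Rightarrow> ('k, 'a) galg \<Rightarrow> ('k, 'a, 'm) gmod \<Rightarrow> bool" where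
  "graded_module K A M \<longleftrightarrow>
     (\<forall>n. vectorspace K (mcomp M n)) \<and>
     (\<forall>m n. \<forall>a\<in>carrier (acomp A n).
        (\<lambda>x. mact M m n x a) \<in> LinearCombinations.module_hom K (mcomp M m) (mcomp M (m + n))) \<and>
     (\<forall>m n. \<forall>x\<in>carrier (mcomp M m).
        mact M m n x \<in> LinearCombinations.module_hom K (acomp A n) (mcomp M (m + n))) \<and>
     (\<forall>m. \<forall>x\<in>carrier (mcomp M m). mact M m 0 x (aone A) = x) \<and>
     (\<forall>l m n. \<forall>x\<in>carrier (mcomp M l). \<forall>a\<in>carrier (acomp A m). \<forall>b\<in>carrier (acomp A n).
        mact M (l + m) n (mact M l m x a) b = mact M l (m + n) x (amult A m n a b))"

definition bounded_below :: "('k, 'a, 'm) gmod \<Rightarrow> bool" where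
  "bounded_below M \<longleftrightarrow> (\<exists>n\<^sub>0. \<forall>n<n\<^sub>0. carrier (mcomp M n) = {\<zero>\<^bsub>mcomp M n\<^esub>})"

definition gmod_hom ::
    "'k ring \<Rightarrow> ('k, 'a) galg \<Rightarrow> ('k, 'a, 'm) gmod \<Rightarrow> ('k, 'a, 'n) gmod \<Rightarrow> (int \<Rightarrow> 'm \<Rightarrow> 'n) set" where
  "gmod_hom K A M N = {\<phi>.
     (\<forall>n. \<phi> n \<in> LinearCombinations.module_hom K (mcomp M n) (mcomp N n)) \<and>
     (\<forall>m n. \<forall>x\<in>carrier (mcomp M m). \<forall>a\<in>carrier (acomp A n).
        \<phi> (m + n) (mact M m n x a) = mact N m n (\<phi> m x) a)}"

definition gmod_iso ::
    "'k ring \<Rightarrow> ('k, 'a) galg \<Rightarrow> ('k, 'a, 'm) gmod \<Rightarrow> ('k, 'a, 'n) gmod \<Rightarrow> bool" where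
  "gmod_iso K A M N \<longleftrightarrow>
     (\<exists>\<phi>\<in>gmod_hom K A M N. \<forall>n. bij_betw (\<phi> n) (carrier (mcomp M n)) (carrier (mcomp N n)))"

text \<open>\<open>M(j)\<close>, with \<open>M(j)\<^sub>i = M\<^sub>i\<^sub>+\<^sub>j\<close>.\<close>

definition gmod_shift :: "('k, 'a, 'm) gmod \<Rightarrow> int \<Rightarrow> ('k, 'a, 'm) gmod" where
  "gmod_shift M j = \<lparr>mcomp = (\<lambda>i. mcomp M (i + j)), mact = (\<lambda>i n. mact M (i + j) n)\<rparr>"

definition gmod_sub :: "('k, 'a, 'm) gmod \<Rightarrow> (int \<Rightarrow> 'm set) \<Rightarrow> ('k, 'a, 'm) gmod" where
  "gmod_sub M Z = \<lparr>mcomp = (\<lambda>n. (mcomp M n)\<lparr>carrier := Z n\<rparr>), mact = mact M\<rparr>"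

definition gmod_quot :: "('k, 'a, 'm) gmod \<Rightarrow> (int \<Rightarrow> 'm set) \<Rightarrow> ('k, 'a, 'm set) gmod" where
  "gmod_quot M B =
     \<lparr>mcomp = (\<lambda>n. quot_vs (mcomp M n) (B n)),
      mact = (\<lambda>m n X a. B (m + n) +>\<^bsub>mcomp M (m + n)\<^esub> mact M m n (rep X) a)\<rparr>"

definition gmod_dirsum ::
    "'i set \<Rightarrow> ('i \<Rightarrow> ('k, 'a, 'm) gmod) \<Rightarrow> ('k, 'a, 'i \<Rightarrow> 'm) gmod" where
  "gmod_dirsum I F =
     \<lparr>mcomp = (\<lambda>n.
        \<lparr>carrier = {f \<in> \<Pi>\<^sub>E i\<in>I. carrier (mcomp (F i) n). finite {i \<in> I. f i \<noteq> \<zero>\<^bsub>mcomp (F i) n\<^esub>}},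
         monoid.mult = undefined, one = undefined,
         zero = (\<lambda>i\<in>I. \<zero>\<^bsub>mcomp (F i) n\<^esub>),
         add = (\<lambda>f g. \<lambda>i\<in>I. f i \<oplus>\<^bsub>mcomp (F i) n\<^esub> g i),
         smult = (\<lambda>c f. \<lambda>i\<in>I. c \<odot>\<^bsub>mcomp (F i) n\<^esub> f i)\<rparr>),
      mact = (\<lambda>m n f a. \<lambda>i\<in>I. mact (F i) m n (f i) a)\<rparr>"

text \<open>\<open>U \<otimes> A\<close>, with \<open>U\<close> in degree 0.\<close>

definition gmod_free ::
    "'k ring \<Rightarrow> ('k, 'u) module \<Rightarrow> ('k, 'a) galg \<Rightarrow> ('k, 'a, ('u \<times> 'a \<Rightarrow> 'k) set) gmod" where
  "gmod_free K U A =
     \<lparr>mcomp = (\<lambda>n. tensor K U (acomp A n)),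
      mact = (\<lambda>m n X a. lift K (tensor K U (acomp A (m + n)))
        (\<lambda>(u, b). tens K U (acomp A (m + n)) u (amult A m n b a)) X)\<rparr>"

text \<open>The degree-\<open>n\<close> part of the submodule generated by a set \<open>S\<close> of elements of degree \<open>d\<close>.\<close>

definition gmod_gen ::
    "'k ring \<Rightarrow> ('k, 'a) galg \<Rightarrow> ('k, 'a, 'm) gmod \<Rightarrow> int \<Rightarrow> 'm set \<Rightarrow> int \<Rightarrow> 'm set" where
  "gmod_gen K A M d S n = LinearCombinations.module.span K (mcomp M n)
     {mact M d (n - d) s a | s a. s \<in> S \<and> a \<in> carrier (acomp A (n - d))}"

text \<open>
  The trivial module: \<open>K\<close> in degree 0, on which a degree-0 element \<open>c 1\<close> of the algebra acts by \<open>c\<close>.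
\<close>

definition trivial_gmod :: "'k ring \<Rightarrow> ('k, 'a) galg \<Rightarrow> ('k, 'a, 'k) gmod" where
  "trivial_gmod K A =
     \<lparr>mcomp = (\<lambda>n. if n = 0 then ground_vs K else (ground_vs K)\<lparr>carrier := {\<zero>\<^bsub>K\<^esub>}\<rparr>),
      mact = (\<lambda>m n x a. if m = 0 \<and> n = 0
        then x \<otimes>\<^bsub>K\<^esub> (THE c. c \<in> carrier K \<and> a = c \<odot>\<^bsub>acomp A 0\<^esub> aone A) else \<zero>\<^bsub>K\<^esub>)\<rparr>"


section \<open>Quadratic modules, their duals and Koszul complexes\<close>

definition act_map ::
    "'k ring \<Rightarrow> ('k, 'a, 'm) gmod \<Rightarrow> int \<Rightarrow> ('m \<times> 'a \<Rightarrow> 'k) set \<Rightarrow> 'm" where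
  "act_map K M n = lift K (mcomp M n) (\<lambda>(x, a). mact M 0 n x a)"

text \<open>The map \<open>U \<otimes> V \<rightarrow> U \<otimes> A\<^sub>1\<close> identifying \<open>V\<close> with the degree-1 component of \<open>A = T(V)/(R)\<close>.\<close>

definition embed1 ::
    "'k ring \<Rightarrow> ('k, 'v) module \<Rightarrow> ('v list \<Rightarrow> 'k) set set \<Rightarrow> ('k, 'u) module
      \<Rightarrow> ('u \<times> 'v \<Rightarrow> 'k) set \<Rightarrow> ('u \<times> ('v list \<Rightarrow> 'k) set set \<Rightarrow> 'k) set" where
  "embed1 K V R U = lift K (tensor K U (acomp (quad_alg K V R) 1))
     (\<lambda>(u, v). tens K U (acomp (quad_alg K V R) 1) u (quad_gen K V R v))"

definition quadratic_module ::
    "'k ring \<Rightarrow> ('k, 'v) module \<Rightarrow> ('v list \<Rightarrow> 'k) set set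
      \<Rightarrow> ('k, ('v list \<Rightarrow> 'k) set set, 'm) gmod \<Rightarrow> bool" where
  "quadratic_module K V R M \<longleftrightarrow> (let A = quad_alg K V R; V\<^sub>M = mcomp M 0; F = gmod_free K V\<^sub>M A in
     graded_module K A M \<and>
     (\<forall>n<0. carrier (mcomp M n) = {\<zero>\<^bsub>mcomp M n\<^esub>}) \<and>
     vectorspace.fin_dim K V\<^sub>M \<and>
     (\<forall>n. act_map K M n ` carrier (mcomp F n) = carrier (mcomp M n)) \<and>
     (\<exists>R\<^sub>M. VectorSpace.subspace K R\<^sub>M (tensor K V\<^sub>M V) \<and>
        (\<forall>n. a_kernel (mcomp F n) (mcomp M n) (act_map K M n)
           = gmod_gen K A F 1 (embed1 K V R V\<^sub>M ` R\<^sub>M) n)))"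

text \<open>
  A subspace \<open>R\<^sub>M\<close> of \<open>V\<^sub>M \<otimes> V\<close> generating the kernel of \<open>V\<^sub>M \<otimes> A \<rightarrow> M\<close> is necessarily the degree-1
  part of that kernel.
\<close>

definition mod_rels ::
    "'k ring \<Rightarrow> ('k, 'v) module \<Rightarrow> ('v list \<Rightarrow> 'k) set set
      \<Rightarrow> ('k, ('v list \<Rightarrow> 'k) set set, 'm) gmod \<Rightarrow> ('m \<times> 'v \<Rightarrow> 'k) set set" where
  "mod_rels K V R M =
     {r \<in> carrier (tensor K (mcomp M 0) V). act_map K M 1 (embed1 K V R (mcomp M 0) r) = \<zero>\<^bsub>mcomp M 1\<^esub>}"

definition mod_pairing ::
    "'k ring \<Rightarrow> (('m \<Rightarrow> 'k) \<times> ('v \<Rightarrow> 'k) \<Rightarrow> 'k) set \<Rightarrow> ('m \<times> 'v \<Rightarrow> 'k) set \<Rightarrow> 'k" where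
  "mod_pairing K \<rho> r = lift K (ground_vs K)
     (\<lambda>(f, g). lift K (ground_vs K) (\<lambda>(u, v). f u \<otimes>\<^bsub>K\<^esub> g v) r) \<rho>"

definition mod_perp ::
    "'k ring \<Rightarrow> ('k, 'v) module \<Rightarrow> ('v list \<Rightarrow> 'k) set set
      \<Rightarrow> ('k, ('v list \<Rightarrow> 'k) set set, 'm) gmod
      \<Rightarrow> (('m \<Rightarrow> 'k) \<times> ('v \<Rightarrow> 'k) \<Rightarrow> 'k) set set" where
  "mod_perp K V R M =
     {\<rho> \<in> carrier (tensor K (dual_vs K (mcomp M 0)) (dual_vs K V)).
        \<forall>r\<in>mod_rels K V R M. mod_pairing K \<rho> r = \<zero>\<^bsub>K\<^esub>}"

definition mod_dual where
  "mod_dual K V R M = (let B = quad_dual K V R; U = dual_vs K (mcomp M 0); F = gmod_free K U B in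
     gmod_quot F
       (gmod_gen K B F 1 (embed1 K (dual_vs K V) (perp K V R) U ` mod_perp K V R M)))"

text \<open>\<open>(M\<^sup>!\<^sub>-\<^sub>n)\<^sup>*\<close>\<close>

definition kos_coeff where
  "kos_coeff K V R M n = dual_vs K (mcomp (mod_dual K V R M) (int n))"

definition koszul where
  "koszul K V R M n = gmod_shift (gmod_free K (kos_coeff K V R M n) (quad_alg K V R)) (- int n)"

text \<open>The left action \<open>(y \<cdot> f)(w) = f(wy)\<close> of \<open>y \<in> V\<^sup>*\<close> on \<open>f \<in> (M\<^sup>!\<^sub>-\<^sub>n\<^sub>-\<^sub>1)\<^sup>*\<close>.\<close>

definition kos_coeff_act where
  "kos_coeff_act K V R M n y f =
     (\<lambda>w\<in>carrier (mcomp (mod_dual K V R M) (int n)).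
        f (mact (mod_dual K V R M) (int n) 1 w (quad_gen K (dual_vs K V) (perp K V R) y)))"

definition chosen_basis :: "'k ring \<Rightarrow> ('k, 'v) module \<Rightarrow> 'v set" where
  "chosen_basis K V = (SOME X. finite X \<and> vectorspace.basis K V X)"

definition dual_vec :: "'k ring \<Rightarrow> ('k, 'v) module \<Rightarrow> 'v set \<Rightarrow> 'v \<Rightarrow> 'v \<Rightarrow> 'k" where
  "dual_vec K V X x =
     (THE y. y \<in> carrier (dual_vs K V) \<and> (\<forall>x'\<in>X. y x' = (if x' = x then \<one>\<^bsub>K\<^esub> else \<zero>\<^bsub>K\<^esub>)))"

text \<open>
  \<open>koszul_d K V R M n i\<close> is the degree-\<open>i\<close> component of the differential from the \<open>(n+1)\<close>-st to the
  \<open>n\<close>-th term; it does not depend on the basis used.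
\<close>

definition koszul_d where
  "koszul_d K V R M n i = (let A = quad_alg K V R; X = chosen_basis K V;
       T = tensor K (kos_coeff K V R M n) (acomp A (i - int n)) in
     lift K T (\<lambda>(f, a). \<Oplus>\<^bsub>T\<^esub>x\<in>X.
       tens K (kos_coeff K V R M n) (acomp A (i - int n))
         (kos_coeff_act K V R M n (dual_vec K V X x) f)
         (amult A 1 (i - int n - 1) (quad_gen K V R x) a)))"

definition koszul_cycles where
  "koszul_cycles K V R M n i =
     (case n of
        0 \<Rightarrow> carrier (mcomp (koszul K V R M 0) i)
      | Suc m \<Rightarrow> a_kernel (mcomp (koszul K V R M (Suc m)) i) (mcomp (koszul K V R M m) i)
                  (koszul_d K V R M m i))"

definition koszul_boundaries where
  "koszul_boundaries K V R M n i =
     koszul_d K V R M n i ` carrier (mcomp (koszul K V R M (Suc n)) i)"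

definition koszul_homology where
  "koszul_homology K V R M n =
     gmod_quot (gmod_sub (koszul K V R M n) (koszul_cycles K V R M n)) (koszul_boundaries K V R M n)"


section \<open>Resolving data and quivers\<close>

definition short_exact ::
    "'k ring \<Rightarrow> ('k, 'a) galg \<Rightarrow> ('k, 'a, 'x) gmod \<Rightarrow> ('k, 'a, 'y) gmod \<Rightarrow> ('k, 'a, 'z) gmod
      \<Rightarrow> (int \<Rightarrow> 'x \<Rightarrow> 'y) \<Rightarrow> (int \<Rightarrow> 'y \<Rightarrow> 'z) \<Rightarrow> bool" where
  "short_exact K A X Y Z \<phi> \<psi> \<longleftrightarrow>
     \<phi> \<in> gmod_hom K A X Y \<and> \<psi> \<in> gmod_hom K A Y Z \<and>
     (\<forall>n. inj_on (\<phi> n) (carrier (mcomp X n)) \<and>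
          \<phi> n ` carrier (mcomp X n) = a_kernel (mcomp Y n) (mcomp Z n) (\<psi> n) \<and>
          \<psi> n ` carrier (mcomp Y n) = carrier (mcomp Z n))"

text \<open>Splitting of a short exact sequence with surjection \<open>\<psi>\<close>.\<close>

definition splits ::
    "'k ring \<Rightarrow> ('k, 'a) galg \<Rightarrow> ('k, 'a, 'y) gmod \<Rightarrow> ('k, 'a, 'z) gmod
      \<Rightarrow> (int \<Rightarrow> 'y \<Rightarrow> 'z) \<Rightarrow> bool" where
  "splits K A Y Z \<psi> \<longleftrightarrow>
     (\<exists>\<sigma>\<in>gmod_hom K A Z Y. \<forall>n. \<forall>z\<in>carrier (mcomp Z n). \<psi> n (\<sigma> n z) = z)"

definition mult_sum ::
    "nat \<Rightarrow> (nat \<Rightarrow> ('k, 'a, 'm) gmod) \<Rightarrow> (nat \<Rightarrow> nat \<Rightarrow> nat)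
      \<Rightarrow> ('k, 'a, nat \<times> nat \<times> nat \<Rightarrow> 'm) gmod" where
  "mult_sum N M e = gmod_dirsum {(j, l, c). j \<le> N \<and> 1 \<le> l \<and> c < e j l}
     (\<lambda>(j, l, c). gmod_shift (M j) (- int l))"

text \<open>
  The indices \<open>k\<close>, \<open>l\<close> range over positive integers; values of \<open>h\<close> outside
  \<open>{0..N}\<^sup>2 \<times> {1,2,\<dots>}\<^sup>2\<close> are never used. The exact sequences belong to the datum, so the splitting
  condition concerns the given sequence only.
\<close>

definition resolving_datum ::
    "'k ring \<Rightarrow> ('k, 'v) module \<Rightarrow> ('v list \<Rightarrow> 'k) set set \<Rightarrow> nat
      \<Rightarrow> (nat \<Rightarrow> ('k, ('v list \<Rightarrow> 'k) set set, 'm) gmod)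
      \<Rightarrow> (nat \<Rightarrow> nat \<Rightarrow> nat \<Rightarrow> nat \<Rightarrow> nat \<times> nat) \<Rightarrow> bool" where
  "resolving_datum K V R N M h \<longleftrightarrow> (let A = quad_alg K V R in
     (\<forall>i\<le>N. quadratic_module K V R (M i)) \<and>
     (\<forall>i\<le>N. \<forall>j\<le>N. i \<noteq> j \<longrightarrow> \<not> gmod_iso K A (M i) (M j)) \<and>
     gmod_iso K A (M 0) (trivial_gmod K A) \<and>
     finite {(i, j, k, l). i \<le> N \<and> j \<le> N \<and> 1 \<le> k \<and> 1 \<le> l \<and> h i j k l \<noteq> (0, 0)} \<and>
     (\<forall>i\<le>N. \<forall>k\<ge>1.
        let X = mult_sum N M (\<lambda>j l. fst (h i j k l));
            H = koszul_homology K V R (M i) k;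
            Z = mult_sum N M (\<lambda>j l. snd (h i j k l)) in
        \<exists>\<phi> \<psi>. short_exact K A X H Z \<phi> \<psi> \<and>
          (splits K A H Z \<psi> \<longrightarrow> (\<forall>j\<le>N. \<forall>l\<ge>1. fst (h i j k l) = 0))))"

text \<open>
  \<open>SubArrow i j d' d'' c\<close> and \<open>QuotArrow i j d' d'' c\<close> are the \<open>c\<close>-th elements of the sets
  \<open>Ar'\<close> and \<open>Ar''\<close> of arrows of bidegree \<open>(d', d'')\<close> from vertex \<open>i\<close> to vertex \<open>j\<close>.
\<close>

datatype arrow =
    is_SubArrow: SubArrow (asrc: nat) (atgt: nat) (adeg1: nat) (adeg2: nat) (anum: nat)
  | is_QuotArrow: QuotArrow (asrc: nat) (atgt: nat) (adeg1: nat) (adeg2: nat) (anum: nat)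

text \<open>The vertex \<open>M\<^sup>i\<close> is represented by its index \<open>i\<close>.\<close>

definition resolving_quiver ::
    "nat \<Rightarrow> (nat \<Rightarrow> nat \<Rightarrow> nat \<Rightarrow> nat \<Rightarrow> nat \<times> nat) \<Rightarrow> (nat, arrow) pre_digraph" where
  "resolving_quiver N h =
     \<lparr>verts = {..N},
      arcs = {SubArrow i j d e c | i j d e c.
                i \<le> N \<and> j \<le> N \<and> 2 \<le> d \<and> 1 \<le> e \<and> c < fst (h i j (d - 1) e)}
           \<union> {QuotArrow i j d e c | i j d e c.
                i \<le> N \<and> j \<le> N \<and> 2 \<le> d \<and> 1 \<le> e \<and> c < snd (h i j (d - 1) e)},
      tail = asrc, head = atgt\<rparr>"

definition arrow_less :: "arrow \<Rightarrow> arrow \<Rightarrow> bool" where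
  "arrow_less \<alpha> \<beta> \<longleftrightarrow> asrc \<alpha> = asrc \<beta> \<and> adeg1 \<alpha> = adeg1 \<beta> \<and> is_QuotArrow \<alpha> \<and> is_SubArrow \<beta>"

definition paths_from :: "('v, 'e) pre_digraph \<Rightarrow> 'v \<Rightarrow> 'e list set" where
  "paths_from Q i = {p. \<exists>j. pre_digraph.awalk Q i p j}"

definition path_target :: "('v, 'e) pre_digraph \<Rightarrow> 'v \<Rightarrow> 'e list \<Rightarrow> 'v" where
  "path_target Q i p = pre_digraph.awlast Q i p"

definition bideg1 :: "arrow list \<Rightarrow> nat" where
  "bideg1 p = (\<Sum>\<alpha>\<leftarrow>p. adeg1 \<alpha>)"

definition bideg2 :: "arrow list \<Rightarrow> nat" where
  "bideg2 p = (\<Sum>\<alpha>\<leftarrow>p. adeg2 \<alpha>)"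

definition dfdeg :: "arrow list \<Rightarrow> int" where
  "dfdeg p = int (bideg2 p) - int (bideg1 p)"

text \<open>Compares paths with a common source, so the empty list is the length-zero path there.\<close>

definition path_less :: "arrow list \<Rightarrow> arrow list \<Rightarrow> bool" where
  "path_less p q \<longleftrightarrow>
     (p \<noteq> [] \<and> q = []) \<or>
     (p \<noteq> [] \<and> q \<noteq> [] \<and>
      (\<exists>j \<le> min (length p) (length q). take j p = take j q \<and>
        (j < length p \<and> j < length q \<and> adeg1 (p ! j) = adeg1 (q ! j) \<and> arrow_less (p ! j) (q ! j) \<or>
         j < length p \<and> j < length q \<and> adeg1 (p ! j) < adeg1 (q ! j) \<or>
         j = length q \<and> length q < length p)))"


section \<open>Projective resolutions\<close>

text \<open>
  Lifting along surjections of bounded below graded modules. HOL cannot quantify over types inside a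
  formula, so the underlying types \<open>'x\<close>, \<open>'y\<close> of the test modules are parameters.
\<close>

definition projective ::
    "'x itself \<Rightarrow> 'y itself \<Rightarrow> 'k ring \<Rightarrow> ('k, 'a) galg \<Rightarrow> ('k, 'a, 'p) gmod \<Rightarrow> bool" where
  "projective _ _ K A P \<longleftrightarrow>
     (\<forall>(X :: ('k, 'a, 'x) gmod) (Y :: ('k, 'a, 'y) gmod).
        graded_module K A X \<and> bounded_below X \<and> graded_module K A Y \<and> bounded_below Y \<longrightarrow>
        (\<forall>g\<in>gmod_hom K A X Y. \<forall>f\<in>gmod_hom K A P Y.
           (\<forall>n. g n ` carrier (mcomp X n) = carrier (mcomp Y n)) \<longrightarrow>
           (\<exists>l\<in>gmod_hom K A P X. \<forall>n. \<forall>p\<in>carrier (mcomp P n). g n (l n p) = f n p)))"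

text \<open>\<open>d n\<close> is the differential from \<open>P (n+1)\<close> to \<open>P n\<close>, and \<open>\<epsilon>\<close> the augmentation.\<close>

definition projective_resolution ::
    "'x itself \<Rightarrow> 'y itself \<Rightarrow> 'k ring \<Rightarrow> ('k, 'a) galg \<Rightarrow> ('k, 'a, 'm) gmod
      \<Rightarrow> (nat \<Rightarrow> ('k, 'a, 'p) gmod) \<Rightarrow> (nat \<Rightarrow> int \<Rightarrow> 'p \<Rightarrow> 'p) \<Rightarrow> (int \<Rightarrow> 'p \<Rightarrow> 'm) \<Rightarrow> bool" where
  "projective_resolution tx ty K A M P d \<epsilon> \<longleftrightarrow>
     graded_module K A M \<and> bounded_below M \<and>
     (\<forall>n. graded_module K A (P n) \<and> bounded_below (P n) \<and> projective tx ty K A (P n)) \<and>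
     (\<forall>n. d n \<in> gmod_hom K A (P (Suc n)) (P n)) \<and>
     \<epsilon> \<in> gmod_hom K A (P 0) M \<and>
     (\<forall>i. \<epsilon> i ` carrier (mcomp (P 0) i) = carrier (mcomp M i)) \<and>
     (\<forall>i. d 0 i ` carrier (mcomp (P 1) i) = a_kernel (mcomp (P 0) i) (mcomp M i) (\<epsilon> i)) \<and>
     (\<forall>n i. d (Suc n) i ` carrier (mcomp (P (Suc (Suc n))) i)
              = a_kernel (mcomp (P (Suc n)) i) (mcomp (P n) i) (d n i))"

text \<open>Minimality: the image of every differential lies in \<open>P\<^sub>n A\<^sub>>\<^sub>0\<close>.\<close>

definition minimal_complex ::
    "'k ring \<Rightarrow> ('k, 'a) galg \<Rightarrow> (nat \<Rightarrow> ('k, 'a, 'p) gmod) \<Rightarrow> (nat \<Rightarrow> int \<Rightarrow> 'p \<Rightarrow> 'p) \<Rightarrow> bool" where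
  "minimal_complex K A P d \<longleftrightarrow>
     (\<forall>n i. d n i ` carrier (mcomp (P (Suc n)) i) \<subseteq> LinearCombinations.module.span K (mcomp (P n) i)
        {mact (P n) (i - j) j p a | j p a.
           0 < j \<and> p \<in> carrier (mcomp (P n) (i - j)) \<and> a \<in> carrier (acomp A j)})"

text \<open>The paths that index the direct sum serve as the labels of its summands.\<close>

definition resolution_term where
  "resolution_term K V R N M h i n =
     gmod_dirsum {p \<in> paths_from (resolving_quiver N h) i. bideg1 p \<le> n}
       (\<lambda>p. gmod_shift
          (koszul K V R (M (path_target (resolving_quiver N h) i p)) (n - bideg1 p))
          (- int (bideg2 p)))"

definition dfdeg_condition :: "(nat, arrow) pre_digraph \<Rightarrow> nat \<Rightarrow> bool" where
  "dfdeg_condition Q i \<longleftrightarrow>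
     (\<forall>p\<in>paths_from Q i. \<forall>q\<in>paths_from Q i. path_less p q \<longrightarrow> dfdeg p \<noteq> dfdeg q - 1)"

end

theory Submission
  imports Defs
begin

text \<open>
  The resolution is glued from Koszul complexes. For \<open>k \<ge> 1\<close> the short exact
  sequence of the resolving datum, together with the augmentations
  \<open>K\<^sub>1(M\<^sup>j) \<rightarrow> K\<^sub>0(M\<^sup>j) \<rightarrow> M\<^sup>j \<rightarrow> 0\<close>, yields for every arrow \<open>\<alpha>\<close> from \<open>M\<^sup>i\<close> with first degree \<open>k + 1\<close> a lift of
  \<open>K\<^sub>0(t(\<alpha>))\<close> to the \<open>k\<close>-cycles of \<open>K(M\<^sup>i)\<close>; the lifts generate the cycles modulo boundaries. Splitting off
  the first arrow of a path decomposes the \<open>n\<close>-th term for \<open>M\<^sup>i\<close> into \<open>K\<^sub>n(M\<^sup>i)\<close> and one block for each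
  arrow \<open>\<alpha>\<close>, a shift of an earlier term for \<open>t(\<alpha>)\<close>. The differentials are built simultaneously for all \<open>i\<close> by
  induction on \<open>n\<close>, block triangular for the order of the arrows: on the diagonal they are the differentials
  for the targets, and a block of first degree \<open>n + 1\<close> enters through the lift of its arrow. The
  correction needed for \<open>d\<^sup>2 = 0\<close> can be chosen in the blocks of strictly larger arrows because the part
  of the complex spanned by an upper set of arrows is exact in the relevant degrees. On the level of paths
  the differential only increases, and the degree condition excludes the components of degree 0.
\<close>

text \<open>The obstacle is that the homology of a Koszul complex is an extension, not a direct sum:
  relations among generators lifted from the quotient part hold only up to generators of the
  submodule part. Diagonal blocks and lifts alone therefore need not square to zero, and corrections
  must run from quotient arrows towards submodule arrows. The number \<open>rank\<close> records
  this direction, with the first degree dominating. It compares first arrows as the order on paths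
  does, so the construction itself yields the triangularity behind minimality.

  Finding a correction is an exactness problem one degree lower: it is a preimage under the
  differential already built, taken inside the blocks of higher rank. Hence exactness is proved for
  upper sets of arrows and not just for the whole complex. The recursion is well founded because
  arrows have first degree at least 2, so the diagonal block for a target lives strictly lower.
  Preimages are chosen linearly over the algebra because all terms are free, which in turn rests on
  complements in arbitrary vector spaces.\<close>

abbreviation "el M n \<equiv> carrier (mcomp M n)"
abbreviation "ael A n \<equiv> carrier (acomp A n)"

section \<open>Linear algebra\<close>

text \<open>Vector spaces enter as premises \<open>VS U\<close> instead of locale parameters,
  because one argument handles many of them at once, indexed by degrees, words and paths.\<close>

locale kfield = field K for K :: "'k ring" (structure)
begin

abbreviation VS :: "('k, 'u) module \<Rightarrow> bool" where "VS U \<equiv> vectorspace K U"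
abbreviation SUB :: "'u set \<Rightarrow> ('k, 'u) module \<Rightarrow> bool" where "SUB W U \<equiv> submodule K W U"
abbreviation lin :: "('k, 'u) module \<Rightarrow> ('k, 'w) module \<Rightarrow> ('u \<Rightarrow> 'w) set"
  where "lin U W \<equiv> LinearCombinations.module_hom K U W"
abbreviation spn :: "('k, 'u) module \<Rightarrow> 'u set \<Rightarrow> 'u set"
  where "spn U S \<equiv> LinearCombinations.module.span K U S"

lemma VS_module: "VS U \<Longrightarrow> Module.module K U"
  by (simp add: vectorspace_def)

lemma VS_group: "VS U \<Longrightarrow> abelian_group U"
  using VS_module Module.module_def by blast

lemma VS_I: "Module.module K U \<Longrightarrow> VS U"
  using field_axioms by (simp add: vectorspace_def)

section \<open>Arithmetic in a vector space\<close>

lemma VS_closed [simp]: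
  assumes "VS U"
  shows "\<zero>\<^bsub>U\<^esub> \<in> carrier U"
    and "x \<in> carrier U \<Longrightarrow> y \<in> carrier U \<Longrightarrow> x \<oplus>\<^bsub>U\<^esub> y \<in> carrier U"
    and "x \<in> carrier U \<Longrightarrow> \<ominus>\<^bsub>U\<^esub> x \<in> carrier U"
    and "x \<in> carrier U \<Longrightarrow> y \<in> carrier U \<Longrightarrow> x \<ominus>\<^bsub>U\<^esub> y \<in> carrier U"
    and "c \<in> carrier K \<Longrightarrow> x \<in> carrier U \<Longrightarrow> c \<odot>\<^bsub>U\<^esub> x \<in> carrier U"
proof -
  interpret vectorspace K U by fact
  show "\<zero>\<^bsub>U\<^esub> \<in> carrier U"
    and "x \<in> carrier U \<Longrightarrow> y \<in> carrier U \<Longrightarrow> x \<oplus>\<^bsub>U\<^esub> y \<in> carrier U"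
    and "x \<in> carrier U \<Longrightarrow> \<ominus>\<^bsub>U\<^esub> x \<in> carrier U"
    and "x \<in> carrier U \<Longrightarrow> y \<in> carrier U \<Longrightarrow> x \<ominus>\<^bsub>U\<^esub> y \<in> carrier U"
    and "c \<in> carrier K \<Longrightarrow> x \<in> carrier U \<Longrightarrow> c \<odot>\<^bsub>U\<^esub> x \<in> carrier U"
    by auto
qed

lemma VS_add [simp]:
  assumes "VS U"
  shows "x \<in> carrier U \<Longrightarrow> \<zero>\<^bsub>U\<^esub> \<oplus>\<^bsub>U\<^esub> x = x"
    and "x \<in> carrier U \<Longrightarrow> x \<oplus>\<^bsub>U\<^esub> \<zero>\<^bsub>U\<^esub> = x"
    and "x \<in> carrier U \<Longrightarrow> \<ominus>\<^bsub>U\<^esub> x \<oplus>\<^bsub>U\<^esub> x = \<zero>\<^bsub>U\<^esub>"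
    and "x \<in> carrier U \<Longrightarrow> x \<oplus>\<^bsub>U\<^esub> \<ominus>\<^bsub>U\<^esub> x = \<zero>\<^bsub>U\<^esub>"
    and "x \<in> carrier U \<Longrightarrow> x \<ominus>\<^bsub>U\<^esub> x = \<zero>\<^bsub>U\<^esub>"
    and "\<ominus>\<^bsub>U\<^esub> \<zero>\<^bsub>U\<^esub> = \<zero>\<^bsub>U\<^esub>"
    and "x \<in> carrier U \<Longrightarrow> \<ominus>\<^bsub>U\<^esub> (\<ominus>\<^bsub>U\<^esub> x) = x"
    and "x \<in> carrier U \<Longrightarrow> x \<ominus>\<^bsub>U\<^esub> \<zero>\<^bsub>U\<^esub> = x"
proof -
  interpret vectorspace K U by fact
  show "x \<in> carrier U \<Longrightarrow> \<zero>\<^bsub>U\<^esub> \<oplus>\<^bsub>U\<^esub> x = x"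
    and "x \<in> carrier U \<Longrightarrow> x \<oplus>\<^bsub>U\<^esub> \<zero>\<^bsub>U\<^esub> = x"
    and "x \<in> carrier U \<Longrightarrow> \<ominus>\<^bsub>U\<^esub> x \<oplus>\<^bsub>U\<^esub> x = \<zero>\<^bsub>U\<^esub>"
    and "x \<in> carrier U \<Longrightarrow> x \<oplus>\<^bsub>U\<^esub> \<ominus>\<^bsub>U\<^esub> x = \<zero>\<^bsub>U\<^esub>"
    and "x \<in> carrier U \<Longrightarrow> x \<ominus>\<^bsub>U\<^esub> x = \<zero>\<^bsub>U\<^esub>"
    and "\<ominus>\<^bsub>U\<^esub> \<zero>\<^bsub>U\<^esub> = \<zero>\<^bsub>U\<^esub>"
    and "x \<in> carrier U \<Longrightarrow> \<ominus>\<^bsub>U\<^esub> (\<ominus>\<^bsub>U\<^esub> x) = x"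
    and "x \<in> carrier U \<Longrightarrow> x \<ominus>\<^bsub>U\<^esub> \<zero>\<^bsub>U\<^esub> = x"
    by (auto simp: M.l_neg M.r_neg M.minus_eq)
qed

lemma VS_smult [simp]:
  assumes "VS U"
  shows "c \<in> carrier K \<Longrightarrow> c \<odot>\<^bsub>U\<^esub> \<zero>\<^bsub>U\<^esub> = \<zero>\<^bsub>U\<^esub>"
    and "x \<in> carrier U \<Longrightarrow> \<zero> \<odot>\<^bsub>U\<^esub> x = \<zero>\<^bsub>U\<^esub>"
    and "x \<in> carrier U \<Longrightarrow> \<one> \<odot>\<^bsub>U\<^esub> x = x"
    and "c \<in> carrier K \<Longrightarrow> d \<in> carrier K \<Longrightarrow> x \<in> carrier U \<Longrightarrow> c \<odot>\<^bsub>U\<^esub> (d \<odot>\<^bsub>U\<^esub> x) = (c \<otimes> d) \<odot>\<^bsub>U\<^esub> x"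
proof -
  interpret vectorspace K U by fact
  show "c \<in> carrier K \<Longrightarrow> c \<odot>\<^bsub>U\<^esub> \<zero>\<^bsub>U\<^esub> = \<zero>\<^bsub>U\<^esub>"
    and "x \<in> carrier U \<Longrightarrow> \<zero> \<odot>\<^bsub>U\<^esub> x = \<zero>\<^bsub>U\<^esub>"
    and "x \<in> carrier U \<Longrightarrow> \<one> \<odot>\<^bsub>U\<^esub> x = x"
    and "c \<in> carrier K \<Longrightarrow> d \<in> carrier K \<Longrightarrow> x \<in> carrier U \<Longrightarrow> c \<odot>\<^bsub>U\<^esub> (d \<odot>\<^bsub>U\<^esub> x) = (c \<otimes> d) \<odot>\<^bsub>U\<^esub> x"
    by (auto simp: smult_assoc1)
qed

lemma VS_ac:
  assumes "VS U"
  shows "x \<in> carrier U \<Longrightarrow> y \<in> carrier U \<Longrightarrow> z \<in> carrier U \<Longrightarrow> (x \<oplus>\<^bsub>U\<^esub> y) \<oplus>\<^bsub>U\<^esub> z = x \<oplus>\<^bsub>U\<^esub> (y \<oplus>\<^bsub>U\<^esub> z)"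
    and "x \<in> carrier U \<Longrightarrow> y \<in> carrier U \<Longrightarrow> x \<oplus>\<^bsub>U\<^esub> y = y \<oplus>\<^bsub>U\<^esub> x"
    and "x \<in> carrier U \<Longrightarrow> y \<in> carrier U \<Longrightarrow> z \<in> carrier U \<Longrightarrow> x \<oplus>\<^bsub>U\<^esub> (y \<oplus>\<^bsub>U\<^esub> z) = y \<oplus>\<^bsub>U\<^esub> (x \<oplus>\<^bsub>U\<^esub> z)"
proof -
  interpret vectorspace K U by fact
  show "x \<in> carrier U \<Longrightarrow> y \<in> carrier U \<Longrightarrow> z \<in> carrier U \<Longrightarrow> (x \<oplus>\<^bsub>U\<^esub> y) \<oplus>\<^bsub>U\<^esub> z = x \<oplus>\<^bsub>U\<^esub> (y \<oplus>\<^bsub>U\<^esub> z)"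
    and "x \<in> carrier U \<Longrightarrow> y \<in> carrier U \<Longrightarrow> x \<oplus>\<^bsub>U\<^esub> y = y \<oplus>\<^bsub>U\<^esub> x"
    and "x \<in> carrier U \<Longrightarrow> y \<in> carrier U \<Longrightarrow> z \<in> carrier U \<Longrightarrow> x \<oplus>\<^bsub>U\<^esub> (y \<oplus>\<^bsub>U\<^esub> z) = y \<oplus>\<^bsub>U\<^esub> (x \<oplus>\<^bsub>U\<^esub> z)"
    by (simp_all add: M.a_ac)
qed

lemma VS_distr:
  assumes "VS U"
  shows "c \<in> carrier K \<Longrightarrow> x \<in> carrier U \<Longrightarrow> y \<in> carrier U \<Longrightarrow> c \<odot>\<^bsub>U\<^esub> (x \<oplus>\<^bsub>U\<^esub> y) = c \<odot>\<^bsub>U\<^esub> x \<oplus>\<^bsub>U\<^esub> c \<odot>\<^bsub>U\<^esub> y"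
    and "c \<in> carrier K \<Longrightarrow> d \<in> carrier K \<Longrightarrow> x \<in> carrier U \<Longrightarrow> (c \<oplus> d) \<odot>\<^bsub>U\<^esub> x = c \<odot>\<^bsub>U\<^esub> x \<oplus>\<^bsub>U\<^esub> d \<odot>\<^bsub>U\<^esub> x"
    and "c \<in> carrier K \<Longrightarrow> x \<in> carrier U \<Longrightarrow> c \<odot>\<^bsub>U\<^esub> (\<ominus>\<^bsub>U\<^esub> x) = \<ominus>\<^bsub>U\<^esub> (c \<odot>\<^bsub>U\<^esub> x)"
    and "x \<in> carrier U \<Longrightarrow> y \<in> carrier U \<Longrightarrow> \<ominus>\<^bsub>U\<^esub> (x \<oplus>\<^bsub>U\<^esub> y) = \<ominus>\<^bsub>U\<^esub> x \<oplus>\<^bsub>U\<^esub> \<ominus>\<^bsub>U\<^esub> y"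
    and "x \<in> carrier U \<Longrightarrow> (\<ominus> \<one>) \<odot>\<^bsub>U\<^esub> x = \<ominus>\<^bsub>U\<^esub> x"
    and "c \<in> carrier K \<Longrightarrow> x \<in> carrier U \<Longrightarrow> y \<in> carrier U \<Longrightarrow> c \<odot>\<^bsub>U\<^esub> (x \<ominus>\<^bsub>U\<^esub> y) = c \<odot>\<^bsub>U\<^esub> x \<ominus>\<^bsub>U\<^esub> c \<odot>\<^bsub>U\<^esub> y"
proof -
  interpret vectorspace K U by fact
  show "c \<in> carrier K \<Longrightarrow> x \<in> carrier U \<Longrightarrow> y \<in> carrier U \<Longrightarrow> c \<odot>\<^bsub>U\<^esub> (x \<oplus>\<^bsub>U\<^esub> y) = c \<odot>\<^bsub>U\<^esub> x \<oplus>\<^bsub>U\<^esub> c \<odot>\<^bsub>U\<^esub> y"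
    and "c \<in> carrier K \<Longrightarrow> d \<in> carrier K \<Longrightarrow> x \<in> carrier U \<Longrightarrow> (c \<oplus> d) \<odot>\<^bsub>U\<^esub> x = c \<odot>\<^bsub>U\<^esub> x \<oplus>\<^bsub>U\<^esub> d \<odot>\<^bsub>U\<^esub> x"
    and "c \<in> carrier K \<Longrightarrow> x \<in> carrier U \<Longrightarrow> c \<odot>\<^bsub>U\<^esub> (\<ominus>\<^bsub>U\<^esub> x) = \<ominus>\<^bsub>U\<^esub> (c \<odot>\<^bsub>U\<^esub> x)"
    and "x \<in> carrier U \<Longrightarrow> y \<in> carrier U \<Longrightarrow> \<ominus>\<^bsub>U\<^esub> (x \<oplus>\<^bsub>U\<^esub> y) = \<ominus>\<^bsub>U\<^esub> x \<oplus>\<^bsub>U\<^esub> \<ominus>\<^bsub>U\<^esub> y"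
    and "x \<in> carrier U \<Longrightarrow> (\<ominus> \<one>) \<odot>\<^bsub>U\<^esub> x = \<ominus>\<^bsub>U\<^esub> x"
    and "c \<in> carrier K \<Longrightarrow> x \<in> carrier U \<Longrightarrow> y \<in> carrier U \<Longrightarrow> c \<odot>\<^bsub>U\<^esub> (x \<ominus>\<^bsub>U\<^esub> y) = c \<odot>\<^bsub>U\<^esub> x \<ominus>\<^bsub>U\<^esub> c \<odot>\<^bsub>U\<^esub> y"
    by (simp_all add: smult_r_distr smult_l_distr smult_r_minus M.minus_add smult_minus_1 M.minus_eq)
qed

lemma VS_minus_eq: "x \<ominus>\<^bsub>U\<^esub> y = x \<oplus>\<^bsub>U\<^esub> \<ominus>\<^bsub>U\<^esub> y"
  by (simp add: a_minus_def)

lemma VS_cancel: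
  assumes "VS U"
  shows "x \<in> carrier U \<Longrightarrow> y \<in> carrier U \<Longrightarrow> x \<ominus>\<^bsub>U\<^esub> y = \<zero>\<^bsub>U\<^esub> \<longleftrightarrow> x = y"
    and "x \<in> carrier U \<Longrightarrow> y \<in> carrier U \<Longrightarrow> x \<ominus>\<^bsub>U\<^esub> y \<oplus>\<^bsub>U\<^esub> y = x"
    and "x \<in> carrier U \<Longrightarrow> y \<in> carrier U \<Longrightarrow> y \<oplus>\<^bsub>U\<^esub> (x \<ominus>\<^bsub>U\<^esub> y) = x"
    and "x \<in> carrier U \<Longrightarrow> y \<in> carrier U \<Longrightarrow> x \<oplus>\<^bsub>U\<^esub> y \<ominus>\<^bsub>U\<^esub> y = x"
    and "x \<in> carrier U \<Longrightarrow> y \<in> carrier U \<Longrightarrow> x \<oplus>\<^bsub>U\<^esub> y = \<zero>\<^bsub>U\<^esub> \<longleftrightarrow> x = \<ominus>\<^bsub>U\<^esub> y"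
proof -
  interpret vectorspace K U by fact
  show "x \<in> carrier U \<Longrightarrow> y \<in> carrier U \<Longrightarrow> x \<ominus>\<^bsub>U\<^esub> y = \<zero>\<^bsub>U\<^esub> \<longleftrightarrow> x = y"
    by auto
  show "x \<in> carrier U \<Longrightarrow> y \<in> carrier U \<Longrightarrow> x \<ominus>\<^bsub>U\<^esub> y \<oplus>\<^bsub>U\<^esub> y = x"
    and "x \<in> carrier U \<Longrightarrow> y \<in> carrier U \<Longrightarrow> y \<oplus>\<^bsub>U\<^esub> (x \<ominus>\<^bsub>U\<^esub> y) = x"
    and "x \<in> carrier U \<Longrightarrow> y \<in> carrier U \<Longrightarrow> x \<oplus>\<^bsub>U\<^esub> y \<ominus>\<^bsub>U\<^esub> y = x"
    by (simp_all add: M.minus_eq M.a_ac M.r_neg M.l_neg M.r_neg2)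
  show "x \<in> carrier U \<Longrightarrow> y \<in> carrier U \<Longrightarrow> x \<oplus>\<^bsub>U\<^esub> y = \<zero>\<^bsub>U\<^esub> \<longleftrightarrow> x = \<ominus>\<^bsub>U\<^esub> y"
    by (metis M.minus_equality M.l_neg)
qed

lemma VS_finsum_closed [simp]:
  "VS U \<Longrightarrow> (\<And>i. i \<in> A \<Longrightarrow> f i \<in> carrier U) \<Longrightarrow> finsum U f A \<in> carrier U"
  by (rule abelian_monoid.finsum_closed) (auto simp: VS_group abelian_group.axioms)

lemma VS_finsum_insert:
  "VS U \<Longrightarrow> finite A \<Longrightarrow> a \<notin> A \<Longrightarrow> (\<And>i. i \<in> A \<Longrightarrow> f i \<in> carrier U) \<Longrightarrow> f a \<in> carrier U
    \<Longrightarrow> finsum U f (insert a A) = f a \<oplus>\<^bsub>U\<^esub> finsum U f A"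
  by (rule abelian_monoid.finsum_insert) (auto simp: VS_group abelian_group.axioms)

lemma VS_finsum_empty [simp]: "VS U \<Longrightarrow> finsum U f {} = \<zero>\<^bsub>U\<^esub>"
  by (rule abelian_monoid.finsum_empty) (auto simp: VS_group abelian_group.axioms)

lemma VS_finsum_cong:
  "VS U \<Longrightarrow> A = B \<Longrightarrow> (\<And>i. i \<in> B \<Longrightarrow> g i \<in> carrier U) \<Longrightarrow> (\<And>i. i \<in> B \<Longrightarrow> f i = g i)
    \<Longrightarrow> finsum U f A = finsum U g B"
  by (rule abelian_monoid.finsum_cong') (auto simp: VS_group abelian_group.axioms)

lemma VS_finsum_zero:
  "VS U \<Longrightarrow> (\<And>i. i \<in> A \<Longrightarrow> f i = \<zero>\<^bsub>U\<^esub>) \<Longrightarrow> finsum U f A = \<zero>\<^bsub>U\<^esub>"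
  using VS_finsum_cong[of U A A "\<lambda>i. \<zero>\<^bsub>U\<^esub>" f] abelian_monoid.finsum_zero[of U A]
  by (simp add: VS_group abelian_group.axioms)

lemma VS_finsum_add:
  "VS U \<Longrightarrow> (\<And>i. i \<in> A \<Longrightarrow> f i \<in> carrier U) \<Longrightarrow> (\<And>i. i \<in> A \<Longrightarrow> g i \<in> carrier U)
    \<Longrightarrow> finsum U (\<lambda>i. f i \<oplus>\<^bsub>U\<^esub> g i) A = finsum U f A \<oplus>\<^bsub>U\<^esub> finsum U g A"
  by (rule abelian_monoid.finsum_addf) (auto simp: VS_group abelian_group.axioms)

lemma VS_finsum_mono_neutral:
  assumes U: "VS U" and B: "finite B" and AB: "A \<subseteq> B"
    and f: "\<And>i. i \<in> B \<Longrightarrow> f i \<in> carrier U" and z: "\<And>i. i \<in> B \<Longrightarrow> i \<notin> A \<Longrightarrow> f i = \<zero>\<^bsub>U\<^esub>"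
  shows "finsum U f B = finsum U f A"
proof -
  have "finsum U f (A \<union> C) = finsum U f A" if "finite C" "C \<subseteq> B - A" for C
    using that
  proof (induction C)
    case (insert c C)
    then have "finsum U f (insert c (A \<union> C)) = f c \<oplus>\<^bsub>U\<^esub> finsum U f (A \<union> C)"
      using AB B by (intro VS_finsum_insert[OF U]) (auto intro!: f intro: finite_subset)
    with insert AB f z U show ?case by (auto simp: subset_iff)
  qed simp
  from this[of "B - A"] AB B show ?thesis by (simp add: Un_absorb1)
qed

lemma VS_finsum_single:
  assumes U: "VS U" and A: "finite A" "a \<in> A" and f: "f a \<in> carrier U"
    and z: "\<And>i. i \<in> A \<Longrightarrow> i \<noteq> a \<Longrightarrow> f i = \<zero>\<^bsub>U\<^esub>"
  shows "finsum U f A = f a"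
proof -
  have "finsum U f A = finsum U f {a}"
    using assms by (intro VS_finsum_mono_neutral) (auto, metis VS_closed(1))
  also have "\<dots> = f a"
    using VS_finsum_insert[OF U, of "{}" a f] U f by simp
  finally show ?thesis .
qed

section \<open>Linear maps\<close>

lemma linI:
  assumes "\<And>x. x \<in> carrier U \<Longrightarrow> f x \<in> carrier W"
    and "\<And>x y. x \<in> carrier U \<Longrightarrow> y \<in> carrier U \<Longrightarrow> f (x \<oplus>\<^bsub>U\<^esub> y) = f x \<oplus>\<^bsub>W\<^esub> f y"
    and "\<And>c x. c \<in> carrier K \<Longrightarrow> x \<in> carrier U \<Longrightarrow> f (c \<odot>\<^bsub>U\<^esub> x) = c \<odot>\<^bsub>W\<^esub> f x"
  shows "f \<in> lin U W"
  using assms by (auto simp: LinearCombinations.module_hom_def)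

lemma lin_closed: "f \<in> lin U W \<Longrightarrow> x \<in> carrier U \<Longrightarrow> f x \<in> carrier W"
  by (auto simp: LinearCombinations.module_hom_def)

lemma lin_add: "f \<in> lin U W \<Longrightarrow> x \<in> carrier U \<Longrightarrow> y \<in> carrier U \<Longrightarrow> f (x \<oplus>\<^bsub>U\<^esub> y) = f x \<oplus>\<^bsub>W\<^esub> f y"
  by (auto simp: LinearCombinations.module_hom_def)

lemma lin_smult: "f \<in> lin U W \<Longrightarrow> c \<in> carrier K \<Longrightarrow> x \<in> carrier U \<Longrightarrow> f (c \<odot>\<^bsub>U\<^esub> x) = c \<odot>\<^bsub>W\<^esub> f x"
  by (auto simp: LinearCombinations.module_hom_def)

lemma lin_zero: "VS U \<Longrightarrow> VS W \<Longrightarrow> f \<in> lin U W \<Longrightarrow> f \<zero>\<^bsub>U\<^esub> = \<zero>\<^bsub>W\<^esub>"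
  using lin_smult[of f U W \<zero> "\<zero>\<^bsub>U\<^esub>"] lin_closed[of f U W "\<zero>\<^bsub>U\<^esub>"] by simp

lemma lin_neg: "VS U \<Longrightarrow> VS W \<Longrightarrow> f \<in> lin U W \<Longrightarrow> x \<in> carrier U \<Longrightarrow> f (\<ominus>\<^bsub>U\<^esub> x) = \<ominus>\<^bsub>W\<^esub> f x"
  using lin_smult[of f U W "\<ominus> \<one>" x] by (simp add: VS_distr lin_closed)

lemma lin_minus: "VS U \<Longrightarrow> VS W \<Longrightarrow> f \<in> lin U W \<Longrightarrow> x \<in> carrier U \<Longrightarrow> y \<in> carrier U
    \<Longrightarrow> f (x \<ominus>\<^bsub>U\<^esub> y) = f x \<ominus>\<^bsub>W\<^esub> f y"
  by (simp add: VS_minus_eq lin_add lin_neg)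

lemma lin_finsum:
  assumes U: "VS U" and W: "VS W" and f: "f \<in> lin U W" and A: "finite A" "\<And>i. i \<in> A \<Longrightarrow> g i \<in> carrier U"
  shows "f (finsum U g A) = finsum W (\<lambda>i. f (g i)) A"
  using A
proof (induction A)
  case empty
  then show ?case using U W f by (simp add: lin_zero)
next
  case (insert a A)
  then show ?case using U W f by (simp add: VS_finsum_insert lin_add lin_closed)
qed

text \<open>\<open>module_hom\<close> constrains a map on the carrier only, so linearity passes
  between a formula and any function agreeing with it there, such as its extensional
  restriction.\<close>

lemma lin_cong:
  assumes "VS U" "f \<in> lin U W" "\<And>x. x \<in> carrier U \<Longrightarrow> f x = g x"
  shows "g \<in> lin U W"
proof (rule linI)
  fix x y c assume xy: "x \<in> carrier U" "y \<in> carrier U" 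
  show "g x \<in> carrier W"
    using assms xy lin_closed by metis
  show "g (x \<oplus>\<^bsub>U\<^esub> y) = g x \<oplus>\<^bsub>W\<^esub> g y"
    using assms xy lin_add by (metis VS_closed(2))
next
  fix x c assume "c \<in> carrier K" "x \<in> carrier U"
  then show "g (c \<odot>\<^bsub>U\<^esub> x) = c \<odot>\<^bsub>W\<^esub> g x"
    using assms lin_smult by (metis VS_closed(5))
qed

lemma lin_id: "(\<lambda>x. x) \<in> lin U U"
  by (rule linI) auto

lemma lin_comp: "f \<in> lin U W \<Longrightarrow> g \<in> lin W X \<Longrightarrow> (\<lambda>x. g (f x)) \<in> lin U X"
  by (rule linI) (auto simp: lin_add lin_smult lin_closed)

lemma lin_zero_map: "VS U \<Longrightarrow> VS W \<Longrightarrow> (\<lambda>x. \<zero>\<^bsub>W\<^esub>) \<in> lin U W"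
  by (rule linI) auto

lemma lin_plus: "VS U \<Longrightarrow> VS W \<Longrightarrow> f \<in> lin U W \<Longrightarrow> g \<in> lin U W \<Longrightarrow> (\<lambda>x. f x \<oplus>\<^bsub>W\<^esub> g x) \<in> lin U W"
  by (rule linI) (auto simp: lin_add lin_smult lin_closed VS_distr VS_ac)

lemma lin_scale: "VS U \<Longrightarrow> VS W \<Longrightarrow> f \<in> lin U W \<Longrightarrow> c \<in> carrier K \<Longrightarrow> (\<lambda>x. c \<odot>\<^bsub>W\<^esub> f x) \<in> lin U W"
  by (rule linI) (auto simp: lin_add lin_smult lin_closed VS_distr m_comm)

lemma lin_uminus: "VS U \<Longrightarrow> VS W \<Longrightarrow> f \<in> lin U W \<Longrightarrow> (\<lambda>x. \<ominus>\<^bsub>W\<^esub> f x) \<in> lin U W"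
  by (rule linI) (auto simp: lin_add lin_smult lin_closed VS_distr)

lemma lin_sum:
  assumes U: "VS U" and W: "VS W" and A: "finite A" "\<And>i. i \<in> A \<Longrightarrow> f i \<in> lin U W"
  shows "(\<lambda>x. finsum W (\<lambda>i. f i x) A) \<in> lin U W"
  using A
proof (induction A)
  case empty
  then show ?case using U W by (simp add: lin_zero_map)
next
  case (insert a A)
  have "(\<lambda>x. f a x \<oplus>\<^bsub>W\<^esub> finsum W (\<lambda>i. f i x) A) \<in> lin U W"
    using insert U W by (intro lin_plus) auto
  then show ?case
  proof (rule lin_cong[OF U])
    fix x assume x: "x \<in> carrier U"
    have "f i x \<in> carrier W" if "i \<in> insert a A" for i
      using that insert.prems x lin_closed by metis
    then show "f a x \<oplus>\<^bsub>W\<^esub> finsum W (\<lambda>i. f i x) A = finsum W (\<lambda>i. f i x) (insert a A)"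
      using insert W by (intro VS_finsum_insert[symmetric]) auto
  qed
qed

lemma VS_finsum_smult:
  assumes "VS U" "c \<in> carrier K" "finite A" "\<And>i. i \<in> A \<Longrightarrow> g i \<in> carrier U"
  shows "c \<odot>\<^bsub>U\<^esub> finsum U g A = finsum U (\<lambda>i. c \<odot>\<^bsub>U\<^esub> g i) A"
  by (rule lin_finsum[where f = "\<lambda>x. c \<odot>\<^bsub>U\<^esub> x"]) (use assms in \<open>auto intro!: lin_scale lin_id\<close>)

section \<open>Subspaces and spans\<close>

lemma SUB_I:
  assumes "VS U" "W \<subseteq> carrier U" "\<zero>\<^bsub>U\<^esub> \<in> W"
    and "\<And>x y. x \<in> W \<Longrightarrow> y \<in> W \<Longrightarrow> x \<oplus>\<^bsub>U\<^esub> y \<in> W"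
    and "\<And>c x. c \<in> carrier K \<Longrightarrow> x \<in> W \<Longrightarrow> c \<odot>\<^bsub>U\<^esub> x \<in> W"
  shows "SUB W U"
  using assms by (simp add: submodule_def VS_module)

lemma subspace_SUB: "VectorSpace.subspace K W U \<longleftrightarrow> VS U \<and> SUB W U"
  by (simp add: VectorSpace.subspace_def)

lemma SUB_subset: "SUB W U \<Longrightarrow> x \<in> W \<Longrightarrow> x \<in> carrier U"
  using submodule.subset by blast

lemma SUB_zero: "SUB W U \<Longrightarrow> \<zero>\<^bsub>U\<^esub> \<in> W"
  by (rule submodule.zero_closed)

lemma SUB_add: "SUB W U \<Longrightarrow> x \<in> W \<Longrightarrow> y \<in> W \<Longrightarrow> x \<oplus>\<^bsub>U\<^esub> y \<in> W"
  by (rule submodule.m_closed)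

lemma SUB_smult: "SUB W U \<Longrightarrow> c \<in> carrier K \<Longrightarrow> x \<in> W \<Longrightarrow> c \<odot>\<^bsub>U\<^esub> x \<in> W"
  by (rule submodule.smult_closed)

lemma SUB_neg: "VS U \<Longrightarrow> SUB W U \<Longrightarrow> x \<in> W \<Longrightarrow> \<ominus>\<^bsub>U\<^esub> x \<in> W"
  using SUB_smult[of W U "\<ominus> \<one>" x] by (simp add: VS_distr SUB_subset)

lemma SUB_minus: "VS U \<Longrightarrow> SUB W U \<Longrightarrow> x \<in> W \<Longrightarrow> y \<in> W \<Longrightarrow> x \<ominus>\<^bsub>U\<^esub> y \<in> W"
  by (simp add: VS_minus_eq SUB_add SUB_neg)

lemma SUB_finsum:
  assumes U: "VS U" and W: "SUB W U" and A: "finite A" "\<And>i. i \<in> A \<Longrightarrow> g i \<in> W"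
  shows "finsum U g A \<in> W"
  using A
proof (induction A)
  case empty
  then show ?case using U W by (simp add: SUB_zero)
next
  case (insert a A)
  then show ?case using U W by (simp add: VS_finsum_insert SUB_subset SUB_add)
qed

lemma SUB_ker: "VS U \<Longrightarrow> VS W \<Longrightarrow> f \<in> lin U W \<Longrightarrow> SUB {x \<in> carrier U. f x = \<zero>\<^bsub>W\<^esub>} U"
  by (rule SUB_I) (auto simp: lin_zero lin_add lin_smult)

lemma SUB_image:
  assumes "VS U" "VS W" "f \<in> lin U W" "SUB S U"
  shows "SUB (f ` S) W"
proof (rule SUB_I)
  show "\<zero>\<^bsub>W\<^esub> \<in> f ` S"
    using assms SUB_zero lin_zero by (metis imageI)
  show "x \<oplus>\<^bsub>W\<^esub> y \<in> f ` S" if "x \<in> f ` S" "y \<in> f ` S" for x y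
    using that assms by (auto simp: SUB_subset SUB_add simp flip: lin_add)
  show "c \<odot>\<^bsub>W\<^esub> x \<in> f ` S" if "c \<in> carrier K" "x \<in> f ` S" for x c
    using that assms by (auto simp: SUB_subset SUB_smult simp flip: lin_smult)
qed (use assms in \<open>auto intro: lin_closed SUB_subset\<close>)

lemma SUB_preimage: "VS U \<Longrightarrow> VS W \<Longrightarrow> f \<in> lin U W \<Longrightarrow> SUB S W \<Longrightarrow> SUB {x \<in> carrier U. f x \<in> S} U"
  by (rule SUB_I) (auto simp: lin_zero lin_add lin_smult SUB_zero SUB_add SUB_smult)

lemma SUB_carrier: "VS U \<Longrightarrow> SUB (carrier U) U"
  by (rule SUB_I) auto

lemma SUB_zero_space: "VS U \<Longrightarrow> SUB {\<zero>\<^bsub>U\<^esub>} U"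
  by (rule SUB_I) auto

text \<open>The equaliser turns an identity between linear maps into membership in a subspace, so
  that it can be checked on generators.\<close>

lemma SUB_eqlin:
  "VS U \<Longrightarrow> VS W \<Longrightarrow> f \<in> lin U W \<Longrightarrow> g \<in> lin U W \<Longrightarrow> SUB {x \<in> carrier U. f x = g x} U"
  by (rule SUB_I) (auto simp: lin_zero lin_add lin_smult)

lemma SUB_VS: "VS U \<Longrightarrow> SUB W U \<Longrightarrow> VS (U\<lparr>carrier := W\<rparr>)"
  by (rule VS_I, rule LinearCombinations.module.submodule_is_module, rule VS_module)

lemma spn_SUB: "VS U \<Longrightarrow> S \<subseteq> carrier U \<Longrightarrow> SUB (spn U S) U"
  by (rule LinearCombinations.module.span_is_submodule, rule VS_module)

lemma spn_incl: "VS U \<Longrightarrow> S \<subseteq> carrier U \<Longrightarrow> x \<in> S \<Longrightarrow> x \<in> spn U S"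
  using LinearCombinations.module.in_own_span[OF VS_module] by blast

lemma spn_least: "VS U \<Longrightarrow> SUB W U \<Longrightarrow> S \<subseteq> W \<Longrightarrow> spn U S \<subseteq> W"
  by (rule LinearCombinations.module.span_is_subset, rule VS_module)

text \<open>The preimage of \<open>T\<close> is a subspace containing \<open>S\<close>, hence its
  span; this is how products with elements of a generated ideal or submodule are controlled.\<close>

lemma lin_spn:
  assumes "VS U" "VS W" "f \<in> lin U W" "SUB T W" "S \<subseteq> carrier U" "\<And>x. x \<in> S \<Longrightarrow> f x \<in> T" "x \<in> spn U S"
  shows "f x \<in> T"
proof -
  have "spn U S \<subseteq> {x \<in> carrier U. f x \<in> T}"
    using assms by (intro spn_least SUB_preimage) auto
  with assms show ?thesis by blast
qed

section \<open>Quotient spaces\<close>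

lemma coset_iff: "z \<in> W +>\<^bsub>U\<^esub> x \<longleftrightarrow> (\<exists>w\<in>W. z = w \<oplus>\<^bsub>U\<^esub> x)"
  by (simp add: a_r_coset_def')

lemma coset_eq:
  assumes U: "VS U" and W: "SUB W U" and x: "x \<in> carrier U" and y: "y \<in> carrier U"
  shows "W +>\<^bsub>U\<^esub> x = W +>\<^bsub>U\<^esub> y \<longleftrightarrow> x \<ominus>\<^bsub>U\<^esub> y \<in> W"
proof
  assume eq: "W +>\<^bsub>U\<^esub> x = W +>\<^bsub>U\<^esub> y"
  have "x \<in> W +>\<^bsub>U\<^esub> x"
    using SUB_zero[OF W] U x by (auto simp: coset_iff intro!: bexI[of _ "\<zero>\<^bsub>U\<^esub>"])
  then obtain w where "w \<in> W" "x = w \<oplus>\<^bsub>U\<^esub> y"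
    by (auto simp: eq coset_iff)
  then show "x \<ominus>\<^bsub>U\<^esub> y \<in> W"
    using U W y by (simp add: VS_cancel SUB_subset)
next
  assume d: "x \<ominus>\<^bsub>U\<^esub> y \<in> W"
  have sub: "W +>\<^bsub>U\<^esub> x \<subseteq> W +>\<^bsub>U\<^esub> y" if d: "x \<ominus>\<^bsub>U\<^esub> y \<in> W" and x: "x \<in> carrier U" and y: "y \<in> carrier U" for x y
  proof
    fix z assume "z \<in> W +>\<^bsub>U\<^esub> x"
    then obtain w where w: "w \<in> W" "z = w \<oplus>\<^bsub>U\<^esub> x" by (auto simp: coset_iff)
    then have "z = (w \<oplus>\<^bsub>U\<^esub> (x \<ominus>\<^bsub>U\<^esub> y)) \<oplus>\<^bsub>U\<^esub> y"
      using U W x y by (simp add: VS_ac(1) VS_cancel SUB_subset)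
    then show "z \<in> W +>\<^bsub>U\<^esub> y"
      using d w W SUB_add[of W U] by (auto simp: coset_iff)
  qed
  have "y \<ominus>\<^bsub>U\<^esub> x = \<ominus>\<^bsub>U\<^esub> (x \<ominus>\<^bsub>U\<^esub> y)"
    using U x y by (simp add: VS_minus_eq VS_distr VS_ac(2))
  then have "y \<ominus>\<^bsub>U\<^esub> x \<in> W" using SUB_neg[OF U W d] by simp
  with d show "W +>\<^bsub>U\<^esub> x = W +>\<^bsub>U\<^esub> y"
    using sub x y by blast
qed

lemma coset_zero_iff:
  assumes U: "VS U" and W: "SUB W U" and x: "x \<in> carrier U"
  shows "W +>\<^bsub>U\<^esub> x = W \<longleftrightarrow> x \<in> W"
proof -
  have "W +>\<^bsub>U\<^esub> \<zero>\<^bsub>U\<^esub> = W"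
    using U SUB_subset[OF W] by (auto simp: set_eq_iff coset_iff)
  then show ?thesis
    using coset_eq[OF U W x, of "\<zero>\<^bsub>U\<^esub>"] U x by simp
qed

lemma rep_coset:
  assumes U: "VS U" and W: "SUB W U" and x: "x \<in> carrier U"
  shows "rep (W +>\<^bsub>U\<^esub> x) \<in> carrier U" "W +>\<^bsub>U\<^esub> rep (W +>\<^bsub>U\<^esub> x) = W +>\<^bsub>U\<^esub> x"
proof -
  have "x \<in> W +>\<^bsub>U\<^esub> x"
    using SUB_zero[OF W] U x by (auto simp: coset_iff intro!: bexI[of _ "\<zero>\<^bsub>U\<^esub>"])
  then have "rep (W +>\<^bsub>U\<^esub> x) \<in> W +>\<^bsub>U\<^esub> x"
    unfolding rep_def by (rule someI)
  then obtain w where w: "w \<in> W" "rep (W +>\<^bsub>U\<^esub> x) = w \<oplus>\<^bsub>U\<^esub> x"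
    by (auto simp: coset_iff)
  then show c: "rep (W +>\<^bsub>U\<^esub> x) \<in> carrier U"
    using U x SUB_subset[OF W] by simp
  show "W +>\<^bsub>U\<^esub> rep (W +>\<^bsub>U\<^esub> x) = W +>\<^bsub>U\<^esub> x"
    using U W x c w SUB_subset[OF W] by (subst coset_eq) (auto simp: VS_cancel)
qed

lemma quot_carrier: "carrier (quot_vs U W) = (\<lambda>x. W +>\<^bsub>U\<^esub> x) ` carrier U"
  by (auto simp: quot_vs_def A_RCOSETS_def')

lemma quot_cases:
  assumes "X \<in> carrier (quot_vs U W)"
  obtains x where "x \<in> carrier U" "X = W +>\<^bsub>U\<^esub> x"
  using assms by (auto simp: quot_carrier)

lemma quot_zero: "\<zero>\<^bsub>quot_vs U W\<^esub> = W"
  by (simp add: quot_vs_def)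

lemma quot_add:
  assumes U: "VS U" and W: "SUB W U" and x: "x \<in> carrier U" and y: "y \<in> carrier U"
  shows "(W +>\<^bsub>U\<^esub> x) \<oplus>\<^bsub>quot_vs U W\<^esub> (W +>\<^bsub>U\<^esub> y) = W +>\<^bsub>U\<^esub> (x \<oplus>\<^bsub>U\<^esub> y)"
proof -
  have "(\<exists>w\<in>W. \<exists>w'\<in>W. z = (w \<oplus>\<^bsub>U\<^esub> x) \<oplus>\<^bsub>U\<^esub> (w' \<oplus>\<^bsub>U\<^esub> y)) \<longleftrightarrow> (\<exists>w\<in>W. z = w \<oplus>\<^bsub>U\<^esub> (x \<oplus>\<^bsub>U\<^esub> y))" for z
  proof safe
    fix w w' assume w: "w \<in> W" "w' \<in> W"
    then have "(w \<oplus>\<^bsub>U\<^esub> x) \<oplus>\<^bsub>U\<^esub> (w' \<oplus>\<^bsub>U\<^esub> y) = (w \<oplus>\<^bsub>U\<^esub> w') \<oplus>\<^bsub>U\<^esub> (x \<oplus>\<^bsub>U\<^esub> y)"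
      using U x y SUB_subset[OF W] by (simp add: VS_ac)
    then show "\<exists>v\<in>W. (w \<oplus>\<^bsub>U\<^esub> x) \<oplus>\<^bsub>U\<^esub> (w' \<oplus>\<^bsub>U\<^esub> y) = v \<oplus>\<^bsub>U\<^esub> (x \<oplus>\<^bsub>U\<^esub> y)"
      using w SUB_add[OF W] by blast
  next
    fix w assume w: "w \<in> W"
    then have "w \<oplus>\<^bsub>U\<^esub> (x \<oplus>\<^bsub>U\<^esub> y) = (w \<oplus>\<^bsub>U\<^esub> x) \<oplus>\<^bsub>U\<^esub> (\<zero>\<^bsub>U\<^esub> \<oplus>\<^bsub>U\<^esub> y)"
      using U x y SUB_subset[OF W] by (simp add: VS_ac)
    then show "\<exists>v\<in>W. \<exists>w'\<in>W. w \<oplus>\<^bsub>U\<^esub> (x \<oplus>\<^bsub>U\<^esub> y) = (v \<oplus>\<^bsub>U\<^esub> x) \<oplus>\<^bsub>U\<^esub> (w' \<oplus>\<^bsub>U\<^esub> y)"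
      using w SUB_zero[OF W] by blast
  qed
  moreover have "(\<exists>a\<in>W +>\<^bsub>U\<^esub> x. \<exists>b\<in>W +>\<^bsub>U\<^esub> y. z = a \<oplus>\<^bsub>U\<^esub> b) \<longleftrightarrow> (\<exists>w\<in>W. \<exists>w'\<in>W. z = (w \<oplus>\<^bsub>U\<^esub> x) \<oplus>\<^bsub>U\<^esub> (w' \<oplus>\<^bsub>U\<^esub> y))" for z
    unfolding Bex_def coset_iff by blast
  moreover have "(W +>\<^bsub>U\<^esub> x) \<oplus>\<^bsub>quot_vs U W\<^esub> (W +>\<^bsub>U\<^esub> y) = {z. \<exists>a\<in>W +>\<^bsub>U\<^esub> x. \<exists>b\<in>W +>\<^bsub>U\<^esub> y. z = a \<oplus>\<^bsub>U\<^esub> b}"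
    unfolding quot_vs_def ring.simps set_add_def' by blast
  ultimately show ?thesis
    by (auto simp only: set_eq_iff mem_Collect_eq coset_iff)
qed

lemma quot_smult:
  assumes U: "VS U" and W: "SUB W U" and c: "c \<in> carrier K" and x: "x \<in> carrier U"
  shows "c \<odot>\<^bsub>quot_vs U W\<^esub> (W +>\<^bsub>U\<^esub> x) = W +>\<^bsub>U\<^esub> (c \<odot>\<^bsub>U\<^esub> x)"
proof -
  have "W +>\<^bsub>U\<^esub> (c \<odot>\<^bsub>U\<^esub> y) = W +>\<^bsub>U\<^esub> (c \<odot>\<^bsub>U\<^esub> x)" if y: "y \<in> W +>\<^bsub>U\<^esub> x" for y
  proof -
    obtain w where w: "w \<in> W" "y = w \<oplus>\<^bsub>U\<^esub> x" using y by (auto simp: coset_iff)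
    have "c \<odot>\<^bsub>U\<^esub> y \<ominus>\<^bsub>U\<^esub> c \<odot>\<^bsub>U\<^esub> x = c \<odot>\<^bsub>U\<^esub> w"
      using U x c w SUB_subset[OF W] by (simp add: VS_distr VS_cancel)
    then show ?thesis
      using U W c x w SUB_subset[OF W] SUB_smult[OF W] by (subst coset_eq) auto
  qed
  moreover have "x \<in> W +>\<^bsub>U\<^esub> x"
    using SUB_zero[OF W] U x by (auto simp: coset_iff intro!: bexI[of _ "\<zero>\<^bsub>U\<^esub>"])
  moreover have "c \<odot>\<^bsub>quot_vs U W\<^esub> (W +>\<^bsub>U\<^esub> x) = (\<Union>y\<in>W +>\<^bsub>U\<^esub> x. W +>\<^bsub>U\<^esub> (c \<odot>\<^bsub>U\<^esub> y))"
    by (simp add: quot_vs_def)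
  ultimately show ?thesis
    by blast
qed

lemma VS_quot [simp]:
  assumes U: "VS U" and W: "SUB W U"
  shows "VS (quot_vs U W)"
proof -
  note s = quot_add[OF U W] quot_smult[OF U W] quot_carrier
  have z: "\<zero>\<^bsub>quot_vs U W\<^esub> = W +>\<^bsub>U\<^esub> \<zero>\<^bsub>U\<^esub>"
    using coset_zero_iff[OF U W, of "\<zero>\<^bsub>U\<^esub>"] U SUB_zero[OF W] by (simp add: quot_zero)
  show ?thesis
  proof (rule vs_criteria)
    show "field K" by (rule field_axioms)
    show "\<forall>v\<in>carrier (quot_vs U W). \<exists>n\<in>carrier (quot_vs U W). v \<oplus>\<^bsub>quot_vs U W\<^esub> n = \<zero>\<^bsub>quot_vs U W\<^esub>"
    proof
      fix v assume "v \<in> carrier (quot_vs U W)"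
      then obtain x where x: "x \<in> carrier U" "v = W +>\<^bsub>U\<^esub> x" by (rule quot_cases)
      then show "\<exists>n\<in>carrier (quot_vs U W). v \<oplus>\<^bsub>quot_vs U W\<^esub> n = \<zero>\<^bsub>quot_vs U W\<^esub>"
        using U by (intro bexI[of _ "W +>\<^bsub>U\<^esub> (\<ominus>\<^bsub>U\<^esub> x)"]) (auto simp: s z)
    qed
  qed (use U W in \<open>auto simp: s z VS_ac VS_distr\<close>)
qed

lemma lin_coset: "VS U \<Longrightarrow> SUB W U \<Longrightarrow> (\<lambda>x. W +>\<^bsub>U\<^esub> x) \<in> lin U (quot_vs U W)"
  by (rule linI) (auto simp: quot_carrier quot_add quot_smult)

lemma coset_closed: "x \<in> carrier U \<Longrightarrow> W +>\<^bsub>U\<^esub> x \<in> carrier (quot_vs U W)"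
  by (simp add: quot_carrier)

text \<open>Two representatives of a coset differ by an element of \<open>W\<close>, which
  \<open>h\<close> kills, so composing with the arbitrary choice \<open>rep\<close> is the
  factorisation of \<open>h\<close> through the quotient.\<close>

lemma quot_induced:
  assumes U: "VS U" and W: "SUB W U" and P: "VS P" and h: "h \<in> lin U P"
    and hW: "\<And>w. w \<in> W \<Longrightarrow> h w = \<zero>\<^bsub>P\<^esub>"
  shows "(\<lambda>X. h (rep X)) \<in> lin (quot_vs U W) P"
    and "x \<in> carrier U \<Longrightarrow> h (rep (W +>\<^bsub>U\<^esub> x)) = h x"
proof -
  have *: "h (rep (W +>\<^bsub>U\<^esub> x)) = h x" if x: "x \<in> carrier U" for x
  proof -
    have "h (rep (W +>\<^bsub>U\<^esub> x) \<ominus>\<^bsub>U\<^esub> x) = \<zero>\<^bsub>P\<^esub>"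
      using rep_coset[OF U W x] coset_eq[OF U W _ x] hW by blast
    then show ?thesis
      using U P h x rep_coset[OF U W x] lin_closed[OF h] by (simp add: lin_minus VS_cancel)
  qed
  then show "x \<in> carrier U \<Longrightarrow> h (rep (W +>\<^bsub>U\<^esub> x)) = h x" .
  show "(\<lambda>X. h (rep X)) \<in> lin (quot_vs U W) P"
    by (rule linI) (auto elim!: quot_cases simp: * quot_add[OF U W] quot_smult[OF U W] U
        lin_closed[OF h] lin_add[OF h] lin_smult[OF h])
qed

lemma quot_kernel:
  assumes U: "VS U" and W: "SUB W U" and x: "x \<in> carrier U"
  shows "W +>\<^bsub>U\<^esub> x = \<zero>\<^bsub>quot_vs U W\<^esub> \<longleftrightarrow> x \<in> W"
  using coset_zero_iff[OF assms] by (simp add: quot_zero)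

section \<open>Ground field, free spaces and presentations\<close>

lemma ground_simps [simp]:
  "carrier (ground_vs K) = carrier K" "\<zero>\<^bsub>ground_vs K\<^esub> = \<zero>" "x \<oplus>\<^bsub>ground_vs K\<^esub> y = x \<oplus> y" "c \<odot>\<^bsub>ground_vs K\<^esub> x = c \<otimes> x"
  by (simp_all add: ground_vs_def)

lemma VS_ground [simp]: "VS (ground_vs K)"
proof (rule vs_criteria)
  show "\<forall>v\<in>carrier (ground_vs K). \<exists>n\<in>carrier (ground_vs K). v \<oplus>\<^bsub>ground_vs K\<^esub> n = \<zero>\<^bsub>ground_vs K\<^esub>"
    using r_neg by auto
qed (auto simp: field_axioms l_distr r_distr m_assoc a_ac)

lemma free_simps [simp]:
  "\<zero>\<^bsub>free_vs K S\<^esub> = (\<lambda>s. \<zero>)" "f \<oplus>\<^bsub>free_vs K S\<^esub> g = (\<lambda>s. f s \<oplus> g s)" "c \<odot>\<^bsub>free_vs K S\<^esub> f = (\<lambda>s. c \<otimes> f s)"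
  by (simp_all add: free_vs_def)

lemma free_carrier:
  "f \<in> carrier (free_vs K S) \<longleftrightarrow> (\<forall>s. f s \<in> carrier K) \<and> finite {s. f s \<noteq> \<zero>} \<and> {s. f s \<noteq> \<zero>} \<subseteq> S"
  by (auto simp: free_vs_def)

lemma VS_free [simp]: "VS (free_vs K S)"
proof (rule vs_criteria)
  show "field K" by (rule field_axioms)
  show "\<forall>v w. v \<in> carrier (free_vs K S) \<and> w \<in> carrier (free_vs K S) \<longrightarrow> v \<oplus>\<^bsub>free_vs K S\<^esub> w \<in> carrier (free_vs K S)"
  proof (intro allI impI)
    fix v w assume a: "v \<in> carrier (free_vs K S) \<and> w \<in> carrier (free_vs K S)"
    have "{s. v s \<oplus> w s \<noteq> \<zero>} \<subseteq> {s. v s \<noteq> \<zero>} \<union> {s. w s \<noteq> \<zero>}"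
      using a by (auto simp: free_carrier)
    with a show "v \<oplus>\<^bsub>free_vs K S\<^esub> w \<in> carrier (free_vs K S)"
      by (simp add: free_carrier) (meson finite_Un finite_subset le_supI subset_trans)
  qed
  show "\<forall>v\<in>carrier (free_vs K S). \<exists>n\<in>carrier (free_vs K S). v \<oplus>\<^bsub>free_vs K S\<^esub> n = \<zero>\<^bsub>free_vs K S\<^esub>"
  proof
    fix v assume v: "v \<in> carrier (free_vs K S)"
    have "{s. \<ominus> v s \<noteq> \<zero>} \<subseteq> {s. v s \<noteq> \<zero>}"
      using v by auto
    then have "(\<lambda>s. \<ominus> v s) \<in> carrier (free_vs K S)"
      using v by (auto simp: free_carrier intro: finite_subset)
    then show "\<exists>n\<in>carrier (free_vs K S). v \<oplus>\<^bsub>free_vs K S\<^esub> n = \<zero>\<^bsub>free_vs K S\<^esub>"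
      by (rule bexI[rotated]) (use v in \<open>auto simp: free_carrier r_neg\<close>)
  qed
  show "\<forall>c v. c \<in> carrier K \<and> v \<in> carrier (free_vs K S) \<longrightarrow> c \<odot>\<^bsub>free_vs K S\<^esub> v \<in> carrier (free_vs K S)"
  proof (intro allI impI)
    fix c v assume a: "c \<in> carrier K \<and> v \<in> carrier (free_vs K S)"
    have "{s. c \<otimes> v s \<noteq> \<zero>} \<subseteq> {s. v s \<noteq> \<zero>}"
      using a by auto
    with a show "c \<odot>\<^bsub>free_vs K S\<^esub> v \<in> carrier (free_vs K S)"
      by (auto simp: free_carrier intro: finite_subset)
  qed
qed (auto simp: free_carrier a_ac l_distr r_distr m_assoc)

lemma free_gen_closed [simp]: "s \<in> S \<Longrightarrow> free_gen K s \<in> carrier (free_vs K S)"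
  by (auto simp: free_carrier free_gen_def)

text \<open>The induction runs over a finite set containing the support and splits off a multiple of
  one generator at a time.\<close>

lemma free_SUB_all:
  assumes T: "SUB T (free_vs K S)" and ST: "\<And>s. s \<in> S \<Longrightarrow> free_gen K s \<in> T" and f: "f \<in> carrier (free_vs K S)"
  shows "f \<in> T"
proof -
  have "f \<in> T" if "finite A" "{s. f s \<noteq> \<zero>} \<subseteq> A" "f \<in> carrier (free_vs K S)" for f A
    using that
  proof (induction A arbitrary: f)
    case empty
    then have "f = \<zero>\<^bsub>free_vs K S\<^esub>" by auto
    then show ?case using SUB_zero[OF T] by simp
  next
    case (insert a A)
    let ?g = "f(a := \<zero>)"
    have sub: "{s. ?g s \<noteq> \<zero>} \<subseteq> {s. f s \<noteq> \<zero>}" by auto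
    then have "finite {s. ?g s \<noteq> \<zero>}"
      by (rule finite_subset) (use insert.prems(2) in \<open>simp add: free_carrier\<close>)
    then have "?g \<in> carrier (free_vs K S)"
      using insert.prems(2) sub by (auto simp: free_carrier)
    moreover have "{s. ?g s \<noteq> \<zero>} \<subseteq> A" using insert.prems by auto
    ultimately have g: "?g \<in> T" using insert.IH by blast
    have fc: "\<And>s. f s \<in> carrier K" using insert.prems by (auto simp: free_carrier)
    show ?case
    proof (cases "f a = \<zero>")
      case True
      then have "?g = f" by auto
      with g show ?thesis by metis
    next
      case False
      then have "a \<in> S" using insert.prems by (auto simp: free_carrier)
      then have "f a \<odot>\<^bsub>free_vs K S\<^esub> free_gen K a \<in> T"
        using ST fc by (intro SUB_smult[OF T])
      from SUB_add[OF T g this] have "(\<lambda>s. ?g s \<oplus> f a \<otimes> free_gen K a s) \<in> T" by simp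
      moreover have "(\<lambda>s. ?g s \<oplus> f a \<otimes> free_gen K a s) = f"
        using fc by (auto simp: free_gen_def)
      ultimately show ?thesis by simp
    qed
  qed
  with f show ?thesis by (auto simp: free_carrier)
qed

text \<open>The linear extension of \<open>\<phi>\<close> to finitely supported functions;
  \<open>lift\<close> is this map applied to a representative of a class.\<close>

definition lext :: "('k, 'p) module \<Rightarrow> ('s \<Rightarrow> 'p) \<Rightarrow> ('s \<Rightarrow> 'k) \<Rightarrow> 'p" where
  "lext P \<phi> f = (\<Oplus>\<^bsub>P\<^esub>s\<in>{s. f s \<noteq> \<zero>}. f s \<odot>\<^bsub>P\<^esub> \<phi> s)"

text \<open>Supports change under addition and scaling, so sums are compared over one finite set
  containing all supports involved.\<close>

lemma lext_superset:
  assumes P: "VS P" and phi: "\<And>s. s \<in> S \<Longrightarrow> \<phi> s \<in> carrier P" and f: "f \<in> carrier (free_vs K S)"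
    and A: "finite A" "{s. f s \<noteq> \<zero>} \<subseteq> A" "A \<subseteq> S"
  shows "lext P \<phi> f = (\<Oplus>\<^bsub>P\<^esub>s\<in>A. f s \<odot>\<^bsub>P\<^esub> \<phi> s)"
  unfolding lext_def
  by (rule VS_finsum_mono_neutral[symmetric, OF P]) (use assms in \<open>auto simp: free_carrier subset_iff\<close>)

lemma lext_lin:
  assumes P: "VS P" and phi: "\<And>s. s \<in> S \<Longrightarrow> \<phi> s \<in> carrier P"
  shows "lext P \<phi> \<in> lin (free_vs K S) P"
proof (rule linI)
  fix f g assume f: "f \<in> carrier (free_vs K S)" and g: "g \<in> carrier (free_vs K S)"
  let ?A = "{s. f s \<noteq> \<zero>} \<union> {s. g s \<noteq> \<zero>}"
  have A: "finite ?A" "?A \<subseteq> S" using f g by (auto simp: free_carrier)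
  have fg: "f \<oplus>\<^bsub>free_vs K S\<^esub> g \<in> carrier (free_vs K S)" using f g by (rule VS_closed(2)[OF VS_free])
  have k: "f s \<in> carrier K" "g s \<in> carrier K" for s using f g by (auto simp: free_carrier)
  have p: "\<And>s. s \<in> ?A \<Longrightarrow> \<phi> s \<in> carrier P" using A phi by blast
  have "lext P \<phi> (f \<oplus>\<^bsub>free_vs K S\<^esub> g) = (\<Oplus>\<^bsub>P\<^esub>s\<in>?A. (f s \<oplus> g s) \<odot>\<^bsub>P\<^esub> \<phi> s)"
    by (subst lext_superset[OF P phi fg, where A = ?A]) (use A k in auto)
  also have "\<dots> = (\<Oplus>\<^bsub>P\<^esub>s\<in>?A. f s \<odot>\<^bsub>P\<^esub> \<phi> s \<oplus>\<^bsub>P\<^esub> g s \<odot>\<^bsub>P\<^esub> \<phi> s)"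
    by (rule VS_finsum_cong[OF P]) (use k p P in \<open>auto simp: VS_distr\<close>)
  also have "\<dots> = (\<Oplus>\<^bsub>P\<^esub>s\<in>?A. f s \<odot>\<^bsub>P\<^esub> \<phi> s) \<oplus>\<^bsub>P\<^esub> (\<Oplus>\<^bsub>P\<^esub>s\<in>?A. g s \<odot>\<^bsub>P\<^esub> \<phi> s)"
    by (rule VS_finsum_add[OF P]) (use k p P in auto)
  also have "\<dots> = lext P \<phi> f \<oplus>\<^bsub>P\<^esub> lext P \<phi> g"
    using lext_superset[OF P phi f, where A = ?A] lext_superset[OF P phi g, where A = ?A] A by simp
  finally show "lext P \<phi> (f \<oplus>\<^bsub>free_vs K S\<^esub> g) = lext P \<phi> f \<oplus>\<^bsub>P\<^esub> lext P \<phi> g" .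
next
  fix c f assume c: "c \<in> carrier K" and f: "f \<in> carrier (free_vs K S)"
  let ?A = "{s. f s \<noteq> \<zero>}"
  have A: "finite ?A" "?A \<subseteq> S" using f by (auto simp: free_carrier)
  have cf: "c \<odot>\<^bsub>free_vs K S\<^esub> f \<in> carrier (free_vs K S)" using c f by (rule VS_closed(5)[OF VS_free])
  have k: "f s \<in> carrier K" for s using f by (auto simp: free_carrier)
  have p: "\<And>s. s \<in> ?A \<Longrightarrow> \<phi> s \<in> carrier P" using A phi by blast
  have "lext P \<phi> (c \<odot>\<^bsub>free_vs K S\<^esub> f) = (\<Oplus>\<^bsub>P\<^esub>s\<in>?A. (c \<otimes> f s) \<odot>\<^bsub>P\<^esub> \<phi> s)"
    by (subst lext_superset[OF P phi cf, where A = ?A]) (use A k c in auto)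
  also have "\<dots> = (\<Oplus>\<^bsub>P\<^esub>s\<in>?A. c \<odot>\<^bsub>P\<^esub> (f s \<odot>\<^bsub>P\<^esub> \<phi> s))"
    by (rule VS_finsum_cong[OF P]) (use k p P c in auto)
  also have "\<dots> = c \<odot>\<^bsub>P\<^esub> lext P \<phi> f"
    unfolding lext_def by (rule VS_finsum_smult[symmetric, OF P c]) (use k p P A in auto)
  finally show "lext P \<phi> (c \<odot>\<^bsub>free_vs K S\<^esub> f) = c \<odot>\<^bsub>P\<^esub> lext P \<phi> f" .
next
  fix f assume f: "f \<in> carrier (free_vs K S)"
  show "lext P \<phi> f \<in> carrier P"
    unfolding lext_def by (rule VS_finsum_closed[OF P]) (use f phi P in \<open>auto simp: free_carrier\<close>)
qed

lemma lext_gen: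
  assumes P: "VS P" and phi: "\<phi> s \<in> carrier P"
  shows "lext P \<phi> (free_gen K s) = \<phi> s"
proof -
  have "{t. free_gen K s t \<noteq> \<zero>} = {s}" by (auto simp: free_gen_def)
  then show ?thesis
    using VS_finsum_insert[of P "{}" s "\<lambda>t. free_gen K s t \<odot>\<^bsub>P\<^esub> \<phi> t"] P phi
    by (simp add: lext_def free_gen_def)
qed

text \<open>Universal property of a space given by generators and relations: the linear extension
  vanishes on the relations, hence on their span, and factors through the quotient. Tensor products
  and tensor powers are both instances.\<close>

lemma lift_presented:
  assumes P: "VS P" and phi: "\<And>s. s \<in> S \<Longrightarrow> \<phi> s \<in> carrier P" and rels: "rels \<subseteq> carrier (free_vs K S)"
    and z: "\<And>r. r \<in> rels \<Longrightarrow> lext P \<phi> r = \<zero>\<^bsub>P\<^esub>"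
  defines "W \<equiv> spn (free_vs K S) rels"
  shows "lift K P \<phi> \<in> lin (quot_vs (free_vs K S) W) P"
    and "\<And>s. s \<in> S \<Longrightarrow> lift K P \<phi> (W +>\<^bsub>free_vs K S\<^esub> free_gen K s) = \<phi> s"
proof -
  have eq: "lift K P \<phi> = (\<lambda>X. lext P \<phi> (rep X))"
    by (auto simp: lift_def lext_def)
  have L: "lext P \<phi> \<in> lin (free_vs K S) P" using P phi by (rule lext_lin)
  have W: "SUB W (free_vs K S)" unfolding W_def using rels by (intro spn_SUB) auto
  have 0: "lext P \<phi> w = \<zero>\<^bsub>P\<^esub>" if "w \<in> W" for w
    using lin_spn[OF VS_free P L SUB_zero_space[OF P] rels, of w] z that by (auto simp: W_def)
  show "lift K P \<phi> \<in> lin (quot_vs (free_vs K S) W) P"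
    unfolding eq using quot_induced(1)[OF VS_free W P L 0] .
  show "lift K P \<phi> (W +>\<^bsub>free_vs K S\<^esub> free_gen K s) = \<phi> s" if "s \<in> S" for s
    unfolding eq using quot_induced(2)[OF VS_free W P L 0 free_gen_closed[OF that]] lext_gen[where \<phi> = \<phi> and s = s, OF P phi[OF that]] by simp
qed

lemma presented_SUB_all:
  assumes W: "SUB W (free_vs K S)" and T: "SUB T (quot_vs (free_vs K S) W)"
    and g: "\<And>s. s \<in> S \<Longrightarrow> W +>\<^bsub>free_vs K S\<^esub> free_gen K s \<in> T" and X: "X \<in> carrier (quot_vs (free_vs K S) W)"
  shows "X \<in> T"
proof -
  obtain x where x: "x \<in> carrier (free_vs K S)" "X = W +>\<^bsub>free_vs K S\<^esub> x" using X by (rule quot_cases)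
  have "x \<in> {x \<in> carrier (free_vs K S). W +>\<^bsub>free_vs K S\<^esub> x \<in> T}"
    by (rule free_SUB_all[OF SUB_preimage[OF VS_free VS_quot[OF VS_free W] lin_coset[OF VS_free W] T]])
       (use g x in auto)
  with x show ?thesis by simp
qed

text \<open>Every subspace avoiding a set of vectors extends to a maximal such one. Bases of
  infinite-dimensional spaces are never needed.\<close>

lemma maximal_avoiding:
  assumes U: "VS U" and C0: "SUB C0 U" "C0 \<inter> A = {}"
  obtains C where "SUB C U" "C0 \<subseteq> C" "C \<inter> A = {}"
    "\<forall>D. SUB D U \<longrightarrow> C \<subseteq> D \<longrightarrow> D \<inter> A = {} \<longrightarrow> D = C"
proof -
  let ?F = "{D. SUB D U \<and> C0 \<subseteq> D \<and> D \<inter> A = {}}"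
  have "\<exists>C\<in>?F. \<forall>D\<in>?F. C \<subseteq> D \<longrightarrow> D = C"
  proof (rule subset_Zorn_nonempty)
    show "?F \<noteq> {}" using C0 by auto
    fix \<C> assume ne: "\<C> \<noteq> {}" and ch: "subset.chain ?F \<C>"
    have sub: "\<And>D. D \<in> \<C> \<Longrightarrow> SUB D U \<and> C0 \<subseteq> D \<and> D \<inter> A = {}"
      using ch unfolding subset_chain_def by blast
    have tot: "\<And>D E. D \<in> \<C> \<Longrightarrow> E \<in> \<C> \<Longrightarrow> D \<subseteq> E \<or> E \<subseteq> D"
      using ch unfolding subset_chain_def by blast
    have "SUB (\<Union>\<C>) U"
    proof (rule SUB_I[OF U])
      show "\<Union>\<C> \<subseteq> carrier U" by (meson Sup_least sub submodule.subset)
      show "\<zero>\<^bsub>U\<^esub> \<in> \<Union>\<C>" using ne SUB_zero[of _ U] sub by (metis UnionI all_not_in_conv)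
      show "x \<oplus>\<^bsub>U\<^esub> y \<in> \<Union>\<C>" if xy: "x \<in> \<Union>\<C>" "y \<in> \<Union>\<C>" for x y
      proof -
        obtain D E where "D \<in> \<C>" "x \<in> D" "E \<in> \<C>" "y \<in> E" using xy by blast
        then obtain G where "G \<in> \<C>" "x \<in> G" "y \<in> G" using tot[of D E] by blast
        then show ?thesis using SUB_add[of G U x y] sub[of G] by blast
      qed
      show "c \<odot>\<^bsub>U\<^esub> x \<in> \<Union>\<C>" if c: "c \<in> carrier K" and x: "x \<in> \<Union>\<C>" for c x
      proof -
        obtain G where "G \<in> \<C>" "x \<in> G" using x by blast
        then show ?thesis using SUB_smult[of G U c x] sub[of G] c by blast
      qed
    qed
    then show "\<Union>\<C> \<in> ?F" using ne sub by blast
  qed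
  then obtain C where C: "C \<in> ?F" "\<forall>D\<in>?F. C \<subseteq> D \<longrightarrow> D = C" by blast
  show thesis
    using C by (intro that[of C]) auto
qed

section \<open>Complements, linear lifts and separating functionals\<close>

lemma SUB_line_sum:
  assumes U: "VS U" and C: "SUB C U" and x: "x \<in> carrier U"
  shows "SUB {c \<oplus>\<^bsub>U\<^esub> a \<odot>\<^bsub>U\<^esub> x | c a. c \<in> C \<and> a \<in> carrier K} U"
proof (rule SUB_I[OF U])
  note Cs = SUB_subset[OF C]
  show "{c \<oplus>\<^bsub>U\<^esub> a \<odot>\<^bsub>U\<^esub> x | c a. c \<in> C \<and> a \<in> carrier K} \<subseteq> carrier U"
    using U x Cs by auto
  show "\<zero>\<^bsub>U\<^esub> \<in> {c \<oplus>\<^bsub>U\<^esub> a \<odot>\<^bsub>U\<^esub> x | c a. c \<in> C \<and> a \<in> carrier K}"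
    using U x SUB_zero[OF C] by (auto intro!: exI[of _ "\<zero>\<^bsub>U\<^esub>"] exI[of _ \<zero>])
  show "y \<oplus>\<^bsub>U\<^esub> z \<in> {c \<oplus>\<^bsub>U\<^esub> a \<odot>\<^bsub>U\<^esub> x | c a. c \<in> C \<and> a \<in> carrier K}"
    if yz: "y \<in> {c \<oplus>\<^bsub>U\<^esub> a \<odot>\<^bsub>U\<^esub> x | c a. c \<in> C \<and> a \<in> carrier K}"
      "z \<in> {c \<oplus>\<^bsub>U\<^esub> a \<odot>\<^bsub>U\<^esub> x | c a. c \<in> C \<and> a \<in> carrier K}" for y z
  proof -
    obtain c a c' a' where "y = c \<oplus>\<^bsub>U\<^esub> a \<odot>\<^bsub>U\<^esub> x" "z = c' \<oplus>\<^bsub>U\<^esub> a' \<odot>\<^bsub>U\<^esub> x"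
      and k: "c \<in> C" "a \<in> carrier K" "c' \<in> C" "a' \<in> carrier K"
      using yz by blast
    then have "y \<oplus>\<^bsub>U\<^esub> z = (c \<oplus>\<^bsub>U\<^esub> c') \<oplus>\<^bsub>U\<^esub> (a \<oplus> a') \<odot>\<^bsub>U\<^esub> x"
      using U x Cs by (simp add: VS_distr VS_ac)
    then show ?thesis using k SUB_add[OF C] by blast
  qed
  show "b \<odot>\<^bsub>U\<^esub> y \<in> {c \<oplus>\<^bsub>U\<^esub> a \<odot>\<^bsub>U\<^esub> x | c a. c \<in> C \<and> a \<in> carrier K}"
    if b: "b \<in> carrier K" and y: "y \<in> {c \<oplus>\<^bsub>U\<^esub> a \<odot>\<^bsub>U\<^esub> x | c a. c \<in> C \<and> a \<in> carrier K}" for b y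
  proof -
    obtain c a where "y = c \<oplus>\<^bsub>U\<^esub> a \<odot>\<^bsub>U\<^esub> x" and k: "c \<in> C" "a \<in> carrier K"
      using y by blast
    then have "b \<odot>\<^bsub>U\<^esub> y = (b \<odot>\<^bsub>U\<^esub> c) \<oplus>\<^bsub>U\<^esub> (b \<otimes> a) \<odot>\<^bsub>U\<^esub> x"
      using U x Cs b by (simp add: VS_distr)
    then show ?thesis using k b SUB_smult[OF C] by blast
  qed
qed

text \<open>Take \<open>C\<close> maximal among the subspaces meeting \<open>W\<close> only in zero.
  If adjoining \<open>u\<close> to \<open>C\<close> creates a nonzero element of \<open>W\<close>,
  its coefficient at \<open>u\<close> is invertible and \<open>u\<close> can be solved for;
  otherwise maximality puts \<open>u\<close> into \<open>C\<close>.\<close>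

lemma complement_exists:
  assumes U: "VS U" and W: "SUB W U"
  obtains C where "SUB C U" "C \<inter> W = {\<zero>\<^bsub>U\<^esub>}" "\<forall>u\<in>carrier U. \<exists>c\<in>C. \<exists>w\<in>W. u = c \<oplus>\<^bsub>U\<^esub> w"
proof -
  have "{\<zero>\<^bsub>U\<^esub>} \<inter> (W - {\<zero>\<^bsub>U\<^esub>}) = {}" by simp
  then obtain C where C: "SUB C U" "{\<zero>\<^bsub>U\<^esub>} \<subseteq> C" "C \<inter> (W - {\<zero>\<^bsub>U\<^esub>}) = {}"
    and mx: "\<forall>D. SUB D U \<longrightarrow> C \<subseteq> D \<longrightarrow> D \<inter> (W - {\<zero>\<^bsub>U\<^esub>}) = {} \<longrightarrow> D = C"
    by (rule maximal_avoiding[OF U SUB_zero_space[OF U]])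
  note Cs = SUB_subset[OF C(1)] and Ws = SUB_subset[OF W]
  have "\<exists>c\<in>C. \<exists>w\<in>W. u = c \<oplus>\<^bsub>U\<^esub> w" if u: "u \<in> carrier U" for u
  proof -
    let ?D = "{c \<oplus>\<^bsub>U\<^esub> a \<odot>\<^bsub>U\<^esub> u | c a. c \<in> C \<and> a \<in> carrier K}"
    have D: "SUB ?D U" using U C(1) u by (rule SUB_line_sum)
    have CD: "C \<subseteq> ?D"
    proof
      fix c assume "c \<in> C"
      moreover from this have "c = c \<oplus>\<^bsub>U\<^esub> \<zero> \<odot>\<^bsub>U\<^esub> u" using U u Cs by simp
      ultimately show "c \<in> ?D" by blast
    qed
    have uD: "u \<in> ?D"
      using U u SUB_zero[OF C(1)] by (auto intro!: exI[of _ "\<zero>\<^bsub>U\<^esub>"] exI[of _ \<one>])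
    show ?thesis
    proof (cases "?D \<inter> (W - {\<zero>\<^bsub>U\<^esub>}) = {}")
      case True
      then have "u \<in> C" using mx[rule_format, OF D CD] uD by simp
      then show ?thesis using U SUB_zero[OF W] Cs by (intro bexI[of _ u] bexI[of _ "\<zero>\<^bsub>U\<^esub>"]) auto
    next
      case False
      then obtain c a where c: "c \<in> C" and a: "a \<in> carrier K" and w: "c \<oplus>\<^bsub>U\<^esub> a \<odot>\<^bsub>U\<^esub> u \<in> W" "c \<oplus>\<^bsub>U\<^esub> a \<odot>\<^bsub>U\<^esub> u \<noteq> \<zero>\<^bsub>U\<^esub>"
        by blast
      have a0: "a \<noteq> \<zero>"
      proof
        assume "a = \<zero>"
        then have "c \<in> W - {\<zero>\<^bsub>U\<^esub>}" using w U u Cs c by auto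
        with C(3) c show False by blast
      qed
      let ?w = "c \<oplus>\<^bsub>U\<^esub> a \<odot>\<^bsub>U\<^esub> u"
      have i: "inv a \<in> carrier K" "inv a \<otimes> a = \<one>" using a a0 by (auto simp: field_Units)
      have "u = \<ominus>\<^bsub>U\<^esub> (inv a \<odot>\<^bsub>U\<^esub> c) \<oplus>\<^bsub>U\<^esub> inv a \<odot>\<^bsub>U\<^esub> ?w"
        using U u Cs[OF c] a i by (simp add: VS_distr VS_ac(1)[symmetric])
      moreover have "\<ominus>\<^bsub>U\<^esub> (inv a \<odot>\<^bsub>U\<^esub> c) \<in> C" using U C(1) c i by (intro SUB_neg SUB_smult)
      moreover have "inv a \<odot>\<^bsub>U\<^esub> ?w \<in> W" using W w i by (intro SUB_smult)
      ultimately show ?thesis by blast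
    qed
  qed
  moreover have "C \<inter> W = {\<zero>\<^bsub>U\<^esub>}" using C SUB_zero[OF C(1)] SUB_zero[OF W] by blast
  ultimately show thesis using that C(1) by blast
qed

text \<open>On a complement of the kernel \<open>g\<close> is injective, so the preimage chosen
  there is unique, and uniqueness makes the choice linear. The lifts of module maps below reduce to
  this.\<close>

lemma lin_lift:
  assumes U: "VS U" and X: "VS X" and Y: "VS Y" and g: "g \<in> lin X Y" and f: "f \<in> lin U Y"
    and im: "\<And>u. u \<in> carrier U \<Longrightarrow> f u \<in> g ` carrier X"
  obtains l where "l \<in> lin U X" "\<forall>u\<in>carrier U. g (l u) = f u"
proof -
  obtain C where C: "SUB C X" "C \<inter> {x \<in> carrier X. g x = \<zero>\<^bsub>Y\<^esub>} = {\<zero>\<^bsub>X\<^esub>}"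
    and dec: "\<forall>u\<in>carrier X. \<exists>c\<in>C. \<exists>w\<in>{x \<in> carrier X. g x = \<zero>\<^bsub>Y\<^esub>}. u = c \<oplus>\<^bsub>X\<^esub> w"
    by (rule complement_exists[OF X SUB_ker[OF X Y g]])
  note Cs = SUB_subset[OF C(1)]
  have inj: "c = d" if "c \<in> C" "d \<in> C" "g c = g d" for c d
  proof -
    have "g (c \<ominus>\<^bsub>X\<^esub> d) = \<zero>\<^bsub>Y\<^esub>" using that Cs X Y g by (simp add: lin_minus lin_closed VS_cancel)
    moreover have "c \<ominus>\<^bsub>X\<^esub> d \<in> C" using that by (intro SUB_minus[OF X C(1)])
    ultimately have "c \<ominus>\<^bsub>X\<^esub> d = \<zero>\<^bsub>X\<^esub>" using C(2) Cs by blast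
    then show ?thesis using that Cs X by (simp add: VS_cancel)
  qed
  have ex: "\<exists>c\<in>C. g c = f u" if u: "u \<in> carrier U" for u
  proof -
    obtain x where x: "x \<in> carrier X" "f u = g x" using im[OF u] by blast
    obtain c w where cw: "c \<in> C" "w \<in> carrier X" "g w = \<zero>\<^bsub>Y\<^esub>" "x = c \<oplus>\<^bsub>X\<^esub> w" using bspec[OF dec x(1)] by blast
    then have "g c = f u" using x Cs Y by (simp add: lin_add[OF g] lin_closed[OF g])
    with cw show ?thesis by blast
  qed
  define l where "l u = (SOME c. c \<in> C \<and> g c = f u)" for u
  have l: "l u \<in> C \<and> g (l u) = f u" if "u \<in> carrier U" for u
    unfolding l_def using ex[OF that] by (intro someI_ex[of "\<lambda>c. c \<in> C \<and> g c = f u"]) blast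
  have "l \<in> lin U X"
  proof (rule linI)
    fix x y c assume x: "x \<in> carrier U"
    show "l x \<in> carrier X" using l[OF x] Cs by blast
    show "l (x \<oplus>\<^bsub>U\<^esub> y) = l x \<oplus>\<^bsub>X\<^esub> l y" if y: "y \<in> carrier U"
      using l[OF x] l[OF y] l[OF VS_closed(2)[OF U x y]] Cs SUB_add[OF C(1)] x y
      by (intro inj) (simp_all add: lin_add[OF g] lin_add[OF f])
  next
    fix c x assume c: "c \<in> carrier K" and x: "x \<in> carrier U"
    show "l (c \<odot>\<^bsub>U\<^esub> x) = c \<odot>\<^bsub>X\<^esub> l x"
      using l[OF x] l[OF VS_closed(5)[OF U c x]] Cs SUB_smult[OF C(1)] x c
      by (intro inj) (simp_all add: lin_smult[OF g] lin_smult[OF f])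
  qed
  then show thesis using that l by blast
qed

text \<open>Divide by \<open>W\<close> and then by a complement \<open>C\<close> of the line through
  the class of \<open>u\<close>. What remains is a copy of the ground field spanned by that class,
  and the functional is the coordinate there, obtained by lifting along the map sending a scalar to
  its multiple of the class.\<close>

lemma separating_functional:
  assumes U: "VS U" and W: "SUB W U" and u: "u \<in> carrier U" "u \<notin> W"
  obtains f where "f \<in> lin U (ground_vs K)" "\<forall>w\<in>W. f w = \<zero>" "f u = \<one>"
proof -
  let ?Q = "quot_vs U W"
  have Q: "VS ?Q" using U W by simp
  let ?q = "W +>\<^bsub>U\<^esub> u"
  have q: "?q \<in> carrier ?Q" "?q \<noteq> \<zero>\<^bsub>?Q\<^esub>" using u by (auto simp: coset_closed quot_kernel[OF U W])
  let ?L = "{a \<odot>\<^bsub>?Q\<^esub> ?q | a. a \<in> carrier K}"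
  have m: "(\<lambda>a. a \<odot>\<^bsub>?Q\<^esub> ?q) \<in> lin (ground_vs K) ?Q"
    by (rule linI) (use Q q in \<open>auto simp: VS_distr\<close>)
  have "SUB ?L ?Q"
    using SUB_image[OF VS_ground Q m SUB_carrier[OF VS_ground]] by (simp add: image_def Bex_def conj_commute)
  then obtain C where C: "SUB C ?Q" "C \<inter> ?L = {\<zero>\<^bsub>?Q\<^esub>}" "\<forall>u\<in>carrier ?Q. \<exists>c\<in>C. \<exists>w\<in>?L. u = c \<oplus>\<^bsub>?Q\<^esub> w"
    by (rule complement_exists[OF Q])
  let ?D = "quot_vs ?Q C"
  have D: "VS ?D" using Q C by simp
  have m': "(\<lambda>a. C +>\<^bsub>?Q\<^esub> (a \<odot>\<^bsub>?Q\<^esub> ?q)) \<in> lin (ground_vs K) ?D"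
    using m lin_coset[OF Q C(1)] by (rule lin_comp)
  have p: "(\<lambda>x. C +>\<^bsub>?Q\<^esub> (W +>\<^bsub>U\<^esub> x)) \<in> lin U ?D"
    using lin_coset[OF U W] lin_coset[OF Q C(1)] by (rule lin_comp)
  have "C +>\<^bsub>?Q\<^esub> (W +>\<^bsub>U\<^esub> x) \<in> (\<lambda>a. C +>\<^bsub>?Q\<^esub> (a \<odot>\<^bsub>?Q\<^esub> ?q)) ` carrier (ground_vs K)" if x: "x \<in> carrier U" for x
  proof -
    obtain c a where ca: "c \<in> C" "a \<in> carrier K" "W +>\<^bsub>U\<^esub> x = c \<oplus>\<^bsub>?Q\<^esub> a \<odot>\<^bsub>?Q\<^esub> ?q"
      using bspec[OF C(3) coset_closed[OF x]] by blast
    then have "C +>\<^bsub>?Q\<^esub> (W +>\<^bsub>U\<^esub> x) = C +>\<^bsub>?Q\<^esub> (a \<odot>\<^bsub>?Q\<^esub> ?q)"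
      using Q q SUB_subset[OF C(1)] by (subst coset_eq[OF Q C(1)]) (auto simp: VS_cancel)
    with ca show ?thesis by auto
  qed
  note im = this
  obtain f where f: "f \<in> lin U (ground_vs K)"
    "\<forall>x\<in>carrier U. C +>\<^bsub>?Q\<^esub> (f x \<odot>\<^bsub>?Q\<^esub> ?q) = C +>\<^bsub>?Q\<^esub> (W +>\<^bsub>U\<^esub> x)"
    by (rule lin_lift[OF U VS_ground D m' p im])
  have inj: "a = b" if k: "a \<in> carrier K" "b \<in> carrier K" and eq: "C +>\<^bsub>?Q\<^esub> (a \<odot>\<^bsub>?Q\<^esub> ?q) = C +>\<^bsub>?Q\<^esub> (b \<odot>\<^bsub>?Q\<^esub> ?q)" for a b
  proof (rule ccontr)
    assume "a \<noteq> b"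
    then have u: "a \<ominus> b \<in> Units K" using k by (simp add: field_Units)
    \<comment> \<open>Subtraction in \<open>ground_vs K\<close> is subtraction in \<open>K\<close>,
      since it depends only on the carrier, zero and addition, which the two records share.\<close>
    have e: "(a \<ominus> b) \<odot>\<^bsub>?Q\<^esub> ?q = a \<odot>\<^bsub>?Q\<^esub> ?q \<ominus>\<^bsub>?Q\<^esub> b \<odot>\<^bsub>?Q\<^esub> ?q"
      using lin_minus[OF VS_ground Q m, of a b] k by (simp add: VS_minus_eq a_minus_def ground_vs_def a_inv_def m_inv_def)
    have "(a \<ominus> b) \<odot>\<^bsub>?Q\<^esub> ?q \<in> C"
      unfolding e using eq k q Q by (subst (asm) coset_eq[OF Q C(1)]) auto
    then have "(a \<ominus> b) \<odot>\<^bsub>?Q\<^esub> ?q = \<zero>\<^bsub>?Q\<^esub>" using C(2) k by blast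
    then have "inv (a \<ominus> b) \<odot>\<^bsub>?Q\<^esub> ((a \<ominus> b) \<odot>\<^bsub>?Q\<^esub> ?q) = \<zero>\<^bsub>?Q\<^esub>" using Q u by simp
    then have "?q = \<zero>\<^bsub>?Q\<^esub>" using u Q q k by simp
    with q show False by simp
  qed
  show thesis
  proof (rule that[OF f(1)])
    show "f u = \<one>"
      using bspec[OF f(2) u(1)] lin_closed[OF f(1) u(1)] Q q by (intro inj) auto
    show "\<forall>w\<in>W. f w = \<zero>"
    proof
    fix w assume w: "w \<in> W"
    then have "W +>\<^bsub>U\<^esub> w = \<zero> \<odot>\<^bsub>?Q\<^esub> ?q" using Q q U W SUB_subset[OF W] by (simp add: quot_kernel)
    then show "f w = \<zero>"
      using bspec[OF f(2), of w] lin_closed[OF f(1), of w] w SUB_subset[OF W] by (intro inj) auto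
    qed
  qed
qed

text \<open>Free spaces are treated abstractly from here on; the pointwise formulas would rewrite
  away the operations that the linearity rules match.\<close>

declare free_simps [simp del]

section \<open>Tensor products and tensor algebras\<close>

definition bilin :: "('k, 'u) module \<Rightarrow> ('k, 'w) module \<Rightarrow> ('k, 'p) module \<Rightarrow> ('u \<Rightarrow> 'w \<Rightarrow> 'p) \<Rightarrow> bool" where
  "bilin U W P \<phi> \<longleftrightarrow> (\<forall>u\<in>carrier U. \<phi> u \<in> lin W P) \<and> (\<forall>w\<in>carrier W. (\<lambda>u. \<phi> u w) \<in> lin U P)"

lemma bilin_r: "bilin U W P \<phi> \<Longrightarrow> u \<in> carrier U \<Longrightarrow> \<phi> u \<in> lin W P"
  and bilin_l: "bilin U W P \<phi> \<Longrightarrow> w \<in> carrier W \<Longrightarrow> (\<lambda>u. \<phi> u w) \<in> lin U P"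
  by (auto simp: bilin_def)

lemma bilin_closed: "bilin U W P \<phi> \<Longrightarrow> u \<in> carrier U \<Longrightarrow> w \<in> carrier W \<Longrightarrow> \<phi> u w \<in> carrier P"
  by (drule (1) bilin_r) (rule lin_closed)

lemma bilin_adds:
  assumes "bilin U W P \<phi>"
  shows "u \<in> carrier U \<Longrightarrow> u' \<in> carrier U \<Longrightarrow> w \<in> carrier W \<Longrightarrow> \<phi> (u \<oplus>\<^bsub>U\<^esub> u') w = \<phi> u w \<oplus>\<^bsub>P\<^esub> \<phi> u' w"
    and "u \<in> carrier U \<Longrightarrow> w \<in> carrier W \<Longrightarrow> w' \<in> carrier W \<Longrightarrow> \<phi> u (w \<oplus>\<^bsub>W\<^esub> w') = \<phi> u w \<oplus>\<^bsub>P\<^esub> \<phi> u w'"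
    and "c \<in> carrier K \<Longrightarrow> u \<in> carrier U \<Longrightarrow> w \<in> carrier W \<Longrightarrow> \<phi> (c \<odot>\<^bsub>U\<^esub> u) w = c \<odot>\<^bsub>P\<^esub> \<phi> u w"
    and "c \<in> carrier K \<Longrightarrow> u \<in> carrier U \<Longrightarrow> w \<in> carrier W \<Longrightarrow> \<phi> u (c \<odot>\<^bsub>W\<^esub> w) = c \<odot>\<^bsub>P\<^esub> \<phi> u w"
  using lin_add[OF bilin_l[OF assms]] lin_add[OF bilin_r[OF assms]]
    lin_smult[OF bilin_l[OF assms]] lin_smult[OF bilin_r[OF assms]] by auto

lemma bilin_zero:
  assumes "VS U" "VS W" "VS P" "bilin U W P \<phi>"
  shows "w \<in> carrier W \<Longrightarrow> \<phi> \<zero>\<^bsub>U\<^esub> w = \<zero>\<^bsub>P\<^esub>" and "u \<in> carrier U \<Longrightarrow> \<phi> u \<zero>\<^bsub>W\<^esub> = \<zero>\<^bsub>P\<^esub>"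
  using lin_zero[OF assms(1,3) bilin_l[OF assms(4)]] lin_zero[OF assms(2,3) bilin_r[OF assms(4)]] by auto

lemma bilinI:
  assumes "\<And>u. u \<in> carrier U \<Longrightarrow> \<phi> u \<in> lin W P" "\<And>w. w \<in> carrier W \<Longrightarrow> (\<lambda>u. \<phi> u w) \<in> lin U P"
  shows "bilin U W P \<phi>"
  using assms by (simp add: bilin_def)

lemma tensor_rels_closed:
  assumes "VS U" "VS W"
  shows "tensor_rels K U W \<subseteq> carrier (free_vs K (carrier U \<times> carrier W))"
  unfolding tensor_rels_def Let_def using assms by auto

lemma tensor_null_SUB:
  assumes "VS U" "VS W"
  shows "SUB (tensor_null K U W) (free_vs K (carrier U \<times> carrier W))"
  unfolding tensor_null_def using tensor_rels_closed[OF assms] by (intro spn_SUB) auto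

lemma VS_tensor [simp]: "VS U \<Longrightarrow> VS W \<Longrightarrow> VS (tensor K U W)"
  unfolding tensor_def by (intro VS_quot tensor_null_SUB) auto

lemma tens_closed [simp]:
  "u \<in> carrier U \<Longrightarrow> w \<in> carrier W \<Longrightarrow> tens K U W u w \<in> carrier (tensor K U W)"
  unfolding tensor_def tens_def by (intro coset_closed free_gen_closed) auto

text \<open>Bilinearity says exactly that the four families of defining relations are sent to
  zero.\<close>

lemma tensor_lift:
  assumes U: "VS U" and W: "VS W" and P: "VS P" and b: "bilin U W P \<phi>"
  shows "lift K P (\<lambda>(u, w). \<phi> u w) \<in> lin (tensor K U W) P"
    and "u \<in> carrier U \<Longrightarrow> w \<in> carrier W \<Longrightarrow> lift K P (\<lambda>(u, w). \<phi> u w) (tens K U W u w) = \<phi> u w"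
proof -
  let ?\<phi> = "\<lambda>(u, w). \<phi> u w" and ?S = "carrier U \<times> carrier W"
  have phi: "?\<phi> s \<in> carrier P" if "s \<in> ?S" for s
    using that bilin_closed[OF b] by auto
  have L: "lext P ?\<phi> \<in> lin (free_vs K ?S) P" using P phi by (rule lext_lin)
  have g: "lext P ?\<phi> (free_gen K (u, w)) = \<phi> u w" if "u \<in> carrier U" "w \<in> carrier W" for u w
    using lext_gen[where \<phi> = ?\<phi> and s = "(u, w)", OF P] that bilin_closed[OF b] by simp
  note ls = lin_minus[OF VS_free P L] lin_add[OF L] lin_smult[OF L]
  have z: "lext P ?\<phi> r = \<zero>\<^bsub>P\<^esub>" if "r \<in> tensor_rels K U W" for r
    using that unfolding tensor_rels_def Let_def
    by (auto simp: ls g U W P bilin_adds[OF b] bilin_closed[OF b])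
  note l = lift_presented[where \<phi> = ?\<phi>, OF P phi tensor_rels_closed[OF U W] z]
  show "lift K P ?\<phi> \<in> lin (tensor K U W) P"
    using l(1) by (simp add: tensor_def tensor_null_def)
  show "lift K P ?\<phi> (tens K U W u w) = \<phi> u w" if "u \<in> carrier U" "w \<in> carrier W"
    using l(2)[of "(u, w)"] that by (simp add: tens_def tensor_null_def)
qed

lemma tensor_SUB_all:
  assumes U: "VS U" and W: "VS W" and T: "SUB T (tensor K U W)"
    and g: "\<And>u w. u \<in> carrier U \<Longrightarrow> w \<in> carrier W \<Longrightarrow> tens K U W u w \<in> T"
    and X: "X \<in> carrier (tensor K U W)"
  shows "X \<in> T"
  using presented_SUB_all[OF tensor_null_SUB[OF U W], of T X] T g X
  by (auto simp: tensor_def tens_def)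

lemma tensor_lin_eq:
  assumes U: "VS U" and W: "VS W" and P: "VS P" and f: "f \<in> lin (tensor K U W) P" and g: "g \<in> lin (tensor K U W) P"
    and eq: "\<And>u w. u \<in> carrier U \<Longrightarrow> w \<in> carrier W \<Longrightarrow> f (tens K U W u w) = g (tens K U W u w)"
    and X: "X \<in> carrier (tensor K U W)"
  shows "f X = g X"
  using tensor_SUB_all[OF U W SUB_eqlin[OF VS_tensor[OF U W] P f g] _ X] eq by simp

text \<open>Each of the four identities is itself a generator of the null space, so both sides lie
  in one coset.\<close>

lemma tens_bilin:
  assumes U: "VS U" and W: "VS W"
  shows "bilin U W (tensor K U W) (tens K U W)"
proof -
  let ?F = "free_vs K (carrier U \<times> carrier W)" and ?N = "tensor_null K U W"
  have N: "SUB ?N ?F" using U W by (rule tensor_null_SUB)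
  note c = lin_coset[OF VS_free N]
  have rel: "?N +>\<^bsub>?F\<^esub> x = ?N +>\<^bsub>?F\<^esub> y" if "x \<ominus>\<^bsub>?F\<^esub> y \<in> tensor_rels K U W" "x \<in> carrier ?F" "y \<in> carrier ?F" for x y
    using that spn_incl[OF VS_free tensor_rels_closed[OF U W]] coset_eq[OF VS_free N]
    by (simp add: tensor_null_def)
  show ?thesis
  proof (intro bilinI linI)
    fix u w w' assume *: "u \<in> carrier U" "w \<in> carrier W" "w' \<in> carrier W"
    have "tens K U W u (w \<oplus>\<^bsub>W\<^esub> w') = ?N +>\<^bsub>?F\<^esub> (free_gen K (u, w) \<oplus>\<^bsub>?F\<^esub> free_gen K (u, w'))"
      unfolding tens_def
      by (rule rel, unfold tensor_rels_def Let_def, use * in blast) (use * U W in simp_all)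
    then show "tens K U W u (w \<oplus>\<^bsub>W\<^esub> w') = tens K U W u w \<oplus>\<^bsub>tensor K U W\<^esub> tens K U W u w'"
      using * by (simp add: lin_add[OF c] tens_def tensor_def)
  next
    fix u u' w assume *: "u \<in> carrier U" "u' \<in> carrier U" "w \<in> carrier W"
    have "tens K U W (u \<oplus>\<^bsub>U\<^esub> u') w = ?N +>\<^bsub>?F\<^esub> (free_gen K (u, w) \<oplus>\<^bsub>?F\<^esub> free_gen K (u', w))"
      unfolding tens_def
      by (rule rel, unfold tensor_rels_def Let_def, use * in blast) (use * U W in simp_all)
    then show "tens K U W (u \<oplus>\<^bsub>U\<^esub> u') w = tens K U W u w \<oplus>\<^bsub>tensor K U W\<^esub> tens K U W u' w"
      using * by (simp add: lin_add[OF c] tens_def tensor_def)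
  next
    fix u w a assume *: "u \<in> carrier U" "w \<in> carrier W" "a \<in> carrier K"
    have "tens K U W u (a \<odot>\<^bsub>W\<^esub> w) = ?N +>\<^bsub>?F\<^esub> (a \<odot>\<^bsub>?F\<^esub> free_gen K (u, w))"
      unfolding tens_def
      by (rule rel, unfold tensor_rels_def Let_def, use * in blast) (use * U W in simp_all)
    then show "tens K U W u (a \<odot>\<^bsub>W\<^esub> w) = a \<odot>\<^bsub>tensor K U W\<^esub> tens K U W u w"
      using * by (simp add: lin_smult[OF c] tens_def tensor_def)
  next
    fix u w a assume *: "u \<in> carrier U" "w \<in> carrier W" "a \<in> carrier K"
    have "tens K U W (a \<odot>\<^bsub>U\<^esub> u) w = ?N +>\<^bsub>?F\<^esub> (a \<odot>\<^bsub>?F\<^esub> free_gen K (u, w))"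
      unfolding tens_def
      by (rule rel, unfold tensor_rels_def Let_def, use * in blast) (use * U W in simp_all)
    then show "tens K U W (a \<odot>\<^bsub>U\<^esub> u) w = a \<odot>\<^bsub>tensor K U W\<^esub> tens K U W u w"
      using * by (simp add: lin_smult[OF c] tens_def tensor_def)
  qed auto
qed

text \<open>Phrased by splitting a word around one letter, exactly as in \<open>word_rels\<close>,
  so that every defining relation of the tensor power is sent to zero by one of the clauses.\<close>

definition multilin :: "('k, 'v) module \<Rightarrow> int \<Rightarrow> ('k, 'p) module \<Rightarrow> ('v list \<Rightarrow> 'p) \<Rightarrow> bool" where
  "multilin V n P \<phi> \<longleftrightarrow> (\<forall>vs\<in>words V n. \<phi> vs \<in> carrier P) \<and>
     (\<forall>us v v' ws. us @ [v] @ ws \<in> words V n \<longrightarrow> v' \<in> carrier V \<longrightarrow>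
        \<phi> (us @ [v \<oplus>\<^bsub>V\<^esub> v'] @ ws) = \<phi> (us @ [v] @ ws) \<oplus>\<^bsub>P\<^esub> \<phi> (us @ [v'] @ ws)) \<and>
     (\<forall>us v ws c. us @ [v] @ ws \<in> words V n \<longrightarrow> c \<in> carrier K \<longrightarrow>
        \<phi> (us @ [c \<odot>\<^bsub>V\<^esub> v] @ ws) = c \<odot>\<^bsub>P\<^esub> \<phi> (us @ [v] @ ws))"

lemma words_replace:
  "us @ [v] @ ws \<in> words V n \<Longrightarrow> v' \<in> carrier V \<Longrightarrow> us @ [v'] @ ws \<in> words V n"
  and words_mid: "us @ [v] @ ws \<in> words V n \<Longrightarrow> v \<in> carrier V"
  by (auto simp: words_def)

lemma words_append: "us \<in> words V m \<Longrightarrow> vs \<in> words V n \<Longrightarrow> us @ vs \<in> words V (m + n)"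
  by (auto simp: words_def)

lemma word_rels_closed:
  assumes V: "VS V"
  shows "word_rels K V n \<subseteq> carrier (free_vs K (words V n))"
proof -
  have "free_gen K (us @ [v'] @ ws) \<in> carrier (free_vs K (words V n))"
    if "us @ [v] @ ws \<in> words V n" "v' \<in> carrier V" for us v ws v'
    using words_replace[OF that] by (rule free_gen_closed)
  moreover have "v \<in> carrier V" if "us @ [v] @ ws \<in> words V n" for us v ws
    using words_mid[OF that] .
  ultimately show ?thesis
    unfolding word_rels_def Let_def using V
    by (intro Un_least subsetI; elim CollectE exE conjE; hypsubst; intro VS_closed(2,4,5)[OF VS_free]) (blast intro: VS_closed(2,5)[OF V] free_gen_closed)+
qed

lemma word_null_SUB: "VS V \<Longrightarrow> SUB (word_null K V n) (free_vs K (words V n))"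
  unfolding word_null_def using word_rels_closed by (intro spn_SUB) auto

lemma VS_tensor_power [simp]: "VS V \<Longrightarrow> VS (tensor_power K V n)"
  unfolding tensor_power_def by (intro VS_quot word_null_SUB) auto

lemma word_tens_alt: "vs \<in> words V n \<Longrightarrow> word_tens K V vs = word_null K V n +>\<^bsub>free_vs K (words V n)\<^esub> free_gen K vs"
  by (auto simp: word_tens_def words_def)

lemma word_tens_closed: "vs \<in> words V n \<Longrightarrow> word_tens K V vs \<in> carrier (tensor_power K V n)"
  unfolding tensor_power_def by (subst word_tens_alt) (auto intro: coset_closed)

lemma tpow_lift:
  assumes V: "VS V" and P: "VS P" and m: "multilin V n P \<phi>"
  shows "lift K P \<phi> \<in> lin (tensor_power K V n) P"
    and "vs \<in> words V n \<Longrightarrow> lift K P \<phi> (word_tens K V vs) = \<phi> vs"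
proof -
  have phi: "\<phi> vs \<in> carrier P" if "vs \<in> words V n" for vs
    using that m by (simp add: multilin_def)
  have L: "lext P \<phi> \<in> lin (free_vs K (words V n)) P" using P phi by (rule lext_lin)
  have g: "lext P \<phi> (free_gen K vs) = \<phi> vs" if "vs \<in> words V n" for vs
    using lext_gen[where \<phi> = \<phi> and s = vs, OF P] that phi by simp
  note ls = lin_minus[OF VS_free P L] lin_add[OF L] lin_smult[OF L]
  have z: "lext P \<phi> r = \<zero>\<^bsub>P\<^esub>" if "r \<in> word_rels K V n" for r
    using that unfolding word_rels_def Let_def
  proof (elim UnE CollectE exE conjE)
    fix us v v' ws
    assume r: "r = free_gen K (us @ [v \<oplus>\<^bsub>V\<^esub> v'] @ ws) \<ominus>\<^bsub>free_vs K (words V n)\<^esub>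
        (free_gen K (us @ [v] @ ws) \<oplus>\<^bsub>free_vs K (words V n)\<^esub> free_gen K (us @ [v'] @ ws))"
      and w: "us @ [v] @ ws \<in> words V n" "v' \<in> carrier V"
    have w': "us @ [v'] @ ws \<in> words V n" "us @ [v \<oplus>\<^bsub>V\<^esub> v'] @ ws \<in> words V n"
      using words_replace[OF w(1)] words_mid[OF w(1)] w V by auto
    have "\<phi> (us @ [v \<oplus>\<^bsub>V\<^esub> v'] @ ws) = \<phi> (us @ [v] @ ws) \<oplus>\<^bsub>P\<^esub> \<phi> (us @ [v'] @ ws)"
      using m w by (simp add: multilin_def)
    then show ?thesis
      unfolding r using w(1) w' phi P by (simp only: ls g free_gen_closed VS_closed VS_free) simp
  next
    fix c us v ws
    assume r: "r = free_gen K (us @ [c \<odot>\<^bsub>V\<^esub> v] @ ws) \<ominus>\<^bsub>free_vs K (words V n)\<^esub>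
        (c \<odot>\<^bsub>free_vs K (words V n)\<^esub> free_gen K (us @ [v] @ ws))"
      and w: "c \<in> carrier K" "us @ [v] @ ws \<in> words V n"
    have w': "us @ [c \<odot>\<^bsub>V\<^esub> v] @ ws \<in> words V n"
      using words_replace[OF w(2)] words_mid[OF w(2)] w V by auto
    have "\<phi> (us @ [c \<odot>\<^bsub>V\<^esub> v] @ ws) = c \<odot>\<^bsub>P\<^esub> \<phi> (us @ [v] @ ws)"
      using m w by (simp add: multilin_def)
    then show ?thesis
      unfolding r using w w' phi P by (simp only: ls g free_gen_closed VS_closed VS_free) simp
  qed
  note l = lift_presented[where \<phi> = \<phi> and S = "words V n" and rels = "word_rels K V n", OF P phi word_rels_closed[OF V] z]
  show "lift K P \<phi> \<in> lin (tensor_power K V n) P"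
    using l(1) by (simp add: tensor_power_def word_null_def)
  show "lift K P \<phi> (word_tens K V vs) = \<phi> vs" if "vs \<in> words V n"
    using l(2)[OF _ _ that] word_tens_alt[OF that] by (simp add: word_null_def)
qed

lemma tpow_SUB_all:
  assumes V: "VS V" and T: "SUB T (tensor_power K V n)"
    and g: "\<And>vs. vs \<in> words V n \<Longrightarrow> word_tens K V vs \<in> T"
    and X: "X \<in> carrier (tensor_power K V n)"
  shows "X \<in> T"
  using presented_SUB_all[OF word_null_SUB[OF V], of T n X] T g X
  by (simp add: tensor_power_def word_tens_alt)

lemma tpow_lin_eq:
  assumes V: "VS V" and P: "VS P" and f: "f \<in> lin (tensor_power K V n) P" and g: "g \<in> lin (tensor_power K V n) P"
    and eq: "\<And>vs. vs \<in> words V n \<Longrightarrow> f (word_tens K V vs) = g (word_tens K V vs)"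
    and X: "X \<in> carrier (tensor_power K V n)"
  shows "f X = g X"
  using tpow_SUB_all[OF V SUB_eqlin[OF VS_tensor_power[OF V] P f g] _ X] eq word_tens_closed by blast

lemma word_tens_multilin:
  assumes V: "VS V"
  shows "multilin V n (tensor_power K V n) (word_tens K V)"
proof -
  let ?F = "free_vs K (words V n)" and ?N = "word_null K V n"
  have N: "SUB ?N ?F" using V by (rule word_null_SUB)
  note c = lin_coset[OF VS_free N]
  have rel: "?N +>\<^bsub>?F\<^esub> x = ?N +>\<^bsub>?F\<^esub> y" if "x \<ominus>\<^bsub>?F\<^esub> y \<in> word_rels K V n" "x \<in> carrier ?F" "y \<in> carrier ?F" for x y
    using that spn_incl[OF VS_free word_rels_closed[OF V]] coset_eq[OF VS_free N]
    by (simp add: word_null_def)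
  show ?thesis
    unfolding multilin_def
  proof (intro conjI allI impI ballI)
    fix us v v' ws assume w: "us @ [v] @ ws \<in> words V n" "v' \<in> carrier V"
    have w': "us @ [v'] @ ws \<in> words V n" "us @ [v \<oplus>\<^bsub>V\<^esub> v'] @ ws \<in> words V n"
      using words_replace[OF w(1)] words_mid[OF w(1)] w V by auto
    have "word_tens K V (us @ [v \<oplus>\<^bsub>V\<^esub> v'] @ ws)
      = ?N +>\<^bsub>?F\<^esub> (free_gen K (us @ [v] @ ws) \<oplus>\<^bsub>?F\<^esub> free_gen K (us @ [v'] @ ws))"
      unfolding word_tens_alt[OF w'(2)]
    proof (rule rel)
      show "free_gen K (us @ [v \<oplus>\<^bsub>V\<^esub> v'] @ ws) \<ominus>\<^bsub>?F\<^esub> (free_gen K (us @ [v] @ ws) \<oplus>\<^bsub>?F\<^esub> free_gen K (us @ [v'] @ ws)) \<in> word_rels K V n"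
        unfolding word_rels_def Let_def using w by blast
    qed (use w(1) w' in \<open>simp_all only: free_gen_closed VS_closed VS_free\<close>)
    then show "word_tens K V (us @ [v \<oplus>\<^bsub>V\<^esub> v'] @ ws) = word_tens K V (us @ [v] @ ws) \<oplus>\<^bsub>tensor_power K V n\<^esub> word_tens K V (us @ [v'] @ ws)"
      unfolding word_tens_alt[OF w(1)] word_tens_alt[OF w'(1)] tensor_power_def
      using w(1) w' by (simp only: lin_add[OF c] free_gen_closed)
  next
    fix us v ws a assume w: "us @ [v] @ ws \<in> words V n" "a \<in> carrier K"
    have w': "us @ [a \<odot>\<^bsub>V\<^esub> v] @ ws \<in> words V n"
      using words_replace[OF w(1)] words_mid[OF w(1)] w V by auto
    have "word_tens K V (us @ [a \<odot>\<^bsub>V\<^esub> v] @ ws)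
      = ?N +>\<^bsub>?F\<^esub> (a \<odot>\<^bsub>?F\<^esub> free_gen K (us @ [v] @ ws))"
      unfolding word_tens_alt[OF w']
    proof (rule rel)
      show "free_gen K (us @ [a \<odot>\<^bsub>V\<^esub> v] @ ws) \<ominus>\<^bsub>?F\<^esub> (a \<odot>\<^bsub>?F\<^esub> free_gen K (us @ [v] @ ws)) \<in> word_rels K V n"
        unfolding word_rels_def Let_def using w by blast
    qed (use w w' in \<open>simp_all only: free_gen_closed VS_closed VS_free\<close>)
    then show "word_tens K V (us @ [a \<odot>\<^bsub>V\<^esub> v] @ ws) = a \<odot>\<^bsub>tensor_power K V n\<^esub> word_tens K V (us @ [v] @ ws)"
      unfolding word_tens_alt[OF w(1)] tensor_power_def
      using w w' by (simp only: lin_smult[OF c] free_gen_closed)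
  qed (rule word_tens_closed)
qed

text \<open>Together with \<open>multilin_suffix\<close> this allows the product of the tensor
  algebra to be lifted one factor at a time.\<close>

lemma multilin_prefix:
  assumes us: "us \<in> words V m" and f: "multilin V (m + n) P \<phi>"
  shows "multilin V n P (\<lambda>vs. \<phi> (us @ vs))"
  unfolding multilin_def
proof (intro conjI allI impI ballI)
  fix xs v v' ws assume w: "xs @ [v] @ ws \<in> words V n" "v' \<in> carrier V"
  have "(us @ xs) @ [v] @ ws \<in> words V (m + n)" using words_append[OF us w(1)] by simp
  then have "\<phi> ((us @ xs) @ [v \<oplus>\<^bsub>V\<^esub> v'] @ ws) = \<phi> ((us @ xs) @ [v] @ ws) \<oplus>\<^bsub>P\<^esub> \<phi> ((us @ xs) @ [v'] @ ws)"
    using f w(2) unfolding multilin_def by blast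
  then show "\<phi> (us @ xs @ [v \<oplus>\<^bsub>V\<^esub> v'] @ ws) = \<phi> (us @ xs @ [v] @ ws) \<oplus>\<^bsub>P\<^esub> \<phi> (us @ xs @ [v'] @ ws)"
    by simp
next
  fix xs v ws a assume w: "xs @ [v] @ ws \<in> words V n" "a \<in> carrier K"
  have "(us @ xs) @ [v] @ ws \<in> words V (m + n)" using words_append[OF us w(1)] by simp
  then have "\<phi> ((us @ xs) @ [a \<odot>\<^bsub>V\<^esub> v] @ ws) = a \<odot>\<^bsub>P\<^esub> \<phi> ((us @ xs) @ [v] @ ws)"
    using f w(2) unfolding multilin_def by blast
  then show "\<phi> (us @ xs @ [a \<odot>\<^bsub>V\<^esub> v] @ ws) = a \<odot>\<^bsub>P\<^esub> \<phi> (us @ xs @ [v] @ ws)"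
    by simp
next
  fix vs assume "vs \<in> words V n"
  then show "\<phi> (us @ vs) \<in> carrier P"
    using f words_append[OF us] unfolding multilin_def by blast
qed

lemma multilin_suffix:
  assumes vs: "vs \<in> words V n" and f: "multilin V (m + n) P \<phi>"
  shows "multilin V m P (\<lambda>us. \<phi> (us @ vs))"
  unfolding multilin_def
proof (intro conjI allI impI ballI)
  fix xs v v' ws assume w: "xs @ [v] @ ws \<in> words V m" "v' \<in> carrier V"
  have "xs @ [v] @ (ws @ vs) \<in> words V (m + n)" using words_append[OF w(1) vs] by simp
  then have "\<phi> (xs @ [v \<oplus>\<^bsub>V\<^esub> v'] @ (ws @ vs)) = \<phi> (xs @ [v] @ (ws @ vs)) \<oplus>\<^bsub>P\<^esub> \<phi> (xs @ [v'] @ (ws @ vs))"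
    using f w(2) unfolding multilin_def by blast
  then show "\<phi> ((xs @ [v \<oplus>\<^bsub>V\<^esub> v'] @ ws) @ vs) = \<phi> ((xs @ [v] @ ws) @ vs) \<oplus>\<^bsub>P\<^esub> \<phi> ((xs @ [v'] @ ws) @ vs)"
    by simp
next
  fix xs v ws a assume w: "xs @ [v] @ ws \<in> words V m" "a \<in> carrier K"
  have "xs @ [v] @ (ws @ vs) \<in> words V (m + n)" using words_append[OF w(1) vs] by simp
  then have "\<phi> (xs @ [a \<odot>\<^bsub>V\<^esub> v] @ (ws @ vs)) = a \<odot>\<^bsub>P\<^esub> \<phi> (xs @ [v] @ (ws @ vs))"
    using f w(2) unfolding multilin_def by blast
  then show "\<phi> ((xs @ [a \<odot>\<^bsub>V\<^esub> v] @ ws) @ vs) = a \<odot>\<^bsub>P\<^esub> \<phi> ((xs @ [v] @ ws) @ vs)"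
    by simp
next
  fix us assume "us \<in> words V m"
  then show "\<phi> (us @ vs) \<in> carrier P"
    using f words_append[OF _ vs] unfolding multilin_def by blast
qed

text \<open>The vanishing in negative degrees makes the degree-0 and degree-1 parts of ideals and
  submodules generated in positive degrees computable, since the indices in \<^const>\<open>ideal2\<close> and
  \<^const>\<open>gmod_gen\<close> range over all integers.\<close>

definition galgebra :: "('k, 'a) galg \<Rightarrow> bool" where
  "galgebra A \<longleftrightarrow> (\<forall>n. VS (acomp A n)) \<and>
     (\<forall>m n. bilin (acomp A m) (acomp A n) (acomp A (m + n)) (amult A m n)) \<and>
     (\<forall>l m n. \<forall>x\<in>ael A l. \<forall>y\<in>ael A m. \<forall>z\<in>ael A n.
        amult A (l + m) n (amult A l m x y) z = amult A l (m + n) x (amult A m n y z)) \<and>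
     aone A \<in> ael A 0 \<and>
     (\<forall>n. \<forall>x\<in>ael A n. amult A 0 n (aone A) x = x \<and> amult A n 0 x (aone A) = x) \<and>
     (\<forall>n<0. ael A n = {\<zero>\<^bsub>acomp A n\<^esub>})"

lemma galgebraD:
  assumes "galgebra A"
  shows "VS (acomp A n)" "bilin (acomp A m) (acomp A n) (acomp A (m + n)) (amult A m n)"
    "x \<in> ael A l \<Longrightarrow> y \<in> ael A m \<Longrightarrow> z \<in> ael A n \<Longrightarrow>
        amult A (l + m) n (amult A l m x y) z = amult A l (m + n) x (amult A m n y z)"
    "aone A \<in> ael A 0"
    "x \<in> ael A n \<Longrightarrow> amult A 0 n (aone A) x = x"
    "x \<in> ael A n \<Longrightarrow> amult A n 0 x (aone A) = x"
    "n < 0 \<Longrightarrow> ael A n = {\<zero>\<^bsub>acomp A n\<^esub>}"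
  using assms by (auto simp: galgebra_def)

lemma galg_mult_closed:
  "galgebra A \<Longrightarrow> x \<in> ael A m \<Longrightarrow> y \<in> ael A n \<Longrightarrow> amult A m n x y \<in> ael A (m + n)"
  by (rule bilin_closed[OF galgebraD(2)])

text \<open>The product is a lift inside a lift, so the inner map must first be shown multilinear in
  the word that the outer one runs over. It is linear in the second factor, so this too is tested on
  words, where it is multilinearity of concatenation.\<close>

lemma tensor_alg_mult:
  assumes V: "VS V"
  shows "bilin (tensor_power K V m) (tensor_power K V n) (tensor_power K V (m + n)) (amult (tensor_alg K V) m n)"
    and "us \<in> words V m \<Longrightarrow> vs \<in> words V n \<Longrightarrow>
      amult (tensor_alg K V) m n (word_tens K V us) (word_tens K V vs) = word_tens K V (us @ vs)"
proof -
  let ?T = "tensor_power K V (m + n)"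
  let ?i = "\<lambda>us. lift K ?T (\<lambda>vs. word_tens K V (us @ vs))"
  have T: "VS ?T" "VS (tensor_power K V n)" "VS (tensor_power K V m)" using V by auto
  note mT = word_tens_multilin[OF V, of "m + n"]
  have i: "?i us \<in> lin (tensor_power K V n) ?T" "\<And>vs. vs \<in> words V n \<Longrightarrow> ?i us (word_tens K V vs) = word_tens K V (us @ vs)"
    if "us \<in> words V m" for us
    using tpow_lift[OF V T(1) multilin_prefix[OF that mT]] by auto
  have mY: "multilin V m ?T (\<lambda>us. ?i us Y)" if Y: "Y \<in> carrier (tensor_power K V n)" for Y
    unfolding multilin_def
  proof (intro conjI allI impI ballI)
    fix us v v' ws assume w: "us @ [v] @ ws \<in> words V m" "v' \<in> carrier V"
    have w': "us @ [v'] @ ws \<in> words V m" "us @ [v \<oplus>\<^bsub>V\<^esub> v'] @ ws \<in> words V m"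
      using words_replace[OF w(1)] words_mid[OF w(1)] w V by auto
    show "?i (us @ [v \<oplus>\<^bsub>V\<^esub> v'] @ ws) Y = ?i (us @ [v] @ ws) Y \<oplus>\<^bsub>?T\<^esub> ?i (us @ [v'] @ ws) Y"
    proof (rule tpow_lin_eq[OF V T(1) i(1)[OF w'(2)] lin_plus[OF T(2) T(1) i(1)[OF w(1)] i(1)[OF w'(1)]] _ Y])
      fix vs assume vs: "vs \<in> words V n"
      show "?i (us @ [v \<oplus>\<^bsub>V\<^esub> v'] @ ws) (word_tens K V vs) = ?i (us @ [v] @ ws) (word_tens K V vs) \<oplus>\<^bsub>?T\<^esub> ?i (us @ [v'] @ ws) (word_tens K V vs)"
        unfolding i(2)[OF w'(2) vs] i(2)[OF w'(1) vs] i(2)[OF w(1) vs]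
        using multilin_suffix[OF vs mT] w unfolding multilin_def by blast
    qed
  next
    fix us v ws a assume w: "us @ [v] @ ws \<in> words V m" "a \<in> carrier K"
    have w': "us @ [a \<odot>\<^bsub>V\<^esub> v] @ ws \<in> words V m"
      using words_replace[OF w(1)] words_mid[OF w(1)] w V by auto
    show "?i (us @ [a \<odot>\<^bsub>V\<^esub> v] @ ws) Y = a \<odot>\<^bsub>?T\<^esub> ?i (us @ [v] @ ws) Y"
    proof (rule tpow_lin_eq[OF V T(1) i(1)[OF w'] lin_scale[OF T(2) T(1) i(1)[OF w(1)] w(2)] _ Y])
      fix vs assume vs: "vs \<in> words V n"
      show "?i (us @ [a \<odot>\<^bsub>V\<^esub> v] @ ws) (word_tens K V vs) = a \<odot>\<^bsub>?T\<^esub> ?i (us @ [v] @ ws) (word_tens K V vs)"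
        unfolding i(2)[OF w' vs] i(2)[OF w(1) vs]
        using multilin_suffix[OF vs mT] w unfolding multilin_def by blast
    qed
  next
    fix us assume "us \<in> words V m"
    then show "?i us Y \<in> carrier ?T" using i(1) Y lin_closed by metis
  qed
  have def: "amult (tensor_alg K V) m n X Y = lift K ?T (\<lambda>us. ?i us Y) X" for X Y
    by (simp add: tensor_alg_def)
  note o = tpow_lift[OF V T(1) mY]
  show g: "amult (tensor_alg K V) m n (word_tens K V us) (word_tens K V vs) = word_tens K V (us @ vs)"
    if "us \<in> words V m" "vs \<in> words V n" for us vs
    unfolding def o(2)[OF word_tens_closed[OF that(2)] that(1)] using i(2)[OF that] .
  have gY: "amult (tensor_alg K V) m n (word_tens K V us) Y = ?i us Y" if "us \<in> words V m" "Y \<in> carrier (tensor_power K V n)" for us Y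
    unfolding def o(2)[OF that(2) that(1)] ..
  have L: "(\<lambda>X. amult (tensor_alg K V) m n X Y) \<in> lin (tensor_power K V m) ?T" if "Y \<in> carrier (tensor_power K V n)" for Y
    unfolding def using o(1)[OF that] .
  note cl = lin_closed[OF L]
  show "bilin (tensor_power K V m) (tensor_power K V n) ?T (amult (tensor_alg K V) m n)"
  proof (intro bilinI linI)
    fix X Y Z assume X: "X \<in> carrier (tensor_power K V m)" and Y: "Y \<in> carrier (tensor_power K V n)" and Z: "Z \<in> carrier (tensor_power K V n)"
    have YZ: "Y \<oplus>\<^bsub>tensor_power K V n\<^esub> Z \<in> carrier (tensor_power K V n)" using Y Z T by simp
    show "amult (tensor_alg K V) m n X (Y \<oplus>\<^bsub>tensor_power K V n\<^esub> Z) = amult (tensor_alg K V) m n X Y \<oplus>\<^bsub>?T\<^esub> amult (tensor_alg K V) m n X Z"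
      by (rule tpow_lin_eq[OF V T(1) L[OF YZ] lin_plus[OF T(3) T(1) L[OF Y] L[OF Z]] _ X])
         (use Y Z YZ i in \<open>simp add: gY lin_add[OF i(1)]\<close>)
  next
    fix X Y c assume X: "X \<in> carrier (tensor_power K V m)" and Y: "Y \<in> carrier (tensor_power K V n)" and c: "c \<in> carrier K"
    have cY: "c \<odot>\<^bsub>tensor_power K V n\<^esub> Y \<in> carrier (tensor_power K V n)" using Y c T by simp
    show "amult (tensor_alg K V) m n X (c \<odot>\<^bsub>tensor_power K V n\<^esub> Y) = c \<odot>\<^bsub>?T\<^esub> amult (tensor_alg K V) m n X Y"
      by (rule tpow_lin_eq[OF V T(1) L[OF cY] lin_scale[OF T(3) T(1) L[OF Y] c] _ X])
         (use Y cY c i in \<open>simp add: gY lin_smult[OF i(1)]\<close>)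
  qed (use cl L in \<open>simp_all add: lin_add[OF L] lin_smult[OF L]\<close>)
qed

lemma tensor_alg_simps: "acomp (tensor_alg K V) = tensor_power K V" "aone (tensor_alg K V) = word_tens K V []"
  by (simp_all add: tensor_alg_def)

lemma tensor_power_neg:
  assumes V: "VS V" and n: "n < 0"
  shows "carrier (tensor_power K V n) = {\<zero>\<^bsub>tensor_power K V n\<^esub>}"
proof -
  have "words V n = {}" using n by (auto simp: words_def)
  then have "X \<in> {\<zero>\<^bsub>tensor_power K V n\<^esub>}" if "X \<in> carrier (tensor_power K V n)" for X
    using tpow_SUB_all[OF V SUB_zero_space[OF VS_tensor_power[OF V, of n]] _ that] by blast
  then show ?thesis using VS_tensor_power[OF V, of n] by auto
qed

text \<open>Both sides of the associative law are linear in each argument, so three successive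
  reductions to words leave associativity of list concatenation.\<close>

lemma tensor_alg_galgebra:
  assumes V: "VS V"
  shows "galgebra (tensor_alg K V)"
proof -
  let ?m = "amult (tensor_alg K V)" and ?T = "tensor_power K V"
  have T: "VS (?T n)" for n using V by simp
  note b = tensor_alg_mult(1)[OF V] and g = tensor_alg_mult(2)[OF V]
  have one: "[] \<in> words V 0" by (simp add: words_def)
  \<comment> \<open>The two bracketings land in the components of degree \<open>l + m + n\<close>
    and \<open>l + (m + n)\<close>, which \<open>add.assoc\<close> identifies.\<close>
  have comp: "(\<lambda>x. ?m (l + m) n (?m l m x y) z) \<in> lin (?T l) (?T (l + m + n))"
      "(\<lambda>x. ?m l (m + n) x (?m m n y z)) \<in> lin (?T l) (?T (l + m + n))"
    if "y \<in> carrier (?T m)" "z \<in> carrier (?T n)" for l m n y z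
    using lin_comp[OF bilin_l[OF b that(1)] bilin_l[OF b that(2)]]
      bilin_l[OF b bilin_closed[OF b that]] by (simp_all add: add.assoc)
  have comp2: "(\<lambda>y. ?m (l + m) n (?m l m x y) z) \<in> lin (?T m) (?T (l + m + n))"
      "(\<lambda>y. ?m l (m + n) x (?m m n y z)) \<in> lin (?T m) (?T (l + m + n))"
    if "x \<in> carrier (?T l)" "z \<in> carrier (?T n)" for l m n x z
    using lin_comp[OF bilin_r[OF b that(1)] bilin_l[OF b that(2)]]
      lin_comp[OF bilin_l[OF b that(2)] bilin_r[OF b that(1)]] by (simp_all add: add.assoc)
  have comp3: "(\<lambda>z. ?m (l + m) n (?m l m x y) z) \<in> lin (?T n) (?T (l + m + n))"
      "(\<lambda>z. ?m l (m + n) x (?m m n y z)) \<in> lin (?T n) (?T (l + m + n))"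
    if "x \<in> carrier (?T l)" "y \<in> carrier (?T m)" for l m n x y
    using bilin_r[OF b bilin_closed[OF b that]]
      lin_comp[OF bilin_r[OF b that(2)] bilin_r[OF b that(1)]] by (simp_all add: add.assoc)
  have assoc: "?m (l + m) n (?m l m x y) z = ?m l (m + n) x (?m m n y z)"
    if x: "x \<in> carrier (?T l)" and y: "y \<in> carrier (?T m)" and z: "z \<in> carrier (?T n)" for l m n x y z
  proof (rule tpow_lin_eq[OF V T comp(1)[OF y z] comp(2)[OF y z] _ x])
    fix us assume us: "us \<in> words V l"
    note u = word_tens_closed[OF us]
    show "?m (l + m) n (?m l m (word_tens K V us) y) z = ?m l (m + n) (word_tens K V us) (?m m n y z)"
    proof (rule tpow_lin_eq[OF V T comp2(1)[OF u z] comp2(2)[OF u z] _ y])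
      fix vs assume vs: "vs \<in> words V m"
      note v = word_tens_closed[OF vs]
      show "?m (l + m) n (?m l m (word_tens K V us) (word_tens K V vs)) z = ?m l (m + n) (word_tens K V us) (?m m n (word_tens K V vs) z)"
      proof (rule tpow_lin_eq[OF V T comp3(1)[OF u v] comp3(2)[OF u v] _ z])
        fix ws assume ws: "ws \<in> words V n"
        show "?m (l + m) n (?m l m (word_tens K V us) (word_tens K V vs)) (word_tens K V ws) = ?m l (m + n) (word_tens K V us) (?m m n (word_tens K V vs) (word_tens K V ws))"
          using us vs ws by (simp add: g words_append)
      qed
    qed
  qed
  have l1: "?m 0 n (word_tens K V []) x = x" and r1: "?m n 0 x (word_tens K V []) = x" if x: "x \<in> carrier (?T n)" for n x
  proof -
    show "?m 0 n (word_tens K V []) x = x"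
      by (rule tpow_lin_eq[OF V T _ lin_id _ x])
         (use bilin_r[OF b[of 0 n] word_tens_closed[OF one]] g[OF one] in auto)
    show "?m n 0 x (word_tens K V []) = x"
      by (rule tpow_lin_eq[OF V T _ lin_id _ x])
         (use bilin_l[OF b[of n 0] word_tens_closed[OF one]] g[OF _ one] in auto)
  qed
  show ?thesis
    unfolding galgebra_def tensor_alg_simps
    using T b assoc l1 r1 word_tens_closed[OF one] tensor_power_neg[OF V] by blast
qed

lemma galg_quot_simps:
  "acomp (galg_quot A I) n = quot_vs (acomp A n) (I n)" "aone (galg_quot A I) = I 0 +>\<^bsub>acomp A 0\<^esub> aone A"
  by (simp_all add: galg_quot_def)

text \<open>The representatives are exchanged one at a time, first in the left factor using that
  \<open>I\<close> is a right ideal, then in the right factor using that it is a left ideal.\<close>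

lemma galg_quot_mult:
  assumes A: "galgebra A" and I: "\<And>n. SUB (I n) (acomp A n)"
    and il: "\<And>m n x z. x \<in> ael A m \<Longrightarrow> z \<in> I n \<Longrightarrow> amult A m n x z \<in> I (m + n)"
    and ir: "\<And>m n x z. z \<in> I m \<Longrightarrow> x \<in> ael A n \<Longrightarrow> amult A m n z x \<in> I (m + n)"
    and x: "x \<in> ael A m" and y: "y \<in> ael A n"
  shows "amult (galg_quot A I) m n (I m +>\<^bsub>acomp A m\<^esub> x) (I n +>\<^bsub>acomp A n\<^esub> y) = I (m + n) +>\<^bsub>acomp A (m + n)\<^esub> amult A m n x y"
proof -
  note V = galgebraD(1)[OF A] and b = galgebraD(2)[OF A]
  let ?x = "rep (I m +>\<^bsub>acomp A m\<^esub> x)" and ?y = "rep (I n +>\<^bsub>acomp A n\<^esub> y)"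
  have rx: "?x \<in> ael A m" "?x \<ominus>\<^bsub>acomp A m\<^esub> x \<in> I m"
    using rep_coset[OF V I x] coset_eq[OF V I _ x] by auto
  have ry: "?y \<in> ael A n" "?y \<ominus>\<^bsub>acomp A n\<^esub> y \<in> I n"
    using rep_coset[OF V I y] coset_eq[OF V I _ y] by auto
  have "amult A m n (?x \<ominus>\<^bsub>acomp A m\<^esub> x) ?y = amult A m n ?x ?y \<ominus>\<^bsub>acomp A (m + n)\<^esub> amult A m n x ?y"
    using lin_minus[OF V V bilin_l[OF b ry(1)] rx(1) x] .
  moreover have "amult A m n x (?y \<ominus>\<^bsub>acomp A n\<^esub> y) = amult A m n x ?y \<ominus>\<^bsub>acomp A (m + n)\<^esub> amult A m n x y"
    using lin_minus[OF V V bilin_r[OF b x] ry(1) y] .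
  ultimately have "I (m + n) +>\<^bsub>acomp A (m + n)\<^esub> amult A m n ?x ?y = I (m + n) +>\<^bsub>acomp A (m + n)\<^esub> amult A m n x ?y"
    "I (m + n) +>\<^bsub>acomp A (m + n)\<^esub> amult A m n x ?y = I (m + n) +>\<^bsub>acomp A (m + n)\<^esub> amult A m n x y"
    using coset_eq[OF V I galg_mult_closed[OF A rx(1) ry(1)] galg_mult_closed[OF A x ry(1)]]
      coset_eq[OF V I galg_mult_closed[OF A x ry(1)] galg_mult_closed[OF A x y]]
      ir[OF rx(2) ry(1)] il[OF x ry(2)] by auto
  then show ?thesis by (simp add: galg_quot_def)
qed

lemma galg_quot_galgebra:
  assumes A: "galgebra A" and I: "\<And>n. SUB (I n) (acomp A n)"
    and il: "\<And>m n x z. x \<in> ael A m \<Longrightarrow> z \<in> I n \<Longrightarrow> amult A m n x z \<in> I (m + n)"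
    and ir: "\<And>m n x z. z \<in> I m \<Longrightarrow> x \<in> ael A n \<Longrightarrow> amult A m n z x \<in> I (m + n)"
  shows "galgebra (galg_quot A I)"
proof -
  note V = galgebraD(1)[OF A] and b = galgebraD(2)[OF A]
  note mu = galg_quot_mult[OF A I il ir] and mc = galg_mult_closed[OF A]
  let ?Q = "galg_quot A I"
  let ?c = "\<lambda>n x. I n +>\<^bsub>acomp A n\<^esub> x"
  have bil: "bilin (acomp ?Q m) (acomp ?Q n) (acomp ?Q (m + n)) (amult ?Q m n)" for m n
    unfolding galg_quot_simps
    by (intro bilinI linI; elim quot_cases; hypsubst)
       (simp_all add: mu V I quot_add quot_smult coset_closed mc bilin_adds[OF b])
  have assoc: "amult ?Q (l + m) n (amult ?Q l m x y) z = amult ?Q l (m + n) x (amult ?Q m n y z)"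
    if xyz: "x \<in> ael ?Q l" "y \<in> ael ?Q m" "z \<in> ael ?Q n" for l m n x y z
  proof -
    obtain x' y' z' where "x' \<in> ael A l" "x = ?c l x'" "y' \<in> ael A m" "y = ?c m y'"
      "z' \<in> ael A n" "z = ?c n z'"
      using xyz unfolding galg_quot_simps by (elim quot_cases) blast
    then show ?thesis
      by (simp add: mu mc galgebraD(3)[OF A] add.assoc)
  qed
  have one: "amult ?Q 0 n (aone ?Q) x = x \<and> amult ?Q n 0 x (aone ?Q) = x" if "x \<in> ael ?Q n" for n x
    using that unfolding galg_quot_simps
    by (elim quot_cases) (use mu[of _ 0 _ n] mu[of _ n _ 0] galgebraD(4-6)[OF A] in simp)
  have neg: "ael ?Q n = {\<zero>\<^bsub>acomp ?Q n\<^esub>}" if "n < 0" for n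
    unfolding galg_quot_simps using galgebraD(7)[OF A that] quot_kernel[OF V I, of "\<zero>\<^bsub>acomp A n\<^esub>" n] V[of n] SUB_zero[OF I, of n]
    by (auto simp: quot_carrier)
  show ?thesis
    unfolding galgebra_def using bil assoc one neg V I coset_closed[OF galgebraD(4)[OF A], of "I 0"]
    by (auto simp: galg_quot_simps)
qed

text \<open>An extra factor \<open>x\<close> is absorbed by associativity into the outer factor
  \<open>u\<close> or \<open>w\<close> of a product \<open>u r w\<close>; the \<open>+ 2\<close> in
  the indices is the degree of \<open>r\<close>.\<close>

lemma ideal2_props:
  assumes A: "galgebra A" and R: "R \<subseteq> ael A 2"
  shows "SUB (ideal2 K A R n) (acomp A n)"
    and "x \<in> ael A m \<Longrightarrow> z \<in> ideal2 K A R n \<Longrightarrow> amult A m n x z \<in> ideal2 K A R (m + n)"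
    and "z \<in> ideal2 K A R m \<Longrightarrow> x \<in> ael A n \<Longrightarrow> amult A m n z x \<in> ideal2 K A R (m + n)"
proof -
  note V = galgebraD(1)[OF A] and b = galgebraD(2)[OF A] and mc = galg_mult_closed[OF A] and as = galgebraD(3)[OF A]
  let ?S = "\<lambda>n. {amult A (i + 2) j (amult A i 2 u r) w | i j u r w.
        i + 2 + j = n \<and> u \<in> ael A i \<and> r \<in> R \<and> w \<in> ael A j}"
  have S: "?S n \<subseteq> ael A n" for n
    using mc R by (auto intro!: mc)
  show sub: "SUB (ideal2 K A R n) (acomp A n)" for n
    unfolding ideal2_def using V S by (rule spn_SUB)
  show "amult A m n x z \<in> ideal2 K A R (m + n)" if x: "x \<in> ael A m" and z: "z \<in> ideal2 K A R n"
  proof (rule lin_spn[OF V V bilin_r[OF b x] sub S _ z[unfolded ideal2_def]])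
    fix s assume "s \<in> ?S n"
    then obtain i j u r w where s: "s = amult A (i + 2) j (amult A i 2 u r) w" and d: "n = i + 2 + j"
      and k: "u \<in> ael A i" "r \<in> R" "w \<in> ael A j" by blast
    have r: "r \<in> ael A 2" using k R by blast
    have "amult A m n x s = amult A (m + i + 2) j (amult A (m + i) 2 (amult A m i x u) r) w"
      using as[OF x mc[OF k(1) r] k(3)] as[OF x k(1) r] by (simp add: s d add.assoc)
    moreover have "amult A m i x u \<in> ael A (m + i)" using mc x k by simp
    ultimately have "amult A m n x s \<in> ?S (m + n)"
      using k d by (intro CollectI exI[of _ "m + i"] exI[of _ j] exI[of _ "amult A m i x u"] exI[of _ r] exI[of _ w]) auto
    then show "amult A m n x s \<in> ideal2 K A R (m + n)"
      unfolding ideal2_def by (rule spn_incl[OF V S])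
  qed
  show "amult A m n z x \<in> ideal2 K A R (m + n)" if z: "z \<in> ideal2 K A R m" and x: "x \<in> ael A n"
  proof (rule lin_spn[OF V V bilin_l[OF b x] sub S _ z[unfolded ideal2_def]])
    fix s assume "s \<in> ?S m"
    then obtain i j u r w where s: "s = amult A (i + 2) j (amult A i 2 u r) w" and d: "m = i + 2 + j"
      and k: "u \<in> ael A i" "r \<in> R" "w \<in> ael A j" by blast
    have r: "r \<in> ael A 2" using k R by blast
    have "amult A m n s x = amult A (i + 2) (j + n) (amult A i 2 u r) (amult A j n w x)"
      using as[OF mc[OF k(1) r] k(3) x] by (simp add: s d)
    moreover have "amult A j n w x \<in> ael A (j + n)" using mc x k by simp
    ultimately have "amult A m n s x \<in> ?S (m + n)"
      using k d by (intro CollectI exI[of _ i] exI[of _ "j + n"] exI[of _ u] exI[of _ r] exI[of _ "amult A j n w x"]) auto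
    then show "amult A m n s x \<in> ideal2 K A R (m + n)"
      unfolding ideal2_def by (rule spn_incl[OF V S])
  qed
qed

lemma quad_alg_galgebra:
  assumes "VS V" "R \<subseteq> carrier (tensor_power K V 2)"
  shows "galgebra (quad_alg K V R)"
  unfolding quad_alg_def
  by (rule galg_quot_galgebra[OF tensor_alg_galgebra[OF assms(1)] ideal2_props])
     (use assms tensor_alg_galgebra[OF assms(1)] in \<open>simp_all add: tensor_alg_simps\<close>)

lemma quad_alg_comp: "acomp (quad_alg K V R) n = quot_vs (tensor_power K V n) (ideal2 K (tensor_alg K V) R n)"
  by (simp add: quad_alg_def galg_quot_simps tensor_alg_simps)

lemma quad_ideal_SUB:
  assumes "VS V" "R \<subseteq> carrier (tensor_power K V 2)"
  shows "SUB (ideal2 K (tensor_alg K V) R n) (tensor_power K V n)"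
  using ideal2_props(1)[OF tensor_alg_galgebra[OF assms(1)], of R n] assms by (simp add: tensor_alg_simps)

lemma quad_gen_lin:
  assumes V: "VS V" and R: "R \<subseteq> carrier (tensor_power K V 2)"
  shows "quad_gen K V R \<in> lin V (acomp (quad_alg K V R) 1)"
proof -
  have w: "[v] \<in> words V 1 \<longleftrightarrow> v \<in> carrier V" for v by (simp add: words_def)
  have "(\<lambda>v. word_tens K V [v]) \<in> lin V (tensor_power K V 1)"
    using word_tens_multilin[OF V, of 1] unfolding multilin_def
    by (intro linI) (metis w append_Nil append_Nil2)+
  from lin_comp[OF this lin_coset[OF VS_tensor_power[OF V] quad_ideal_SUB[OF V R]]]
  show ?thesis by (simp add: quad_gen_def[abs_def] quad_alg_comp)
qed

text \<open>Makes products of two generators explicit; the square of the Koszul differential is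
  computed from them, both in the algebra and in its quadratic dual.\<close>

lemma quad_gen_mult:
  assumes V: "VS V" and R: "R \<subseteq> carrier (tensor_power K V 2)" and v: "v \<in> carrier V" "w \<in> carrier V"
  shows "amult (quad_alg K V R) 1 1 (quad_gen K V R v) (quad_gen K V R w)
    = ideal2 K (tensor_alg K V) R 2 +>\<^bsub>tensor_power K V 2\<^esub> word_tens K V [v, w]"
proof -
  have ws: "[v] \<in> words V 1" "[w] \<in> words V 1" using v by (auto simp: words_def)
  note A = tensor_alg_galgebra[OF V]
  have R': "R \<subseteq> ael (tensor_alg K V) 2" using R by (simp add: tensor_alg_simps)
  show ?thesis
    using galg_quot_mult[OF A ideal2_props[OF A R'], of "word_tens K V [v]" 1 "word_tens K V [w]" 1]
      ws tensor_alg_mult(2)[OF V ws] word_tens_closed[OF ws(1)] word_tens_closed[OF ws(2)]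
    by (simp add: quad_alg_def quad_gen_def tensor_alg_simps)
qed

section \<open>Graded modules\<close>

abbreviation gm :: "('k, 'a) galg \<Rightarrow> ('k, 'a, 'm) gmod \<Rightarrow> bool" where "gm A M \<equiv> graded_module K A M"
abbreviation hm :: "('k, 'a) galg \<Rightarrow> ('k, 'a, 'm) gmod \<Rightarrow> ('k, 'a, 'n) gmod \<Rightarrow> (int \<Rightarrow> 'm \<Rightarrow> 'n) set"
  where "hm A M N \<equiv> gmod_hom K A M N"

lemma gmD:
  assumes "gm A M"
  shows "VS (mcomp M n)" "bilin (mcomp M m) (acomp A n) (mcomp M (m + n)) (mact M m n)"
    "x \<in> el M m \<Longrightarrow> mact M m 0 x (aone A) = x"
    "x \<in> el M l \<Longrightarrow> a \<in> ael A m \<Longrightarrow> b \<in> ael A n \<Longrightarrow>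
      mact M (l + m) n (mact M l m x a) b = mact M l (m + n) x (amult A m n a b)"
  using assms by (auto simp: graded_module_def bilin_def)

lemma gmI:
  assumes "\<And>n. VS (mcomp M n)" "\<And>m n. bilin (mcomp M m) (acomp A n) (mcomp M (m + n)) (mact M m n)"
    "\<And>m x. x \<in> el M m \<Longrightarrow> mact M m 0 x (aone A) = x"
    "\<And>l m n x a b. x \<in> el M l \<Longrightarrow> a \<in> ael A m \<Longrightarrow> b \<in> ael A n \<Longrightarrow>
      mact M (l + m) n (mact M l m x a) b = mact M l (m + n) x (amult A m n a b)"
  shows "gm A M"
  using assms by (auto simp: graded_module_def bilin_def)

lemma gm_act_closed:
  "gm A M \<Longrightarrow> x \<in> el M m \<Longrightarrow> a \<in> ael A n \<Longrightarrow> mact M m n x a \<in> el M (m + n)"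
  by (rule bilin_closed[OF gmD(2)])

lemma hmI:
  assumes "\<And>n. \<phi> n \<in> lin (mcomp M n) (mcomp N n)"
    and "\<And>m n x a. x \<in> el M m \<Longrightarrow> a \<in> ael A n \<Longrightarrow> \<phi> (m + n) (mact M m n x a) = mact N m n (\<phi> m x) a"
  shows "\<phi> \<in> hm A M N"
  using assms by (auto simp: gmod_hom_def)

lemma hm_lin: "\<phi> \<in> hm A M N \<Longrightarrow> \<phi> n \<in> lin (mcomp M n) (mcomp N n)"
  and hm_act: "\<phi> \<in> hm A M N \<Longrightarrow> x \<in> el M m \<Longrightarrow> a \<in> ael A n \<Longrightarrow>
    \<phi> (m + n) (mact M m n x a) = mact N m n (\<phi> m x) a"
  by (auto simp: gmod_hom_def)

lemma hm_closed: "\<phi> \<in> hm A M N \<Longrightarrow> x \<in> el M n \<Longrightarrow> \<phi> n x \<in> el N n"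
  by (rule lin_closed[OF hm_lin])

lemma hm_comp: "\<phi> \<in> hm A M N \<Longrightarrow> \<psi> \<in> hm A N P \<Longrightarrow> (\<lambda>n x. \<psi> n (\<phi> n x)) \<in> hm A M P"
  by (rule hmI) (auto intro: lin_comp hm_lin simp: hm_act hm_closed)

lemma hm_plus:
  assumes M: "gm A M" and N: "gm A N" and f: "\<phi> \<in> hm A M N" and g: "\<psi> \<in> hm A M N"
  shows "(\<lambda>n x. \<phi> n x \<oplus>\<^bsub>mcomp N n\<^esub> \<psi> n x) \<in> hm A M N"
  by (rule hmI)
     (simp_all add: lin_plus gmD(1)[OF M] gmD(1)[OF N] hm_lin[OF f] hm_lin[OF g] hm_act[OF f] hm_act[OF g]
        bilin_adds(1)[OF gmD(2)[OF N]] hm_closed[OF f] hm_closed[OF g])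

lemma hm_neg:
  assumes M: "gm A M" and N: "gm A N" and f: "\<phi> \<in> hm A M N"
  shows "(\<lambda>n x. \<ominus>\<^bsub>mcomp N n\<^esub> \<phi> n x) \<in> hm A M N"
  by (rule hmI)
     (simp_all add: lin_uminus gmD(1)[OF M] gmD(1)[OF N] hm_lin[OF f] hm_act[OF f]
        lin_neg[OF gmD(1)[OF N] gmD(1)[OF N] bilin_l[OF gmD(2)[OF N]]] hm_closed[OF f])

lemma hm_sum:
  assumes M: "gm A M" and N: "gm A N" and I: "finite I" and f: "\<forall>i\<in>I. \<phi> i \<in> hm A M N"
  shows "(\<lambda>n x. finsum (mcomp N n) (\<lambda>i. \<phi> i n x) I) \<in> hm A M N"
proof (rule hmI)
  note VM = gmD(1)[OF M] and VN = gmD(1)[OF N]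
  show "(\<lambda>x. finsum (mcomp N n) (\<lambda>i. \<phi> i n x) I) \<in> lin (mcomp M n) (mcomp N n)" for n
    by (rule lin_sum[OF VM VN I]) (rule hm_lin[OF bspec[OF f]])
  fix m n x a assume x: "x \<in> el M m" and a: "a \<in> ael A n"
  have c: "\<phi> i m x \<in> el N m" if "i \<in> I" for i
    using hm_closed[OF bspec[OF f that] x] .
  have "finsum (mcomp N (m + n)) (\<lambda>i. \<phi> i (m + n) (mact M m n x a)) I = finsum (mcomp N (m + n)) (\<lambda>i. mact N m n (\<phi> i m x) a) I"
    by (rule VS_finsum_cong[OF VN]) (use hm_act[OF bspec[OF f] x a] gm_act_closed[OF N c a] in auto)
  also have "\<dots> = mact N m n (finsum (mcomp N m) (\<lambda>i. \<phi> i m x) I) a"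
    using lin_finsum[OF VN VN bilin_l[OF gmD(2)[OF N] a] I, of "\<lambda>i. \<phi> i m x"] c by simp
  finally show "finsum (mcomp N (m + n)) (\<lambda>i. \<phi> i (m + n) (mact M m n x a)) I = mact N m n (finsum (mcomp N m) (\<lambda>i. \<phi> i m x) I) a" .
qed

lemma a_kernel_iff: "x \<in> a_kernel G H h \<longleftrightarrow> x \<in> carrier G \<and> h x = \<zero>\<^bsub>H\<^esub>"
  by (auto simp: a_kernel_def')

section \<open>Shifts, submodules and quotients\<close>

lemma shift_simps [simp]: "mcomp (gmod_shift M j) i = mcomp M (i + j)" "mact (gmod_shift M j) i n = mact M (i + j) n"
  by (simp_all add: gmod_shift_def)

lemma shift_shift: "gmod_shift (gmod_shift M a) b = gmod_shift M (a + b)"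
  by (simp add: gmod_shift_def ac_simps)

lemma gm_shift:
  assumes M: "gm A M"
  shows "gm A (gmod_shift M j)"
proof (rule gmI)
  \<comment> \<open>Components and actions are indexed by the integer expression itself, so equal
    degrees written differently have to be rewritten into one form.\<close>
  have e: "m + n + j = m + j + n" for m n :: int by simp
  show "VS (mcomp (gmod_shift M j) n)" for n using gmD(1)[OF M] by simp
  show "bilin (mcomp (gmod_shift M j) m) (acomp A n) (mcomp (gmod_shift M j) (m + n)) (mact (gmod_shift M j) m n)" for m n
    using gmD(2)[OF M, of "m + j" n] by (simp add: e)
  show "mact (gmod_shift M j) m 0 x (aone A) = x" if "x \<in> el (gmod_shift M j) m" for m x
    using gmD(3)[OF M] that by simp
  show "mact (gmod_shift M j) (l + m) n (mact (gmod_shift M j) l m x a) b = mact (gmod_shift M j) l (m + n) x (amult A m n a b)"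
    if "x \<in> el (gmod_shift M j) l" "a \<in> ael A m" "b \<in> ael A n" for l m n x a b
    using gmD(4)[OF M, of x "l + j" a m b n] that by (simp add: e)
qed

lemma hm_shift:
  assumes "\<phi> \<in> hm A M N"
  shows "(\<lambda>n. \<phi> (n + j)) \<in> hm A (gmod_shift M j) (gmod_shift N j)"
proof (rule hmI)
  show "\<phi> (n + j) \<in> lin (mcomp (gmod_shift M j) n) (mcomp (gmod_shift N j) n)" for n
    using hm_lin[OF assms] by simp
  have e: "m + n + j = m + j + n" for m n :: int by simp
  show "\<phi> (m + n + j) (mact (gmod_shift M j) m n x a) = mact (gmod_shift N j) m n (\<phi> (m + j) x) a"
    if "x \<in> el (gmod_shift M j) m" "a \<in> ael A n" for m n x a
    using hm_act[OF assms, of x "m + j" a n] that by (simp add: e)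
qed

definition gsub :: "('k, 'a) galg \<Rightarrow> ('k, 'a, 'm) gmod \<Rightarrow> (int \<Rightarrow> 'm set) \<Rightarrow> bool" where
  "gsub A M Z \<longleftrightarrow> (\<forall>n. SUB (Z n) (mcomp M n)) \<and>
     (\<forall>m n. \<forall>x\<in>Z m. \<forall>a\<in>ael A n. mact M m n x a \<in> Z (m + n))"

lemma gsubD:
  "gsub A M Z \<Longrightarrow> SUB (Z n) (mcomp M n)"
  "gsub A M Z \<Longrightarrow> x \<in> Z m \<Longrightarrow> a \<in> ael A n \<Longrightarrow> mact M m n x a \<in> Z (m + n)"
  by (auto simp: gsub_def)

lemma sub_simps [simp]: "mcomp (gmod_sub M Z) n = mcomp M n\<lparr>carrier := Z n\<rparr>" "mact (gmod_sub M Z) = mact M"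
  by (simp_all add: gmod_sub_def)

lemma lin_restrict_carrier:
  "f \<in> lin U W \<Longrightarrow> S \<subseteq> carrier U \<Longrightarrow> (\<And>x. x \<in> S \<Longrightarrow> f x \<in> T) \<Longrightarrow> f \<in> lin (U\<lparr>carrier := S\<rparr>) (W\<lparr>carrier := T\<rparr>)"
  by (rule linI) (auto simp: lin_add lin_smult subset_iff)

lemma lin_restrict_domain:
  "f \<in> lin U W \<Longrightarrow> S \<subseteq> carrier U \<Longrightarrow> f \<in> lin (U\<lparr>carrier := S\<rparr>) W"
  by (rule linI) (auto simp: lin_add lin_smult lin_closed subset_iff)

lemma lin_restrict_codomain:
  "f \<in> lin U W \<Longrightarrow> (\<And>x. x \<in> carrier U \<Longrightarrow> f x \<in> T) \<Longrightarrow> f \<in> lin U (W\<lparr>carrier := T\<rparr>)"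
  by (rule linI) (auto simp: lin_add lin_smult subset_iff)

lemma gm_sub:
  assumes M: "gm A M" and Z: "gsub A M Z"
  shows "gm A (gmod_sub M Z)"
proof (rule gmI)
  note Zs = SUB_subset[OF gsubD(1)[OF Z]]
  show "VS (mcomp (gmod_sub M Z) n)" for n
    using SUB_VS[OF gmD(1)[OF M] gsubD(1)[OF Z]] by simp
  show "bilin (mcomp (gmod_sub M Z) m) (acomp A n) (mcomp (gmod_sub M Z) (m + n)) (mact (gmod_sub M Z) m n)" for m n
  proof (rule bilinI)
    fix x assume "x \<in> el (gmod_sub M Z) m"
    then have x: "x \<in> Z m" by simp
    show "mact (gmod_sub M Z) m n x \<in> lin (acomp A n) (mcomp (gmod_sub M Z) (m + n))"
      using lin_restrict_codomain[OF bilin_r[OF gmD(2)[OF M] Zs[OF x]], of n "Z (m + n)"] gsubD(2)[OF Z x] by simp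
  next
    fix a assume a: "a \<in> ael A n"
    show "(\<lambda>x. mact (gmod_sub M Z) m n x a) \<in> lin (mcomp (gmod_sub M Z) m) (mcomp (gmod_sub M Z) (m + n))"
      using lin_restrict_carrier[OF bilin_l[OF gmD(2)[OF M] a], of "Z m" m "Z (m + n)"] gsubD(2)[OF Z _ a] Zs by auto
  qed
qed (use gmD(3,4)[OF M] SUB_subset[OF gsubD(1)[OF Z]] in auto)

lemma hm_sub_incl: "gsub A M Z \<Longrightarrow> (\<lambda>n x. x) \<in> hm A (gmod_sub M Z) M"
  using SUB_subset[OF gsubD(1)] by (intro hmI) (auto intro!: lin_restrict_domain lin_id)

lemma quot_simps [simp]: "mcomp (gmod_quot M B) n = quot_vs (mcomp M n) (B n)"
  by (simp add: gmod_quot_def)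

lemma gmod_quot_act:
  assumes M: "gm A M" and B: "gsub A M B" and x: "x \<in> el M m" and a: "a \<in> ael A n"
  shows "mact (gmod_quot M B) m n (B m +>\<^bsub>mcomp M m\<^esub> x) a = B (m + n) +>\<^bsub>mcomp M (m + n)\<^esub> mact M m n x a"
proof -
  note V = gmD(1)[OF M] and S = gsubD(1)[OF B]
  let ?r = "rep (B m +>\<^bsub>mcomp M m\<^esub> x)"
  have r: "?r \<in> el M m" "?r \<ominus>\<^bsub>mcomp M m\<^esub> x \<in> B m"
    using rep_coset[OF V S x] coset_eq[OF V S _ x] by auto
  have "mact M m n ?r a \<ominus>\<^bsub>mcomp M (m + n)\<^esub> mact M m n x a \<in> B (m + n)"
    using gsubD(2)[OF B r(2) a] lin_minus[OF V V bilin_l[OF gmD(2)[OF M] a] r(1) x] by simp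
  then show ?thesis
    using coset_eq[OF V S gm_act_closed[OF M r(1) a] gm_act_closed[OF M x a]] by (simp add: gmod_quot_def)
qed

lemma gm_quot:
  assumes M: "gm A M" and A: "galgebra A" and B: "gsub A M B"
  shows "gm A (gmod_quot M B)"
proof (rule gmI)
  note V = gmD(1)[OF M] and S = gsubD(1)[OF B] and act = gmod_quot_act[OF M B]
  note b = gmD(2)[OF M] and cl = gm_act_closed[OF M]
  show "VS (mcomp (gmod_quot M B) n)" for n using V S by simp
  show "bilin (mcomp (gmod_quot M B) m) (acomp A n) (mcomp (gmod_quot M B) (m + n)) (mact (gmod_quot M B) m n)" for m n
    unfolding quot_simps
    by (intro bilinI linI; elim quot_cases; hypsubst)
       (simp_all add: act V S quot_add quot_smult coset_closed cl bilin_adds[OF b] galgebraD(1)[OF A])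
  show "mact (gmod_quot M B) m 0 x (aone A) = x" if "x \<in> el (gmod_quot M B) m" for m x
    using that unfolding quot_simps
    by (elim quot_cases) (use act[of _ m "aone A" 0] galgebraD(4)[OF A] gmD(3)[OF M] in simp)
  show "mact (gmod_quot M B) (l + m) n (mact (gmod_quot M B) l m x a) b = mact (gmod_quot M B) l (m + n) x (amult A m n a b)"
    if x: "x \<in> el (gmod_quot M B) l" and ab: "a \<in> ael A m" "b \<in> ael A n" for l m n x a b
  proof -
    obtain x' where x': "x' \<in> el M l" "x = B l +>\<^bsub>mcomp M l\<^esub> x'"
      using x unfolding quot_simps by (rule quot_cases)
    show ?thesis
      using act[OF x'(1) ab(1)] act[OF cl[OF x'(1) ab(1)] ab(2)] act[OF x'(1) galg_mult_closed[OF A ab]] gmD(4)[OF M x'(1) ab]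
      by (simp add: x'(2) add.assoc)
  qed
qed

lemma hm_quot_proj:
  assumes M: "gm A M" and B: "gsub A M B"
  shows "(\<lambda>n x. B n +>\<^bsub>mcomp M n\<^esub> x) \<in> hm A M (gmod_quot M B)"
  by (rule hmI) (simp_all add: lin_coset gmD(1)[OF M] gsubD(1)[OF B] gmod_quot_act[OF M B])

lemma gsub_ker:
  assumes M: "gm A M" and N: "gm A N" and A: "galgebra A" and f: "\<phi> \<in> hm A M N"
  shows "gsub A M (\<lambda>n. {x \<in> el M n. \<phi> n x = \<zero>\<^bsub>mcomp N n\<^esub>})"
  unfolding gsub_def
  by (auto intro!: SUB_ker gmD(1)[OF M] gmD(1)[OF N] hm_lin[OF f] gm_act_closed[OF M]
      simp: hm_act[OF f] bilin_zero(1)[OF gmD(1)[OF N] galgebraD(1)[OF A] gmD(1)[OF N] gmD(2)[OF N]])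

lemma gsub_image:
  assumes M: "gm A M" and N: "gm A N" and f: "\<phi> \<in> hm A M N" and Z: "gsub A M Z"
  shows "gsub A N (\<lambda>n. \<phi> n ` Z n)"
  unfolding gsub_def
proof (intro conjI allI ballI)
  show "SUB (\<phi> n ` Z n) (mcomp N n)" for n
    by (rule SUB_image[OF gmD(1)[OF M] gmD(1)[OF N] hm_lin[OF f] gsubD(1)[OF Z]])
  fix m n y a assume "y \<in> \<phi> m ` Z m" and a: "a \<in> ael A n"
  then obtain x where x: "x \<in> Z m" "y = \<phi> m x" by blast
  then have "mact N m n y a = \<phi> (m + n) (mact M m n x a)"
    using hm_act[OF f SUB_subset[OF gsubD(1)[OF Z]] a] by simp
  then show "mact N m n y a \<in> \<phi> (m + n) ` Z (m + n)"
    using gsubD(2)[OF Z x(1) a] by blast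
qed

lemma gsub_carrier: "gm A M \<Longrightarrow> gsub A M (\<lambda>n. el M n)"
  by (simp add: gsub_def SUB_carrier gmD(1) gm_act_closed)

lemma gsub_gen:
  assumes M: "gm A M" and A: "galgebra A" and S: "S \<subseteq> el M d"
  shows "gsub A M (gmod_gen K A M d S)"
  unfolding gsub_def
proof (intro conjI allI ballI)
  let ?G = "\<lambda>n. {mact M d (n - d) s a | s a. s \<in> S \<and> a \<in> ael A (n - d)}"
  note V = gmD(1)[OF M]
  have G: "?G n \<subseteq> el M n" for n
    using gm_act_closed[OF M, of _ d _ "n - d"] S by (auto simp: subset_iff)
  show sub: "SUB (gmod_gen K A M d S n) (mcomp M n)" for n
    unfolding gmod_gen_def using V G by (rule spn_SUB)
  fix m n x b assume x: "x \<in> gmod_gen K A M d S m" and b: "b \<in> ael A n"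
  show "mact M m n x b \<in> gmod_gen K A M d S (m + n)"
  proof (rule lin_spn[OF V V bilin_l[OF gmD(2)[OF M] b] sub G _ x[unfolded gmod_gen_def]])
    fix z assume "z \<in> ?G m"
    then obtain s a where sa: "z = mact M d (m - d) s a" "s \<in> S" "a \<in> ael A (m - d)" by blast
    have "mact M m n z b = mact M d (m + n - d) s (amult A (m - d) n a b)"
      using gmD(4)[OF M, of s d a "m - d" b n] sa S b by (auto simp: algebra_simps)
    moreover have "amult A (m - d) n a b \<in> ael A (m + n - d)"
      using galg_mult_closed[OF A sa(3) b] by (simp add: algebra_simps)
    ultimately show "mact M m n z b \<in> gmod_gen K A M d S (m + n)"
      unfolding gmod_gen_def using sa(2) by (intro spn_incl[OF V G]) blast
  qed
qed

lemma gmod_gen_incl: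
  assumes M: "gm A M" and A: "galgebra A" and S: "S \<subseteq> el M d" and s: "s \<in> S"
  shows "s \<in> gmod_gen K A M d S d"
proof -
  have "{mact M d (d - d) s a | s a. s \<in> S \<and> a \<in> ael A (d - d)} \<subseteq> el M d"
    using gm_act_closed[OF M, of _ d _ 0] S by auto
  moreover have "s = mact M d (d - d) s (aone A)" using gmD(3)[OF M] S s by auto
  ultimately show ?thesis
    unfolding gmod_gen_def using s galgebraD(4)[OF A] by (intro spn_incl[OF gmD(1)[OF M]]) auto
qed

lemma gmod_gen_least:
  assumes M: "gm A M" and Z: "gsub A M Z" and S: "S \<subseteq> Z d"
  shows "gmod_gen K A M d S n \<subseteq> Z n"
  unfolding gmod_gen_def
proof (rule spn_least[OF gmD(1)[OF M] gsubD(1)[OF Z]])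
  show "{mact M d (n - d) s a | s a. s \<in> S \<and> a \<in> ael A (n - d)} \<subseteq> Z n"
    using gsubD(2)[OF Z, of _ d _ "n - d"] S by auto
qed

section \<open>Finite direct sums\<close>

lemma dirsum_carrier:
  assumes "finite I"
  shows "el (gmod_dirsum I F) n = (\<Pi>\<^sub>E i\<in>I. el (F i) n)"
  using assms by (auto simp: gmod_dirsum_def)

lemma dirsum_simps:
  "\<zero>\<^bsub>mcomp (gmod_dirsum I F) n\<^esub> = (\<lambda>i\<in>I. \<zero>\<^bsub>mcomp (F i) n\<^esub>)"
  "f \<oplus>\<^bsub>mcomp (gmod_dirsum I F) n\<^esub> g = (\<lambda>i\<in>I. f i \<oplus>\<^bsub>mcomp (F i) n\<^esub> g i)"
  "c \<odot>\<^bsub>mcomp (gmod_dirsum I F) n\<^esub> f = (\<lambda>i\<in>I. c \<odot>\<^bsub>mcomp (F i) n\<^esub> f i)"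
  "mact (gmod_dirsum I F) m n f a = (\<lambda>i\<in>I. mact (F i) m n (f i) a)"
  by (simp_all add: gmod_dirsum_def)

lemma dirsum_VS:
  assumes I: "finite I" and F: "\<forall>i\<in>I. VS (mcomp (F i) n)"
  shows "VS (mcomp (gmod_dirsum I F) n)"
proof (rule vs_criteria)
  note c = dirsum_carrier[OF I]
  show "field K" by (rule field_axioms)
  show "\<forall>v\<in>el (gmod_dirsum I F) n. \<exists>w\<in>el (gmod_dirsum I F) n.
      v \<oplus>\<^bsub>mcomp (gmod_dirsum I F) n\<^esub> w = \<zero>\<^bsub>mcomp (gmod_dirsum I F) n\<^esub>"
  proof
    fix v assume v: "v \<in> el (gmod_dirsum I F) n"
    then show "\<exists>w\<in>el (gmod_dirsum I F) n. v \<oplus>\<^bsub>mcomp (gmod_dirsum I F) n\<^esub> w = \<zero>\<^bsub>mcomp (gmod_dirsum I F) n\<^esub>"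
      using F by (intro bexI[of _ "\<lambda>i\<in>I. \<ominus>\<^bsub>mcomp (F i) n\<^esub> v i"]) (auto simp: c dirsum_simps PiE_iff)
  qed
  show "\<forall>v\<in>el (gmod_dirsum I F) n. v \<oplus>\<^bsub>mcomp (gmod_dirsum I F) n\<^esub> \<zero>\<^bsub>mcomp (gmod_dirsum I F) n\<^esub> = v"
    using F by (auto simp: c dirsum_simps PiE_iff extensional_def fun_eq_iff restrict_def)
  show "\<forall>v\<in>el (gmod_dirsum I F) n. \<one> \<odot>\<^bsub>mcomp (gmod_dirsum I F) n\<^esub> v = v"
    using F by (auto simp: c dirsum_simps PiE_iff extensional_def fun_eq_iff restrict_def)
qed (use F in \<open>auto simp: dirsum_carrier[OF I] dirsum_simps PiE_iff VS_ac VS_distr restrict_def fun_eq_iff extensional_def\<close>)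

lemma gm_dirsum:
  assumes I: "finite I" and A: "galgebra A" and F: "\<forall>i\<in>I. gm A (F i)"
  shows "gm A (gmod_dirsum I F)"
proof (rule gmI)
  note c = dirsum_carrier[OF I]
  have FV: "\<And>i n. i \<in> I \<Longrightarrow> VS (mcomp (F i) n)" using gmD(1)[OF bspec[OF F]] .
  show "VS (mcomp (gmod_dirsum I F) n)" for n
    using dirsum_VS[OF I, of F n] FV by blast
  show "bilin (mcomp (gmod_dirsum I F) m) (acomp A n) (mcomp (gmod_dirsum I F) (m + n)) (mact (gmod_dirsum I F) m n)" for m n
    by (intro bilinI linI)
       (auto simp: c dirsum_simps PiE_iff restrict_def fun_eq_iff extensional_def bilin_adds[OF gmD(2)[OF bspec[OF F]]] gm_act_closed[OF bspec[OF F]])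
  show "mact (gmod_dirsum I F) m 0 x (aone A) = x" if "x \<in> el (gmod_dirsum I F) m" for m x
    using that by (auto simp: c dirsum_simps PiE_iff extensional_def fun_eq_iff restrict_def gmD(3)[OF bspec[OF F]])
  show "mact (gmod_dirsum I F) (l + m) n (mact (gmod_dirsum I F) l m x a) b = mact (gmod_dirsum I F) l (m + n) x (amult A m n a b)"
    if "x \<in> el (gmod_dirsum I F) l" "a \<in> ael A m" "b \<in> ael A n" for l m n x a b
    using that by (auto simp: c dirsum_simps PiE_iff restrict_def fun_eq_iff gmD(4)[OF bspec[OF F]])
qed

definition dinj :: "'i set \<Rightarrow> ('i \<Rightarrow> ('k, 'a, 'm) gmod) \<Rightarrow> 'i \<Rightarrow> int \<Rightarrow> 'm \<Rightarrow> 'i \<Rightarrow> 'm" where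
  "dinj I F i n y = (\<lambda>j\<in>I. if j = i then y else \<zero>\<^bsub>mcomp (F j) n\<^esub>)"

lemma hm_dinj:
  assumes I: "finite I" and A: "galgebra A" and F: "\<forall>i\<in>I. gm A (F i)" and i: "i \<in> I"
  shows "dinj I F i \<in> hm A (F i) (gmod_dirsum I F)"
proof -
  have FV: "\<And>i n. i \<in> I \<Longrightarrow> VS (mcomp (F i) n)" using gmD(1)[OF bspec[OF F]] .
  have z: "mact (F j) m n \<zero>\<^bsub>mcomp (F j) m\<^esub> a = \<zero>\<^bsub>mcomp (F j) (m + n)\<^esub>" if "j \<in> I" "a \<in> ael A n" for j m n a
    using bilin_zero(1)[OF FV[OF that(1)] galgebraD(1)[OF A] FV[OF that(1)] gmD(2)[OF bspec[OF F that(1)]] that(2)] .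
  show ?thesis
    by (intro hmI linI)
       (auto simp: dinj_def dirsum_carrier[OF I] dirsum_simps restrict_def fun_eq_iff extensional_def FV i z)
qed

lemma hm_proj:
  assumes I: "finite I" and i: "i \<in> I"
  shows "(\<lambda>n x. x i) \<in> hm A (gmod_dirsum I F) (F i)"
  by (intro hmI linI) (use i in \<open>auto simp: dirsum_carrier[OF I] dirsum_simps\<close>)

lemma dinj_apply: "j \<in> I \<Longrightarrow> dinj I F i n y j = (if j = i then y else \<zero>\<^bsub>mcomp (F j) n\<^esub>)"
  by (simp add: dinj_def)

lemma dirsum_ext:
  assumes "finite I" "x \<in> el (gmod_dirsum I F) n" "y \<in> el (gmod_dirsum I F) n"
    and "\<And>i. i \<in> I \<Longrightarrow> x i = y i"
  shows "x = y"
  using assms by (auto simp: dirsum_carrier PiE_iff intro: extensionalityI)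

lemma dirsum_decomp:
  assumes I: "finite I" and A: "galgebra A" and F: "\<forall>i\<in>I. gm A (F i)"
    and x: "x \<in> el (gmod_dirsum I F) n"
  shows "x = finsum (mcomp (gmod_dirsum I F) n) (\<lambda>i. dinj I F i n (x i)) I"
proof (rule dirsum_ext[OF I x])
  have V: "VS (mcomp (gmod_dirsum I F) n)" "\<And>i n. i \<in> I \<Longrightarrow> VS (mcomp (F i) n)"
    using gmD(1)[OF gm_dirsum[OF I A F]] gmD(1)[OF bspec[OF F]] by blast+
  have xi: "x i \<in> el (F i) n" if "i \<in> I" for i
    using x that by (auto simp: dirsum_carrier[OF I])
  have c: "dinj I F i n (x i) \<in> el (gmod_dirsum I F) n" if "i \<in> I" for i
    using hm_closed[OF hm_dinj[OF I A F that] xi[OF that]] .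
  then show "finsum (mcomp (gmod_dirsum I F) n) (\<lambda>i. dinj I F i n (x i)) I \<in> el (gmod_dirsum I F) n"
    using V by simp
  fix j assume j: "j \<in> I"
  have "finsum (mcomp (gmod_dirsum I F) n) (\<lambda>i. dinj I F i n (x i)) I j
      = finsum (mcomp (F j) n) (\<lambda>i. dinj I F i n (x i) j) I"
    using lin_finsum[OF V(1) V(2)[OF j] hm_lin[OF hm_proj[OF I j]] I, of "\<lambda>i. dinj I F i n (x i)"] c by simp
  also have "\<dots> = dinj I F j n (x j) j"
    by (rule VS_finsum_single[OF V(2)[OF j] I j]) (use j xi in \<open>auto simp: dinj_apply\<close>)
  finally show "x j = finsum (mcomp (gmod_dirsum I F) n) (\<lambda>i. dinj I F i n (x i)) I j"
    using j by (simp add: dinj_apply)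
qed

section \<open>Free modules and their lifting property\<close>

lemma free_simps1: "mcomp (gmod_free K U A) n = tensor K U (acomp A n)"
  by (simp add: gmod_free_def)

lemma free_act:
  assumes A: "galgebra A" and U: "VS U" and a: "a \<in> ael A n"
  shows "(\<lambda>X. mact (gmod_free K U A) m n X a) \<in> lin (tensor K U (acomp A m)) (tensor K U (acomp A (m + n)))"
    and "u \<in> carrier U \<Longrightarrow> b \<in> ael A m \<Longrightarrow>
      mact (gmod_free K U A) m n (tens K U (acomp A m) u b) a = tens K U (acomp A (m + n)) u (amult A m n b a)"
proof -
  note V = galgebraD(1)[OF A]
  have b: "bilin U (acomp A m) (tensor K U (acomp A (m + n))) (\<lambda>u b. tens K U (acomp A (m + n)) u (amult A m n b a))"
    using lin_comp[OF bilin_l[OF galgebraD(2)[OF A] a] bilin_r[OF tens_bilin[OF U V]]]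
      bilin_l[OF tens_bilin[OF U V] galg_mult_closed[OF A _ a]]
    by (intro bilinI)
  show "(\<lambda>X. mact (gmod_free K U A) m n X a) \<in> lin (tensor K U (acomp A m)) (tensor K U (acomp A (m + n)))"
    using tensor_lift(1)[OF U V VS_tensor[OF U V] b] by (simp add: gmod_free_def)
  show "mact (gmod_free K U A) m n (tens K U (acomp A m) u b) a = tens K U (acomp A (m + n)) u (amult A m n b a)"
    if "u \<in> carrier U" "b \<in> ael A m"
    using tensor_lift(2)[OF U V VS_tensor[OF U V] b that] by (simp add: gmod_free_def)
qed

lemma gm_free:
  assumes A: "galgebra A" and U: "VS U"
  shows "gm A (gmod_free K U A)"
proof (rule gmI)
  note V = galgebraD(1)[OF A] and L = free_act(1)[OF A U] and g = free_act(2)[OF A U] and mc = galg_mult_closed[OF A]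
  note T = VS_tensor[OF U V] and tb = tens_bilin[OF U V]
  let ?F = "gmod_free K U A"
  show "VS (mcomp ?F n)" for n using T by (simp add: free_simps1)
  show "bilin (mcomp ?F m) (acomp A n) (mcomp ?F (m + n)) (mact ?F m n)" for m n
    unfolding free_simps1
  proof (intro bilinI linI)
    fix X a b assume X: "X \<in> carrier (tensor K U (acomp A m))" and a: "a \<in> ael A n" and b: "b \<in> ael A n"
    have ab: "a \<oplus>\<^bsub>acomp A n\<^esub> b \<in> ael A n" using a b V by simp
    show "mact ?F m n X (a \<oplus>\<^bsub>acomp A n\<^esub> b) = mact ?F m n X a \<oplus>\<^bsub>tensor K U (acomp A (m + n))\<^esub> mact ?F m n X b"
      by (rule tensor_lin_eq[OF U V T L[OF ab] lin_plus[OF T T L[OF a] L[OF b]] _ X])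
         (use a b ab in \<open>simp add: g bilin_adds[OF galgebraD(2)[OF A]] bilin_adds[OF tb] mc\<close>)
  next
    fix X a c assume X: "X \<in> carrier (tensor K U (acomp A m))" and a: "a \<in> ael A n" and c: "c \<in> carrier K"
    have ca: "c \<odot>\<^bsub>acomp A n\<^esub> a \<in> ael A n" using a c V by simp
    show "mact ?F m n X (c \<odot>\<^bsub>acomp A n\<^esub> a) = c \<odot>\<^bsub>tensor K U (acomp A (m + n))\<^esub> mact ?F m n X a"
      by (rule tensor_lin_eq[OF U V T L[OF ca] lin_scale[OF T T L[OF a] c] _ X])
         (use a c ca in \<open>simp add: g bilin_adds[OF galgebraD(2)[OF A]] bilin_adds[OF tb] mc\<close>)
  qed (use L in \<open>simp_all add: lin_closed[OF L] lin_add[OF L] lin_smult[OF L]\<close>)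
  show "mact ?F m 0 x (aone A) = x" if x: "x \<in> el ?F m" for m x
  proof -
    note o = galgebraD(4)[OF A]
    have L0: "(\<lambda>x. mact ?F m 0 x (aone A)) \<in> lin (tensor K U (acomp A m)) (tensor K U (acomp A m))"
      using L[OF o, of m] by simp
    show ?thesis
      by (rule tensor_lin_eq[OF U V T L0 lin_id _ x[unfolded free_simps1]])
         (use g[OF o, of _ _ m] galgebraD(6)[OF A] in simp)
  qed
  show "mact ?F (l + m) n (mact ?F l m x a) b = mact ?F l (m + n) x (amult A m n a b)"
    if x: "x \<in> el ?F l" and a: "a \<in> ael A m" and b: "b \<in> ael A n" for l m n x a b
  proof (rule tensor_lin_eq[OF U V T lin_comp[OF L[OF a] L[OF b]] _ _ x[unfolded free_simps1]])
    show "(\<lambda>x. mact ?F l (m + n) x (amult A m n a b)) \<in> lin (tensor K U (acomp A l)) (tensor K U (acomp A (l + m + n)))"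
      using L[OF mc[OF a b], of l] by (simp add: add.assoc)
    fix u c assume u: "u \<in> carrier U" and c: "c \<in> ael A l"
    show "mact ?F (l + m) n (mact ?F l m (tens K U (acomp A l) u c) a) b = mact ?F l (m + n) (tens K U (acomp A l) u c) (amult A m n a b)"
      using g[OF a u c] g[OF b u mc[OF c a]] g[OF mc[OF a b] u c] galgebraD(3)[OF A c a b] by (simp add: add.assoc)
  qed
qed

text \<open>Shifting by \<open>s\<close> puts the generating space \<open>U\<close> in degree
  \<open>- s\<close>, so a linear map from \<open>U\<close> into that degree extends by the action.
  Allowing shifts here covers all Koszul terms and all summands of the resolution.\<close>

lemma free_hom:
  assumes A: "galgebra A" and U: "VS U" and X: "gm A X" and t: "\<tau> \<in> lin U (mcomp X (- s))"
  defines "l \<equiv> \<lambda>n. lift K (mcomp X n) (\<lambda>(u, a). mact X (- s) (n + s) (\<tau> u) a)"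
  shows "l \<in> hm A (gmod_shift (gmod_free K U A) s) X"
    and "u \<in> carrier U \<Longrightarrow> a \<in> ael A (n + s) \<Longrightarrow> l n (tens K U (acomp A (n + s)) u a) = mact X (- s) (n + s) (\<tau> u) a"
proof -
  note V = galgebraD(1)[OF A] and VX = gmD(1)[OF X]
  have b: "bilin U (acomp A (n + s)) (mcomp X n) (\<lambda>u a. mact X (- s) (n + s) (\<tau> u) a)" for n
    using gmD(2)[OF X, of "- s" "n + s"] lin_closed[OF t]
    by (intro bilinI) (auto intro: bilin_r lin_comp[OF t] bilin_l)
  note L = tensor_lift[OF U V VX b]
  show g: "l n (tens K U (acomp A (n + s)) u a) = mact X (- s) (n + s) (\<tau> u) a"
    if "u \<in> carrier U" "a \<in> ael A (n + s)" for n u a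
    unfolding l_def using L(2)[OF that] .
  have Ll: "l n \<in> lin (tensor K U (acomp A (n + s))) (mcomp X n)" for n
    unfolding l_def using L(1) .
  show "l \<in> hm A (gmod_shift (gmod_free K U A) s) X"
  proof (rule hmI)
    show "l n \<in> lin (mcomp (gmod_shift (gmod_free K U A) s) n) (mcomp X n)" for n
      using Ll by (simp add: free_simps1)
    fix m n x a assume x: "x \<in> el (gmod_shift (gmod_free K U A) s) m" and a: "a \<in> ael A n"
    have x': "x \<in> carrier (tensor K U (acomp A (m + s)))" using x by (simp add: free_simps1)
    have e: "m + n + s = m + s + n" by simp
    have "l (m + n) (mact (gmod_free K U A) (m + s) n x a) = mact X m n (l m x) a"
    proof (rule tensor_lin_eq[OF U V VX lin_comp[OF free_act(1)[OF A U a] Ll[of "m + n", unfolded e]] lin_comp[OF Ll bilin_l[OF gmD(2)[OF X] a]] _ x'])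
      fix u c assume u: "u \<in> carrier U" and c: "c \<in> ael A (m + s)"
      have "mact X (- s) (m + s + n) (\<tau> u) (amult A (m + s) n c a) = mact X m n (mact X (- s) (m + s) (\<tau> u) c) a"
        using gmD(4)[OF X lin_closed[OF t u] c a] by simp
      then show "l (m + n) (mact (gmod_free K U A) (m + s) n (tens K U (acomp A (m + s)) u c) a) = mact X m n (l m (tens K U (acomp A (m + s)) u c)) a"
        using free_act(2)[OF A U a u c] g[OF u c] g[of u _ "m + n", OF u] galg_mult_closed[OF A c a] by (simp add: e)
    qed
    then show "l (m + n) (mact (gmod_shift (gmod_free K U A) s) m n x a) = mact X m n (l m x) a" by simp
  qed
qed

lemma tens_gen:
  assumes A: "galgebra A" and U: "VS U" and u: "u \<in> carrier U" and a: "a \<in> ael A n"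
  shows "tens K U (acomp A n) u a = mact (gmod_free K U A) 0 n (tens K U (acomp A 0) u (aone A)) a"
  using free_act(2)[OF A U a u galgebraD(4)[OF A]] galgebraD(5)[OF A a] by simp

text \<open>Generators are lifted by linear algebra and the lift extends by freeness. The hypothesis
  is containment of images, because later \<open>g\<close> is a differential restricted to a
  submodule and only particular elements are known to lie in its image.\<close>

lemma free_lift:
  assumes A: "galgebra A" and U: "VS U" and X: "gm A X" and Y: "gm A Y" and g: "g \<in> hm A X Y"
    and f: "f \<in> hm A (gmod_shift (gmod_free K U A) s) Y"
    and im: "\<And>n p. p \<in> el (gmod_shift (gmod_free K U A) s) n \<Longrightarrow> f n p \<in> g n ` el X n"
  shows "\<exists>l\<in>hm A (gmod_shift (gmod_free K U A) s) X.
     \<forall>n. \<forall>p\<in>el (gmod_shift (gmod_free K U A) s) n. g n (l n p) = f n p"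
proof -
  note V = galgebraD(1)[OF A] and VX = gmD(1)[OF X] and VY = gmD(1)[OF Y]
  let ?P = "gmod_shift (gmod_free K U A) s"
  let ?e = "\<lambda>u. tens K U (acomp A 0) u (aone A)"
  have e: "?e \<in> lin U (mcomp ?P (- s))"
    using bilin_l[OF tens_bilin[OF U V] galgebraD(4)[OF A]] by (simp add: free_simps1)
  have "f (- s) (?e u) \<in> g (- s) ` el X (- s)" if "u \<in> carrier U" for u
    by (rule im[OF lin_closed[OF e that]])
  then obtain \<tau> where t: "\<tau> \<in> lin U (mcomp X (- s))" "\<forall>u\<in>carrier U. g (- s) (\<tau> u) = f (- s) (?e u)"
    by (rule lin_lift[OF U VX VY hm_lin[OF g] lin_comp[OF e hm_lin[OF f]]])
  define l where "l = (\<lambda>n. lift K (mcomp X n) (\<lambda>(u, a). mact X (- s) (n + s) (\<tau> u) a))"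
  have l: "l \<in> hm A ?P X" "\<And>u a n. u \<in> carrier U \<Longrightarrow> a \<in> ael A (n + s) \<Longrightarrow>
      l n (tens K U (acomp A (n + s)) u a) = mact X (- s) (n + s) (\<tau> u) a"
    unfolding l_def by (rule free_hom[OF A U X t(1)]; assumption)+
  have "g n (l n p) = f n p" if p: "p \<in> el ?P n" for n p
  proof (rule tensor_lin_eq[OF U V VY])
    show "(\<lambda>p. g n (l n p)) \<in> lin (tensor K U (acomp A (n + s))) (mcomp Y n)" "f n \<in> lin (tensor K U (acomp A (n + s))) (mcomp Y n)"
      using lin_comp[OF hm_lin[OF l(1)] hm_lin[OF g], of n] hm_lin[OF f, of n] by (simp_all add: free_simps1)
    show "p \<in> carrier (tensor K U (acomp A (n + s)))" using p by (simp add: free_simps1)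
    fix u a assume u: "u \<in> carrier U" and a: "a \<in> ael A (n + s)"
    have "f n (tens K U (acomp A (n + s)) u a) = f (- s + (n + s)) (mact ?P (- s) (n + s) (?e u) a)"
      using tens_gen[OF A U u a] by simp
    also have "\<dots> = mact Y (- s) (n + s) (f (- s) (?e u)) a"
      by (rule hm_act[OF f lin_closed[OF e u] a])
    also have "\<dots> = g (- s + (n + s)) (mact X (- s) (n + s) (\<tau> u) a)"
      using hm_act[OF g lin_closed[OF t(1) u] a] t(2) u by simp
    also have "\<dots> = g n (l n (tens K U (acomp A (n + s)) u a))"
      using l(2)[OF u a] by simp
    finally show "g n (l n (tens K U (acomp A (n + s)) u a)) = f n (tens K U (acomp A (n + s)) u a)" ..
  qed
  with l(1) show ?thesis by blast
qed

text \<open>The lifts on the summands, composed with the projections, are added up; this is a finite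
  sum of homomorphisms.\<close>

lemma dirsum_lift:
  assumes I: "finite I" and A: "galgebra A" and F: "\<forall>i\<in>I. gm A (F i)"
    and X: "gm A X" and Y: "gm A Y" and g: "g \<in> hm A X Y" and f: "f \<in> hm A (gmod_dirsum I F) Y"
    and l: "\<And>i. i \<in> I \<Longrightarrow> \<exists>l\<in>hm A (F i) X. \<forall>n. \<forall>p\<in>el (F i) n. g n (l n p) = f n (dinj I F i n p)"
  shows "\<exists>l\<in>hm A (gmod_dirsum I F) X. \<forall>n. \<forall>p\<in>el (gmod_dirsum I F) n. g n (l n p) = f n p"
proof -
  obtain l where l: "\<And>i. i \<in> I \<Longrightarrow> l i \<in> hm A (F i) X" "\<And>i n p. i \<in> I \<Longrightarrow> p \<in> el (F i) n \<Longrightarrow> g n (l i n p) = f n (dinj I F i n p)"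
    using l by metis
  note S = gm_dirsum[OF I A F]
  note VX = gmD(1)[OF X] and VY = gmD(1)[OF Y] and VS = gmD(1)[OF S]
  have L: "(\<lambda>n x. finsum (mcomp X n) (\<lambda>i. l i n (x i)) I) \<in> hm A (gmod_dirsum I F) X"
    by (rule hm_sum[OF S X I]) (auto intro: hm_comp[OF hm_proj[OF I] l(1)])
  have G: "g n (finsum (mcomp X n) (\<lambda>i. l i n (p i)) I) = f n p" if p: "p \<in> el (gmod_dirsum I F) n" for n p
  proof -
    have pi: "p i \<in> el (F i) n" if "i \<in> I" for i
      using p that by (auto simp: dirsum_carrier[OF I])
    have dc: "dinj I F i n (p i) \<in> el (gmod_dirsum I F) n" if "i \<in> I" for i
      using hm_closed[OF hm_dinj[OF I A F that] pi[OF that]] .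
    have "g n (finsum (mcomp X n) (\<lambda>i. l i n (p i)) I) = finsum (mcomp Y n) (\<lambda>i. g n (l i n (p i))) I"
      by (rule lin_finsum[OF VX VY hm_lin[OF g] I]) (rule hm_closed[OF l(1) pi])
    also have "\<dots> = finsum (mcomp Y n) (\<lambda>i. f n (dinj I F i n (p i))) I"
      by (rule VS_finsum_cong[OF VY]) (use l(2) pi hm_closed[OF f dc] in auto)
    also have "\<dots> = f n (finsum (mcomp (gmod_dirsum I F) n) (\<lambda>i. dinj I F i n (p i)) I)"
      by (rule lin_finsum[symmetric, OF VS VY hm_lin[OF f] I dc])
    also have "\<dots> = f n p" using dirsum_decomp[OF I A F p] by simp
    finally show ?thesis .
  qed
  show ?thesis
    by (rule bexI[OF _ L]) (use G in blast)
qed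

lemma bounded_below_shift: "bounded_below M \<Longrightarrow> bounded_below (gmod_shift M j)"
proof -
  assume "bounded_below M"
  then obtain n0 where "\<forall>n<n0. el M n = {\<zero>\<^bsub>mcomp M n\<^esub>}" by (auto simp: bounded_below_def)
  then show ?thesis unfolding bounded_below_def by (intro exI[of _ "n0 - j"]) auto
qed

text \<open>Used twice: for boundedness below, and in the minimality argument, where a summand has
  nothing below its generating degree.\<close>

lemma free_neg:
  assumes A: "galgebra A" and U: "VS U" and n: "n < 0"
  shows "carrier (tensor K U (acomp A n)) = {\<zero>\<^bsub>tensor K U (acomp A n)\<^esub>}"
proof -
  note V = galgebraD(1)[OF A] and T = VS_tensor[OF U galgebraD(1)[OF A]]
  have "X \<in> {\<zero>\<^bsub>tensor K U (acomp A n)\<^esub>}" if "X \<in> carrier (tensor K U (acomp A n))" for X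
    by (rule tensor_SUB_all[OF U V SUB_zero_space[OF T] _ that])
       (use galgebraD(7)[OF A n] bilin_zero(2)[OF U V T tens_bilin[OF U V]] in auto)
  then show ?thesis using VS_closed(1)[OF T] by blast
qed

lemma bounded_below_free: "galgebra A \<Longrightarrow> VS U \<Longrightarrow> bounded_below (gmod_free K U A)"
  unfolding bounded_below_def by (intro exI[of _ 0]) (auto simp: free_simps1 dest: free_neg)

lemma bounded_below_dirsum:
  assumes I: "finite I" and A: "galgebra A" and F: "\<forall>i\<in>I. gm A (F i)" and b: "\<forall>i\<in>I. bounded_below (F i)"
  shows "bounded_below (gmod_dirsum I F)"
proof -
  obtain n0 where n0: "\<And>i n. i \<in> I \<Longrightarrow> n < n0 i \<Longrightarrow> el (F i) n = {\<zero>\<^bsub>mcomp (F i) n\<^esub>}"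
    using b unfolding bounded_below_def by (metis (no_types, lifting))
  note V = gmD(1)[OF gm_dirsum[OF I A F]]
  have "el (gmod_dirsum I F) n = {\<zero>\<^bsub>mcomp (gmod_dirsum I F) n\<^esub>}" if n: "n < Min (insert 0 (n0 ` I))" for n
  proof -
    have n': "\<And>i. i \<in> I \<Longrightarrow> n < n0 i" using n I by auto
    have "x = \<zero>\<^bsub>mcomp (gmod_dirsum I F) n\<^esub>" if x: "x \<in> el (gmod_dirsum I F) n" for x
    proof (rule dirsum_ext[OF I x VS_closed(1)[OF V]])
      fix i assume i: "i \<in> I"
      then have "x i \<in> el (F i) n" using x by (auto simp: dirsum_carrier[OF I])
      then show "x i = \<zero>\<^bsub>mcomp (gmod_dirsum I F) n\<^esub> i" using n0[OF i n'[OF i]] i by (simp add: dirsum_simps)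
    qed
    then show ?thesis using VS_closed(1)[OF V] by blast
  qed
  then show ?thesis unfolding bounded_below_def by blast
qed

section \<open>Duals and the Koszul complex\<close>

lemma VS_finsum_swap:
  assumes U: "VS U" and X: "finite X" and Y: "finite Y" and g: "\<And>x y. x \<in> X \<Longrightarrow> y \<in> Y \<Longrightarrow> g x y \<in> carrier U"
  shows "finsum U (\<lambda>x. finsum U (\<lambda>y. g x y) Y) X = finsum U (\<lambda>y. finsum U (\<lambda>x. g x y) X) Y"
  using X g
proof (induction X)
  case empty
  then show ?case using U VS_finsum_zero[OF U, of Y "\<lambda>y. \<zero>\<^bsub>U\<^esub>"] by simp
next
  case (insert a X)
  have "finsum U (\<lambda>y. finsum U (\<lambda>x. g x y) (insert a X)) Y = finsum U (\<lambda>y. g a y \<oplus>\<^bsub>U\<^esub> finsum U (\<lambda>x. g x y) X) Y"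
    by (rule VS_finsum_cong[OF U]) (use insert U in \<open>auto intro!: VS_finsum_insert\<close>)
  also have "\<dots> = finsum U (\<lambda>y. g a y) Y \<oplus>\<^bsub>U\<^esub> finsum U (\<lambda>y. finsum U (\<lambda>x. g x y) X) Y"
    by (rule VS_finsum_add[OF U]) (use insert U in auto)
  also have "\<dots> = finsum U (\<lambda>x. finsum U (\<lambda>y. g x y) Y) (insert a X)"
    using insert U by (simp add: VS_finsum_insert)
  finally show ?case ..
qed

section \<open>Dual spaces and dual bases\<close>

lemma dual_carrier: "f \<in> carrier (dual_vs K U) \<longleftrightarrow> f \<in> lin U (ground_vs K) \<and> f \<in> extensional (carrier U)"
  by (simp add: dual_vs_def)

lemma dual_ops:
  "\<zero>\<^bsub>dual_vs K U\<^esub> = (\<lambda>v\<in>carrier U. \<zero>)" "f \<oplus>\<^bsub>dual_vs K U\<^esub> g = (\<lambda>v\<in>carrier U. f v \<oplus> g v)"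
  "c \<odot>\<^bsub>dual_vs K U\<^esub> f = (\<lambda>v\<in>carrier U. c \<otimes> f v)"
  by (simp_all add: dual_vs_def func_space_def)

text \<open>The dual is a subspace of the functions on the carrier; extensionality makes functionals
  equal once they agree on the carrier.\<close>

lemma VS_dual [simp]:
  assumes U: "VS U"
  shows "VS (dual_vs K U)"
proof -
  let ?F = "func_space (carrier U)"
  have F: "VS ?F" using func_space_is_module by (rule VS_I)
  have r: "restrict f (carrier U) \<in> lin U (ground_vs K)" if "f \<in> lin U (ground_vs K)" for f
    by (rule lin_cong[OF U that]) simp
  have "SUB (lin U (ground_vs K) \<inter> extensional (carrier U)) ?F"
  proof (rule SUB_I[OF F])
    show "lin U (ground_vs K) \<inter> extensional (carrier U) \<subseteq> carrier ?F"
      using lin_closed[where W = "ground_vs K" and U = U] by (auto simp: func_space_def PiE_iff extensional_def)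
  qed (use lin_zero_map[OF U VS_ground] lin_plus[OF U VS_ground] lin_scale[OF U VS_ground]
       in \<open>auto simp: func_space_def intro!: r\<close>)
  from SUB_VS[OF F this] show ?thesis by (simp add: dual_vs_def)
qed

lemma dual_lin: "f \<in> carrier (dual_vs K U) \<Longrightarrow> f \<in> lin U (ground_vs K)"
  by (simp add: dual_carrier)

lemma dual_apply_closed: "f \<in> carrier (dual_vs K U) \<Longrightarrow> v \<in> carrier U \<Longrightarrow> f v \<in> carrier K"
  using lin_closed[OF dual_lin] by fastforce

lemma dual_restrict: "VS U \<Longrightarrow> f \<in> lin U (ground_vs K) \<Longrightarrow> restrict f (carrier U) \<in> carrier (dual_vs K U)"
  by (auto simp: dual_carrier intro: lin_cong)

lemma dual_ext:
  "f \<in> carrier (dual_vs K U) \<Longrightarrow> g \<in> carrier (dual_vs K U) \<Longrightarrow> (\<And>v. v \<in> carrier U \<Longrightarrow> f v = g v) \<Longrightarrow> f = g"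
  by (auto simp: dual_carrier intro: extensionalityI)

lemma dual_eval: "v \<in> carrier U \<Longrightarrow> (\<lambda>f. f v) \<in> lin (dual_vs K U) (ground_vs K)"
  by (rule linI) (auto simp: dual_ops dual_apply_closed)

text \<open>A finite basis packaged with its dual basis. Coordinates are then values of functionals,
  and every expansion below is a finite sum with explicit coefficients.\<close>

definition fdb :: "('k, 'u) module \<Rightarrow> 'u set \<Rightarrow> ('u \<Rightarrow> 'u \<Rightarrow> 'k) \<Rightarrow> bool" where
  "fdb U X y \<longleftrightarrow> finite X \<and> X \<subseteq> carrier U \<and> (\<forall>x\<in>X. y x \<in> carrier (dual_vs K U)) \<and>
     (\<forall>x\<in>X. \<forall>x'\<in>X. y x x' = (if x' = x then \<one> else \<zero>)) \<and>
     (\<forall>v\<in>carrier U. v = (\<Oplus>\<^bsub>U\<^esub>x\<in>X. y x v \<odot>\<^bsub>U\<^esub> x))"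

lemma fdbD:
  assumes "fdb U X y"
  shows "finite X" "x \<in> X \<Longrightarrow> x \<in> carrier U" "x \<in> X \<Longrightarrow> y x \<in> carrier (dual_vs K U)"
    "x \<in> X \<Longrightarrow> x' \<in> X \<Longrightarrow> y x x' = (if x' = x then \<one> else \<zero>)"
    "v \<in> carrier U \<Longrightarrow> v = (\<Oplus>\<^bsub>U\<^esub>x\<in>X. y x v \<odot>\<^bsub>U\<^esub> x)"
    "x \<in> X \<Longrightarrow> v \<in> carrier U \<Longrightarrow> y x v \<in> carrier K"
proof -
  show "finite X" "x \<in> X \<Longrightarrow> x \<in> carrier U" "x \<in> X \<Longrightarrow> y x \<in> carrier (dual_vs K U)"
    "x \<in> X \<Longrightarrow> x' \<in> X \<Longrightarrow> y x x' = (if x' = x then \<one> else \<zero>)"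
    "v \<in> carrier U \<Longrightarrow> v = (\<Oplus>\<^bsub>U\<^esub>x\<in>X. y x v \<odot>\<^bsub>U\<^esub> x)"
    using assms unfolding fdb_def by blast+
  then show "y x v \<in> carrier K" if "x \<in> X" "v \<in> carrier U"
    using that dual_apply_closed[of "y x" U v] by simp
qed

text \<open>By independence \<open>x\<close> lies outside the span of the other basis vectors, so a
  separating functional serves as the coordinate at \<open>x\<close>. The expansion formula holds on
  the basis, and both of its sides are linear.\<close>

lemma basis_fdb:
  assumes U: "VS U" and X: "finite X" "vectorspace.basis K U X"
  obtains y where "fdb U X y"
proof -
  interpret U: vectorspace K U by fact
  have b: "U.lin_indpt X" "spn U X = carrier U" "X \<subseteq> carrier U"
    using X(2) unfolding U.basis_def by auto
  have "\<exists>f. f \<in> carrier (dual_vs K U) \<and> (\<forall>x'\<in>X. f x' = (if x' = x then \<one> else \<zero>))" if x: "x \<in> X" for x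
  proof -
    let ?W = "spn U (X - {x})"
    have Xx: "X - {x} \<subseteq> carrier U" "x \<in> carrier U" using b(3) x by auto
    have "U.lin_indpt (X - {x})" using U.subset_li_is_li[OF b(1)] by auto
    then have "x \<notin> ?W"
      using U.lin_dep_iff_in_span[OF Xx(1) _ Xx(2)] b(1) x by (simp add: insert_absorb)
    then obtain f where f: "f \<in> lin U (ground_vs K)" "\<forall>w\<in>?W. f w = \<zero>" "f x = \<one>"
      by (rule separating_functional[OF U spn_SUB[OF U Xx(1)] Xx(2)])
    have "x' \<in> ?W" if "x' \<in> X" "x' \<noteq> x" for x'
      using spn_incl[OF U Xx(1)] that by blast
    then show ?thesis
      using f b(3) by (intro exI[of _ "restrict f (carrier U)"] conjI dual_restrict[OF U f(1)]) auto
  qed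
  then obtain y where y: "\<And>x. x \<in> X \<Longrightarrow> y x \<in> carrier (dual_vs K U)"
    "\<And>x x'. x \<in> X \<Longrightarrow> x' \<in> X \<Longrightarrow> y x x' = (if x' = x then \<one> else \<zero>)"
    by metis
  have L: "(\<lambda>v. \<Oplus>\<^bsub>U\<^esub>x\<in>X. y x v \<odot>\<^bsub>U\<^esub> x) \<in> lin U U"
  proof (rule lin_sum[OF U U X(1)])
    fix x assume "x \<in> X"
    then have x: "x \<in> carrier U" and yx: "y x \<in> lin U (ground_vs K)" using b(3) dual_lin[OF y(1)] by auto
    show "(\<lambda>v. y x v \<odot>\<^bsub>U\<^esub> x) \<in> lin U U"
      by (rule linI) (use U x lin_closed[OF yx] in \<open>simp_all add: lin_add[OF yx] lin_smult[OF yx] VS_distr\<close>)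
  qed
  have "v \<in> {v \<in> carrier U. v = (\<Oplus>\<^bsub>U\<^esub>x\<in>X. y x v \<odot>\<^bsub>U\<^esub> x)}" if v: "v \<in> carrier U" for v
  proof -
    have "x = (\<Oplus>\<^bsub>U\<^esub>z\<in>X. y z x \<odot>\<^bsub>U\<^esub> z)" if x: "x \<in> X" for x
    proof -
      have "(\<Oplus>\<^bsub>U\<^esub>z\<in>X. y z x \<odot>\<^bsub>U\<^esub> z) = y x x \<odot>\<^bsub>U\<^esub> x"
        by (rule VS_finsum_single[OF U X(1) x]) (use x y b(3) U in \<open>auto simp: subset_iff\<close>)
      then show ?thesis using x y b(3) U by auto
    qed
    then have "spn U X \<subseteq> {v \<in> carrier U. v = (\<Oplus>\<^bsub>U\<^esub>x\<in>X. y x v \<odot>\<^bsub>U\<^esub> x)}"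
      using b(3) by (intro spn_least[OF U SUB_eqlin[OF U U lin_id L]]) blast
    then show ?thesis using v b(2) by blast
  qed
  then show thesis
    using that[of y] y X(1) b(3) unfolding fdb_def by blast
qed

lemma fin_dim_fdb:
  assumes U: "VS U" and f: "vectorspace.fin_dim K U"
  obtains X y where "fdb U X y"
proof -
  obtain X where "finite X" "vectorspace.basis K U X"
    using vectorspace.finite_basis_exists[OF U f] by blast
  then show thesis using basis_fdb[OF U] that by metis
qed

lemma fin_dimI: "VS U \<Longrightarrow> finite X \<Longrightarrow> X \<subseteq> carrier U \<Longrightarrow> carrier U \<subseteq> spn U X \<Longrightarrow> vectorspace.fin_dim K U"
  unfolding vectorspace.fin_dim_def
  by (intro exI[of _ X]) (auto dest: SUB_subset[OF spn_SUB])

lemma lin_expand: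
  assumes U: "VS U" and P: "VS P" and b: "fdb U X y" and f: "f \<in> lin U P" and u: "u \<in> carrier U"
  shows "f u = (\<Oplus>\<^bsub>P\<^esub>x\<in>X. y x u \<odot>\<^bsub>P\<^esub> f x)"
proof -
  note [simp] = fdbD[OF b]
  have "f u = f (\<Oplus>\<^bsub>U\<^esub>x\<in>X. y x u \<odot>\<^bsub>U\<^esub> x)" using fdbD(5)[OF b u] by simp
  also have "\<dots> = (\<Oplus>\<^bsub>P\<^esub>x\<in>X. f (y x u \<odot>\<^bsub>U\<^esub> x))"
    by (rule lin_finsum[OF U P f]) (use u U in auto)
  also have "\<dots> = (\<Oplus>\<^bsub>P\<^esub>x\<in>X. y x u \<odot>\<^bsub>P\<^esub> f x)"
    by (rule VS_finsum_cong[OF P]) (use u P lin_closed[OF f] lin_smult[OF f] in auto)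
  finally show ?thesis .
qed

lemma bilin_expand:
  assumes U: "VS U" and W: "VS W" and P: "VS P" and b: "fdb U X y" "fdb W Z z" and f: "bilin U W P \<beta>"
    and u: "u \<in> carrier U" and w: "w \<in> carrier W"
  shows "\<beta> u w = (\<Oplus>\<^bsub>P\<^esub>c\<in>Z. \<Oplus>\<^bsub>P\<^esub>x\<in>X. (y x u \<otimes> z c w) \<odot>\<^bsub>P\<^esub> \<beta> x c)"
proof -
  note bX = fdbD[OF b(1)] and bZ = fdbD[OF b(2)] and cl = bilin_closed[OF f]
  have "\<beta> u w = (\<Oplus>\<^bsub>P\<^esub>c\<in>Z. z c w \<odot>\<^bsub>P\<^esub> \<beta> u c)"
    by (rule lin_expand[OF W P b(2) bilin_r[OF f u] w])
  also have "\<dots> = (\<Oplus>\<^bsub>P\<^esub>c\<in>Z. \<Oplus>\<^bsub>P\<^esub>x\<in>X. (y x u \<otimes> z c w) \<odot>\<^bsub>P\<^esub> \<beta> x c)"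
  proof (rule VS_finsum_cong[OF P refl])
    fix c assume c: "c \<in> Z"
    have zc: "z c w \<in> carrier K" "c \<in> carrier W" using bZ c w by auto
    show "(\<Oplus>\<^bsub>P\<^esub>x\<in>X. (y x u \<otimes> z c w) \<odot>\<^bsub>P\<^esub> \<beta> x c) \<in> carrier P"
      by (rule VS_finsum_closed[OF P]) (use zc u bX cl P in auto)
    have "z c w \<odot>\<^bsub>P\<^esub> \<beta> u c = z c w \<odot>\<^bsub>P\<^esub> (\<Oplus>\<^bsub>P\<^esub>x\<in>X. y x u \<odot>\<^bsub>P\<^esub> \<beta> x c)"
      using lin_expand[OF U P b(1) bilin_l[OF f zc(2)] u] by simp
    also have "\<dots> = (\<Oplus>\<^bsub>P\<^esub>x\<in>X. z c w \<odot>\<^bsub>P\<^esub> (y x u \<odot>\<^bsub>P\<^esub> \<beta> x c))"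
      by (rule VS_finsum_smult[OF P zc(1) bX(1)]) (use zc u bX cl P in auto)
    also have "\<dots> = (\<Oplus>\<^bsub>P\<^esub>x\<in>X. (y x u \<otimes> z c w) \<odot>\<^bsub>P\<^esub> \<beta> x c)"
      by (rule VS_finsum_cong[OF P]) (use zc u bX cl P in \<open>auto simp: m_comm\<close>)
    finally show "z c w \<odot>\<^bsub>P\<^esub> \<beta> u c = (\<Oplus>\<^bsub>P\<^esub>x\<in>X. (y x u \<otimes> z c w) \<odot>\<^bsub>P\<^esub> \<beta> x c)" .
  qed
  finally show ?thesis .
qed

lemma words2_cases:
  assumes "vs \<in> words V 2"
  obtains u v where "vs = [u, v]" "u \<in> carrier V" "v \<in> carrier V"
proof -
  have "length vs = 2" using assms by (simp add: words_def)
  then obtain u v where "vs = [u, v]" by (auto simp: length_Suc_conv numeral_2_eq_2)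
  then show thesis using that assms by (simp add: words_def)
qed

lemma words1_cases:
  assumes "vs \<in> words V 1"
  obtains u where "vs = [u]" "u \<in> carrier V"
proof -
  have "length vs = 1" using assms by (simp add: words_def)
  then obtain u where "vs = [u]" by (auto simp: length_Suc_conv)
  then show thesis using that assms by (simp add: words_def)
qed

lemma words0: "words V 0 = {[]}"
  by (auto simp: words_def)

lemma words_mem: "[u] \<in> words V 1 \<longleftrightarrow> u \<in> carrier V" "[u, v] \<in> words V 2 \<longleftrightarrow> u \<in> carrier V \<and> v \<in> carrier V"
  by (auto simp: words_def)

text \<open>In a word of length 2 the part before or the part after the distinguished letter is
  empty, so multilinearity is linearity in one of two arguments.\<close>

lemma multilin2:
  assumes V: "VS V" and b: "bilin V V P \<beta>"
  shows "multilin V 2 P (\<lambda>vs. \<beta> (vs ! 0) (vs ! 1))"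
proof -
  have len: "(us = [] \<and> (\<exists>w. ws = [w] \<and> w \<in> carrier V) \<or> ws = [] \<and> (\<exists>u. us = [u] \<and> u \<in> carrier V)) \<and> v \<in> carrier V"
    if w: "us @ [v] @ ws \<in> words V 2" for us v ws
  proof -
    obtain a b where "us @ [v] @ ws = [a, b]" "a \<in> carrier V" "b \<in> carrier V" using w by (rule words2_cases)
    then show ?thesis by (cases us; cases ws) auto
  qed
  show ?thesis
    unfolding multilin_def
  proof (intro conjI allI impI ballI)
    fix us v v' ws assume w: "us @ [v] @ ws \<in> words V 2" and v': "v' \<in> carrier V"
    show "\<beta> ((us @ [v \<oplus>\<^bsub>V\<^esub> v'] @ ws) ! 0) ((us @ [v \<oplus>\<^bsub>V\<^esub> v'] @ ws) ! 1)
      = \<beta> ((us @ [v] @ ws) ! 0) ((us @ [v] @ ws) ! 1) \<oplus>\<^bsub>P\<^esub> \<beta> ((us @ [v'] @ ws) ! 0) ((us @ [v'] @ ws) ! 1)"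
      using len[OF w] v' by (elim conjE disjE exE) (simp_all add: bilin_adds[OF b])
  next
    fix us v ws c assume w: "us @ [v] @ ws \<in> words V 2" and c: "c \<in> carrier K"
    show "\<beta> ((us @ [c \<odot>\<^bsub>V\<^esub> v] @ ws) ! 0) ((us @ [c \<odot>\<^bsub>V\<^esub> v] @ ws) ! 1)
      = c \<odot>\<^bsub>P\<^esub> \<beta> ((us @ [v] @ ws) ! 0) ((us @ [v] @ ws) ! 1)"
      using len[OF w] c by (elim conjE disjE exE) (simp_all add: bilin_adds[OF b])
  next
    fix vs assume "vs \<in> words V 2"
    then show "\<beta> (vs ! 0) (vs ! 1) \<in> carrier P"
      by (elim words2_cases) (simp add: bilin_closed[OF b])
  qed
qed

lemma word_tens2_bilin:
  assumes V: "VS V"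
  shows "bilin V V (tensor_power K V 2) (\<lambda>u v. word_tens K V [u, v])"
proof -
  note m = word_tens_multilin[OF V, of 2, unfolded multilin_def]
  have a: "word_tens K V [u \<oplus>\<^bsub>V\<^esub> u', v] = word_tens K V [u, v] \<oplus>\<^bsub>tensor_power K V 2\<^esub> word_tens K V [u', v]"
    "word_tens K V [v, u \<oplus>\<^bsub>V\<^esub> u'] = word_tens K V [v, u] \<oplus>\<^bsub>tensor_power K V 2\<^esub> word_tens K V [v, u']"
    if "u \<in> carrier V" "u' \<in> carrier V" "v \<in> carrier V" for u u' v
    using m[THEN conjunct2, THEN conjunct1, rule_format, of "[]" u "[v]" u']
      m[THEN conjunct2, THEN conjunct1, rule_format, of "[v]" u "[]" u'] that by (simp_all add: words_mem)
  have s: "word_tens K V [c \<odot>\<^bsub>V\<^esub> u, v] = c \<odot>\<^bsub>tensor_power K V 2\<^esub> word_tens K V [u, v]"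
    "word_tens K V [v, c \<odot>\<^bsub>V\<^esub> u] = c \<odot>\<^bsub>tensor_power K V 2\<^esub> word_tens K V [v, u]"
    if "c \<in> carrier K" "u \<in> carrier V" "v \<in> carrier V" for u v c
    using m[THEN conjunct2, THEN conjunct2, rule_format, of "[]" u "[v]" c]
      m[THEN conjunct2, THEN conjunct2, rule_format, of "[v]" u "[]" c] that by (simp_all add: words_mem)
  show ?thesis
    by (intro bilinI linI) (simp_all add: a s word_tens_closed words_mem)
qed

lemma bilin_prod:
  assumes "f \<in> lin U (ground_vs K)" "g \<in> lin W (ground_vs K)"
  shows "bilin U W (ground_vs K) (\<lambda>u v. f u \<otimes> g v)"
proof -
  have "f u \<in> carrier K" if "u \<in> carrier U" for u using lin_closed[OF assms(1) that] by simp
  moreover have "g u \<in> carrier K" if "u \<in> carrier W" for u using lin_closed[OF assms(2) that] by simp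
  ultimately show ?thesis
    by (intro bilinI linI)
      (simp_all add: lin_add[OF assms(1)] lin_add[OF assms(2)] lin_smult[OF assms(1)] lin_smult[OF assms(2)]
        l_distr r_distr m_assoc m_lcomm)
qed

text \<open>Written for an abstract space \<open>S\<close> spanned by elements
  \<open>\<gamma> u v\<close>, so that it serves both the pairing for relations of the algebra and
  the one for relations of a module. Bilinearity in the functionals is an identity of functionals on
  \<open>S\<close>, hence is checked on the spanning elements.\<close>

lemma dual_pairing_bilin:
  assumes U: "VS U" and V: "VS V" and S: "VS S"
    and L: "\<And>f g. f \<in> carrier (dual_vs K U) \<Longrightarrow> g \<in> carrier (dual_vs K V) \<Longrightarrow> L f g \<in> lin S (ground_vs K)"
    and v: "\<And>f g u v. f \<in> carrier (dual_vs K U) \<Longrightarrow> g \<in> carrier (dual_vs K V) \<Longrightarrow> u \<in> carrier U \<Longrightarrow> v \<in> carrier V \<Longrightarrow>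
      L f g (\<gamma> u v) = f u \<otimes> g v"
    and all: "\<And>T. SUB T S \<Longrightarrow> (\<And>u v. u \<in> carrier U \<Longrightarrow> v \<in> carrier V \<Longrightarrow> \<gamma> u v \<in> T) \<Longrightarrow> carrier S \<subseteq> T"
    and g: "\<And>u v. u \<in> carrier U \<Longrightarrow> v \<in> carrier V \<Longrightarrow> \<gamma> u v \<in> carrier S"
    and s: "s \<in> carrier S"
  shows "bilin (dual_vs K U) (dual_vs K V) (ground_vs K) (\<lambda>f g. L f g s)"
proof -
  have eq: "p s = q s" if p: "p \<in> lin S (ground_vs K)" and q: "q \<in> lin S (ground_vs K)"
    and e: "\<And>u v. u \<in> carrier U \<Longrightarrow> v \<in> carrier V \<Longrightarrow> p (\<gamma> u v) = q (\<gamma> u v)" for p q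
  proof -
    have "carrier S \<subseteq> {x \<in> carrier S. p x = q x}"
      by (rule all[OF SUB_eqlin[OF S VS_ground p q]]) (simp add: g e)
    then show ?thesis using s by blast
  qed
  have D: "VS (dual_vs K U)" "VS (dual_vs K V)" using U V by auto
  show ?thesis
  proof (intro bilinI linI)
    fix f g h assume k: "f \<in> carrier (dual_vs K U)" "g \<in> carrier (dual_vs K V)" "h \<in> carrier (dual_vs K V)"
    have gh: "g \<oplus>\<^bsub>dual_vs K V\<^esub> h \<in> carrier (dual_vs K V)" using k D by simp
    show "L f (g \<oplus>\<^bsub>dual_vs K V\<^esub> h) s = L f g s \<oplus>\<^bsub>ground_vs K\<^esub> L f h s"
      by (rule eq[OF L[OF k(1) gh] lin_plus[OF S VS_ground L[OF k(1,2)] L[OF k(1,3)]]])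
        (use k gh in \<open>simp add: v dual_ops dual_apply_closed r_distr\<close>)
  next
    fix f g h assume k: "f \<in> carrier (dual_vs K U)" "h \<in> carrier (dual_vs K U)" "g \<in> carrier (dual_vs K V)"
    have gh: "f \<oplus>\<^bsub>dual_vs K U\<^esub> h \<in> carrier (dual_vs K U)" using k D by simp
    show "L (f \<oplus>\<^bsub>dual_vs K U\<^esub> h) g s = L f g s \<oplus>\<^bsub>ground_vs K\<^esub> L h g s"
      by (rule eq[OF L[OF gh k(3)] lin_plus[OF S VS_ground L[OF k(1,3)] L[OF k(2,3)]]])
        (use k gh in \<open>simp add: v dual_ops dual_apply_closed l_distr\<close>)
  next
    fix f g c assume k: "f \<in> carrier (dual_vs K U)" "g \<in> carrier (dual_vs K V)" "c \<in> carrier K"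
    have gh: "c \<odot>\<^bsub>dual_vs K V\<^esub> g \<in> carrier (dual_vs K V)" using k D by simp
    show "L f (c \<odot>\<^bsub>dual_vs K V\<^esub> g) s = c \<odot>\<^bsub>ground_vs K\<^esub> L f g s"
      by (rule eq[OF L[OF k(1) gh] lin_scale[OF S VS_ground L[OF k(1,2)] k(3)]])
        (use k gh in \<open>simp add: v dual_ops dual_apply_closed m_lcomm\<close>)
  next
    fix f g c assume k: "f \<in> carrier (dual_vs K U)" "g \<in> carrier (dual_vs K V)" "c \<in> carrier K"
    have gh: "c \<odot>\<^bsub>dual_vs K U\<^esub> f \<in> carrier (dual_vs K U)" using k D by simp
    show "L (c \<odot>\<^bsub>dual_vs K U\<^esub> f) g s = c \<odot>\<^bsub>ground_vs K\<^esub> L f g s"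
      by (rule eq[OF L[OF gh k(2)] lin_scale[OF S VS_ground L[OF k(1,2)] k(3)]])
        (use k gh in \<open>simp add: v dual_ops dual_apply_closed m_assoc\<close>)
  qed (rule lin_closed[OF L s]; assumption)+
qed

lemma pairing2_props:
  assumes V: "VS V"
  shows "s \<in> carrier (tensor_power K V 2) \<Longrightarrow> (\<lambda>\<rho>. pairing2 K \<rho> s) \<in> lin (tensor_power K (dual_vs K V) 2) (ground_vs K)"
    and "f \<in> carrier (dual_vs K V) \<Longrightarrow> g \<in> carrier (dual_vs K V) \<Longrightarrow>
      pairing2 K (word_tens K (dual_vs K V) [f, g]) \<in> lin (tensor_power K V 2) (ground_vs K)"
    and "f \<in> carrier (dual_vs K V) \<Longrightarrow> g \<in> carrier (dual_vs K V) \<Longrightarrow> u \<in> carrier V \<Longrightarrow> v \<in> carrier V \<Longrightarrow>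
      pairing2 K (word_tens K (dual_vs K V) [f, g]) (word_tens K V [u, v]) = f u \<otimes> g v"
proof -
  let ?V' = "dual_vs K V" and ?k = "ground_vs K" and ?T = "tensor_power K V 2"
  let ?L = "\<lambda>f g. lift K ?k (\<lambda>vs. f (vs ! 0) \<otimes> g (vs ! 1))"
  have V': "VS ?V'" and T: "VS ?T" using V by auto
  have b: "bilin V V ?k (\<lambda>u v. f u \<otimes> g v)" if "f \<in> carrier ?V'" "g \<in> carrier ?V'" for f g
    using that by (intro bilin_prod dual_lin)
  note L = tpow_lift[OF V VS_ground multilin2[OF V b]]
  have v: "?L f g (word_tens K V [u, v]) = f u \<otimes> g v"
    if "f \<in> carrier ?V'" "g \<in> carrier ?V'" "u \<in> carrier V" "v \<in> carrier V" for f g u v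
    using L(2)[OF that(1,2), of "[u, v]"] that by (simp add: words_mem)
  have all: "carrier ?T \<subseteq> S" if S: "SUB S ?T" and g: "\<And>u v. u \<in> carrier V \<Longrightarrow> v \<in> carrier V \<Longrightarrow> word_tens K V [u, v] \<in> S" for S
  proof
    fix X assume "X \<in> carrier ?T"
    then show "X \<in> S" by (rule tpow_SUB_all[OF V S, rotated]) (elim words2_cases, simp add: g)
  qed
  have ib: "bilin ?V' ?V' ?k (\<lambda>f g. ?L f g s)" if s: "s \<in> carrier ?T" for s
    by (rule dual_pairing_bilin[where \<gamma> = "\<lambda>u v. word_tens K V [u, v]" and L = ?L, OF V V T L(1) v all _ s])
       (auto simp: word_tens_closed words_mem)
  have p: "pairing2 K \<rho> s = lift K ?k (\<lambda>fs. ?L (fs ! 0) (fs ! 1) s) \<rho>" for \<rho> s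
    by (simp add: pairing2_def)
  note o = tpow_lift[OF V' VS_ground multilin2[OF V' ib]]
  show "(\<lambda>\<rho>. pairing2 K \<rho> s) \<in> lin (tensor_power K ?V' 2) ?k" if "s \<in> carrier ?T" for s
    unfolding p using o(1)[OF that] .
  have pw: "pairing2 K (word_tens K ?V' [f, g]) s = ?L f g s"
    if "f \<in> carrier ?V'" "g \<in> carrier ?V'" "s \<in> carrier ?T" for f g s
    unfolding p using o(2)[OF that(3), of "[f, g]"] that by (simp add: words_mem)
  show "pairing2 K (word_tens K ?V' [f, g]) \<in> lin ?T ?k" if "f \<in> carrier ?V'" "g \<in> carrier ?V'"
    by (rule lin_cong[OF T L(1)[OF that]]) (rule pw[OF that, symmetric])
  show "pairing2 K (word_tens K ?V' [f, g]) (word_tens K V [u, v]) = f u \<otimes> g v"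
    if "f \<in> carrier ?V'" "g \<in> carrier ?V'" "u \<in> carrier V" "v \<in> carrier V"
    using pw[OF that(1,2), of "word_tens K V [u, v]"] v[OF that] that by (simp add: word_tens_closed words_mem)
qed

lemma mod_pairing_props:
  assumes U: "VS U" and V: "VS V"
  shows "s \<in> carrier (tensor K U V) \<Longrightarrow> (\<lambda>\<rho>. mod_pairing K \<rho> s) \<in> lin (tensor K (dual_vs K U) (dual_vs K V)) (ground_vs K)"
    and "f \<in> carrier (dual_vs K U) \<Longrightarrow> g \<in> carrier (dual_vs K V) \<Longrightarrow>
      mod_pairing K (tens K (dual_vs K U) (dual_vs K V) f g) \<in> lin (tensor K U V) (ground_vs K)"
    and "f \<in> carrier (dual_vs K U) \<Longrightarrow> g \<in> carrier (dual_vs K V) \<Longrightarrow> u \<in> carrier U \<Longrightarrow> v \<in> carrier V \<Longrightarrow>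
      mod_pairing K (tens K (dual_vs K U) (dual_vs K V) f g) (tens K U V u v) = f u \<otimes> g v"
proof -
  let ?V' = "dual_vs K V" and ?U' = "dual_vs K U" and ?k = "ground_vs K" and ?T = "tensor K U V"
  let ?L = "\<lambda>f g. lift K ?k (\<lambda>(u, v). f u \<otimes> g v)"
  have V': "VS ?V'" "VS ?U'" and T: "VS ?T" using V U by auto
  have b: "bilin U V ?k (\<lambda>u v. f u \<otimes> g v)" if "f \<in> carrier ?U'" "g \<in> carrier ?V'" for f g
    using that by (intro bilin_prod dual_lin)
  note L = tensor_lift[OF U V VS_ground b]
  have all: "carrier ?T \<subseteq> S" if S: "SUB S ?T" and g: "\<And>u v. u \<in> carrier U \<Longrightarrow> v \<in> carrier V \<Longrightarrow> tens K U V u v \<in> S" for S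
    using tensor_SUB_all[OF U V S g] by blast
  have ib: "bilin ?U' ?V' ?k (\<lambda>f g. ?L f g s)" if s: "s \<in> carrier ?T" for s
    by (rule dual_pairing_bilin[where \<gamma> = "tens K U V" and L = ?L, OF U V T L(1) L(2) all _ s]) auto
  have p: "mod_pairing K \<rho> s = lift K ?k (\<lambda>(f, g). ?L f g s) \<rho>" for \<rho> s
    by (simp add: mod_pairing_def)
  note o = tensor_lift[OF V'(2,1) VS_ground ib]
  show "(\<lambda>\<rho>. mod_pairing K \<rho> s) \<in> lin (tensor K ?U' ?V') ?k" if "s \<in> carrier ?T" for s
    unfolding p using o(1)[OF that] .
  have pw: "mod_pairing K (tens K ?U' ?V' f g) s = ?L f g s"
    if "f \<in> carrier ?U'" "g \<in> carrier ?V'" "s \<in> carrier ?T" for f g s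
    unfolding p using o(2)[OF that(3) that(1,2)] .
  show "mod_pairing K (tens K ?U' ?V' f g) \<in> lin ?T ?k" if "f \<in> carrier ?U'" "g \<in> carrier ?V'"
    by (rule lin_cong[OF T L(1)[OF that]]) (rule pw[OF that, symmetric])
  show "mod_pairing K (tens K ?U' ?V' f g) (tens K U V u v) = f u \<otimes> g v"
    if "f \<in> carrier ?U'" "g \<in> carrier ?V'" "u \<in> carrier U" "v \<in> carrier V"
    using pw[OF that(1,2) tens_closed[OF that(3,4)]] L(2)[OF that] by simp
qed

text \<open>If the total degree is below 2, one of the outer factors has negative degree and is
  therefore zero.\<close>

lemma ideal2_low:
  assumes A: "galgebra A" and R: "R \<subseteq> ael A 2" and n: "n < 2"
  shows "ideal2 K A R n = {\<zero>\<^bsub>acomp A n\<^esub>}"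
proof -
  note V = galgebraD(1)[OF A] and b = galgebraD(2)[OF A] and mc = galg_mult_closed[OF A]
  have "amult A (i + 2) j (amult A i 2 u r) w = \<zero>\<^bsub>acomp A n\<^esub>"
    if k: "i + 2 + j = n" "u \<in> ael A i" "r \<in> R" "w \<in> ael A j" for i j u r w
  proof -
    have r: "r \<in> ael A 2" using k R by blast
    have "i < 0 \<or> j < 0" using n k(1) by linarith
    then show ?thesis
    proof
      assume "i < 0"
      then have "u = \<zero>\<^bsub>acomp A i\<^esub>" using galgebraD(7)[OF A] k(2) by blast
      then show ?thesis
        using bilin_zero(1)[OF V V V b r, of i] bilin_zero(1)[OF V V V b k(4), of "i + 2"] k(1) by simp
    next
      assume "j < 0"
      then have "w = \<zero>\<^bsub>acomp A j\<^esub>" using galgebraD(7)[OF A] k(4) by blast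
      then show ?thesis
        using bilin_zero(2)[OF V V V b mc[OF k(2) r], of j] k(1) by simp
    qed
  qed
  then have "{amult A (i + 2) j (amult A i 2 u r) w | i j u r w.
        i + 2 + j = n \<and> u \<in> ael A i \<and> r \<in> R \<and> w \<in> ael A j} \<subseteq> {\<zero>\<^bsub>acomp A n\<^esub>}" by blast
  then have "ideal2 K A R n \<subseteq> {\<zero>\<^bsub>acomp A n\<^esub>}"
    unfolding ideal2_def by (rule spn_least[OF V SUB_zero_space[OF V]])
  then show ?thesis using SUB_zero[OF ideal2_props(1)[OF A R, of n]] by blast
qed

lemma ideal2_incl:
  assumes A: "galgebra A" and R: "R \<subseteq> ael A 2" and r: "r \<in> R"
  shows "r \<in> ideal2 K A R 2"
proof -
  have S: "{amult A (i + 2) j (amult A i 2 u r) w | i j u r w.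
        i + 2 + j = 2 \<and> u \<in> ael A i \<and> r \<in> R \<and> w \<in> ael A j} \<subseteq> ael A 2"
  proof clarify
    fix i j u r w assume k: "i + 2 + j = 2" "u \<in> ael A i" "r \<in> R" "w \<in> ael A j"
    then show "amult A (i + 2) j (amult A i 2 u r) w \<in> ael A 2"
      using galg_mult_closed[OF A galg_mult_closed[OF A k(2) subsetD[OF R k(3)]] k(4)] unfolding k(1) by simp
  qed
  have "r = amult A (0 + 2) 0 (amult A 0 2 (aone A) r) (aone A)"
    using galgebraD(5,6)[OF A, of r 2] r R by auto
  then show ?thesis
    unfolding ideal2_def using r galgebraD(4)[OF A] by (intro spn_incl[OF galgebraD(1)[OF A] S]) fastforce
qed

text \<open>In degree 0 the ideal vanishes and the empty word is the only word, so the component is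
  the line through the unit; \<open>c\<close> reads off the scalar.\<close>

lemma quad_alg_deg0:
  fixes V :: "('k, 'v) module"
  assumes V: "VS V" and R: "R \<subseteq> carrier (tensor_power K V 2)"
  obtains c where "c \<in> lin (acomp (quad_alg K V R) 0) (ground_vs K)" "c (aone (quad_alg K V R)) = \<one>"
    "\<forall>b\<in>ael (quad_alg K V R) 0. b = c b \<odot>\<^bsub>acomp (quad_alg K V R) 0\<^esub> aone (quad_alg K V R)"
proof -
  let ?T = "tensor_power K V 0" and ?I = "ideal2 K (tensor_alg K V) R 0" and ?A = "quad_alg K V R"
  have T: "VS ?T" using V by simp
  have I: "SUB ?I ?T" "?I = {\<zero>\<^bsub>?T\<^esub>}"
    by (rule quad_ideal_SUB[OF V R], use ideal2_low[OF tensor_alg_galgebra[OF V], of R 0] R in \<open>simp add: tensor_alg_simps\<close>)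
  have m: "multilin V 0 (ground_vs K) (\<lambda>vs :: 'v list. \<one>)"
    by (auto simp: multilin_def words0)
  note L = tpow_lift[OF V VS_ground m]
  let ?l = "lift K (ground_vs K) (\<lambda>vs :: 'v list. \<one>)"
  note q = quot_induced[OF T I(1) VS_ground L(1)]
  have z: "?l w = \<zero>\<^bsub>ground_vs K\<^esub>" if "w \<in> ?I" for w
    using that lin_zero[OF T VS_ground L(1)] by (simp add: I(2))
  have one: "aone ?A = ?I +>\<^bsub>?T\<^esub> word_tens K V []" "word_tens K V [] \<in> carrier ?T"
    using word_tens_closed[of "[]" V 0] by (auto simp: quad_alg_def galg_quot_simps tensor_alg_simps words0)
  define c where "c = (\<lambda>X. ?l (rep X))"
  have c: "c \<in> lin (acomp ?A 0) (ground_vs K)"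
    unfolding c_def quad_alg_comp using q(1)[OF z] .
  have c1: "c (aone ?A) = \<one>"
    unfolding c_def one(1) using q(2)[OF z one(2)] L(2)[of "[]"] by (simp add: words0)
  have A0: "VS (acomp ?A 0)" "aone ?A \<in> ael ?A 0"
    using galgebraD(1,4)[OF quad_alg_galgebra[OF V R]] by auto
  have l: "(\<lambda>b. c b \<odot>\<^bsub>acomp ?A 0\<^esub> aone ?A) \<in> lin (acomp ?A 0) (acomp ?A 0)"
    by (rule linI) (use A0 lin_closed[OF c] in \<open>auto simp: lin_add[OF c] lin_smult[OF c] VS_distr\<close>)
  have "b = c b \<odot>\<^bsub>acomp ?A 0\<^esub> aone ?A" if b: "b \<in> ael ?A 0" for b
  proof -
    obtain t where t: "t \<in> carrier ?T" "b = ?I +>\<^bsub>?T\<^esub> t" using b unfolding quad_alg_comp by (rule quot_cases)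
    have "?I +>\<^bsub>?T\<^esub> t = c (?I +>\<^bsub>?T\<^esub> t) \<odot>\<^bsub>acomp ?A 0\<^esub> aone ?A"
      by (rule tpow_lin_eq[OF V A0(1) _ lin_comp[OF _ l] _ t(1)])
         (use lin_coset[OF T I(1)] one c1 A0 in \<open>auto simp: quad_alg_comp words0\<close>)
    then show ?thesis using t(2) by simp
  qed
  with c c1 that show thesis by blast
qed

text \<open>The ideal starts in degree 2, so degree 1 is \<open>V\<close> itself; \<open>b\<close>
  is the inverse of \<open>quad_gen\<close>.\<close>

lemma quad_alg_deg1:
  fixes V :: "('k, 'v) module"
  assumes V: "VS V" and R: "R \<subseteq> carrier (tensor_power K V 2)"
  obtains b where "b \<in> lin (acomp (quad_alg K V R) 1) V" "\<forall>v\<in>carrier V. b (quad_gen K V R v) = v"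
    "\<forall>x\<in>ael (quad_alg K V R) 1. quad_gen K V R (b x) = x"
proof -
  let ?T = "tensor_power K V 1" and ?I = "ideal2 K (tensor_alg K V) R 1" and ?A = "quad_alg K V R"
  have T: "VS ?T" using V by simp
  have I: "SUB ?I ?T" "?I = {\<zero>\<^bsub>?T\<^esub>}"
    by (rule quad_ideal_SUB[OF V R], use ideal2_low[OF tensor_alg_galgebra[OF V], of R 1] R in \<open>simp add: tensor_alg_simps\<close>)
  have "us = [] \<and> ws = [] \<and> v \<in> carrier V" if "us @ [v] @ ws \<in> words V 1" for us v ws
    using that by (auto simp: words_def)
  then have m: "multilin V 1 V (\<lambda>vs. vs ! 0)"
    unfolding multilin_def by (fastforce elim: words1_cases)
  note L = tpow_lift[OF V V m]
  let ?l = "lift K V (\<lambda>vs :: 'v list. vs ! 0)"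
  note q = quot_induced[OF T I(1) V L(1)]
  have z: "?l w = \<zero>\<^bsub>V\<^esub>" if "w \<in> ?I" for w
    using that lin_zero[OF T V L(1)] by (simp add: I(2))
  define b where "b = (\<lambda>X. ?l (rep X))"
  have b: "b \<in> lin (acomp ?A 1) V"
    unfolding b_def quad_alg_comp using q(1)[OF z] .
  have w: "word_tens K V [v] \<in> carrier ?T" if "v \<in> carrier V" for v
    using that by (simp add: word_tens_closed words_mem)
  have b1: "b (quad_gen K V R v) = v" if v: "v \<in> carrier V" for v
    unfolding b_def quad_gen_def using q(2)[OF z w[OF v]] L(2)[of "[v]"] v by (simp add: words_mem)
  have A1: "VS (acomp ?A 1)" using galgebraD(1)[OF quad_alg_galgebra[OF V R]] by auto
  have "quad_gen K V R (b x) = x" if x: "x \<in> ael ?A 1" for x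
  proof -
    obtain t where t: "t \<in> carrier ?T" "x = ?I +>\<^bsub>?T\<^esub> t" using x unfolding quad_alg_comp by (rule quot_cases)
    have lc: "(\<lambda>t. ?I +>\<^bsub>?T\<^esub> t) \<in> lin ?T (acomp ?A 1)" using lin_coset[OF T I(1)] by (simp add: quad_alg_comp)
    have "quad_gen K V R (b (?I +>\<^bsub>?T\<^esub> t)) = ?I +>\<^bsub>?T\<^esub> t"
    proof (rule tpow_lin_eq[OF V A1 lin_comp[OF lin_comp[OF lc b] quad_gen_lin[OF V R]] lc _ t(1)])
      fix vs assume "vs \<in> words V 1"
      then obtain v where v: "vs = [v]" "v \<in> carrier V" by (rule words1_cases)
      show "quad_gen K V R (b (?I +>\<^bsub>?T\<^esub> word_tens K V vs)) = ?I +>\<^bsub>?T\<^esub> word_tens K V vs"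
        using b1[OF v(2)] by (simp add: v(1) quad_gen_def)
    qed
    then show ?thesis using t(2) by simp
  qed
  with b b1 that show thesis by blast
qed

end

text \<open>All data are premises because the lemma is applied twice: to the algebra with the
  generators of a module, and to the dual algebra with the dual of those generators.\<close>

lemma embed1_lin:
  fixes K :: "'k ring" and V :: "('k, 'v) module" and U :: "('k, 'u) module"
  assumes K: "kfield K" and V: "vectorspace K V" and R: "R \<subseteq> carrier (tensor_power K V 2)" and U: "vectorspace K U"
  shows "embed1 K V R U \<in> LinearCombinations.module_hom K (tensor K U V) (tensor K U (acomp (quad_alg K V R) 1))"
    and "u \<in> carrier U \<Longrightarrow> v \<in> carrier V \<Longrightarrow>
      embed1 K V R U (tens K U V u v) = tens K U (acomp (quad_alg K V R) 1) u (quad_gen K V R v)"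
proof -
  interpret kfield K by fact
  note A = quad_alg_galgebra[OF V R]
  note A1 = galgebraD(1)[OF A, of 1]
  have b: "bilin U V (tensor K U (acomp (quad_alg K V R) 1)) (\<lambda>u v. tens K U (acomp (quad_alg K V R) 1) u (quad_gen K V R v))"
    using lin_comp[OF quad_gen_lin[OF V R] bilin_r[OF tens_bilin[OF U A1]]]
      bilin_l[OF tens_bilin[OF U A1] lin_closed[OF quad_gen_lin[OF V R]]]
    by (intro bilinI)
  note l = tensor_lift[OF U V VS_tensor[OF U A1] b]
  show "embed1 K V R U \<in> lin (tensor K U V) (tensor K U (acomp (quad_alg K V R) 1))"
    using l(1) by (simp add: embed1_def)
  show "u \<in> carrier U \<Longrightarrow> v \<in> carrier V \<Longrightarrow>
      embed1 K V R U (tens K U V u v) = tens K U (acomp (quad_alg K V R) 1) u (quad_gen K V R v)"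
    using l(2) by (simp add: embed1_def)
qed

locale quad_setting = kfield K for K :: "'k ring" (structure) +
  fixes V :: "('k, 'v) module" and R :: "('v list \<Rightarrow> 'k) set set"
  assumes V: "vectorspace K V" and V_fin: "vectorspace.fin_dim K V" and R_sub: "submodule K R (tensor_power K V 2)"
begin

abbreviation "A \<equiv> quad_alg K V R"
abbreviation "V' \<equiv> dual_vs K V"
abbreviation "R' \<equiv> perp K V R"
abbreviation "B \<equiv> quad_dual K V R"
abbreviation "gen \<equiv> quad_gen K V R"
abbreviation "gen' \<equiv> quad_gen K V' R'"
abbreviation "X \<equiv> chosen_basis K V"
abbreviation "y \<equiv> dual_vec K V X"

lemma R: "R \<subseteq> carrier (tensor_power K V 2)"
  using SUB_subset[OF R_sub] by blast

lemma R': "R' \<subseteq> carrier (tensor_power K V' 2)"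
  by (auto simp: perp_def)

lemma V': "VS V'"
  using V by simp

lemma A: "galgebra A"
  using V R by (rule quad_alg_galgebra)

lemma B: "galgebra B"
  unfolding quad_dual_def using V' R' by (rule quad_alg_galgebra)

lemma gen_lin: "gen \<in> lin V (acomp A 1)"
  using V R by (rule quad_gen_lin)

lemma gen'_lin: "gen' \<in> lin V' (acomp B 1)"
  unfolding quad_dual_def using V' R' by (rule quad_gen_lin)

text \<open>The description operator in \<open>dual_vec\<close> is legitimate because a functional
  is determined by its values on a basis; it then agrees with the dual basis obtained from
  separation.\<close>

lemma X_fdb: "fdb V X y"
proof -
  have "\<exists>X. finite X \<and> vectorspace.basis K V X"
    using vectorspace.finite_basis_exists[OF V V_fin] by blast
  then have X: "finite X" "vectorspace.basis K V X"
    unfolding chosen_basis_def by (metis (mono_tags, lifting) someI_ex)+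
  obtain z where z: "fdb V X z" using basis_fdb[OF V X] .
  have eq: "y x = z x" if x: "x \<in> X" for x
    unfolding dual_vec_def
  proof (rule the_equality)
    show "z x \<in> carrier V' \<and> (\<forall>x'\<in>X. z x x' = (if x' = x then \<one> else \<zero>))"
      using fdbD(3,4)[OF z] x by blast
    fix f assume f: "f \<in> carrier V' \<and> (\<forall>x'\<in>X. f x' = (if x' = x then \<one> else \<zero>))"
    show "f = z x"
    proof (rule dual_ext[of _ V])
      fix v assume v: "v \<in> carrier V"
      have "f v = (\<Oplus>\<^bsub>ground_vs K\<^esub>x'\<in>X. z x' v \<odot>\<^bsub>ground_vs K\<^esub> f x')"
        using f by (intro lin_expand[OF V VS_ground z _ v] dual_lin) blast
      also have "\<dots> = (\<Oplus>\<^bsub>ground_vs K\<^esub>x'\<in>X. z x' v \<odot>\<^bsub>ground_vs K\<^esub> z x x')"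
        using f x fdbD[OF z] v by (intro VS_finsum_cong[OF VS_ground]) auto
      also have "\<dots> = z x v"
        using lin_expand[OF V VS_ground z dual_lin[OF fdbD(3)[OF z x]] v] by simp
      finally show "f v = z x v" .
    qed (use f fdbD(3)[OF z x] in auto)
  qed
  have "(\<Oplus>\<^bsub>V\<^esub>x\<in>X. y x v \<odot>\<^bsub>V\<^esub> x) = (\<Oplus>\<^bsub>V\<^esub>x\<in>X. z x v \<odot>\<^bsub>V\<^esub> x)" if "v \<in> carrier V" for v
    using eq fdbD[OF z] V that by (intro VS_finsum_cong[OF V]) auto
  then show ?thesis
    using z eq unfolding fdb_def by (metis (no_types, lifting))
qed

lemma y_closed: "x \<in> X \<Longrightarrow> y x \<in> carrier V'"
  using fdbD(3)[OF X_fdb] .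

text \<open>The classes of products of two basis vectors span. Finite dimension allows the square of
  the Koszul differential to be computed in a basis of this quotient.\<close>

lemma T2_fin: "vectorspace.fin_dim K (quot_vs (tensor_power K V 2) R)"
proof (rule fin_dimI)
  let ?T = "tensor_power K V 2" and ?Q = "quot_vs (tensor_power K V 2) R"
  let ?S = "(\<lambda>(x, x'). R +>\<^bsub>?T\<^esub> word_tens K V [x, x']) ` (X \<times> X)"
  have T: "VS ?T" using V by simp
  note Xd = fdbD[OF X_fdb]
  show Q: "VS ?Q" using T R_sub by simp
  show "finite ?S" using Xd by simp
  have w: "word_tens K V [u, v] \<in> carrier ?T" if "u \<in> carrier V" "v \<in> carrier V" for u v
    using that by (simp add: word_tens_closed words_mem)
  show S: "?S \<subseteq> carrier ?Q" using Xd(2) w by (auto intro!: coset_closed)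
  note sS = spn_SUB[OF Q S]
  show "carrier ?Q \<subseteq> spn ?Q ?S"
  proof
    fix q assume "q \<in> carrier ?Q"
    then obtain t where t: "t \<in> carrier ?T" "q = R +>\<^bsub>?T\<^esub> t" by (rule quot_cases)
    have "t \<in> {t \<in> carrier ?T. R +>\<^bsub>?T\<^esub> t \<in> spn ?Q ?S}"
    proof (rule tpow_SUB_all[OF V SUB_preimage[OF T Q lin_coset[OF T R_sub] sS] _ t(1)])
      fix vs assume "vs \<in> words V 2"
      then obtain u v where uv: "vs = [u, v]" "u \<in> carrier V" "v \<in> carrier V" by (rule words2_cases)
      have "word_tens K V [u, v] = (\<Oplus>\<^bsub>?T\<^esub>c\<in>X. \<Oplus>\<^bsub>?T\<^esub>x\<in>X. (y x u \<otimes> y c v) \<odot>\<^bsub>?T\<^esub> word_tens K V [x, c])"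
        by (rule bilin_expand[OF V V T X_fdb X_fdb word_tens2_bilin[OF V] uv(2,3)])
      also have "\<dots> \<in> {t \<in> carrier ?T. R +>\<^bsub>?T\<^esub> t \<in> spn ?Q ?S}" (is "_ \<in> ?P")
      proof -
        have P: "SUB ?P ?T" by (rule SUB_preimage[OF T Q lin_coset[OF T R_sub] sS])
        have "word_tens K V [x, c] \<in> ?P" if "x \<in> X" "c \<in> X" for x c
          using spn_incl[OF Q S, of "R +>\<^bsub>?T\<^esub> word_tens K V [x, c]"] that w Xd(2) by auto
        then show ?thesis
          using Xd uv by (intro SUB_finsum[OF T P] SUB_smult[OF P]) auto
      qed
      finally show "word_tens K V vs \<in> ?P" by (simp add: uv(1))
    qed
    then show "q \<in> spn ?Q ?S" using t(2) by simp
  qed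
qed

end

section \<open>The Koszul complex of one quadratic module\<close>

locale quad_mod = quad_setting K V R for K :: "'k ring" (structure) and V :: "('k, 'v) module" and R +
  fixes M :: "('k, ('v list \<Rightarrow> 'k) set set, 'm) gmod"
  assumes M_quad: "quadratic_module K V R M"
begin

abbreviation "M0 \<equiv> mcomp M 0"
abbreviation "U \<equiv> dual_vs K M0"
abbreviation "F \<equiv> gmod_free K U B"
abbreviation "D \<equiv> mod_dual K V R M"
abbreviation "S \<equiv> embed1 K V' R' U ` mod_perp K V R M"
abbreviation "C n \<equiv> kos_coeff K V R M n"
abbreviation "kos n \<equiv> koszul K V R M n"
abbreviation "dk n \<equiv> koszul_d K V R M n"
abbreviation "cact n \<equiv> kos_coeff_act K V R M n"

lemma M: "gm A M" and M_neg: "n < 0 \<Longrightarrow> el M n = {\<zero>\<^bsub>mcomp M n\<^esub>}"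
  and M0_fin: "vectorspace.fin_dim K M0"
  and M_surj: "act_map K M n ` el (gmod_free K M0 A) n = el M n"
  using M_quad by (auto simp: quadratic_module_def Let_def)

lemma M0: "VS M0"
  using M by (rule gmD(1))

lemma U: "VS U"
  using M0 by simp

lemma F: "gm B F"
  using B U by (rule gm_free)

lemma embed'_lin: "embed1 K V' R' U \<in> lin (tensor K U V') (tensor K U (acomp B 1))"
  and embed'_tens: "u \<in> carrier U \<Longrightarrow> v \<in> carrier V' \<Longrightarrow>
    embed1 K V' R' U (tens K U V' u v) = tens K U (acomp B 1) u (gen' v)"
  using embed1_lin[OF kfield_axioms V' R' U] by (auto simp: quad_dual_def)

lemma embed_lin: "embed1 K V R M0 \<in> lin (tensor K M0 V) (tensor K M0 (acomp A 1))"
  and embed_tens: "u \<in> carrier M0 \<Longrightarrow> v \<in> carrier V \<Longrightarrow>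
    embed1 K V R M0 (tens K M0 V u v) = tens K M0 (acomp A 1) u (gen v)"
  using embed1_lin[OF kfield_axioms V R M0] by auto

lemma S: "S \<subseteq> el F 1"
  using lin_closed[OF embed'_lin] by (auto simp: mod_perp_def free_simps1)

lemma G: "gsub B F (gmod_gen K B F 1 S)"
  using F B S by (rule gsub_gen)

lemma D_eq: "D = gmod_quot F (gmod_gen K B F 1 S)"
  by (simp add: mod_dual_def Let_def)

lemma D: "gm B D"
  unfolding D_eq using F B G by (rule gm_quot)

lemma D_VS: "VS (mcomp D n)"
  using D by (rule gmD(1))

lemma C_VS: "VS (C n)"
  unfolding kos_coeff_def using D_VS by simp

lemma kos_eq: "kos n = gmod_shift (gmod_free K (C n) A) (- int n)"
  by (simp add: koszul_def)

lemma kos_gm: "gm A (kos n)"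
  unfolding kos_eq using gm_free[OF A C_VS] by (rule gm_shift)

lemma A_VS: "VS (acomp A n)"
  using A by (rule galgebraD(1))

lemma kos_comp: "mcomp (kos n) i = tensor K (C n) (acomp A (i - int n))"
  by (simp add: kos_eq free_simps1)

lemma C_Suc: "C (Suc n) = dual_vs K (mcomp D (int n + 1))"
  by (simp add: kos_coeff_def add.commute)

lemma cact_apply:
  assumes "w \<in> el D (int n)"
  shows "cact n z f w = f (mact D (int n) 1 w (gen' z))"
  using assms by (simp add: kos_coeff_act_def)

lemma gen'_act_closed:
  "z \<in> carrier V' \<Longrightarrow> w \<in> el D m \<Longrightarrow> mact D m 1 w (gen' z) \<in> el D (m + 1)"
  by (rule gm_act_closed[OF D _ lin_closed[OF gen'_lin]])

lemma cact_lin: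
  assumes z: "z \<in> carrier V'"
  shows "cact n z \<in> lin (C (Suc n)) (C n)"
proof (rule linI)
  note gz = lin_closed[OF gen'_lin z]
  note L = bilin_l[OF gmD(2)[OF D] gz]
  note cl = gen'_act_closed[OF z]
  fix f assume "f \<in> carrier (C (Suc n))"
  then have f: "f \<in> carrier (dual_vs K (mcomp D (int n + 1)))" by (simp add: C_Suc)
  show "cact n z f \<in> carrier (C n)"
    unfolding kos_coeff_def kos_coeff_act_def
    by (rule dual_restrict[OF D_VS lin_comp[OF L dual_lin[OF f]]])
  show "cact n z (f \<oplus>\<^bsub>C (Suc n)\<^esub> g) = cact n z f \<oplus>\<^bsub>C n\<^esub> cact n z g" for g
    unfolding C_Suc by (auto simp: kos_coeff_act_def kos_coeff_def dual_ops cl)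
  show "cact n z (c \<odot>\<^bsub>C (Suc n)\<^esub> f) = c \<odot>\<^bsub>C n\<^esub> cact n z f" for c
    unfolding C_Suc by (auto simp: kos_coeff_act_def kos_coeff_def dual_ops cl)
qed

text \<open>The element \<open>d(f \<otimes> 1)\<close>.\<close>

definition dgen :: "nat \<Rightarrow> _ \<Rightarrow> _" where
  "dgen n f = (\<Oplus>\<^bsub>tensor K (C n) (acomp A 1)\<^esub>x\<in>X. tens K (C n) (acomp A 1) (cact n (y x) f) (gen x))"

lemma gen_closed: "x \<in> X \<Longrightarrow> gen x \<in> ael A 1"
  using lin_closed[OF gen_lin fdbD(2)[OF X_fdb]] .

lemma dgen_lin: "dgen n \<in> lin (C (Suc n)) (tensor K (C n) (acomp A 1))"
  unfolding dgen_def[abs_def]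
proof (rule lin_sum[OF C_VS VS_tensor[OF C_VS A_VS] fdbD(1)[OF X_fdb]])
  fix x assume x: "x \<in> X"
  show "(\<lambda>f. tens K (C n) (acomp A 1) (cact n (y x) f) (gen x)) \<in> lin (C (Suc n)) (tensor K (C n) (acomp A 1))"
    by (rule lin_comp[OF cact_lin[OF y_closed[OF x]] bilin_l[OF tens_bilin[OF C_VS A_VS] gen_closed[OF x]]])
qed

lemma dk_tens: "f \<in> carrier (C (Suc n)) \<Longrightarrow> a \<in> ael A (i - int (Suc n)) \<Longrightarrow>
    dk n i (tens K (C (Suc n)) (acomp A (i - int (Suc n))) f a)
      = (\<Oplus>\<^bsub>tensor K (C n) (acomp A (i - int n))\<^esub>x\<in>X. tens K (C n) (acomp A (i - int n)) (cact n (y x) f) (amult A 1 (i - int (Suc n)) (gen x) a))"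
  and dk_lin: "dk n i \<in> lin (mcomp (kos (Suc n)) i) (mcomp (kos n) i)"
proof -
  let ?j = "i - int (Suc n)"
  let ?T = "tensor K (C n) (acomp A (1 + ?j))"
  have T: "VS ?T" using C_VS A_VS by simp
  have b: "bilin (C (Suc n)) (acomp A ?j) ?T (\<lambda>f a. \<Oplus>\<^bsub>?T\<^esub>x\<in>X. tens K (C n) (acomp A (1 + ?j)) (cact n (y x) f) (amult A 1 ?j (gen x) a))"
  proof (rule bilinI)
    fix f assume f: "f \<in> carrier (C (Suc n))"
    show "(\<lambda>a. \<Oplus>\<^bsub>?T\<^esub>x\<in>X. tens K (C n) (acomp A (1 + ?j)) (cact n (y x) f) (amult A 1 ?j (gen x) a)) \<in> lin (acomp A ?j) ?T"
    proof (rule lin_sum[OF A_VS T fdbD(1)[OF X_fdb]])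
      fix x assume x: "x \<in> X"
      show "(\<lambda>a. tens K (C n) (acomp A (1 + ?j)) (cact n (y x) f) (amult A 1 ?j (gen x) a)) \<in> lin (acomp A ?j) ?T"
        by (rule lin_comp[OF bilin_r[OF galgebraD(2)[OF A] gen_closed[OF x]] bilin_r[OF tens_bilin[OF C_VS A_VS] lin_closed[OF cact_lin[OF y_closed[OF x]] f]]])
    qed
  next
    fix a assume a: "a \<in> ael A ?j"
    show "(\<lambda>f. \<Oplus>\<^bsub>?T\<^esub>x\<in>X. tens K (C n) (acomp A (1 + ?j)) (cact n (y x) f) (amult A 1 ?j (gen x) a)) \<in> lin (C (Suc n)) ?T"
    proof (rule lin_sum[OF C_VS T fdbD(1)[OF X_fdb]])
      fix x assume x: "x \<in> X"
      show "(\<lambda>f. tens K (C n) (acomp A (1 + ?j)) (cact n (y x) f) (amult A 1 ?j (gen x) a)) \<in> lin (C (Suc n)) ?T"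
        by (rule lin_comp[OF cact_lin[OF y_closed[OF x]] bilin_l[OF tens_bilin[OF C_VS A_VS] galg_mult_closed[OF A gen_closed[OF x] a]]])
    qed
  qed
  \<comment> \<open>\<open>?j\<close> is the degree of the algebra factor at the source. The
    differential raises it by one while the homological index drops by one, so the internal degree
    \<open>i\<close> is kept.\<close>
  have e: "1 + ?j = i - int n" and e': "i - int n - 1 = ?j" by auto
  note l = tensor_lift[OF C_VS A_VS T b, unfolded e]
  have d: "dk n i = lift K (tensor K (C n) (acomp A (i - int n)))
     (\<lambda>(f, a). \<Oplus>\<^bsub>tensor K (C n) (acomp A (i - int n))\<^esub>x\<in>X. tens K (C n) (acomp A (i - int n)) (cact n (y x) f) (amult A 1 ?j (gen x) a))"
    unfolding koszul_d_def Let_def e' ..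
  show "dk n i (tens K (C (Suc n)) (acomp A ?j) f a)
      = (\<Oplus>\<^bsub>tensor K (C n) (acomp A (i - int n))\<^esub>x\<in>X. tens K (C n) (acomp A (i - int n)) (cact n (y x) f) (amult A 1 ?j (gen x) a))"
    if "f \<in> carrier (C (Suc n))" "a \<in> ael A ?j"
    unfolding d using l(2)[OF that] .
  show "dk n i \<in> lin (mcomp (kos (Suc n)) i) (mcomp (kos n) i)"
    unfolding d kos_comp using l(1) .
qed

text \<open>The differential is determined by its values on the elements
  \<open>f \<otimes> 1\<close>, which sit in internal degree \<open>Suc n\<close>.\<close>

lemma dk_tens_dgen:
  assumes f: "f \<in> carrier (C (Suc n))" and a: "a \<in> ael A (i - int (Suc n))"
  shows "dk n i (tens K (C (Suc n)) (acomp A (i - int (Suc n))) f a) = mact (kos n) (int (Suc n)) (i - int (Suc n)) (dgen n f) a"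
proof -
  let ?j = "i - int (Suc n)"
  have T: "VS (tensor K (C n) (acomp A m))" for m using C_VS A_VS by simp
  have e: "1 + ?j = i - int n" by auto
  have c: "tens K (C n) (acomp A 1) (cact n (y x) f) (gen x) \<in> carrier (tensor K (C n) (acomp A 1))" if x: "x \<in> X" for x
    using lin_closed[OF cact_lin[OF y_closed[OF x]] f] gen_closed[OF x] by simp
  note act = free_act[where m = 1 and U = "C n", OF A C_VS a, unfolded e]
  have "mact (kos n) (int (Suc n)) ?j (dgen n f) a = mact (gmod_free K (C n) A) 1 ?j (dgen n f) a"
    by (simp add: kos_eq)
  also have "\<dots> = (\<Oplus>\<^bsub>tensor K (C n) (acomp A (i - int n))\<^esub>x\<in>X. mact (gmod_free K (C n) A) 1 ?j (tens K (C n) (acomp A 1) (cact n (y x) f) (gen x)) a)"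
    unfolding dgen_def by (rule lin_finsum[OF T T act(1) fdbD(1)[OF X_fdb] c])
  also have "\<dots> = (\<Oplus>\<^bsub>tensor K (C n) (acomp A (i - int n))\<^esub>x\<in>X. tens K (C n) (acomp A (i - int n)) (cact n (y x) f) (amult A 1 ?j (gen x) a))"
  proof (rule VS_finsum_cong[OF T refl])
    fix x assume x: "x \<in> X"
    show "mact (gmod_free K (C n) A) 1 ?j (tens K (C n) (acomp A 1) (cact n (y x) f) (gen x)) a = tens K (C n) (acomp A (i - int n)) (cact n (y x) f) (amult A 1 ?j (gen x) a)"
      by (rule act(2)[OF lin_closed[OF cact_lin[OF y_closed[OF x]] f] gen_closed[OF x]])
    show "tens K (C n) (acomp A (i - int n)) (cact n (y x) f) (amult A 1 ?j (gen x) a) \<in> carrier (tensor K (C n) (acomp A (i - int n)))"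
      using lin_closed[OF cact_lin[OF y_closed[OF x]] f] galg_mult_closed[OF A gen_closed[OF x] a] by (simp add: e)
  qed
  also have "\<dots> = dk n i (tens K (C (Suc n)) (acomp A ?j) f a)"
    using dk_tens(1)[OF f a] by simp
  finally show ?thesis ..
qed

lemma dgen_lin': "dgen n \<in> lin (C (Suc n)) (mcomp (kos n) (int (Suc n)))"
proof -
  have "int (Suc n) - int n = 1" by simp
  then show ?thesis unfolding kos_comp using dgen_lin by simp
qed

text \<open>Compatibility with the action is not checked directly: the differential is identified
  with the homomorphism that \<open>free_hom\<close> attaches to \<open>dgen\<close>.\<close>

lemma dk_hm: "dk n \<in> hm A (kos (Suc n)) (kos n)"
proof -
  define l where "l = (\<lambda>i. lift K (mcomp (kos n) i) (\<lambda>(f, a). mact (kos n) (- (- int (Suc n))) (i + - int (Suc n)) (dgen n f) a))"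
  have t: "dgen n \<in> lin (C (Suc n)) (mcomp (kos n) (- (- int (Suc n))))" using dgen_lin' by (simp del: of_nat_Suc)
  have l: "l \<in> hm A (kos (Suc n)) (kos n)"
    unfolding l_def kos_eq[of "Suc n"] by (rule free_hom(1)[OF A C_VS kos_gm t])
  have lt: "l i (tens K (C (Suc n)) (acomp A (i + - int (Suc n))) f a) = mact (kos n) (- (- int (Suc n))) (i + - int (Suc n)) (dgen n f) a"
    if "f \<in> carrier (C (Suc n))" "a \<in> ael A (i + - int (Suc n))" for i f a
    unfolding l_def by (rule free_hom(2)[OF A C_VS kos_gm t that])
  have eq: "dk n i x = l i x" if x: "x \<in> el (kos (Suc n)) i" for i x
  proof (rule tensor_lin_eq[OF C_VS A_VS gmD(1)[OF kos_gm] dk_lin[of n, unfolded kos_comp[of "Suc n"]] hm_lin[OF l, unfolded kos_comp[of "Suc n"]]])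
    show "x \<in> carrier (tensor K (C (Suc n)) (acomp A (i - int (Suc n))))" using x by (simp only: kos_comp)
    fix f a assume f: "f \<in> carrier (C (Suc n))" and a: "a \<in> ael A (i - int (Suc n))"
    then show "dk n i (tens K (C (Suc n)) (acomp A (i - int (Suc n))) f a) = l i (tens K (C (Suc n)) (acomp A (i - int (Suc n))) f a)"
      using dk_tens_dgen[OF f a] lt[OF f, of a i] by (simp only: add_uminus_conv_diff group_add_class.minus_minus)
  qed
  show ?thesis
  proof (rule hmI)
    fix m k x a assume x: "x \<in> el (kos (Suc n)) m" and a: "a \<in> ael A k"
    show "dk n (m + k) (mact (kos (Suc n)) m k x a) = mact (kos n) m k (dk n m x) a"
      using hm_act[OF l x a] eq[OF x] eq[OF gm_act_closed[OF kos_gm x a]] by simp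
  next
    show "dk n i \<in> lin (mcomp (kos (Suc n)) i) (mcomp (kos n) i)" for i by (rule dk_lin)
  qed
qed

text \<open>Since \<open>d\<^sup>2\<close> pairs \<open>A\<^sub>2 = V \<otimes> V / R\<close> with \<open>y\<^sub>i y\<^sub>j \<in> A\<^sup>!\<^sub>2 = V\<^sup>* \<otimes> V\<^sup>* / R\<^sup>\<bottom>\<close>, it is
  computed in a basis of \<open>V \<otimes> V / R\<close>, whose dual vectors lie in \<open>R\<^sup>\<bottom>\<close>.\<close>

lemma dk_dk_gen:
  assumes f: "f \<in> carrier (C (Suc (Suc n)))"
  shows "dk n (int (Suc (Suc n))) (dgen (Suc n) f) = \<zero>\<^bsub>mcomp (kos n) (int (Suc (Suc n)))\<^esub>"
proof -
  let ?T = "tensor_power K V 2" and ?T' = "tensor_power K V' 2" and ?i = "int (Suc (Suc n))"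
  let ?Q = "quot_vs ?T R" and ?P = "tensor K (C n) (acomp A 2)" and ?I = "ideal2 K (tensor_alg K V) R 2"
  let ?k = "ground_vs K"
  have ei: "?i - int (Suc n) = 1" "?i - int n = 2" by auto
  have T: "VS ?T" "VS ?T'" "VS ?Q" "VS ?P" using V V' R_sub C_VS A_VS by auto
  have wX: "word_tens K V [x, x'] \<in> carrier ?T" if "x \<in> X" "x' \<in> X" for x x'
    using that fdbD(2)[OF X_fdb] by (simp add: word_tens_closed words_mem)
  have wY: "word_tens K V' [y x, y x'] \<in> carrier ?T'" if "x \<in> X" "x' \<in> X" for x x'
    using that y_closed by (simp add: word_tens_closed words_mem)
  note finX = fdbD(1)[OF X_fdb]
  let ?G = "\<lambda>x x'. cact n (y x') (cact (Suc n) (y x) f)"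
  have Gc: "?G x x' \<in> carrier (C n)" if "x \<in> X" "x' \<in> X" for x x'
    using lin_closed[OF cact_lin[OF y_closed[OF that(2)]] lin_closed[OF cact_lin[OF y_closed[OF that(1)]] f]] .
  \<comment> \<open>A basis \<open>Z\<close> of \<open>V \<otimes> V / R\<close> with coordinates
    \<open>z\<close>. All products of two generators are expanded in it, so that only the
    coefficient of each basis vector has to vanish.\<close>
  obtain Z z where Z: "fdb ?Q Z z" using fin_dim_fdb[OF T(3) T2_fin] .
  note Zd = fdbD[OF Z]
  have I: "SUB ?I ?T" using V R by (rule quad_ideal_SUB)
  have A2: "acomp A 2 = quot_vs ?T ?I" by (rule quad_alg_comp)
  have lc: "(\<lambda>e. ?I +>\<^bsub>?T\<^esub> e) \<in> lin ?T (acomp A 2)" unfolding A2 by (rule lin_coset[OF T(1) I])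
  have RI: "?I +>\<^bsub>?T\<^esub> r = \<zero>\<^bsub>acomp A 2\<^esub>" if "r \<in> R" for r
    unfolding A2 quot_kernel[OF T(1) I subsetD[OF R that]]
    using ideal2_incl[OF tensor_alg_galgebra[OF V] _ that] R by (simp add: tensor_alg_simps)
  have qi1: "(\<lambda>q. ?I +>\<^bsub>?T\<^esub> rep q) \<in> lin ?Q (acomp A 2)"
    by (rule quot_induced(1)[OF T(1) R_sub A_VS lc]) (rule RI)
  have qi2: "?I +>\<^bsub>?T\<^esub> rep (R +>\<^bsub>?T\<^esub> e) = ?I +>\<^bsub>?T\<^esub> e" if "e \<in> carrier ?T" for e
    by (rule quot_induced(2)[OF T(1) R_sub A_VS lc _ that]) (rule RI)
  let ?p = "\<lambda>q. ?I +>\<^bsub>?T\<^esub> rep q"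
  \<comment> \<open>Coordinates of the product with \<open>x'\<close> before \<open>x\<close>: the
    second application of the differential multiplies the algebra factor from the left.\<close>
  define lam where "lam = (\<lambda>k x x'. z k (R +>\<^bsub>?T\<^esub> word_tens K V [x', x]))"
  let ?te = "\<lambda>x x' k. tens K (C n) (acomp A 2) (lam k x x' \<odot>\<^bsub>C n\<^esub> ?G x x') (?p k)"
  have lamc: "lam k x x' \<in> carrier K" if "k \<in> Z" "x \<in> X" "x' \<in> X" for k x x'
    unfolding lam_def using Zd(6)[OF that(1) coset_closed[OF wX[OF that(3,2)]]] .
  have E: "?I +>\<^bsub>?T\<^esub> word_tens K V [x', x] = (\<Oplus>\<^bsub>acomp A 2\<^esub>k\<in>Z. lam k x x' \<odot>\<^bsub>acomp A 2\<^esub> ?p k)"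
    if "x \<in> X" "x' \<in> X" for x x'
    using lin_expand[OF T(3) A_VS Z qi1 coset_closed[OF wX[OF that(2,1)]]] qi2[OF wX[OF that(2,1)]]
    by (simp add: lam_def)
  have pk: "?p k \<in> ael A 2" if "k \<in> Z" for k
    using lin_closed[OF qi1 Zd(2)[OF that]] .
  note tb = tens_bilin[OF C_VS A_VS]
  have inner: "tens K (C n) (acomp A 2) (?G x x') (amult A 1 1 (gen x') (gen x))
      = (\<Oplus>\<^bsub>?P\<^esub>k\<in>Z. ?te x x' k)" if x: "x \<in> X" "x' \<in> X" for x x'
  proof -
    have "tens K (C n) (acomp A 2) (?G x x') (amult A 1 1 (gen x') (gen x))
      = tens K (C n) (acomp A 2) (?G x x') (\<Oplus>\<^bsub>acomp A 2\<^esub>k\<in>Z. lam k x x' \<odot>\<^bsub>acomp A 2\<^esub> ?p k)"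
      using quad_gen_mult[OF V R fdbD(2)[OF X_fdb x(2)] fdbD(2)[OF X_fdb x(1)]] E[OF x] by simp
    also have "\<dots> = (\<Oplus>\<^bsub>?P\<^esub>k\<in>Z. tens K (C n) (acomp A 2) (?G x x') (lam k x x' \<odot>\<^bsub>acomp A 2\<^esub> ?p k))"
      by (rule lin_finsum[OF A_VS T(4) bilin_r[OF tb Gc[OF x]] Zd(1)]) (use lamc x pk A_VS in auto)
    also have "\<dots> = (\<Oplus>\<^bsub>?P\<^esub>k\<in>Z. ?te x x' k)"
    proof (rule VS_finsum_cong[OF T(4) refl])
      fix k assume k: "k \<in> Z"
      note c = lamc[OF k x] Gc[OF x] pk[OF k]
      show "tens K (C n) (acomp A 2) (?G x x') (lam k x x' \<odot>\<^bsub>acomp A 2\<^esub> ?p k) = ?te x x' k"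
        unfolding bilin_adds(3,4)[OF tb c] ..
      show "?te x x' k \<in> carrier ?P"
        using c C_VS by (intro tens_closed VS_closed(5)) auto
    qed
    finally show ?thesis .
  qed
  have tc: "?te x x' k \<in> carrier ?P" if "k \<in> Z" "x \<in> X" "x' \<in> X" for k x x'
    using that lamc pk Gc C_VS by simp
  \<comment> \<open>For fixed \<open>k\<close>, the value of the coefficient at \<open>w\<close> is
    \<open>f\<close> applied to \<open>w\<close> times the class of \<open>?rho\<close>, and this
    class is zero.\<close>
  have S0: "(\<Oplus>\<^bsub>C n\<^esub>x\<in>X. \<Oplus>\<^bsub>C n\<^esub>x'\<in>X. lam k x x' \<odot>\<^bsub>C n\<^esub> ?G x x') = \<zero>\<^bsub>C n\<^esub>" (is "?S = _") if k: "k \<in> Z" for k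
  proof (rule dual_ext[of _ "mcomp D (int n)"])
    let ?rho = "\<Oplus>\<^bsub>?T'\<^esub>x\<in>X. \<Oplus>\<^bsub>?T'\<^esub>x'\<in>X. lam k x x' \<odot>\<^bsub>?T'\<^esub> word_tens K V' [y x', y x]"
    have kc: "lam k x x' \<odot>\<^bsub>C n\<^esub> ?G x x' \<in> carrier (C n)" if "x \<in> X" "x' \<in> X" for x x'
      using C_VS lamc[OF k that] Gc[OF that] by simp
    have kcw: "lam k x x' \<odot>\<^bsub>?T'\<^esub> word_tens K V' [y x', y x] \<in> carrier ?T'" if "x \<in> X" "x' \<in> X" for x x'
      using T lamc[OF k that] wY[OF that(2,1)] by simp
    show "?S \<in> carrier (dual_vs K (mcomp D (int n)))" "\<zero>\<^bsub>C n\<^esub> \<in> carrier (dual_vs K (mcomp D (int n)))"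
      using C_VS kc unfolding kos_coeff_def[symmetric] by (auto intro!: VS_finsum_closed[OF C_VS])
    have rho_c: "?rho \<in> carrier ?T'" using T kcw by (auto intro!: VS_finsum_closed[OF T(2)])
    have zl: "z k \<in> lin ?Q ?k" by (rule dual_lin[OF Zd(3)[OF k]])
    have zTl: "(\<lambda>e. z k (R +>\<^bsub>?T\<^esub> e)) \<in> lin ?T ?k" by (rule lin_comp[OF lin_coset[OF T(1) R_sub] zl])
    have nested: "h (\<Oplus>\<^bsub>Y\<^esub>x\<in>X. \<Oplus>\<^bsub>Y\<^esub>x'\<in>X. lam k x x' \<odot>\<^bsub>Y\<^esub> w x x') = (\<Oplus>\<^bsub>?k\<^esub>x\<in>X. \<Oplus>\<^bsub>?k\<^esub>x'\<in>X. lam k x x' \<otimes> h (w x x'))"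
      if Y: "VS Y" and h: "h \<in> lin Y ?k" and w: "\<And>x x'. x \<in> X \<Longrightarrow> x' \<in> X \<Longrightarrow> w x x' \<in> carrier Y" for h w and Y :: "('k, 'z) module"
    proof -
      have hw: "h (w x x') \<in> carrier K" if "x \<in> X" "x' \<in> X" for x x' using lin_closed[OF h w[OF that]] by simp
      have lw: "lam k x x' \<odot>\<^bsub>Y\<^esub> w x x' \<in> carrier Y" if "x \<in> X" "x' \<in> X" for x x' using Y lamc[OF k that] w[OF that] by simp
      have "h (\<Oplus>\<^bsub>Y\<^esub>x\<in>X. \<Oplus>\<^bsub>Y\<^esub>x'\<in>X. lam k x x' \<odot>\<^bsub>Y\<^esub> w x x') = (\<Oplus>\<^bsub>?k\<^esub>x\<in>X. h (\<Oplus>\<^bsub>Y\<^esub>x'\<in>X. lam k x x' \<odot>\<^bsub>Y\<^esub> w x x'))"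
        by (rule lin_finsum[OF Y VS_ground h finX VS_finsum_closed[OF Y lw]])
      also have "\<dots> = (\<Oplus>\<^bsub>?k\<^esub>x\<in>X. \<Oplus>\<^bsub>?k\<^esub>x'\<in>X. lam k x x' \<otimes> h (w x x'))"
      proof (rule VS_finsum_cong[OF VS_ground refl])
        fix x assume x: "x \<in> X"
        show "(\<Oplus>\<^bsub>?k\<^esub>x'\<in>X. lam k x x' \<otimes> h (w x x')) \<in> carrier ?k"
          by (rule VS_finsum_closed[OF VS_ground]) (use lamc[OF k x] hw[OF x] in simp)
        have "h (\<Oplus>\<^bsub>Y\<^esub>x'\<in>X. lam k x x' \<odot>\<^bsub>Y\<^esub> w x x') = (\<Oplus>\<^bsub>?k\<^esub>x'\<in>X. h (lam k x x' \<odot>\<^bsub>Y\<^esub> w x x'))"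
          by (rule lin_finsum[OF Y VS_ground h finX lw[OF x]])
        also have "\<dots> = (\<Oplus>\<^bsub>?k\<^esub>x'\<in>X. lam k x x' \<otimes> h (w x x'))"
          by (rule VS_finsum_cong[OF VS_ground refl]) (use lamc[OF k x] w[OF x] hw[OF x] lin_smult[OF h] in auto)
        finally show "h (\<Oplus>\<^bsub>Y\<^esub>x'\<in>X. lam k x x' \<odot>\<^bsub>Y\<^esub> w x x') = (\<Oplus>\<^bsub>?k\<^esub>x'\<in>X. lam k x x' \<otimes> h (w x x'))" .
      qed
      finally show ?thesis .
    qed
    \<comment> \<open>The tensor \<open>?rho\<close> represents the functional \<open>z k\<close>
      pulled back to \<open>V \<otimes> V\<close>. It factors through the quotient by
      \<open>R\<close>, so \<open>?rho\<close> is orthogonal to \<open>R\<close>.\<close>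
    have "pairing2 K ?rho r = \<zero>" if r: "r \<in> R" for r
    proof -
      have rT: "r \<in> carrier ?T" using R r by blast
      have pY: "pairing2 K (word_tens K V' [y x', y x]) \<in> lin ?T ?k" if "x \<in> X" "x' \<in> X" for x x'
        by (rule pairing2_props(2)[OF V y_closed[OF that(2)] y_closed[OF that(1)]])
      have sl: "(\<lambda>r. \<Oplus>\<^bsub>?k\<^esub>x\<in>X. \<Oplus>\<^bsub>?k\<^esub>x'\<in>X. lam k x x' \<otimes> pairing2 K (word_tens K V' [y x', y x]) r) \<in> lin ?T ?k"
        using lin_scale[OF T(1) VS_ground pY lamc[OF k]] by (intro lin_sum[OF T(1) VS_ground finX]) simp
      have "pairing2 K ?rho r = (\<Oplus>\<^bsub>?k\<^esub>x\<in>X. \<Oplus>\<^bsub>?k\<^esub>x'\<in>X. lam k x x' \<otimes> pairing2 K (word_tens K V' [y x', y x]) r)"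
        by (rule nested[OF T(2) pairing2_props(1)[OF V rT] wY])
      also have "\<dots> = z k (R +>\<^bsub>?T\<^esub> r)"
      proof (rule tpow_lin_eq[OF V VS_ground sl zTl _ rT])
        fix vs assume "vs \<in> words V 2"
        then obtain u v where uv: "vs = [u, v]" "u \<in> carrier V" "v \<in> carrier V" by (rule words2_cases)
        have b: "bilin V V ?k (\<lambda>u v. z k (R +>\<^bsub>?T\<^esub> word_tens K V [u, v]))"
          using lin_comp[OF bilin_r[OF word_tens2_bilin[OF V]] zTl] lin_comp[OF bilin_l[OF word_tens2_bilin[OF V]] zTl]
          by (intro bilinI)
        have yc: "y x u \<in> carrier K" "y x v \<in> carrier K" if "x \<in> X" for x using fdbD(6)[OF X_fdb that] uv by auto
        have "z k (R +>\<^bsub>?T\<^esub> word_tens K V [u, v]) = (\<Oplus>\<^bsub>?k\<^esub>x\<in>X. \<Oplus>\<^bsub>?k\<^esub>x'\<in>X. (y x' u \<otimes> y x v) \<otimes> lam k x x')"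
          using bilin_expand[OF V V VS_ground X_fdb X_fdb b uv(2,3)] by (simp add: lam_def)
        also have "\<dots> = (\<Oplus>\<^bsub>?k\<^esub>x\<in>X. \<Oplus>\<^bsub>?k\<^esub>x'\<in>X. lam k x x' \<otimes> pairing2 K (word_tens K V' [y x', y x]) (word_tens K V [u, v]))"
          by (intro VS_finsum_cong[OF VS_ground refl] VS_finsum_closed[OF VS_ground])
             (use lamc[OF k] yc pairing2_props(3)[OF V y_closed y_closed uv(2,3)] in \<open>auto simp: m_comm\<close>)
        finally show "(\<Oplus>\<^bsub>?k\<^esub>x\<in>X. \<Oplus>\<^bsub>?k\<^esub>x'\<in>X. lam k x x' \<otimes> pairing2 K (word_tens K V' [y x', y x]) (word_tens K V vs)) = z k (R +>\<^bsub>?T\<^esub> word_tens K V vs)"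
          by (simp add: uv(1))
      qed
      also have "\<dots> = \<zero>"
        using quot_kernel[OF T(1) R_sub rT] r lin_zero[OF T(3) VS_ground zl] by simp
      finally show ?thesis .
    qed
    then have rho: "?rho \<in> R'" using rho_c by (simp add: perp_def)
    fix w assume w: "w \<in> el D (int n)"
    let ?I' = "ideal2 K (tensor_alg K V') R' 2"
    \<comment> \<open>\<open>?h\<close> is linear in the tensor and vanishes at \<open>?rho\<close>,
      because elements of \<open>R'\<close> are zero in degree 2 of the dual algebra. Expanding
      \<open>?h\<close> at \<open>?rho\<close> gives the sum in question.\<close>
    let ?h = "\<lambda>e. f (mact D (int n) 2 w (?I' +>\<^bsub>?T'\<^esub> e))"
    have I': "SUB ?I' ?T'" using V' R' by (rule quad_ideal_SUB)
    have B2: "acomp B 2 = quot_vs ?T' ?I'" unfolding quad_dual_def by (rule quad_alg_comp)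
    have lc': "(\<lambda>e. ?I' +>\<^bsub>?T'\<^esub> e) \<in> lin ?T' (acomp B 2)" unfolding B2 by (rule lin_coset[OF T(2) I'])
    have f': "f \<in> lin (mcomp D (int n + 2)) ?k"
      using dual_lin[OF f[unfolded kos_coeff_def]] by (simp add: add.commute)
    have hl: "?h \<in> lin ?T' ?k"
      using lin_comp[OF lin_comp[OF lc' bilin_r[OF gmD(2)[OF D] w]] f'] .
    have "?I' +>\<^bsub>?T'\<^esub> ?rho = \<zero>\<^bsub>acomp B 2\<^esub>"
      unfolding B2 quot_kernel[OF T(2) I' rho_c]
      using ideal2_incl[OF tensor_alg_galgebra[OF V'] _ rho] R' by (simp add: tensor_alg_simps)
    then have "?h ?rho = \<zero>"
      using bilin_zero(2)[OF D_VS galgebraD(1)[OF B] D_VS gmD(2)[OF D] w] lin_zero[OF D_VS VS_ground f'] by simp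
    moreover have "?h ?rho = (\<Oplus>\<^bsub>?k\<^esub>x\<in>X. \<Oplus>\<^bsub>?k\<^esub>x'\<in>X. lam k x x' \<otimes> ?h (word_tens K V' [y x', y x]))"
      by (rule nested[OF T(2) hl wY])
    moreover have "?h (word_tens K V' [y x', y x]) = ?G x x' w" if "x \<in> X" "x' \<in> X" for x x'
    proof -
      note g = lin_closed[OF gen'_lin y_closed[OF that(1)]] lin_closed[OF gen'_lin y_closed[OF that(2)]]
      have e: "int (Suc n) = int n + 1" by simp
      have "?G x x' w = cact (Suc n) (y x) f (mact D (int n) 1 w (gen' (y x')))"
        by (rule cact_apply[OF w])
      also have "\<dots> = f (mact D (int n + 1) 1 (mact D (int n) 1 w (gen' (y x'))) (gen' (y x)))"
        using cact_apply[of "mact D (int n) 1 w (gen' (y x'))" "Suc n" "y x" f] gen'_act_closed[OF y_closed[OF that(2)] w]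
        unfolding e by blast
      also have "\<dots> = f (mact D (int n) 2 w (amult B 1 1 (gen' (y x')) (gen' (y x))))"
        using gmD(4)[OF D w g(2,1)] by simp
      also have "amult B 1 1 (gen' (y x')) (gen' (y x)) = ?I' +>\<^bsub>?T'\<^esub> word_tens K V' [y x', y x]"
        unfolding quad_dual_def by (rule quad_gen_mult[OF V' R' y_closed[OF that(2)] y_closed[OF that(1)]])
      finally show ?thesis ..
    qed
    moreover have "?S w = (\<Oplus>\<^bsub>?k\<^esub>x\<in>X. \<Oplus>\<^bsub>?k\<^esub>x'\<in>X. lam k x x' \<otimes> ?G x x' w)"
      by (rule nested[OF C_VS _ Gc]) (use dual_eval[OF w] in \<open>simp add: kos_coeff_def\<close>)
    moreover have "(\<Oplus>\<^bsub>?k\<^esub>x\<in>X. \<Oplus>\<^bsub>?k\<^esub>x'\<in>X. lam k x x' \<otimes> ?h (word_tens K V' [y x', y x])) = (\<Oplus>\<^bsub>?k\<^esub>x\<in>X. \<Oplus>\<^bsub>?k\<^esub>x'\<in>X. lam k x x' \<otimes> ?G x x' w)"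
      if "\<And>x x'. x \<in> X \<Longrightarrow> x' \<in> X \<Longrightarrow> ?h (word_tens K V' [y x', y x]) = ?G x x' w"
      by (intro VS_finsum_cong[OF VS_ground refl] VS_finsum_closed[OF VS_ground])
         (use that lamc[OF k] dual_apply_closed[OF Gc[unfolded kos_coeff_def[of K V R M n]] w] in auto)
    ultimately show "?S w = \<zero>\<^bsub>C n\<^esub> w"
      using w by (simp add: kos_coeff_def dual_ops)
  qed
  have "dk n ?i (dgen (Suc n) f) = (\<Oplus>\<^bsub>?P\<^esub>x\<in>X. dk n ?i (tens K (C (Suc n)) (acomp A 1) (cact (Suc n) (y x) f) (gen x)))"
    unfolding dgen_def
    by (rule lin_finsum[OF VS_tensor[OF C_VS A_VS] T(4) _ finX])
       (use hm_lin[OF dk_hm[of n], of ?i] lin_closed[OF cact_lin[OF y_closed] f] gen_closed in \<open>auto simp: kos_comp ei simp del: of_nat_Suc\<close>)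
  also have "\<dots> = (\<Oplus>\<^bsub>?P\<^esub>x\<in>X. \<Oplus>\<^bsub>?P\<^esub>x'\<in>X. \<Oplus>\<^bsub>?P\<^esub>k\<in>Z. ?te x x' k)"
  proof (rule VS_finsum_cong[OF T(4) refl])
    fix x assume x: "x \<in> X"
    show "(\<Oplus>\<^bsub>?P\<^esub>x'\<in>X. \<Oplus>\<^bsub>?P\<^esub>k\<in>Z. ?te x x' k) \<in> carrier ?P"
      using tc[OF _ x] by (intro VS_finsum_closed[OF T(4)]) auto
    have "dk n ?i (tens K (C (Suc n)) (acomp A 1) (cact (Suc n) (y x) f) (gen x))
      = (\<Oplus>\<^bsub>?P\<^esub>x'\<in>X. tens K (C n) (acomp A 2) (?G x x') (amult A 1 1 (gen x') (gen x)))"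
      using dk_tens(1)[of "cact (Suc n) (y x) f" n "gen x" ?i] lin_closed[OF cact_lin[OF y_closed[OF x]] f] gen_closed[OF x]
      unfolding ei by blast
    also have "\<dots> = (\<Oplus>\<^bsub>?P\<^esub>x'\<in>X. \<Oplus>\<^bsub>?P\<^esub>k\<in>Z. ?te x x' k)"
      by (rule VS_finsum_cong[OF T(4) refl VS_finsum_closed[OF T(4) tc[OF _ x]] inner[OF x]])
    finally show "dk n ?i (tens K (C (Suc n)) (acomp A 1) (cact (Suc n) (y x) f) (gen x))
      = (\<Oplus>\<^bsub>?P\<^esub>x'\<in>X. \<Oplus>\<^bsub>?P\<^esub>k\<in>Z. ?te x x' k)" .
  qed
  \<comment> \<open>The sum over \<open>Z\<close> is moved outside, so that the coefficient of each
    basis vector can be treated separately.\<close>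
  also have "\<dots> = (\<Oplus>\<^bsub>?P\<^esub>x\<in>X. \<Oplus>\<^bsub>?P\<^esub>k\<in>Z. \<Oplus>\<^bsub>?P\<^esub>x'\<in>X. ?te x x' k)"
    using tc by (intro VS_finsum_cong[OF T(4) refl] VS_finsum_swap[OF T(4) finX Zd(1)] VS_finsum_closed[OF T(4)]) auto
  also have "\<dots> = (\<Oplus>\<^bsub>?P\<^esub>k\<in>Z. \<Oplus>\<^bsub>?P\<^esub>x\<in>X. \<Oplus>\<^bsub>?P\<^esub>x'\<in>X. ?te x x' k)"
    using tc by (intro VS_finsum_swap[OF T(4) finX Zd(1)] VS_finsum_closed[OF T(4)]) auto
  also have "\<dots> = \<zero>\<^bsub>?P\<^esub>"
  proof (rule VS_finsum_zero[OF T(4)])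
    fix k assume k: "k \<in> Z"
    have kc: "lam k x x' \<odot>\<^bsub>C n\<^esub> ?G x x' \<in> carrier (C n)" if "x \<in> X" "x' \<in> X" for x x'
      using C_VS lamc[OF k that] Gc[OF that] by simp
    note L = bilin_l[OF tb pk[OF k]]
    have "(\<Oplus>\<^bsub>?P\<^esub>x\<in>X. \<Oplus>\<^bsub>?P\<^esub>x'\<in>X. ?te x x' k)
      = (\<Oplus>\<^bsub>?P\<^esub>x\<in>X. tens K (C n) (acomp A 2) (\<Oplus>\<^bsub>C n\<^esub>x'\<in>X. lam k x x' \<odot>\<^bsub>C n\<^esub> ?G x x') (?p k))"
      by (intro VS_finsum_cong[OF T(4) refl] lin_finsum[symmetric, OF C_VS T(4) L finX] tens_closed VS_finsum_closed[OF C_VS])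
         (use kc pk[OF k] in auto)
    also have "\<dots> = tens K (C n) (acomp A 2) (\<Oplus>\<^bsub>C n\<^esub>x\<in>X. \<Oplus>\<^bsub>C n\<^esub>x'\<in>X. lam k x x' \<odot>\<^bsub>C n\<^esub> ?G x x') (?p k)"
      by (rule lin_finsum[symmetric, OF C_VS T(4) L finX VS_finsum_closed[OF C_VS kc]])
    also have "\<dots> = \<zero>\<^bsub>?P\<^esub>"
      unfolding S0[OF k] by (rule bilin_zero(1)[OF C_VS A_VS T(4) tb pk[OF k]])
    finally show "(\<Oplus>\<^bsub>?P\<^esub>x\<in>X. \<Oplus>\<^bsub>?P\<^esub>x'\<in>X. ?te x x' k) = \<zero>\<^bsub>?P\<^esub>" .
  qed
  finally show ?thesis by (simp only: kos_comp ei)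
qed

text \<open>The elements \<open>f \<otimes> a\<close> span and the differentials commute with the
  action of \<open>a\<close>, so the vanishing on \<open>f \<otimes> 1\<close> suffices.\<close>

lemma dk_dk:
  assumes x: "x \<in> el (kos (Suc (Suc n))) i"
  shows "dk n i (dk (Suc n) i x) = \<zero>\<^bsub>mcomp (kos n) i\<^esub>"
proof -
  note K = gmD(1)[OF kos_gm]
  let ?s = "int (Suc (Suc n))"
  show ?thesis
  proof (rule tensor_lin_eq[OF C_VS A_VS K lin_comp[OF hm_lin[OF dk_hm, of "Suc n" i, unfolded kos_comp[of "Suc (Suc n)"]] hm_lin[OF dk_hm]] lin_zero_map[OF VS_tensor[OF C_VS A_VS] K] _ x[unfolded kos_comp]])
    fix f a assume f: "f \<in> carrier (C (Suc (Suc n)))" and a: "a \<in> ael A (i - ?s)"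
    have "dk n i (dk (Suc n) i (tens K (C (Suc (Suc n))) (acomp A (i - ?s)) f a))
      = dk n (?s + (i - ?s)) (mact (kos (Suc n)) ?s (i - ?s) (dgen (Suc n) f) a)"
      unfolding dk_tens_dgen[OF f a] by simp
    also have "\<dots> = mact (kos n) ?s (i - ?s) (dk n ?s (dgen (Suc n) f)) a"
      by (rule hm_act[OF dk_hm lin_closed[OF dgen_lin' f] a])
    also have "\<dots> = \<zero>\<^bsub>mcomp (kos n) (?s + (i - ?s))\<^esub>"
      unfolding dk_dk_gen[OF f] by (rule bilin_zero(1)[OF K A_VS K gmD(2)[OF kos_gm] a])
    finally show "dk n i (dk (Suc n) i (tens K (C (Suc (Suc n))) (acomp A (i - ?s)) f a)) = \<zero>\<^bsub>mcomp (kos n) i\<^esub>"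
      by simp
  qed
qed

end

context kfield
begin

lemma lin_nested_sum:
  assumes Y: "VS Y" and P: "VS P" and h: "h \<in> lin Y P" and fin: "finite I" "finite J"
    and c: "\<And>i j. i \<in> I \<Longrightarrow> j \<in> J \<Longrightarrow> c i j \<in> carrier K" and w: "\<And>i j. i \<in> I \<Longrightarrow> j \<in> J \<Longrightarrow> w i j \<in> carrier Y"
  shows "h (\<Oplus>\<^bsub>Y\<^esub>i\<in>I. \<Oplus>\<^bsub>Y\<^esub>j\<in>J. c i j \<odot>\<^bsub>Y\<^esub> w i j) = (\<Oplus>\<^bsub>P\<^esub>i\<in>I. \<Oplus>\<^bsub>P\<^esub>j\<in>J. c i j \<odot>\<^bsub>P\<^esub> h (w i j))"
proof -
  have hw: "h (w i j) \<in> carrier P" if "i \<in> I" "j \<in> J" for i j using lin_closed[OF h w[OF that]] .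
  have cw: "c i j \<odot>\<^bsub>Y\<^esub> w i j \<in> carrier Y" if "i \<in> I" "j \<in> J" for i j using Y c[OF that] w[OF that] by simp
  have "h (\<Oplus>\<^bsub>Y\<^esub>i\<in>I. \<Oplus>\<^bsub>Y\<^esub>j\<in>J. c i j \<odot>\<^bsub>Y\<^esub> w i j) = (\<Oplus>\<^bsub>P\<^esub>i\<in>I. h (\<Oplus>\<^bsub>Y\<^esub>j\<in>J. c i j \<odot>\<^bsub>Y\<^esub> w i j))"
    by (rule lin_finsum[OF Y P h fin(1) VS_finsum_closed[OF Y cw]])
  also have "\<dots> = (\<Oplus>\<^bsub>P\<^esub>i\<in>I. \<Oplus>\<^bsub>P\<^esub>j\<in>J. c i j \<odot>\<^bsub>P\<^esub> h (w i j))"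
  proof (rule VS_finsum_cong[OF P refl])
    fix i assume i: "i \<in> I"
    show "(\<Oplus>\<^bsub>P\<^esub>j\<in>J. c i j \<odot>\<^bsub>P\<^esub> h (w i j)) \<in> carrier P"
      by (rule VS_finsum_closed[OF P]) (use c[OF i] hw[OF i] P in simp)
    have "h (\<Oplus>\<^bsub>Y\<^esub>j\<in>J. c i j \<odot>\<^bsub>Y\<^esub> w i j) = (\<Oplus>\<^bsub>P\<^esub>j\<in>J. h (c i j \<odot>\<^bsub>Y\<^esub> w i j))"
      by (rule lin_finsum[OF Y P h fin(2) cw[OF i]])
    also have "\<dots> = (\<Oplus>\<^bsub>P\<^esub>j\<in>J. c i j \<odot>\<^bsub>P\<^esub> h (w i j))"
      by (rule VS_finsum_cong[OF P refl]) (use c[OF i] w[OF i] hw[OF i] P lin_smult[OF h] in auto)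
    finally show "h (\<Oplus>\<^bsub>Y\<^esub>j\<in>J. c i j \<odot>\<^bsub>Y\<^esub> w i j) = (\<Oplus>\<^bsub>P\<^esub>j\<in>J. c i j \<odot>\<^bsub>P\<^esub> h (w i j))" .
  qed
  finally show ?thesis .
qed

lemma lin_nested:
  assumes Y: "VS Y" and P: "VS P" and fin: "finite I" "finite J"
    and f: "\<And>i j. i \<in> I \<Longrightarrow> j \<in> J \<Longrightarrow> f i j \<in> lin Y P"
  shows "(\<lambda>x. \<Oplus>\<^bsub>P\<^esub>i\<in>I. \<Oplus>\<^bsub>P\<^esub>j\<in>J. f i j x) \<in> lin Y P"
  using fin f by (intro lin_sum[OF Y P]) auto

lemma nested_cong:
  assumes P: "VS P" and "\<And>i j. i \<in> I \<Longrightarrow> j \<in> J \<Longrightarrow> g i j \<in> carrier P" and "\<And>i j. i \<in> I \<Longrightarrow> j \<in> J \<Longrightarrow> f i j = g i j"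
  shows "(\<Oplus>\<^bsub>P\<^esub>i\<in>I. \<Oplus>\<^bsub>P\<^esub>j\<in>J. f i j) = (\<Oplus>\<^bsub>P\<^esub>i\<in>I. \<Oplus>\<^bsub>P\<^esub>j\<in>J. g i j)"
  using assms by (intro VS_finsum_cong[OF P refl] VS_finsum_closed[OF P]) auto

lemma dual_expand:
  assumes U: "VS U" and b: "fdb U X y" and f: "f \<in> carrier (dual_vs K U)"
  shows "f = (\<Oplus>\<^bsub>dual_vs K U\<^esub>x\<in>X. f x \<odot>\<^bsub>dual_vs K U\<^esub> y x)"
proof (rule dual_ext[OF f])
  note bd = fdbD[OF b]
  have D: "VS (dual_vs K U)" using U by simp
  have c: "f x \<odot>\<^bsub>dual_vs K U\<^esub> y x \<in> carrier (dual_vs K U)" if "x \<in> X" for x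
    using D bd(3)[OF that] dual_apply_closed[OF f bd(2)[OF that]] by simp
  show "(\<Oplus>\<^bsub>dual_vs K U\<^esub>x\<in>X. f x \<odot>\<^bsub>dual_vs K U\<^esub> y x) \<in> carrier (dual_vs K U)"
    by (rule VS_finsum_closed[OF D c])
  fix v assume v: "v \<in> carrier U"
  have "(\<Oplus>\<^bsub>dual_vs K U\<^esub>x\<in>X. f x \<odot>\<^bsub>dual_vs K U\<^esub> y x) v = (\<Oplus>\<^bsub>ground_vs K\<^esub>x\<in>X. (f x \<odot>\<^bsub>dual_vs K U\<^esub> y x) v)"
    by (rule lin_finsum[OF D VS_ground dual_eval[OF v] bd(1) c])
  also have "\<dots> = (\<Oplus>\<^bsub>ground_vs K\<^esub>x\<in>X. y x v \<odot>\<^bsub>ground_vs K\<^esub> f x)"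
    by (rule VS_finsum_cong[OF VS_ground refl])
       (use v bd dual_apply_closed[OF f] in \<open>auto simp: dual_ops m_comm\<close>)
  also have "\<dots> = f v" by (rule lin_expand[OF U VS_ground b dual_lin[OF f] v, symmetric])
  finally show "f v = (\<Oplus>\<^bsub>dual_vs K U\<^esub>x\<in>X. f x \<odot>\<^bsub>dual_vs K U\<^esub> y x) v" ..
qed

end

section \<open>The augmentation of the Koszul complex\<close>

context quad_mod
begin

abbreviation "F' \<equiv> gmod_free K M0 A"
abbreviation "GG \<equiv> gmod_gen K B F 1 S"

lemma F': "gm A F'"
  using A M0 by (rule gm_free)

lemma C_0: "C 0 = dual_vs K (mcomp D 0)" and C_1: "C (Suc 0) = dual_vs K (mcomp D 1)"
  by (simp_all add: kos_coeff_def)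

lemma D_comp: "mcomp D n = quot_vs (tensor K U (acomp B n)) (GG n)"
  by (simp add: D_eq free_simps1)

lemma GG_SUB: "SUB (GG n) (tensor K U (acomp B n))"
  using gsubD(1)[OF G] by (simp add: free_simps1)

lemma B_VS: "VS (acomp B n)"
  using B by (rule galgebraD(1))

lemma TB_VS: "VS (tensor K U (acomp B n))"
  using U B_VS by simp

text \<open>The relations of the dual module sit in degree 1, so reaching degree 0 would take an
  algebra element of degree -1.\<close>

lemma GG_0: "GG 0 = {\<zero>\<^bsub>tensor K U (acomp B 0)\<^esub>}"
proof -
  have "mact F 1 (0 - 1) s a = \<zero>\<^bsub>mcomp F 0\<^esub>" if s: "s \<in> S" and a: "a \<in> ael B (0 - 1)" for s a
  proof -
    have "a = \<zero>\<^bsub>acomp B (0 - 1)\<^esub>" using galgebraD(7)[OF B, of "0 - 1"] a by simp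
    then show ?thesis
      using bilin_zero(2)[OF gmD(1)[OF F] B_VS gmD(1)[OF F] gmD(2)[OF F], of s 1 "0 - 1"] s S by auto
  qed
  then have "GG 0 \<subseteq> {\<zero>\<^bsub>mcomp F 0\<^esub>}"
    unfolding gmod_gen_def by (intro spn_least[OF gmD(1)[OF F] SUB_zero_space[OF gmD(1)[OF F]]]) blast
  then show ?thesis using SUB_zero[OF GG_SUB, of 0] by (auto simp: free_simps1)
qed

text \<open>The generators of the quadratic dual module; \<open>cls1\<close> gives their products
  with the generators of the dual algebra, as \<open>cls0_act\<close> confirms.\<close>

definition cls0 :: "_ \<Rightarrow> _" where
  "cls0 u = GG 0 +>\<^bsub>tensor K U (acomp B 0)\<^esub> tens K U (acomp B 0) u (aone B)"

definition cls1 :: "_ \<Rightarrow> _ \<Rightarrow> _" where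
  "cls1 u z = GG 1 +>\<^bsub>tensor K U (acomp B 1)\<^esub> tens K U (acomp B 1) u (gen' z)"

lemma coset_lin_D: "(\<lambda>t. GG n +>\<^bsub>tensor K U (acomp B n)\<^esub> t) \<in> lin (tensor K U (acomp B n)) (mcomp D n)"
  unfolding D_comp by (rule lin_coset[OF TB_VS GG_SUB])

lemma cls0_lin: "cls0 \<in> lin U (mcomp D 0)"
  unfolding cls0_def[abs_def]
  by (rule lin_comp[OF bilin_l[OF tens_bilin[OF U B_VS] galgebraD(4)[OF B]] coset_lin_D])

lemma cls0_act:
  assumes u: "u \<in> carrier U" and z: "z \<in> carrier V'"
  shows "mact D 0 1 (cls0 u) (gen' z) = cls1 u z"
proof -
  note g = lin_closed[OF gen'_lin z]
  have t: "tens K U (acomp B 0) u (aone B) \<in> el F 0"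
    using u galgebraD(4)[OF B] by (simp add: free_simps1)
  have "mact D 0 1 (cls0 u) (gen' z) = GG (0 + 1) +>\<^bsub>mcomp F (0 + 1)\<^esub> mact F 0 1 (tens K U (acomp B 0) u (aone B)) (gen' z)"
    unfolding D_eq cls0_def using gmod_quot_act[OF F G t g] by (simp add: free_simps1)
  then show ?thesis
    using tens_gen[OF B U u g] by (simp add: cls1_def free_simps1)
qed

text \<open>There are no relations in degree 0 and the dual algebra is the ground field there, so
  this component is the dual of the generators of the module; \<open>k\<close> is the inverse of
  \<open>cls0\<close>.\<close>

lemma D0_iso:
  obtains k where "k \<in> lin (mcomp D 0) U" "\<forall>u\<in>carrier U. k (cls0 u) = u" "\<forall>w\<in>el D 0. \<exists>u\<in>carrier U. w = cls0 u"
proof -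
  obtain c where c: "c \<in> lin (acomp B 0) (ground_vs K)" "c (aone B) = \<one>"
    "\<forall>b\<in>ael B 0. b = c b \<odot>\<^bsub>acomp B 0\<^esub> aone B"
    using quad_alg_deg0[OF V' R'] unfolding quad_dual_def by blast
  note cc = lin_closed[OF c(1)]
  have b: "bilin U (acomp B 0) U (\<lambda>u b. c b \<odot>\<^bsub>U\<^esub> u)"
    by (intro bilinI linI) (use cc U in \<open>auto simp: lin_add[OF c(1)] lin_smult[OF c(1)] VS_distr m_comm\<close>)
  note L = tensor_lift[OF U B_VS U b]
  let ?l = "lift K U (\<lambda>(u, b). c b \<odot>\<^bsub>U\<^esub> u)"
  have z: "?l w = \<zero>\<^bsub>U\<^esub>" if "w \<in> GG 0" for w
    using that lin_zero[OF TB_VS U L(1)] by (simp add: GG_0)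
  have k1: "(\<lambda>X. ?l (rep X)) \<in> lin (mcomp D 0) U"
    unfolding D_comp by (rule quot_induced(1)[OF TB_VS GG_SUB U L(1)]) (rule z)
  have o: "aone B \<in> ael B 0" by (rule galgebraD(4)[OF B])
  have k2: "?l (rep (cls0 u)) = u" if u: "u \<in> carrier U" for u
  proof -
    have "?l (rep (cls0 u)) = ?l (tens K U (acomp B 0) u (aone B))"
      unfolding cls0_def by (rule quot_induced(2)[OF TB_VS GG_SUB U L(1)]) (use z u o in auto)
    then show ?thesis using L(2)[OF u o] c(2) u U by simp
  qed
  have "w \<in> cls0 ` carrier U" if w: "w \<in> el D 0" for w
  proof -
    have im: "SUB (cls0 ` carrier U) (mcomp D 0)" by (rule SUB_image[OF U D_VS cls0_lin SUB_carrier[OF U]])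
    obtain t where t: "t \<in> carrier (tensor K U (acomp B 0))" "w = GG 0 +>\<^bsub>tensor K U (acomp B 0)\<^esub> t"
      using w unfolding D_comp by (rule quot_cases)
    have "t \<in> {t \<in> carrier (tensor K U (acomp B 0)). GG 0 +>\<^bsub>tensor K U (acomp B 0)\<^esub> t \<in> cls0 ` carrier U}"
    proof (rule tensor_SUB_all[OF U B_VS SUB_preimage[OF TB_VS D_VS coset_lin_D im] _ t(1)])
      fix u b assume u: "u \<in> carrier U" and b: "b \<in> ael B 0"
      have cb: "c b \<in> carrier K" using cc[OF b] by simp
      have "tens K U (acomp B 0) u b = tens K U (acomp B 0) u (c b \<odot>\<^bsub>acomp B 0\<^esub> aone B)" using c(3) b by simp
      also have "\<dots> = tens K U (acomp B 0) (c b \<odot>\<^bsub>U\<^esub> u) (aone B)"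
        by (simp only: bilin_adds(3,4)[OF tens_bilin[OF U B_VS] cb u o])
      finally have "GG 0 +>\<^bsub>tensor K U (acomp B 0)\<^esub> tens K U (acomp B 0) u b = cls0 (c b \<odot>\<^bsub>U\<^esub> u)" by (simp add: cls0_def)
      then show "tens K U (acomp B 0) u b \<in> {t \<in> carrier (tensor K U (acomp B 0)). GG 0 +>\<^bsub>tensor K U (acomp B 0)\<^esub> t \<in> cls0 ` carrier U}"
        using u b cb U by auto
    qed
    then show ?thesis using t(2) by simp
  qed
  then show thesis using that[OF k1] k2 by blast
qed

text \<open>\<open>act_map\<close> is the homomorphism that \<open>free_hom\<close> attaches to the
  identity on the generators, with shift 0.\<close>

lemma act_hm: "act_map K M \<in> hm A F' M"
  and act_tens: "v \<in> carrier M0 \<Longrightarrow> a \<in> ael A n \<Longrightarrow> act_map K M n (tens K M0 (acomp A n) v a) = mact M 0 n v a"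
proof -
  have e: "gmod_shift F' 0 = F'" by (simp add: gmod_shift_def)
  have t: "(\<lambda>v. v) \<in> lin M0 (mcomp M (- 0))" using lin_id by simp
  have a: "act_map K M = (\<lambda>n. lift K (mcomp M n) (\<lambda>(u, a). mact M (- 0) (n + 0) u a))"
    by (simp add: act_map_def[abs_def])
  show "act_map K M \<in> hm A F' M"
    using free_hom(1)[OF A M0 M t] unfolding a e .
  show "v \<in> carrier M0 \<Longrightarrow> a \<in> ael A n \<Longrightarrow> act_map K M n (tens K M0 (acomp A n) v a) = mact M 0 n v a"
    using free_hom(2)[OF A M0 M t, of v a n] by (simp add: a)
qed

lemma free_map:
  assumes W: "VS W" and W': "VS W'" and t: "\<theta> \<in> lin W W'"
  obtains T where "T \<in> hm A (gmod_free K W A) (gmod_free K W' A)"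
    "\<forall>n. \<forall>w\<in>carrier W. \<forall>a\<in>ael A n. T n (tens K W (acomp A n) w a) = tens K W' (acomp A n) (\<theta> w) a"
proof -
  have e: "gmod_shift (gmod_free K W A) 0 = gmod_free K W A" by (simp add: gmod_shift_def)
  let ?F = "gmod_free K W' A"
  have t': "(\<lambda>w. tens K W' (acomp A 0) (\<theta> w) (aone A)) \<in> lin W (mcomp ?F (- 0))"
    using lin_comp[OF t bilin_l[OF tens_bilin[OF W' A_VS] galgebraD(4)[OF A]]] by (simp add: free_simps1)
  note f = free_hom[OF A W gm_free[OF A W'] t', unfolded e]
  show thesis
  proof (rule that[OF f(1)], intro allI ballI)
    fix n w a assume w: "w \<in> carrier W" and a: "a \<in> ael A n"
    show "lift K (mcomp ?F n) (\<lambda>(u, a). mact ?F (- 0) (n + 0) (tens K W' (acomp A 0) (\<theta> u) (aone A)) a) (tens K W (acomp A n) w a)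
        = tens K W' (acomp A n) (\<theta> w) a"
      using f(2)[of w a n] w a tens_gen[OF A W' lin_closed[OF t w] a] by simp
  qed
qed

lemma rels_SUB: "SUB (mod_rels K V R M) (tensor K M0 V)"
  unfolding mod_rels_def
  by (rule SUB_ker[OF VS_tensor[OF M0 V] gmD(1)[OF M] lin_comp[OF embed_lin]])
     (use hm_lin[OF act_hm, of 1] in \<open>simp add: free_simps1\<close>)

text \<open>The functionals on \<open>M\<^sup>!\<^sub>-\<^sub>1\<close> correspond to the relations of \<open>M\<close>; \<open>rel f\<close> is the relation of \<open>f\<close>.\<close>

definition rel :: "'m set \<Rightarrow> ('m \<Rightarrow> 'm \<Rightarrow> 'k) \<Rightarrow> _ \<Rightarrow> ('m \<times> 'v \<Rightarrow> 'k) set" where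
  "rel E es f = (\<Oplus>\<^bsub>tensor K M0 V\<^esub>x\<in>X. \<Oplus>\<^bsub>tensor K M0 V\<^esub>e\<in>E. f (cls1 (es e) (y x)) \<odot>\<^bsub>tensor K M0 V\<^esub> tens K M0 V e x)"

lemma cls1_closed: "u \<in> carrier U \<Longrightarrow> z \<in> carrier V' \<Longrightarrow> cls1 u z \<in> el D 1"
  unfolding cls1_def by (intro lin_closed[OF coset_lin_D] tens_closed lin_closed[OF gen'_lin])

lemma tens_expand:
  assumes E: "fdb M0 E es" and P: "VS P" and l: "l \<in> lin (tensor K M0 V) P" and u: "u \<in> carrier M0" and v: "v \<in> carrier V"
  shows "l (tens K M0 V u v) = (\<Oplus>\<^bsub>P\<^esub>x\<in>X. \<Oplus>\<^bsub>P\<^esub>e\<in>E. (es e u \<otimes> y x v) \<odot>\<^bsub>P\<^esub> l (tens K M0 V e x))"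
proof -
  have "bilin M0 V P (\<lambda>u v. l (tens K M0 V u v))"
    using lin_comp[OF bilin_r[OF tens_bilin[OF M0 V]] l] lin_comp[OF bilin_l[OF tens_bilin[OF M0 V]] l]
    by (intro bilinI)
  from bilin_expand[OF M0 V P E X_fdb this u v] show ?thesis .
qed

text \<open>A functional separating \<open>rel E es f\<close> from the relations would be
  represented by some \<open>rho\<close> orthogonal to them, hence zero in the quadratic dual, while
  \<open>f\<close> takes the value 1 on it. Separation thus takes the place of a dimension count for
  double orthogonals.\<close>

lemma rel_mem:
  assumes E: "fdb M0 E es" and f: "f \<in> carrier (C (Suc 0))"
  shows "rel E es f \<in> mod_rels K V R M"
proof (rule ccontr)
  let ?T = "tensor K M0 V" and ?T' = "tensor K U V'" and ?k = "ground_vs K"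
  assume n: "rel E es f \<notin> mod_rels K V R M"
  have T: "VS ?T" "VS ?T'" using M0 V U V' by auto
  note Ed = fdbD[OF E] and Xd = fdbD[OF X_fdb]
  have f': "f \<in> lin (mcomp D 1) ?k" using dual_lin[OF f[unfolded C_1]] .
  have fc: "f (cls1 (es e) (y x)) \<in> carrier K" if "x \<in> X" "e \<in> E" for x e
    using lin_closed[OF f' cls1_closed[OF Ed(3)[OF that(2)] y_closed[OF that(1)]]] by simp
  have tc: "tens K M0 V e x \<in> carrier ?T" if "x \<in> X" "e \<in> E" for x e using Ed Xd that by simp
  have tc': "tens K U V' (es e) (y x) \<in> carrier ?T'" if "x \<in> X" "e \<in> E" for x e
    using Ed y_closed that by simp
  have rc: "rel E es f \<in> carrier ?T"
    unfolding rel_def using fc tc T by (auto intro!: VS_finsum_closed[OF T(1)])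
  obtain l where l: "l \<in> lin ?T ?k" "\<forall>r\<in>mod_rels K V R M. l r = \<zero>" "l (rel E es f) = \<one>"
    using separating_functional[OF T(1) rels_SUB rc n] by blast
  have lc: "l (tens K M0 V e x) \<in> carrier K" if "x \<in> X" "e \<in> E" for x e
    using lin_closed[OF l(1) tc[OF that]] by simp
  \<comment> \<open>The functional \<open>l\<close> written in the dual bases, so that pairing with
    \<open>rho\<close> is \<open>l\<close>.\<close>
  define rho where "rho = (\<Oplus>\<^bsub>?T'\<^esub>x\<in>X. \<Oplus>\<^bsub>?T'\<^esub>e\<in>E. l (tens K M0 V e x) \<odot>\<^bsub>?T'\<^esub> tens K U V' (es e) (y x))"
  have rho_c: "rho \<in> carrier ?T'"
    unfolding rho_def using lc tc' T by (auto intro!: VS_finsum_closed[OF T(2)])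
  have "mod_pairing K rho r = l r" if r: "r \<in> carrier ?T" for r
  proof -
    have m: "mod_pairing K (tens K U V' (es e) (y x)) \<in> lin ?T ?k" if "x \<in> X" "e \<in> E" for x e
      by (rule mod_pairing_props(2)[OF M0 V Ed(3)[OF that(2)] y_closed[OF that(1)]])
    have "mod_pairing K rho r = (\<Oplus>\<^bsub>?k\<^esub>x\<in>X. \<Oplus>\<^bsub>?k\<^esub>e\<in>E. l (tens K M0 V e x) \<odot>\<^bsub>?k\<^esub> mod_pairing K (tens K U V' (es e) (y x)) r)"
      unfolding rho_def by (rule lin_nested_sum[OF T(2) VS_ground mod_pairing_props(1)[OF M0 V r] Xd(1) Ed(1) lc tc'])
    also have "\<dots> = l r"
    proof (rule tensor_lin_eq[OF M0 V VS_ground lin_nested[OF T(1) VS_ground Xd(1) Ed(1) lin_scale[OF T(1) VS_ground m lc]] l(1) _ r])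
      fix u v assume uv: "u \<in> carrier M0" "v \<in> carrier V"
      show "(\<Oplus>\<^bsub>?k\<^esub>x\<in>X. \<Oplus>\<^bsub>?k\<^esub>e\<in>E. l (tens K M0 V e x) \<odot>\<^bsub>?k\<^esub> mod_pairing K (tens K U V' (es e) (y x)) (tens K M0 V u v)) = l (tens K M0 V u v)"
        unfolding tens_expand[OF E VS_ground l(1) uv]
        by (rule nested_cong[OF VS_ground])
           (use lc uv Ed(6) Xd(6) mod_pairing_props(3)[OF M0 V Ed(3) y_closed uv] in \<open>auto simp: m_comm\<close>)
    qed
    finally show ?thesis .
  qed
  then have "rho \<in> mod_perp K V R M"
    using rho_c l(2) SUB_subset[OF rels_SUB] by (auto simp: mod_perp_def)
  then have e: "embed1 K V' R' U rho \<in> GG 1"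
    using gmod_gen_incl[OF F B S] by blast
  let ?h = "\<lambda>t. f (GG 1 +>\<^bsub>tensor K U (acomp B 1)\<^esub> embed1 K V' R' U t)"
  have hl: "?h \<in> lin ?T' ?k"
    by (rule lin_comp[OF lin_comp[OF embed'_lin coset_lin_D] f'])
  have "?h rho = (\<Oplus>\<^bsub>?k\<^esub>x\<in>X. \<Oplus>\<^bsub>?k\<^esub>e\<in>E. l (tens K M0 V e x) \<odot>\<^bsub>?k\<^esub> ?h (tens K U V' (es e) (y x)))"
    unfolding rho_def by (rule lin_nested_sum[OF T(2) VS_ground hl Xd(1) Ed(1) lc tc'])
  also have "\<dots> = (\<Oplus>\<^bsub>?k\<^esub>x\<in>X. \<Oplus>\<^bsub>?k\<^esub>e\<in>E. f (cls1 (es e) (y x)) \<odot>\<^bsub>?k\<^esub> l (tens K M0 V e x))"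
    by (rule nested_cong[OF VS_ground])
       (use lc fc embed'_tens[OF Ed(3) y_closed] in \<open>auto simp: m_comm cls1_def\<close>)
  also have "\<dots> = l (rel E es f)"
    unfolding rel_def by (rule lin_nested_sum[symmetric, OF T(1) VS_ground l(1) Xd(1) Ed(1) fc tc])
  finally have "?h rho = \<one>" using l(3) by simp
  moreover have "GG 1 +>\<^bsub>tensor K U (acomp B 1)\<^esub> embed1 K V' R' U rho = \<zero>\<^bsub>mcomp D 1\<^esub>"
    unfolding D_comp using quot_kernel[OF TB_VS GG_SUB lin_closed[OF embed'_lin rho_c]] e by simp
  then have "?h rho = \<zero>" using lin_zero[OF D_VS VS_ground f'] by simp
  ultimately show False using one_not_zero by simp
qed

text \<open>Pairing with \<open>r\<close> is a functional that kills the orthogonal of the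
  relations, so it descends to degree 1 of the quadratic dual. Its values on the dual bases are the
  coordinates of \<open>r\<close>, so \<open>rel\<close> returns \<open>r\<close>.\<close>

lemma rel_surj:
  assumes E: "fdb M0 E es" and r: "r \<in> mod_rels K V R M"
  shows "\<exists>f\<in>carrier (C (Suc 0)). rel E es f = r"
proof -
  let ?T = "tensor K M0 V" and ?T' = "tensor K U V'" and ?k = "ground_vs K" and ?TB = "tensor K U (acomp B 1)"
  have T: "VS ?T" "VS ?T'" using M0 V U V' by auto
  note Ed = fdbD[OF E] and Xd = fdbD[OF X_fdb]
  have rT: "r \<in> carrier ?T" using r SUB_subset[OF rels_SUB] by blast
  obtain b where b: "b \<in> lin (acomp B 1) V'" "\<forall>v\<in>carrier V'. b (gen' v) = v" "\<forall>x\<in>ael B 1. gen' (b x) = x"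
    using quad_alg_deg1[OF V' R'] unfolding quad_dual_def by blast
  have bi: "bilin U (acomp B 1) ?T' (\<lambda>u x. tens K U V' u (b x))"
    using lin_comp[OF b(1) bilin_r[OF tens_bilin[OF U V']]] bilin_l[OF tens_bilin[OF U V'] lin_closed[OF b(1)]]
    by (intro bilinI)
  \<comment> \<open>\<open>?J\<close> undoes \<open>embed1\<close>, bringing elements back to the
    tensor product on which the pairing is defined.\<close>
  let ?J = "lift K ?T' (\<lambda>(u, x). tens K U V' u (b x))"
  note J = tensor_lift[OF U B_VS T(2) bi]
  have Je: "?J (embed1 K V' R' U \<rho>) = \<rho>" if "\<rho> \<in> carrier ?T'" for \<rho>
    by (rule tensor_lin_eq[OF U V' T(2) lin_comp[OF embed'_lin J(1)] lin_id _ that])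
       (use b(2) embed'_tens J(2) lin_closed[OF gen'_lin] in auto)
  let ?g = "\<lambda>t. mod_pairing K (?J t) r"
  have g: "?g \<in> lin ?TB ?k" by (rule lin_comp[OF J(1) mod_pairing_props(1)[OF M0 V rT]])
  have gz: "?g t = \<zero>\<^bsub>?k\<^esub>" if t: "t \<in> GG 1" for t
  proof -
    obtain c where c: "c \<in> lin (acomp B 0) (ground_vs K)" "c (aone B) = \<one>"
      "\<forall>b\<in>ael B 0. b = c b \<odot>\<^bsub>acomp B 0\<^esub> aone B"
      using quad_alg_deg0[OF V' R'] unfolding quad_dual_def by blast
    \<comment> \<open>In degree 1 the generated submodule uses only algebra elements of degree 0,
      that is, scalars; hence it adds nothing beyond the span of the orthogonal of the
      relations.\<close>
    let ?W = "{x \<in> carrier ?TB. ?g x = \<zero>\<^bsub>?k\<^esub>}"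
    have W: "SUB ?W (mcomp F 1)"
      using SUB_ker[OF TB_VS VS_ground g] by (simp add: free_simps1)
    have "GG 1 \<subseteq> ?W"
      unfolding gmod_gen_def
    proof (rule spn_least[OF gmD(1)[OF F] W], clarify)
      fix s a \<rho> assume a: "a \<in> ael B (1 - 1)" and \<rho>: "\<rho> \<in> mod_perp K V R M"
      let ?s = "embed1 K V' R' U \<rho>"
      have \<rho>': "\<rho> \<in> carrier ?T'" "mod_pairing K \<rho> r = \<zero>" using \<rho> r by (auto simp: mod_perp_def)
      have s: "?s \<in> el F 1" "?s \<in> carrier ?TB" using lin_closed[OF embed'_lin \<rho>'(1)] by (auto simp: free_simps1)
      have a0: "a \<in> ael B 0" and ca: "c a \<in> carrier K" using a lin_closed[OF c(1)] by auto
      have "mact F 1 (1 - 1) ?s a = mact F 1 0 ?s (c a \<odot>\<^bsub>acomp B 0\<^esub> aone B)" using c(3) a0 by simp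
      also have "\<dots> = c a \<odot>\<^bsub>mcomp F (1 + 0)\<^esub> mact F 1 0 ?s (aone B)"
        by (rule bilin_adds(4)[OF gmD(2)[OF F] ca s(1) galgebraD(4)[OF B]])
      also have "\<dots> = c a \<odot>\<^bsub>?TB\<^esub> ?s" using gmD(3)[OF F s(1)] by (simp add: free_simps1)
      finally have e: "mact F 1 (1 - 1) ?s a = c a \<odot>\<^bsub>?TB\<^esub> ?s" .
      have "?g ?s = \<zero>" using Je[OF \<rho>'(1)] \<rho>'(2) by simp
      then have "?g (c a \<odot>\<^bsub>?TB\<^esub> ?s) = \<zero>\<^bsub>?k\<^esub>" using lin_smult[OF g ca s(2)] ca by simp
      then show "mact F 1 (1 - 1) ?s a \<in> carrier ?TB \<and> ?g (mact F 1 (1 - 1) ?s a) = \<zero>\<^bsub>?k\<^esub>"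
        unfolding e using TB_VS s ca by simp
    qed
    then show ?thesis using t by blast
  qed
  define f where "f = restrict (\<lambda>X. ?g (rep X)) (el D 1)"
  have "(\<lambda>X. ?g (rep X)) \<in> lin (mcomp D 1) ?k"
    unfolding D_comp by (rule quot_induced(1)[OF TB_VS GG_SUB VS_ground g]) (rule gz)
  then have f: "f \<in> carrier (C (Suc 0))"
    unfolding C_1 f_def by (rule dual_restrict[OF D_VS])
  have fv: "f (cls1 u z) = mod_pairing K (tens K U V' u z) r" if uz: "u \<in> carrier U" "z \<in> carrier V'" for u z
  proof -
    have t: "tens K U (acomp B 1) u (gen' z) \<in> carrier ?TB" using uz lin_closed[OF gen'_lin] by simp
    have "f (cls1 u z) = ?g (rep (cls1 u z))" unfolding f_def using cls1_closed[OF uz] by simp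
    also have "\<dots> = ?g (tens K U (acomp B 1) u (gen' z))"
      unfolding cls1_def by (rule quot_induced(2)[OF TB_VS GG_SUB VS_ground g _ t]) (rule gz)
    finally show ?thesis using J(2)[OF uz(1) lin_closed[OF gen'_lin uz(2)]] b(2) uz by simp
  qed
  have m: "mod_pairing K (tens K U V' (es e) (y x)) \<in> lin ?T ?k" if "x \<in> X" "e \<in> E" for x e
    by (rule mod_pairing_props(2)[OF M0 V Ed(3)[OF that(2)] y_closed[OF that(1)]])
  have tc: "tens K M0 V e x \<in> carrier ?T" if "x \<in> X" "e \<in> E" for x e using Ed Xd that by simp
  have ml: "(\<lambda>s. mod_pairing K (tens K U V' (es e) (y x)) s \<odot>\<^bsub>?T\<^esub> tens K M0 V e x) \<in> lin ?T ?T" if xe: "x \<in> X" "e \<in> E" for x e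
    by (rule linI) (use T tc[OF xe] lin_closed[OF m[OF xe]] in \<open>auto simp: lin_add[OF m[OF xe]] lin_smult[OF m[OF xe]] VS_distr\<close>)
  have mc: "mod_pairing K (tens K U V' (es e) (y x)) s \<in> carrier K" if "s \<in> carrier ?T" "x \<in> X" "e \<in> E" for s x e
    using lin_closed[OF m[OF that(2,3)] that(1)] by simp
  have "rel E es f = (\<Oplus>\<^bsub>?T\<^esub>x\<in>X. \<Oplus>\<^bsub>?T\<^esub>e\<in>E. mod_pairing K (tens K U V' (es e) (y x)) r \<odot>\<^bsub>?T\<^esub> tens K M0 V e x)"
    unfolding rel_def by (rule nested_cong[OF T(1)]) (use fv[OF Ed(3) y_closed] mc[OF rT] tc T in auto)
  also have "\<dots> = r"
  proof (rule tensor_lin_eq[OF M0 V T(1) lin_nested[OF T(1) T(1) Xd(1) Ed(1) ml] lin_id _ rT])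
    fix u v assume uv: "u \<in> carrier M0" "v \<in> carrier V"
    have "(\<Oplus>\<^bsub>?T\<^esub>x\<in>X. \<Oplus>\<^bsub>?T\<^esub>e\<in>E. mod_pairing K (tens K U V' (es e) (y x)) (tens K M0 V u v) \<odot>\<^bsub>?T\<^esub> tens K M0 V e x)
      = (\<Oplus>\<^bsub>?T\<^esub>x\<in>X. \<Oplus>\<^bsub>?T\<^esub>e\<in>E. (es e u \<otimes> y x v) \<odot>\<^bsub>?T\<^esub> tens K M0 V e x)"
      by (rule nested_cong[OF T(1)])
         (use tc uv Ed(6) Xd(6) T mod_pairing_props(3)[OF M0 V Ed(3) y_closed uv] in auto)
    also have "\<dots> = tens K M0 V u v" using tens_expand[OF E T(1) lin_id uv] by simp
    finally show "(\<Oplus>\<^bsub>?T\<^esub>x\<in>X. \<Oplus>\<^bsub>?T\<^esub>e\<in>E. mod_pairing K (tens K U V' (es e) (y x)) (tens K M0 V u v) \<odot>\<^bsub>?T\<^esub> tens K M0 V e x) = tens K M0 V u v" .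
  qed
  finally show ?thesis using f by blast
qed

text \<open>The 0-th Koszul term is the bidual of the generators tensored with the algebra, and the
  next term carries the relations. After identifying the bidual with the generators, the action map
  is the augmentation, and the image of the first differential is the submodule generated by the
  relations. So the complex is a presentation of the module at this end, and the resolving datum
  only has to describe homology in positive degrees.\<close>

lemma augmentation:
  obtains eps where "eps \<in> hm A (kos 0) M" "\<forall>i. eps i ` el (kos 0) i = el M i"
    "\<forall>i. \<forall>x\<in>el (kos 0) i. eps i x = \<zero>\<^bsub>mcomp M i\<^esub> \<longleftrightarrow> x \<in> dk 0 i ` el (kos (Suc 0)) i"
proof -
  obtain E es where E: "fdb M0 E es" using fin_dim_fdb[OF M0 M0_fin] .
  note Ed = fdbD[OF E] and Xd = fdbD[OF X_fdb]
  obtain k where k: "k \<in> lin (mcomp D 0) U" "\<forall>u\<in>carrier U. k (cls0 u) = u" "\<forall>w\<in>el D 0. \<exists>u\<in>carrier U. w = cls0 u"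
    by (rule D0_iso)
  \<comment> \<open>\<open>th\<close> and \<open>et\<close> are mutually inverse:
    \<open>et v\<close> is evaluation at \<open>v\<close>, and \<open>th\<close> recovers a vector
    from the values of the functional on the dual basis.\<close>
  define th where "th = (\<lambda>f. \<Oplus>\<^bsub>M0\<^esub>e\<in>E. f (cls0 (es e)) \<odot>\<^bsub>M0\<^esub> e)"
  define et where "et = (\<lambda>v. \<lambda>w\<in>el D 0. k w v)"
  have cc: "cls0 (es e) \<in> el D 0" if "e \<in> E" for e
    using lin_closed[OF cls0_lin Ed(3)[OF that]] .
  have ev: "(\<lambda>f. f w) \<in> lin (C 0) (ground_vs K)" if "w \<in> el D 0" for w
    unfolding C_0 by (rule dual_eval[OF that])
  have evc: "f w \<in> carrier K" if "f \<in> carrier (C 0)" "w \<in> el D 0" for f w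
    using lin_closed[OF ev[OF that(2)] that(1)] by simp
  have th: "th \<in> lin (C 0) M0"
    unfolding th_def
  proof (rule lin_sum[OF C_VS M0 Ed(1)])
    fix e assume e: "e \<in> E"
    show "(\<lambda>f. f (cls0 (es e)) \<odot>\<^bsub>M0\<^esub> e) \<in> lin (C 0) M0"
      by (rule linI) (use evc[OF _ cc[OF e]] Ed(2)[OF e] M0 in \<open>auto simp: lin_add[OF ev[OF cc[OF e]]] lin_smult[OF ev[OF cc[OF e]]] VS_distr\<close>)
  qed
  have kU: "k w \<in> carrier U" if "w \<in> el D 0" for w using lin_closed[OF k(1) that] .
  have etc: "et v \<in> carrier (C 0)" if "v \<in> carrier M0" for v
    unfolding C_0 et_def by (rule dual_restrict[OF D_VS lin_comp[OF k(1) dual_eval[OF that]]])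
  have et: "et \<in> lin M0 (C 0)"
  proof (rule linI)
    show "et (u \<oplus>\<^bsub>M0\<^esub> v) = et u \<oplus>\<^bsub>C 0\<^esub> et v" if "u \<in> carrier M0" "v \<in> carrier M0" for u v
      unfolding C_0 et_def using that lin_add[OF dual_lin[OF kU]] by (auto simp: dual_ops)
    show "et (c \<odot>\<^bsub>M0\<^esub> v) = c \<odot>\<^bsub>C 0\<^esub> et v" if "c \<in> carrier K" "v \<in> carrier M0" for c v
      unfolding C_0 et_def using that lin_smult[OF dual_lin[OF kU]] by (auto simp: dual_ops)
  qed (rule etc)
  have the: "th (et v) = v" if v: "v \<in> carrier M0" for v
  proof -
    have "th (et v) = (\<Oplus>\<^bsub>M0\<^esub>e\<in>E. es e v \<odot>\<^bsub>M0\<^esub> e)"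
      unfolding th_def
      by (rule VS_finsum_cong[OF M0 refl]) (use k(2) cc Ed v M0 in \<open>auto simp: et_def\<close>)
    then show ?thesis using Ed(5)[OF v] by simp
  qed
  have eth: "et (th f) = f" if f: "f \<in> carrier (C 0)" for f
  proof (rule dual_ext[of _ "mcomp D 0"])
    show "et (th f) \<in> carrier (dual_vs K (mcomp D 0))" "f \<in> carrier (dual_vs K (mcomp D 0))"
      using etc[OF lin_closed[OF th f]] f unfolding C_0 by auto
    fix w assume w: "w \<in> el D 0"
    then obtain u where u: "u \<in> carrier U" "w = cls0 u" using k(3) by blast
    have fl: "f \<in> lin (mcomp D 0) (ground_vs K)" using dual_lin[OF f[unfolded C_0]] .
    have ue: "u e \<in> carrier K" if "e \<in> E" for e using dual_apply_closed[OF u(1) Ed(2)[OF that]] .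
    have "et (th f) w = u (th f)" using w u k(2) by (simp add: et_def)
    also have "\<dots> = (\<Oplus>\<^bsub>ground_vs K\<^esub>e\<in>E. u (f (cls0 (es e)) \<odot>\<^bsub>M0\<^esub> e))"
      unfolding th_def by (rule lin_finsum[OF M0 VS_ground dual_lin[OF u(1)] Ed(1)]) (use evc[OF f cc] Ed(2) M0 in auto)
    also have "\<dots> = (\<Oplus>\<^bsub>ground_vs K\<^esub>e\<in>E. f (cls0 (u e \<odot>\<^bsub>U\<^esub> es e)))"
      by (rule VS_finsum_cong[OF VS_ground refl])
         (use evc[OF f cc] Ed(2,3) ue cc in \<open>auto simp: lin_smult[OF dual_lin[OF u(1)]] lin_smult[OF cls0_lin] lin_smult[OF fl] m_comm\<close>)
    also have "\<dots> = f (cls0 (\<Oplus>\<^bsub>U\<^esub>e\<in>E. u e \<odot>\<^bsub>U\<^esub> es e))"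
      by (rule lin_finsum[symmetric, OF U VS_ground lin_comp[OF cls0_lin fl] Ed(1)]) (use ue Ed(3) U in auto)
    also have "\<dots> = f w" using dual_expand[OF M0 E u(1)] u(2) by simp
    finally show "et (th f) w = f w" .
  qed
  have kos0: "kos 0 = gmod_free K (C 0) A" by (simp add: kos_eq gmod_shift_def)
  obtain T where T: "T \<in> hm A (kos 0) F'" "\<forall>n. \<forall>w\<in>carrier (C 0). \<forall>a\<in>ael A n. T n (tens K (C 0) (acomp A n) w a) = tens K M0 (acomp A n) (th w) a"
    unfolding kos0 by (rule free_map[OF C_VS M0 th])
  obtain H where H: "H \<in> hm A F' (kos 0)" "\<forall>n. \<forall>w\<in>carrier M0. \<forall>a\<in>ael A n. H n (tens K M0 (acomp A n) w a) = tens K (C 0) (acomp A n) (et w) a"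
    unfolding kos0 by (rule free_map[OF M0 C_VS et])
  have HT: "H i (T i x) = x" if x: "x \<in> el (kos 0) i" for i x
  proof (rule tensor_lin_eq[OF C_VS A_VS VS_tensor[OF C_VS A_VS] _ lin_id])
    show "(\<lambda>x. H i (T i x)) \<in> lin (tensor K (C 0) (acomp A i)) (tensor K (C 0) (acomp A i))"
      using lin_comp[OF hm_lin[OF T(1), of i] hm_lin[OF H(1), of i]] by (simp add: kos0 free_simps1)
    show "x \<in> carrier (tensor K (C 0) (acomp A i))" using x by (simp add: kos0 free_simps1)
  qed (use T(2) H(2) eth lin_closed[OF th] in simp)
  have TH: "T i (H i x) = x" if x: "x \<in> el F' i" for i x
  proof (rule tensor_lin_eq[OF M0 A_VS VS_tensor[OF M0 A_VS] _ lin_id])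
    show "(\<lambda>x. T i (H i x)) \<in> lin (tensor K M0 (acomp A i)) (tensor K M0 (acomp A i))"
      using lin_comp[OF hm_lin[OF H(1), of i] hm_lin[OF T(1), of i]] by (simp add: free_simps1)
    show "x \<in> carrier (tensor K M0 (acomp A i))" using x by (simp add: free_simps1)
  qed (use T(2) H(2) the lin_closed[OF et] in simp)
  \<comment> \<open>Under this identification the first differential sends the generator
    \<open>f\<close> to the relation that \<open>rel\<close> attaches to it.\<close>
  have Td: "T 1 (dgen 0 f) = embed1 K V R M0 (rel E es f)" if f: "f \<in> carrier (C (Suc 0))" for f
  proof -
    let ?P = "tensor K M0 (acomp A 1)"
    have P: "VS ?P" using M0 A_VS by simp
    note cl = lin_closed[OF cact_lin[OF y_closed] f]
    have fc: "f (cls1 (es e) (y x)) \<in> carrier K" if "x \<in> X" "e \<in> E" for x e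
      using lin_closed[OF dual_lin[OF f[unfolded C_1]] cls1_closed[OF Ed(3)[OF that(2)] y_closed[OF that(1)]]] by simp
    have "T 1 (dgen 0 f) = (\<Oplus>\<^bsub>?P\<^esub>x\<in>X. T 1 (tens K (C 0) (acomp A 1) (cact 0 (y x) f) (gen x)))"
      unfolding dgen_def
      by (rule lin_finsum[OF VS_tensor[OF C_VS A_VS] P _ Xd(1)])
         (use hm_lin[OF T(1), of 1] cl gen_closed in \<open>auto simp: kos0 free_simps1\<close>)
    also have "\<dots> = (\<Oplus>\<^bsub>?P\<^esub>x\<in>X. \<Oplus>\<^bsub>?P\<^esub>e\<in>E. f (cls1 (es e) (y x)) \<odot>\<^bsub>?P\<^esub> tens K M0 (acomp A 1) e (gen x))"
    proof (rule VS_finsum_cong[OF P refl])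
      fix x assume x: "x \<in> X"
      show "(\<Oplus>\<^bsub>?P\<^esub>e\<in>E. f (cls1 (es e) (y x)) \<odot>\<^bsub>?P\<^esub> tens K M0 (acomp A 1) e (gen x)) \<in> carrier ?P"
        by (rule VS_finsum_closed[OF P]) (use fc[OF x] gen_closed[OF x] Ed(2) P in auto)
      have "th (cact 0 (y x) f) = (\<Oplus>\<^bsub>M0\<^esub>e\<in>E. f (cls1 (es e) (y x)) \<odot>\<^bsub>M0\<^esub> e)"
        unfolding th_def
        by (rule VS_finsum_cong[OF M0 refl])
           (use fc[OF x] Ed(2,3) M0 cc cact_apply[of _ 0 "y x" f] cls0_act[OF Ed(3) y_closed[OF x]] in auto)
      then have "T 1 (tens K (C 0) (acomp A 1) (cact 0 (y x) f) (gen x)) = tens K M0 (acomp A 1) (\<Oplus>\<^bsub>M0\<^esub>e\<in>E. f (cls1 (es e) (y x)) \<odot>\<^bsub>M0\<^esub> e) (gen x)"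
        using T(2) cl[OF x] gen_closed[OF x] by simp
      also have "\<dots> = (\<Oplus>\<^bsub>?P\<^esub>e\<in>E. tens K M0 (acomp A 1) (f (cls1 (es e) (y x)) \<odot>\<^bsub>M0\<^esub> e) (gen x))"
        by (rule lin_finsum[OF M0 P bilin_l[OF tens_bilin[OF M0 A_VS] gen_closed[OF x]] Ed(1)]) (use fc[OF x] Ed(2) M0 in auto)
      also have "\<dots> = (\<Oplus>\<^bsub>?P\<^esub>e\<in>E. f (cls1 (es e) (y x)) \<odot>\<^bsub>?P\<^esub> tens K M0 (acomp A 1) e (gen x))"
        by (rule VS_finsum_cong[OF P refl])
           (use fc[OF x] Ed(2) P gen_closed[OF x] bilin_adds(3)[OF tens_bilin[OF M0 A_VS]] in auto)
      finally show "T 1 (tens K (C 0) (acomp A 1) (cact 0 (y x) f) (gen x)) = (\<Oplus>\<^bsub>?P\<^esub>e\<in>E. f (cls1 (es e) (y x)) \<odot>\<^bsub>?P\<^esub> tens K M0 (acomp A 1) e (gen x))" .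
    qed
    also have "\<dots> = (\<Oplus>\<^bsub>?P\<^esub>x\<in>X. \<Oplus>\<^bsub>?P\<^esub>e\<in>E. f (cls1 (es e) (y x)) \<odot>\<^bsub>?P\<^esub> embed1 K V R M0 (tens K M0 V e x))"
      by (rule nested_cong[OF P]) (use fc Ed(2) Xd(2) P gen_closed embed_tens in auto)
    also have "\<dots> = embed1 K V R M0 (rel E es f)"
      unfolding rel_def by (rule lin_nested_sum[symmetric, OF VS_tensor[OF M0 V] P embed_lin Xd(1) Ed(1) fc]) (use Ed(2) Xd(2) in auto)
    finally show ?thesis .
  qed
  define eps where "eps = (\<lambda>i x. act_map K M i (T i x))"
  have eps: "eps \<in> hm A (kos 0) M" unfolding eps_def by (rule hm_comp[OF T(1) act_hm])
  have eps_dgen: "eps 1 (dgen 0 f) = \<zero>\<^bsub>mcomp M 1\<^esub>" if f: "f \<in> carrier (C (Suc 0))" for f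
    using rel_mem[OF E f] unfolding eps_def Td[OF f] by (simp add: mod_rels_def)
  have K: "VS (mcomp (kos n) i)" for n i by (rule gmD(1)[OF kos_gm])
  have eps_d: "eps i (dk 0 i z) = \<zero>\<^bsub>mcomp M i\<^esub>" if z: "z \<in> el (kos (Suc 0)) i" for i z
  proof (rule tensor_lin_eq[OF C_VS A_VS gmD(1)[OF M] lin_comp[OF dk_lin[of 0 i, unfolded kos_comp[of "Suc 0"]] hm_lin[OF eps]] lin_zero_map[OF VS_tensor[OF C_VS A_VS] gmD(1)[OF M]] _ z[unfolded kos_comp]])
    fix f a assume f: "f \<in> carrier (C (Suc 0))" and a: "a \<in> ael A (i - int (Suc 0))"
    let ?s = "int (Suc 0)"
    have "eps (?s + (i - ?s)) (mact (kos 0) ?s (i - ?s) (dgen 0 f) a) = mact M ?s (i - ?s) (eps ?s (dgen 0 f)) a"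
      by (rule hm_act[OF eps lin_closed[OF dgen_lin' f] a])
    also have "\<dots> = \<zero>\<^bsub>mcomp M (?s + (i - ?s))\<^esub>"
      using bilin_zero(1)[OF gmD(1)[OF M] A_VS gmD(1)[OF M] gmD(2)[OF M] a, of ?s] eps_dgen[OF f] by simp
    finally show "eps i (dk 0 i (tens K (C (Suc 0)) (acomp A (i - ?s)) f a)) = \<zero>\<^bsub>mcomp M i\<^esub>"
      unfolding dk_tens_dgen[OF f a] by simp
  qed
  obtain RM where RM: "VectorSpace.subspace K RM (tensor K M0 V)"
    "\<forall>n. a_kernel (mcomp F' n) (mcomp M n) (act_map K M n) = gmod_gen K A F' 1 (embed1 K V R M0 ` RM) n"
    using M_quad unfolding quadratic_module_def Let_def by blast
  have RMc: "RM \<subseteq> carrier (tensor K M0 V)" using RM(1) SUB_subset by (auto simp: subspace_SUB)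
  have eRM: "embed1 K V R M0 ` RM \<subseteq> el F' 1"
    using lin_closed[OF embed_lin] RMc by (auto simp: free_simps1)
  have RM_rels: "RM \<subseteq> mod_rels K V R M"
  proof
    fix r assume r: "r \<in> RM"
    have "embed1 K V R M0 r \<in> a_kernel (mcomp F' 1) (mcomp M 1) (act_map K M 1)"
      using RM(2) gmod_gen_incl[OF F' A eRM] r by blast
    then show "r \<in> mod_rels K V R M" using r RMc by (auto simp: mod_rels_def a_kernel_iff)
  qed
  have ker: "x \<in> dk 0 i ` el (kos (Suc 0)) i" if x: "x \<in> el (kos 0) i" and e: "eps i x = \<zero>\<^bsub>mcomp M i\<^esub>" for i x
  proof -
    \<comment> \<open>The image of the first differential, moved to the free module on the
      generators, is a submodule containing the generating relations, so it contains the whole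
      kernel of the action.\<close>
    have Z: "gsub A F' (\<lambda>n. T n ` dk 0 n ` el (kos (Suc 0)) n)"
      by (rule gsub_image[OF kos_gm F' T(1) gsub_image[OF kos_gm kos_gm dk_hm gsub_carrier[OF kos_gm]]])
    have "embed1 K V R M0 ` RM \<subseteq> T 1 ` dk 0 1 ` el (kos (Suc 0)) 1"
    proof clarify
      fix r assume "r \<in> RM"
      then obtain f where f: "f \<in> carrier (C (Suc 0))" "rel E es f = r" using rel_surj[OF E] RM_rels by blast
      have o: "aone A \<in> ael A (1 - int (Suc 0))" using galgebraD(4)[OF A] by simp
      have "dk 0 1 (tens K (C (Suc 0)) (acomp A (1 - int (Suc 0))) f (aone A)) = dgen 0 f"
        using dk_tens_dgen[OF f(1) o] gmD(3)[OF kos_gm lin_closed[OF dgen_lin' f(1)]] by simp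
      moreover have "tens K (C (Suc 0)) (acomp A (1 - int (Suc 0))) f (aone A) \<in> el (kos (Suc 0)) 1"
        unfolding kos_comp using f o by (intro tens_closed)
      ultimately have "dgen 0 f \<in> dk 0 1 ` el (kos (Suc 0)) 1" by (metis imageI)
      then show "embed1 K V R M0 r \<in> T 1 ` dk 0 1 ` el (kos (Suc 0)) 1"
        using Td[OF f(1)] f(2) by (metis imageI)
    qed
    then have "gmod_gen K A F' 1 (embed1 K V R M0 ` RM) i \<subseteq> T i ` dk 0 i ` el (kos (Suc 0)) i"
      by (rule gmod_gen_least[OF F' Z])
    moreover have "T i x \<in> a_kernel (mcomp F' i) (mcomp M i) (act_map K M i)"
      using hm_closed[OF T(1) x] e by (simp add: a_kernel_iff eps_def)
    ultimately obtain z where z: "z \<in> el (kos (Suc 0)) i" "T i x = T i (dk 0 i z)"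
      using RM(2) by blast
    have "x = dk 0 i z"
      using HT[OF x] HT[OF hm_closed[OF dk_hm z(1)]] unfolding z(2) by (rule trans[OF sym])
    with z show ?thesis by blast
  qed
  have surj: "eps i ` el (kos 0) i = el M i" for i
  proof
    show "eps i ` el (kos 0) i \<subseteq> el M i" using hm_closed[OF eps] by blast
    show "el M i \<subseteq> eps i ` el (kos 0) i"
    proof
      fix m assume "m \<in> el M i"
      then obtain t where t: "t \<in> el F' i" "m = act_map K M i t" using M_surj[of i] by blast
      then have "m = eps i (H i t)" using TH by (simp add: eps_def)
      then show "m \<in> eps i ` el (kos 0) i" using hm_closed[OF H(1) t(1)] by blast
    qed
  qed
  show thesis
    using that[OF eps] surj ker eps_d by blast
qed

end

section \<open>Lifting the homology of the Koszul complexes\<close>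

context kfield
begin

lemma SUB_in_SUB:
  assumes "SUB B U" "SUB C U" "VS U" "B \<subseteq> C"
  shows "SUB B (U\<lparr>carrier := C\<rparr>)"
  by (rule SUB_I) (use assms in \<open>auto simp: SUB_VS SUB_zero SUB_add SUB_smult\<close>)

lemma dirsum_sum:
  assumes "finite I" "galgebra A" "\<forall>i\<in>I. gm A (F i)" "\<And>i. i \<in> I \<Longrightarrow> x i \<in> el (F i) n"
  shows "finsum (mcomp (gmod_dirsum I F) n) (\<lambda>i. dinj I F i n (x i)) I = (\<lambda>i\<in>I. x i)"
    and "(\<lambda>i\<in>I. x i) \<in> el (gmod_dirsum I F) n"
proof -
  show c: "(\<lambda>i\<in>I. x i) \<in> el (gmod_dirsum I F) n"
    using assms by (auto simp: dirsum_carrier)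
  have "VS (mcomp (gmod_dirsum I F) n)" using gmD(1)[OF gm_dirsum[OF assms(1-3)]] .
  then have "finsum (mcomp (gmod_dirsum I F) n) (\<lambda>i. dinj I F i n (x i)) I
    = finsum (mcomp (gmod_dirsum I F) n) (\<lambda>i. dinj I F i n ((\<lambda>i\<in>I. x i) i)) I"
    by (rule VS_finsum_cong) (use hm_closed[OF hm_dinj[OF assms(1-3)]] assms(4) in auto)
  then show "finsum (mcomp (gmod_dirsum I F) n) (\<lambda>i. dinj I F i n (x i)) I = (\<lambda>i\<in>I. x i)"
    using dirsum_decomp[OF assms(1-3) c] by simp
qed

text \<open>A finite family of modules, each covered by a free module generated in a single degree.
  In the application the indices are arrows and \<open>e\<close> comes from the augmentations of
  their targets.\<close>

definition aug_cover :: "('k, 'a) galg \<Rightarrow> 'i set \<Rightarrow> ('i \<Rightarrow> ('k, 'a, 'm) gmod) \<Rightarrow> ('i \<Rightarrow> ('k, 'u) module) \<Rightarrow> ('i \<Rightarrow> int)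
    \<Rightarrow> ('i \<Rightarrow> int \<Rightarrow> ('u \<times> 'a \<Rightarrow> 'k) set \<Rightarrow> 'm) \<Rightarrow> bool" where
  "aug_cover A I F W s e \<longleftrightarrow> finite I \<and> (\<forall>t\<in>I. gm A (F t) \<and> VS (W t) \<and>
     e t \<in> hm A (gmod_shift (gmod_free K (W t) A) (s t)) (F t) \<and>
     (\<forall>n. e t n ` el (gmod_shift (gmod_free K (W t) A) (s t)) n = el (F t) n))"

text \<open>
  Lifts of the generators of a submodule (indexed by \<open>I\<close>) and of the quotient by it (indexed by \<open>J\<close>) of
  \<open>Z/B\<close>; \<open>D t\<close> is the kernel of the map from \<open>P t\<close> onto the \<open>t\<close>-th summand. The fourth clause is injectivity
  of the submodule, the last one says that the relations of the quotient hold up to elements of the submodule.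
\<close>

definition lifting where
  "lifting A L Z B I J P D g \<longleftrightarrow>
    (\<forall>t\<in>I \<union> J. g t \<in> hm A (P t) L) \<and>
    (\<forall>t\<in>I \<union> J. \<forall>n. \<forall>p\<in>el (P t) n. g t n p \<in> Z n) \<and>
    (\<forall>n. \<forall>z\<in>Z n. \<exists>u. \<exists>b\<in>B n. (\<forall>t\<in>I \<union> J. u t \<in> el (P t) n) \<and>
      z = b \<oplus>\<^bsub>mcomp L n\<^esub> finsum (mcomp L n) (\<lambda>t. g t n (u t)) (I \<union> J)) \<and>
    (\<forall>n u. (\<forall>t\<in>I \<union> J. u t \<in> el (P t) n) \<longrightarrow> finsum (mcomp L n) (\<lambda>t. g t n (u t)) (I \<union> J) \<in> B n \<longrightarrow>
      (\<forall>t\<in>I \<union> J. t \<in> J \<or> (\<forall>t\<in>J. u t = \<zero>\<^bsub>mcomp (P t) n\<^esub>) \<longrightarrow> u t \<in> D t n)) \<and>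
    (\<forall>t\<in>I \<union> J. \<forall>n. \<forall>w\<in>D t n. \<exists>u. \<exists>b\<in>B n.
      (\<forall>t'\<in>I \<union> J. u t' \<in> el (P t') n \<and> (\<not> (t \<in> J \<and> t' \<in> I) \<longrightarrow> u t' = \<zero>\<^bsub>mcomp (P t') n\<^esub>)) \<and>
      g t n w = b \<oplus>\<^bsub>mcomp L n\<^esub> finsum (mcomp L n) (\<lambda>t. g t n (u t)) (I \<union> J))"

lemma lifting_cong:
  assumes l: "lifting A L Z B I J P D g" and P: "\<And>t. t \<in> I \<union> J \<Longrightarrow> P' t = P t" and D: "\<And>t n. t \<in> I \<union> J \<Longrightarrow> D' t n = D t n"
  shows "lifting A L Z B I J P' D' g"
proof -
  have J: "t \<in> J \<Longrightarrow> t \<in> I \<union> J" for t by simp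
  have "lifting A L Z B I J P' D' g \<longleftrightarrow> lifting A L Z B I J P D g"
    unfolding lifting_def by (simp only: P D J cong: ball_cong)
  then show ?thesis using l by simp
qed

text \<open>For indices in \<open>I\<close> the map into the submodule of \<open>Z/B\<close> is
  lifted to \<open>Z\<close>; for indices in \<open>J\<close> only the image in the quotient can be
  prescribed. Because of this asymmetry the relations of the \<open>J\<close> part hold only up to
  the \<open>I\<close> part, and the components in \<open>I\<close> are controlled only once those
  in \<open>J\<close> vanish.\<close>

lemma ses_lift:
  assumes A: "galgebra A" and L: "gm A L" and Z: "gsub A L Z" and B: "gsub A L B" and BZ: "\<And>n. B n \<subseteq> Z n"
    and cov: "aug_cover A (I \<union> J) F W s e" and IJ: "I \<inter> J = {}"
    and ex: "short_exact K A (gmod_dirsum I F) (gmod_quot (gmod_sub L Z) B) (gmod_dirsum J F) \<phi> \<psi>"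
  defines "P t \<equiv> gmod_shift (gmod_free K (W t) A) (s t)"
  shows "\<exists>g. lifting A L Z B I J P (\<lambda>t n. {p \<in> el (P t) n. e t n p = \<zero>\<^bsub>mcomp (F t) n\<^esub>}) g"
proof -
  let ?S = "gmod_sub L Z" and ?X = "gmod_dirsum I F" and ?Y = "gmod_dirsum J F"
  let ?H = "gmod_quot ?S B"
  let ?\<pi> = "\<lambda>n x. B n +>\<^bsub>mcomp ?S n\<^esub> x"
  have I: "finite I" "\<forall>t\<in>I. gm A (F t)" "\<And>t. t \<in> I \<Longrightarrow> VS (W t)" "\<And>t. t \<in> I \<Longrightarrow> e t \<in> hm A (P t) (F t)"
      "\<And>t n. t \<in> I \<Longrightarrow> e t n ` el (P t) n = el (F t) n"
    using cov unfolding aug_cover_def P_def by auto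
  have J: "finite J" "\<forall>t\<in>J. gm A (F t)" "\<And>t. t \<in> J \<Longrightarrow> VS (W t)" "\<And>t. t \<in> J \<Longrightarrow> e t \<in> hm A (P t) (F t)"
      "\<And>t n. t \<in> J \<Longrightarrow> e t n ` el (P t) n = el (F t) n"
    using cov unfolding aug_cover_def P_def by auto
  have S: "gm A ?S" using L Z by (rule gm_sub)
  have BS: "gsub A ?S B"
    using SUB_in_SUB[OF gsubD(1)[OF B] gsubD(1)[OF Z] gmD(1)[OF L] BZ] gsubD(2)[OF B] by (simp add: gsub_def)
  have H: "gm A ?H" using S A BS by (rule gm_quot)
  have X: "gm A ?X" and Y: "gm A ?Y" using gm_dirsum[OF I(1) A I(2)] gm_dirsum[OF J(1) A J(2)] .
  have VSS: "VS (mcomp ?S n)" and VL: "VS (mcomp L n)" and VH: "VS (mcomp ?H n)" and VX: "VS (mcomp ?X n)" and VY: "VS (mcomp ?Y n)" for n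
    using gmD(1)[OF S] gmD(1)[OF L] gmD(1)[OF H] gmD(1)[OF X] gmD(1)[OF Y] by auto
  have pi: "?\<pi> \<in> hm A ?S ?H" using S BS by (rule hm_quot_proj)
  have pi_surj: "?\<pi> n ` el ?S n = el ?H n" for n
    by (simp only: quot_simps quot_carrier)
  have pi_zero: "?\<pi> n x = \<zero>\<^bsub>mcomp ?H n\<^esub> \<longleftrightarrow> x \<in> B n" if "x \<in> Z n" for n x
    using quot_kernel[OF VSS gsubD(1)[OF BS], of x n] that by simp
  have phi: "\<phi> \<in> hm A ?X ?H" and psi: "\<psi> \<in> hm A ?H ?Y"
    and inj: "\<And>n. inj_on (\<phi> n) (el ?X n)"
    and mid: "\<And>n. \<phi> n ` el ?X n = a_kernel (mcomp ?H n) (mcomp ?Y n) (\<psi> n)"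
    and surj: "\<And>n. \<psi> n ` el ?H n = el ?Y n"
    using ex unfolding short_exact_def by auto
  note psipi = hm_comp[OF pi psi]
  note dI = hm_dinj[OF I(1) A I(2)] and dJ = hm_dinj[OF J(1) A J(2)]
  have "\<exists>l\<in>hm A (P t) ?S. \<forall>n. \<forall>p\<in>el (P t) n. ?\<pi> n (l n p) = \<phi> n (dinj I F t n (e t n p))" if t: "t \<in> I" for t
  proof -
    have f: "(\<lambda>n p. \<phi> n (dinj I F t n (e t n p))) \<in> hm A (P t) ?H"
      by (rule hm_comp[OF hm_comp[OF I(4)[OF t] dI[OF t]] phi])
    show ?thesis
      unfolding P_def by (rule free_lift[OF A I(3)[OF t] S H pi f[unfolded P_def]])
        (use hm_closed[OF f, unfolded P_def] pi_surj in blast)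
  qed
  then obtain g where g: "\<And>t. t \<in> I \<Longrightarrow> g t \<in> hm A (P t) ?S"
    "\<And>t n p. t \<in> I \<Longrightarrow> p \<in> el (P t) n \<Longrightarrow> ?\<pi> n (g t n p) = \<phi> n (dinj I F t n (e t n p))"
    by metis
  have "\<exists>l\<in>hm A (P t) ?S. \<forall>n. \<forall>p\<in>el (P t) n. \<psi> n (?\<pi> n (l n p)) = dinj J F t n (e t n p)" if t: "t \<in> J" for t
  proof -
    have f: "(\<lambda>n p. dinj J F t n (e t n p)) \<in> hm A (P t) ?Y"
      by (rule hm_comp[OF J(4)[OF t] dJ[OF t]])
    show ?thesis
      unfolding P_def
    proof (rule free_lift[OF A J(3)[OF t] S Y psipi f[unfolded P_def]])
      fix n p assume "p \<in> el (gmod_shift (gmod_free K (W t) A) (s t)) n"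
      then have "dinj J F t n (e t n p) \<in> \<psi> n ` ?\<pi> n ` el ?S n"
        using hm_closed[OF f] unfolding pi_surj surj P_def by blast
      then show "dinj J F t n (e t n p) \<in> (\<lambda>x. \<psi> n (?\<pi> n x)) ` el ?S n"
        by (simp only: image_image)
    qed
  qed
  then obtain g' where g': "\<And>t. t \<in> J \<Longrightarrow> g' t \<in> hm A (P t) ?S"
    "\<And>t n p. t \<in> J \<Longrightarrow> p \<in> el (P t) n \<Longrightarrow> \<psi> n (?\<pi> n (g' t n p)) = dinj J F t n (e t n p)"
    by metis
  have gc: "g t n p \<in> Z n" if "t \<in> I" "p \<in> el (P t) n" for t n p
    using hm_closed[OF g(1)[OF that(1)] that(2)] by simp
  have gc': "g' t n p \<in> Z n" if "t \<in> J" "p \<in> el (P t) n" for t n p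
    using hm_closed[OF g'(1)[OF that(1)] that(2)] by simp
  note Zs = SUB_subset[OF gsubD(1)[OF Z]] and Z_sub = gsubD(1)[OF Z]
  have cZ: "el ?S n = Z n" for n by simp
  have incl: "(\<lambda>x. x) \<in> lin (mcomp ?S n) (mcomp L n)" for n using hm_lin[OF hm_sub_incl[OF Z]] .
  let ?s = "\<lambda>n u. finsum (mcomp L n) (\<lambda>t. g t n (u t)) I" and ?s' = "\<lambda>n v. finsum (mcomp L n) (\<lambda>t. g' t n (v t)) J"
  have sZ: "?s n u \<in> Z n \<and> ?\<pi> n (?s n u) = \<phi> n (\<lambda>t\<in>I. e t n (u t)) \<and> (\<lambda>t\<in>I. e t n (u t)) \<in> el ?X n"
    if u: "\<And>t. t \<in> I \<Longrightarrow> u t \<in> el (P t) n" for n u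
  proof (intro conjI)
    have eu: "e t n (u t) \<in> el (F t) n" if "t \<in> I" for t using hm_closed[OF I(4)[OF that] u[OF that]] .
    show "?s n u \<in> Z n" using gc u by (intro SUB_finsum[OF VL Z_sub I(1)]) blast
    show "(\<lambda>t\<in>I. e t n (u t)) \<in> el ?X n" by (rule dirsum_sum(2)[OF I(1) A I(2) eu])
    have gcS: "g t n (u t) \<in> el ?S n" if "t \<in> I" for t using gc[OF that u[OF that]] by simp
    have "?s n u = finsum (mcomp ?S n) (\<lambda>t. g t n (u t)) I"
      by (rule lin_finsum[OF VSS VL incl I(1) gcS, symmetric])
    then have "?\<pi> n (?s n u) = finsum (mcomp ?H n) (\<lambda>t. ?\<pi> n (g t n (u t))) I"
      using lin_finsum[OF VSS VH hm_lin[OF pi] I(1) gcS] by simp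
    also have "\<dots> = finsum (mcomp ?H n) (\<lambda>t. \<phi> n (dinj I F t n (e t n (u t)))) I"
      by (rule VS_finsum_cong[OF VH refl hm_closed[OF phi hm_closed[OF dI eu]] g(2)[OF _ u]])
    also have "\<dots> = \<phi> n (finsum (mcomp ?X n) (\<lambda>t. dinj I F t n (e t n (u t))) I)"
      by (rule lin_finsum[OF VX VH hm_lin[OF phi] I(1) hm_closed[OF dI eu], symmetric])
    also have "\<dots> = \<phi> n (\<lambda>t\<in>I. e t n (u t))" using dirsum_sum(1)[OF I(1) A I(2) eu] by simp
    finally show "?\<pi> n (?s n u) = \<phi> n (\<lambda>t\<in>I. e t n (u t))" .
  qed
  have sZ': "?s' n v \<in> Z n \<and> \<psi> n (?\<pi> n (?s' n v)) = (\<lambda>t\<in>J. e t n (v t))"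
    if v: "\<And>t. t \<in> J \<Longrightarrow> v t \<in> el (P t) n" for n v
  proof
    have eu: "e t n (v t) \<in> el (F t) n" if "t \<in> J" for t using hm_closed[OF J(4)[OF that] v[OF that]] .
    show "?s' n v \<in> Z n" using gc' v by (intro SUB_finsum[OF VL Z_sub J(1)]) blast
    have gcS: "g' t n (v t) \<in> el ?S n" if "t \<in> J" for t using gc'[OF that v[OF that]] by simp
    have "?s' n v = finsum (mcomp ?S n) (\<lambda>t. g' t n (v t)) J"
      by (rule lin_finsum[OF VSS VL incl J(1) gcS, symmetric])
    then have "\<psi> n (?\<pi> n (?s' n v)) = finsum (mcomp ?Y n) (\<lambda>t. \<psi> n (?\<pi> n (g' t n (v t)))) J"
      using lin_finsum[OF VSS VY hm_lin[OF psipi] J(1) gcS] by simp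
    also have "\<dots> = finsum (mcomp ?Y n) (\<lambda>t. dinj J F t n (e t n (v t))) J"
      by (rule VS_finsum_cong[OF VY refl hm_closed[OF dJ eu] g'(2)[OF _ v]])
    also have "\<dots> = (\<lambda>t\<in>J. e t n (v t))" by (rule dirsum_sum(1)[OF J(1) A J(2) eu])
    finally show "\<psi> n (?\<pi> n (?s' n v)) = (\<lambda>t\<in>J. e t n (v t))" .
  qed
  have psiphi: "\<psi> n (\<phi> n x) = \<zero>\<^bsub>mcomp ?Y n\<^esub>" if "x \<in> el ?X n" for n x
    using mid[of n] that by (auto simp: a_kernel_iff)
  have pi_add: "?\<pi> n (x \<oplus>\<^bsub>mcomp L n\<^esub> y) = ?\<pi> n x \<oplus>\<^bsub>mcomp ?H n\<^esub> ?\<pi> n y" if "x \<in> Z n" "y \<in> Z n" for n x y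
    using lin_add[OF hm_lin[OF pi], of x n y] that by simp
  have pi_c: "?\<pi> n x \<in> el ?H n" if "x \<in> Z n" for n x
    using hm_closed[OF pi, of x n] that by simp
  have pi_eq: "x \<ominus>\<^bsub>mcomp L n\<^esub> y \<in> B n" if "x \<in> Z n" "y \<in> Z n" "?\<pi> n x = ?\<pi> n y" for n x y
  proof -
    have "?\<pi> n (x \<ominus>\<^bsub>mcomp L n\<^esub> y \<oplus>\<^bsub>mcomp L n\<^esub> y) = ?\<pi> n (x \<ominus>\<^bsub>mcomp L n\<^esub> y) \<oplus>\<^bsub>mcomp ?H n\<^esub> ?\<pi> n y"
      using that by (intro pi_add SUB_minus[OF VL Z_sub])
    then have "?\<pi> n y = ?\<pi> n (x \<ominus>\<^bsub>mcomp L n\<^esub> y) \<oplus>\<^bsub>mcomp ?H n\<^esub> ?\<pi> n y"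
      using that Zs VL by (simp only: VS_cancel(2)[OF VL Zs Zs])
    then have "?\<pi> n (x \<ominus>\<^bsub>mcomp L n\<^esub> y) = ?\<pi> n y \<ominus>\<^bsub>mcomp ?H n\<^esub> ?\<pi> n y"
      using VS_cancel(4)[OF VH pi_c[OF SUB_minus[OF VL Z_sub that(1,2)]] pi_c[OF that(2)]] by simp
    then have "?\<pi> n (x \<ominus>\<^bsub>mcomp L n\<^esub> y) = \<zero>\<^bsub>mcomp ?H n\<^esub>"
      using VS_add(5)[OF VH pi_c[OF that(2)]] by simp
    then show ?thesis using pi_zero[OF SUB_minus[OF VL Z_sub that(1,2)]] by simp
  qed
  \<comment> \<open>An element of \<open>Z\<close> whose class dies in the quotient comes from the
    submodule, hence is a combination of the \<open>I\<close> lifts modulo \<open>B\<close>.\<close>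
  have lift_X: "\<exists>u. (\<forall>t\<in>I. u t \<in> el (P t) n) \<and> z \<ominus>\<^bsub>mcomp L n\<^esub> ?s n u \<in> B n"
    if z: "z \<in> Z n" and k: "\<psi> n (?\<pi> n z) = \<zero>\<^bsub>mcomp ?Y n\<^esub>" for n z
  proof -
    have "?\<pi> n z \<in> a_kernel (mcomp ?H n) (mcomp ?Y n) (\<psi> n)" using pi_c[OF z] k by (simp only: a_kernel_iff)
    then obtain x where x: "x \<in> el ?X n" "?\<pi> n z = \<phi> n x" using mid[of n] by blast
    have "\<exists>u\<in>el (P t) n. e t n u = x t" if "t \<in> I" for t
    proof -
      have "x t \<in> el (F t) n" using x(1) that by (auto simp: dirsum_carrier[OF I(1)])
      then show ?thesis using I(5)[OF that, of n] by (metis imageE)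
    qed
    then obtain u where u: "\<And>t. t \<in> I \<Longrightarrow> u t \<in> el (P t) n" "\<And>t. t \<in> I \<Longrightarrow> e t n (u t) = x t" by metis
    have "(\<lambda>t\<in>I. e t n (u t)) = x"
      by (rule dirsum_ext[OF I(1) _ x(1)]) (use sZ[OF u(1)] u(2) in auto)
    then have "?\<pi> n z = ?\<pi> n (?s n u)" using sZ[OF u(1)] x(2) by metis
    then have "z \<ominus>\<^bsub>mcomp L n\<^esub> ?s n u \<in> B n" using pi_eq[OF z] sZ[OF u(1)] by blast
    then show ?thesis using u(1) by blast
  qed
  define h where "h = (\<lambda>t. if t \<in> J then g' t else g t)"
  have h: "t \<in> I \<Longrightarrow> h t = g t" "t \<in> J \<Longrightarrow> h t = g' t" for t using IJ by (auto simp: h_def)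
  have hc: "h t n p \<in> Z n" if "t \<in> I \<union> J" "p \<in> el (P t) n" for t n p
    using that gc gc' h by (metis UnE)
  have hm: "h t \<in> hm A (P t) ?S" if "t \<in> I \<union> J" for t
    using that g(1) g'(1) h by (metis UnE)
  have VP: "VS (mcomp (P t) n)" if "t \<in> I \<union> J" for t n
    using that I(3) J(3) gmD(1)[OF gm_shift[OF gm_free[OF A]]] unfolding P_def by blast
  have h0: "h t n \<zero>\<^bsub>mcomp (P t) n\<^esub> = \<zero>\<^bsub>mcomp L n\<^esub>" if "t \<in> I \<union> J" for t n
    using lin_zero[OF VP[OF that] VSS hm_lin[OF hm[OF that]]] by simp
  let ?h = "\<lambda>n w. finsum (mcomp L n) (\<lambda>t. h t n (w t)) (I \<union> J)"
  have hs: "?h n w = ?s n u \<oplus>\<^bsub>mcomp L n\<^esub> ?s' n v"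
    if u: "\<And>t. t \<in> I \<Longrightarrow> w t = u t" "\<And>t. t \<in> I \<Longrightarrow> u t \<in> el (P t) n"
      and v: "\<And>t. t \<in> J \<Longrightarrow> w t = v t" "\<And>t. t \<in> J \<Longrightarrow> v t \<in> el (P t) n" for n u v w
  proof -
    interpret U: vectorspace K "mcomp L n" by (rule VL)
    have "?h n w = finsum (mcomp L n) (\<lambda>t. h t n (w t)) I \<oplus>\<^bsub>mcomp L n\<^esub> finsum (mcomp L n) (\<lambda>t. h t n (w t)) J"
      using u v Zs[OF hc] by (intro U.finsum_Un_disjoint I(1) J(1) IJ) auto
    moreover have "finsum (mcomp L n) (\<lambda>t. h t n (w t)) I = ?s n u"
      by (rule VS_finsum_cong[OF VL refl]) (use gc Zs u h in auto)
    moreover have "finsum (mcomp L n) (\<lambda>t. h t n (w t)) J = ?s' n v"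
      by (rule VS_finsum_cong[OF VL refl]) (use gc' Zs v h in auto)
    ultimately show ?thesis by simp
  qed
  let ?D = "\<lambda>t n. {p \<in> el (P t) n. e t n p = \<zero>\<^bsub>mcomp (F t) n\<^esub>}"
  show ?thesis
    unfolding lifting_def
  proof (rule exI[of _ h], intro conjI)
    show "\<forall>t\<in>I \<union> J. h t \<in> hm A (P t) L" using hm_comp[OF hm hm_sub_incl[OF Z]] by blast
    show "\<forall>t\<in>I \<union> J. \<forall>n. \<forall>p\<in>el (P t) n. h t n p \<in> Z n" using hc by blast
    show "\<forall>n. \<forall>z\<in>Z n. \<exists>u. \<exists>b\<in>B n. (\<forall>t\<in>I \<union> J. u t \<in> el (P t) n) \<and> z = b \<oplus>\<^bsub>mcomp L n\<^esub> ?h n u"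
    proof (intro allI ballI)
      fix n z assume z: "z \<in> Z n"
      \<comment> \<open>The component in the quotient is removed first, using lifts indexed by
        \<open>J\<close>; the remainder then falls under \<open>lift_X\<close>.\<close>
      let ?y = "\<psi> n (?\<pi> n z)"
      have y: "?y \<in> el ?Y n" using hm_closed[OF psi pi_c[OF z]] .
      have "\<exists>u\<in>el (P t) n. e t n u = ?y t" if "t \<in> J" for t
      proof -
        have "?y t \<in> e t n ` el (P t) n"
          unfolding J(5)[OF that] using y that unfolding dirsum_carrier[OF J(1)] by blast
        then obtain u where "u \<in> el (P t) n" "?y t = e t n u" by blast
        then show ?thesis by (intro bexI[of _ u]) simp_all
      qed
      then obtain v where v: "\<And>t. t \<in> J \<Longrightarrow> v t \<in> el (P t) n" "\<And>t. t \<in> J \<Longrightarrow> e t n (v t) = ?y t" by metis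
      have eu: "e t n (v t) \<in> el (F t) n" if "t \<in> J" for t using hm_closed[OF J(4)[OF that] v(1)[OF that]] .
      have "(\<lambda>t\<in>J. e t n (v t)) = ?y"
        by (rule dirsum_ext[OF J(1) dirsum_sum(2)[OF J(1) A J(2) eu] y]) (use v(2) in auto)
      then have eq: "\<psi> n (?\<pi> n (?s' n v)) = ?y" and s': "?s' n v \<in> Z n" using sZ'[OF v(1)] by auto
      have z': "z \<ominus>\<^bsub>mcomp L n\<^esub> ?s' n v \<in> Z n" using SUB_minus[OF VL Z_sub z s'] .
      have "?y = \<psi> n (?\<pi> n (z \<ominus>\<^bsub>mcomp L n\<^esub> ?s' n v \<oplus>\<^bsub>mcomp L n\<^esub> ?s' n v))"
        using VS_cancel(2)[OF VL Zs[OF z] Zs[OF s']] by simp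
      also have "\<dots> = \<psi> n (?\<pi> n (z \<ominus>\<^bsub>mcomp L n\<^esub> ?s' n v)) \<oplus>\<^bsub>mcomp ?Y n\<^esub> ?y"
        unfolding pi_add[OF z' s'] lin_add[OF hm_lin[OF psi] pi_c[OF z'] pi_c[OF s']] eq ..
      finally have "\<psi> n (?\<pi> n (z \<ominus>\<^bsub>mcomp L n\<^esub> ?s' n v)) = \<zero>\<^bsub>mcomp ?Y n\<^esub>"
        using VS_cancel(4)[OF VY hm_closed[OF psi pi_c[OF z']] y] VS_add(5)[OF VY y] by simp
      then obtain u where u: "\<forall>t\<in>I. u t \<in> el (P t) n"
        "z \<ominus>\<^bsub>mcomp L n\<^esub> ?s' n v \<ominus>\<^bsub>mcomp L n\<^esub> ?s n u \<in> B n" using lift_X[OF z'] by blast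
      have s: "?s n u \<in> Z n" using sZ u(1) by blast
      have "z = (z \<ominus>\<^bsub>mcomp L n\<^esub> ?s' n v \<ominus>\<^bsub>mcomp L n\<^esub> ?s n u) \<oplus>\<^bsub>mcomp L n\<^esub> (?s n u \<oplus>\<^bsub>mcomp L n\<^esub> ?s' n v)"
        using VS_ac(1)[OF VL, symmetric] VS_cancel(2)[OF VL] Zs[OF z] Zs[OF s] Zs[OF s'] Zs[OF z'] VL by simp
      moreover have "?h n (\<lambda>t. if t \<in> J then v t else u t) = ?s n u \<oplus>\<^bsub>mcomp L n\<^esub> ?s' n v"
        by (rule hs) (use u(1) v(1) IJ in auto)
      ultimately show "\<exists>u. \<exists>b\<in>B n. (\<forall>t\<in>I \<union> J. u t \<in> el (P t) n) \<and> z = b \<oplus>\<^bsub>mcomp L n\<^esub> ?h n u"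
        using u v(1) by (intro exI[of _ "\<lambda>t. if t \<in> J then v t else u t"] bexI[OF _ u(2)]) auto
    qed
    show "\<forall>n u. (\<forall>t\<in>I \<union> J. u t \<in> el (P t) n) \<longrightarrow> ?h n u \<in> B n \<longrightarrow>
      (\<forall>t\<in>I \<union> J. t \<in> J \<or> (\<forall>t\<in>J. u t = \<zero>\<^bsub>mcomp (P t) n\<^esub>) \<longrightarrow> u t \<in> ?D t n)"
    proof (intro allI impI ballI)
      fix n u t assume w: "\<forall>t\<in>I \<union> J. u t \<in> el (P t) n" and "?h n u \<in> B n"
        and t: "t \<in> I \<union> J" and or: "t \<in> J \<or> (\<forall>t\<in>J. u t = \<zero>\<^bsub>mcomp (P t) n\<^esub>)"
      then have b: "?s n u \<oplus>\<^bsub>mcomp L n\<^esub> ?s' n u \<in> B n" using hs[of u u n u] by auto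
      have s: "?s n u \<in> Z n" "?\<pi> n (?s n u) = \<phi> n (\<lambda>t\<in>I. e t n (u t))" "(\<lambda>t\<in>I. e t n (u t)) \<in> el ?X n"
        using sZ w by blast+
      have s': "?s' n u \<in> Z n" "\<psi> n (?\<pi> n (?s' n u)) = (\<lambda>t\<in>J. e t n (u t))" using sZ' w by blast+
      have yc: "(\<lambda>t\<in>J. e t n (u t)) \<in> el ?Y n" using hm_closed[OF psi pi_c[OF s'(1)]] s'(2) by simp
      have 0: "?\<pi> n (?s n u) \<oplus>\<^bsub>mcomp ?H n\<^esub> ?\<pi> n (?s' n u) = \<zero>\<^bsub>mcomp ?H n\<^esub>"
        using pi_add[OF s(1) s'(1)] pi_zero[OF SUB_add[OF Z_sub s(1) s'(1)]] b by simp
      then have "\<psi> n (?\<pi> n (?s n u)) \<oplus>\<^bsub>mcomp ?Y n\<^esub> \<psi> n (?\<pi> n (?s' n u)) = \<zero>\<^bsub>mcomp ?Y n\<^esub>"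
        using lin_add[OF hm_lin[OF psi] pi_c[OF s(1)] pi_c[OF s'(1)]] lin_zero[OF VH VY hm_lin[OF psi]] by simp
      \<comment> \<open>Applying \<open>\<psi>\<close> erases the \<open>I\<close> part, so the
        \<open>J\<close> components are relations in every case. For the \<open>I\<close> components
        injectivity of \<open>\<phi>\<close> is used, after the \<open>J\<close> components have
        been assumed zero.\<close>
      then have y0: "(\<lambda>t\<in>J. e t n (u t)) = \<zero>\<^bsub>mcomp ?Y n\<^esub>"
        using psiphi[OF s(3)] yc VY unfolding s(2) s'(2) by simp
      have "e t n (u t) = \<zero>\<^bsub>mcomp (F t) n\<^esub>" if "t \<in> J" for t
        using fun_cong[OF y0, of t] that by (simp add: dirsum_simps)
      moreover have "e t n (u t) = \<zero>\<^bsub>mcomp (F t) n\<^esub>" if vz: "\<forall>t\<in>J. u t = \<zero>\<^bsub>mcomp (P t) n\<^esub>" and t: "t \<in> I" for t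
      proof -
        have "g' t n (u t) = \<zero>\<^bsub>mcomp L n\<^esub>" if "t \<in> J" for t
          using h0[of t n] h(2)[OF that] vz that by simp
        then have "?s' n u = \<zero>\<^bsub>mcomp L n\<^esub>" by (rule VS_finsum_zero[OF VL])
        then have "?s n u \<in> B n" using b Zs[OF s(1)] VL by simp
        then have "\<phi> n (\<lambda>t\<in>I. e t n (u t)) = \<phi> n \<zero>\<^bsub>mcomp ?X n\<^esub>"
          using pi_zero[OF s(1)] s(2) lin_zero[OF VX VH hm_lin[OF phi]] by simp
        then have "(\<lambda>t\<in>I. e t n (u t)) = \<zero>\<^bsub>mcomp ?X n\<^esub>"
          using inj_onD[OF inj[of n] _ s(3) VS_closed(1)[OF VX]] by blast
        from fun_cong[OF this, of t] t show ?thesis by (simp add: dirsum_simps)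
      qed
      ultimately show "u t \<in> ?D t n" using or t w by blast
    qed
    show "\<forall>t\<in>I \<union> J. \<forall>n. \<forall>w\<in>?D t n. \<exists>u. \<exists>b\<in>B n.
      (\<forall>t'\<in>I \<union> J. u t' \<in> el (P t') n \<and> (\<not> (t \<in> J \<and> t' \<in> I) \<longrightarrow> u t' = \<zero>\<^bsub>mcomp (P t') n\<^esub>)) \<and>
      h t n w = b \<oplus>\<^bsub>mcomp L n\<^esub> ?h n u"
    proof (intro ballI allI)
      fix t n w assume "t \<in> I \<union> J" and w': "w \<in> ?D t n"
      let ?z = "\<lambda>t. \<zero>\<^bsub>mcomp (P t) n\<^esub>"
      from \<open>t \<in> I \<union> J\<close> show "\<exists>u. \<exists>b\<in>B n.
        (\<forall>t'\<in>I \<union> J. u t' \<in> el (P t') n \<and> (\<not> (t \<in> J \<and> t' \<in> I) \<longrightarrow> u t' = \<zero>\<^bsub>mcomp (P t') n\<^esub>)) \<and>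
        h t n w = b \<oplus>\<^bsub>mcomp L n\<^esub> ?h n u"
      proof
        assume t: "t \<in> I"
        have w: "w \<in> el (P t) n" "e t n w = \<zero>\<^bsub>mcomp (F t) n\<^esub>" using w' by auto
        have "dinj I F t n (e t n w) = \<zero>\<^bsub>mcomp ?X n\<^esub>"
          using lin_zero[OF gmD(1)[OF bspec[OF I(2) t]] VX hm_lin[OF dI[OF t]]] w(2) by simp
        then have "h t n w \<in> B n"
          using g(2)[OF t w(1)] lin_zero[OF VX VH hm_lin[OF phi]] pi_zero[OF gc[OF t w(1)]] h(1)[OF t] by simp
        moreover have "?h n ?z = \<zero>\<^bsub>mcomp L n\<^esub>" by (rule VS_finsum_zero[OF VL h0])
        ultimately show ?thesis
          using VP Zs[OF hc[OF UnI1[OF t] w(1)]] VL by (intro exI[of _ ?z] bexI[of _ "h t n w"]) auto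
      next
        assume t: "t \<in> J"
        have w: "w \<in> el (P t) n" "e t n w = \<zero>\<^bsub>mcomp (F t) n\<^esub>" using w' by auto
        have "dinj J F t n (e t n w) = \<zero>\<^bsub>mcomp ?Y n\<^esub>"
          using lin_zero[OF gmD(1)[OF bspec[OF J(2) t]] VY hm_lin[OF dJ[OF t]]] w(2) by simp
        then obtain u where u: "\<forall>t\<in>I. u t \<in> el (P t) n" "g' t n w \<ominus>\<^bsub>mcomp L n\<^esub> ?s n u \<in> B n"
          using lift_X[OF gc'[OF t w(1)]] g'(2)[OF t w(1)] by auto
        have s: "?s n u \<in> Z n" using sZ u(1) by blast
        let ?u = "\<lambda>t. if t \<in> J then ?z t else u t"
        have "?s' n ?z = \<zero>\<^bsub>mcomp L n\<^esub>" using h0 h(2) by (intro VS_finsum_zero[OF VL]) (metis UnCI)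
        moreover have "?h n ?u = ?s n u \<oplus>\<^bsub>mcomp L n\<^esub> ?s' n ?z"
          by (rule hs) (use u(1) VP IJ in auto)
        ultimately have "?h n ?u = ?s n u" using Zs[OF s] VL by simp
        moreover have "g' t n w = (g' t n w \<ominus>\<^bsub>mcomp L n\<^esub> ?s n u) \<oplus>\<^bsub>mcomp L n\<^esub> ?s n u"
          using VS_cancel(2)[OF VL Zs[OF gc'[OF t w(1)]] Zs[OF s]] by simp
        ultimately show ?thesis
          using u(1) VP h(2)[OF t] t by (intro exI[of _ ?u] bexI[OF _ u(2)]) auto
      qed
    qed
  qed
qed

lemma dirsum_cong: "(\<And>t. t \<in> I \<Longrightarrow> F t = G t) \<Longrightarrow> gmod_dirsum I F = gmod_dirsum I G"
  by (auto simp: gmod_dirsum_def fun_eq_iff restrict_def cong: PiE_cong conj_cong)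

lemma dirsum_reindex_hm:
  assumes I: "finite I" and T: "finite T" and A: "galgebra A" and b: "b \<in> T \<rightarrow> I" and F: "\<forall>t\<in>I. gm A (F t)"
  shows "(\<lambda>n f. \<lambda>t\<in>T. f (b t)) \<in> hm A (gmod_dirsum I F) (gmod_dirsum T (\<lambda>t. F (b t)))"
proof (rule hmI)
  fix n
  show "(\<lambda>f. \<lambda>t\<in>T. f (b t)) \<in> lin (mcomp (gmod_dirsum I F) n) (mcomp (gmod_dirsum T (\<lambda>t. F (b t))) n)"
    by (rule linI) (use b in \<open>auto simp: dirsum_carrier[OF I] dirsum_carrier[OF T] dirsum_simps Pi_iff intro!: restrict_ext\<close>)
qed (use b in \<open>auto simp: dirsum_simps Pi_iff intro!: restrict_ext\<close>)

text \<open>The resolving datum indexes summands by triples, the quiver by arrows. The index set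
  enters the carrier of a direct sum, so an explicit isomorphism is needed.\<close>

lemma dirsum_reindex:
  assumes I: "finite I" and A: "galgebra A" and b: "bij_betw b T I" and F: "\<forall>t\<in>I. gm A (F t)"
  obtains r r' where "r \<in> hm A (gmod_dirsum I F) (gmod_dirsum T (\<lambda>t. F (b t)))" "r' \<in> hm A (gmod_dirsum T (\<lambda>t. F (b t))) (gmod_dirsum I F)"
    "\<And>n x. x \<in> el (gmod_dirsum I F) n \<Longrightarrow> r' n (r n x) = x"
    "\<And>n x. x \<in> el (gmod_dirsum T (\<lambda>t. F (b t))) n \<Longrightarrow> r n (r' n x) = x"
proof -
  let ?c = "inv_into T b" and ?G = "\<lambda>t. F (b t)"
  have T: "finite T" using bij_betw_finite[OF b] I by simp
  have c: "?c \<in> I \<rightarrow> T" and bT: "b \<in> T \<rightarrow> I" and bc: "\<And>t. t \<in> I \<Longrightarrow> b (?c t) = t" and cb: "\<And>t. t \<in> T \<Longrightarrow> ?c (b t) = t"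
    using bij_betw_apply[OF bij_betw_inv_into[OF b]] bij_betw_apply[OF b] bij_betw_inv_into_right[OF b] bij_betw_inv_into_left[OF b] by auto
  have G: "\<forall>t\<in>T. gm A (?G t)" using F bT by auto
  have e: "gmod_dirsum I (\<lambda>t. ?G (?c t)) = gmod_dirsum I F" by (rule dirsum_cong) (simp only: bc)
  show thesis
  proof (rule that)
    show "(\<lambda>n f. \<lambda>t\<in>T. f (b t)) \<in> hm A (gmod_dirsum I F) (gmod_dirsum T ?G)" by (rule dirsum_reindex_hm[OF I T A bT F])
    show "(\<lambda>n f. \<lambda>t\<in>I. f (?c t)) \<in> hm A (gmod_dirsum T ?G) (gmod_dirsum I F)"
      using dirsum_reindex_hm[OF T I A c G] unfolding e .
    show "(\<lambda>t\<in>I. (\<lambda>t\<in>T. x (b t)) (?c t)) = x" if x: "x \<in> el (gmod_dirsum I F) n" for n x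
      using x c bc by (auto simp: dirsum_carrier[OF I] PiE_def extensional_def Pi_iff fun_eq_iff)
    show "(\<lambda>t\<in>T. (\<lambda>t\<in>I. x (?c t)) (b t)) = x" if x: "x \<in> el (gmod_dirsum T ?G) n" for n x
      using x bT cb by (auto simp: dirsum_carrier[OF T] PiE_def extensional_def Pi_iff fun_eq_iff)
  qed
qed

lemma short_exact_reindex:
  assumes A: "galgebra A" and I: "finite I" "\<forall>t\<in>I. gm A (F t)" "bij_betw a S I" and J: "finite J" "\<forall>t\<in>J. gm A (F' t)" "bij_betw b T J"
    and H: "gm A H" and ex: "short_exact K A (gmod_dirsum I F) H (gmod_dirsum J F') \<phi> \<psi>"
  shows "\<exists>\<phi> \<psi>. short_exact K A (gmod_dirsum S (\<lambda>t. F (a t))) H (gmod_dirsum T (\<lambda>t. F' (b t))) \<phi> \<psi>"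
proof -
  let ?X = "gmod_dirsum I F" and ?X' = "gmod_dirsum S (\<lambda>t. F (a t))" and ?Y = "gmod_dirsum J F'" and ?Y' = "gmod_dirsum T (\<lambda>t. F' (b t))"
  obtain r r' where r: "r \<in> hm A ?X ?X'" "r' \<in> hm A ?X' ?X" "\<And>n x. x \<in> el ?X n \<Longrightarrow> r' n (r n x) = x"
    "\<And>n x. x \<in> el ?X' n \<Longrightarrow> r n (r' n x) = x"
    using dirsum_reindex[OF I(1) A I(3,2)] by blast
  obtain q q' where q: "q \<in> hm A ?Y ?Y'" "q' \<in> hm A ?Y' ?Y" "\<And>n x. x \<in> el ?Y n \<Longrightarrow> q' n (q n x) = x"
    "\<And>n x. x \<in> el ?Y' n \<Longrightarrow> q n (q' n x) = x"
    using dirsum_reindex[OF J(1) A J(3,2)] by blast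
  have phi: "\<phi> \<in> hm A ?X H" and psi: "\<psi> \<in> hm A H ?Y" and inj: "\<And>n. inj_on (\<phi> n) (el ?X n)"
    and mid: "\<And>n. \<phi> n ` el ?X n = a_kernel (mcomp H n) (mcomp ?Y n) (\<psi> n)"
    and surj: "\<And>n. \<psi> n ` el H n = el ?Y n"
    using ex unfolding short_exact_def by auto
  have T: "finite T" using bij_betw_finite[OF J(3)] J(1) by simp
  have "\<forall>t\<in>T. gm A (F' (b t))" using J(2) bij_betw_apply[OF J(3)] by auto
  note Y = gmD(1)[OF gm_dirsum[OF J(1) A J(2)]] and Y' = gmD(1)[OF gm_dirsum[OF T A this]]
  have ri: "r' n ` el ?X' n = el ?X n" for n
    using hm_closed[OF r(2)] hm_closed[OF r(1)] r(3) by (auto intro!: image_eqI)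
  have qi: "q n ` el ?Y n = el ?Y' n" for n
    using hm_closed[OF q(1)] hm_closed[OF q(2)] q(4) by (auto intro!: image_eqI)
  have z: "q n y' = \<zero>\<^bsub>mcomp ?Y' n\<^esub> \<longleftrightarrow> y' = \<zero>\<^bsub>mcomp ?Y n\<^esub>" if "y' \<in> el ?Y n" for n y'
    using q(3)[OF that] lin_zero[OF Y Y' hm_lin[OF q(1)], of n] lin_zero[OF Y' Y hm_lin[OF q(2)], of n] by metis
  have "inj_on (\<lambda>x. \<phi> n (r' n x)) (el ?X' n)" for n
    using inj_onD[OF inj _ hm_closed[OF r(2)] hm_closed[OF r(2)]] r(4) by (intro inj_onI) metis
  moreover have "(\<lambda>x. \<phi> n (r' n x)) ` el ?X' n = a_kernel (mcomp H n) (mcomp ?Y' n) (\<lambda>x. q n (\<psi> n x))" for n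
  proof -
    have "(\<lambda>x. \<phi> n (r' n x)) ` el ?X' n = a_kernel (mcomp H n) (mcomp ?Y n) (\<psi> n)"
      unfolding mid[symmetric] ri[symmetric] image_image ..
    also have "\<dots> = a_kernel (mcomp H n) (mcomp ?Y' n) (\<lambda>x. q n (\<psi> n x))"
    proof (rule Set.set_eqI)
      fix x
      show "x \<in> a_kernel (mcomp H n) (mcomp ?Y n) (\<psi> n) \<longleftrightarrow> x \<in> a_kernel (mcomp H n) (mcomp ?Y' n) (\<lambda>x. q n (\<psi> n x))"
        unfolding a_kernel_iff using z[OF hm_closed[OF psi], of x n] by blast
    qed
    finally show ?thesis .
  qed
  moreover have "(\<lambda>x. q n (\<psi> n x)) ` el H n = el ?Y' n" for n
    unfolding qi[symmetric] surj[symmetric] image_image ..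
  ultimately show ?thesis
    using hm_comp[OF r(2) phi] hm_comp[OF psi q(1)] unfolding short_exact_def by (intro exI conjI allI)
qed

end

lemma (in quad_mod) kos_0: "kos 0 = gmod_free K (C 0) A"
  by (simp add: kos_eq gmod_shift_def)

section \<open>Resolving data and lifts indexed by arrows\<close>

locale res_setting = quad_setting K V R for K :: "'k ring" (structure) and V :: "('k, 'v) module" and R +
  fixes N :: nat and M :: "nat \<Rightarrow> ('k, ('v list \<Rightarrow> 'k) set set, 'm) gmod" and h :: "nat \<Rightarrow> nat \<Rightarrow> nat \<Rightarrow> nat \<Rightarrow> nat \<times> nat"
  assumes datum: "resolving_datum K V R N M h"
begin

abbreviation "Q \<equiv> resolving_quiver N h"
abbreviation "kosm i n \<equiv> koszul K V R (M i) n"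
abbreviation "KV i n j \<equiv> mcomp (kosm i n) j"
abbreviation "dkm i n \<equiv> koszul_d K V R (M i) n"
abbreviation "Ar i k \<equiv> {\<alpha> \<in> arcs Q. asrc \<alpha> = i \<and> adeg1 \<alpha> = Suc k}"
abbreviation "Ko \<alpha> n \<equiv> el (kosm (atgt \<alpha>) 0) (n - int (adeg2 \<alpha>))"
abbreviation "Bd \<alpha> n \<equiv> dkm (atgt \<alpha>) 0 (n - int (adeg2 \<alpha>)) ` el (kosm (atgt \<alpha>) (Suc 0)) (n - int (adeg2 \<alpha>))"

lemma quad: "i \<le> N \<Longrightarrow> quad_mod K V R (M i)"
  using datum quad_setting_axioms unfolding resolving_datum_def Let_def quad_mod_def quad_mod_axioms_def by blast

text \<open>The support is restricted to the range in which \<open>h\<close> has a meaning; the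
  finiteness condition says nothing about its other values.\<close>

definition hsupp :: "(nat \<times> nat \<times> nat \<times> nat) set" where
  "hsupp = {(i, j, k, l). i \<le> N \<and> j \<le> N \<and> 1 \<le> k \<and> 1 \<le> l \<and> h i j k l \<noteq> (0, 0)}"

lemma finite_hsupp: "finite hsupp"
  using datum by (simp add: resolving_datum_def Let_def hsupp_def)

text \<open>An arrow of first degree \<open>d\<close> comes from homology in degree
  \<open>d - 1\<close>, so \<open>Suc k\<close> appears when arrows are rebuilt from the support of
  \<open>h\<close>.\<close>

lemma finite_arcs: "finite (arcs Q)"
proof -
  have "\<alpha> \<in> (\<lambda>((i, j, k, l), c). SubArrow i j (Suc k) l c) ` (SIGMA (i, j, k, l) : hsupp. {..<fst (h i j k l)})
        \<union> (\<lambda>((i, j, k, l), c). QuotArrow i j (Suc k) l c) ` (SIGMA (i, j, k, l) : hsupp. {..<snd (h i j k l)})"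
    if a: "\<alpha> \<in> arcs Q" for \<alpha>
  proof (cases \<alpha>)
    case (SubArrow i j d l c)
    then have k: "i \<le> N" "j \<le> N" "2 \<le> d" "1 \<le> l" "c < fst (h i j (d - 1) l)"
      using a by (auto simp: resolving_quiver_def)
    then have "((i, j, d - 1, l), c) \<in> (SIGMA (i, j, k, l) : hsupp. {..<fst (h i j k l)})"
      by (auto simp: hsupp_def)
    moreover have "\<alpha> = (\<lambda>((i, j, k, l), c). SubArrow i j (Suc k) l c) ((i, j, d - 1, l), c)" using SubArrow k by simp
    ultimately show ?thesis by blast
  next
    case (QuotArrow i j d l c)
    then have k: "i \<le> N" "j \<le> N" "2 \<le> d" "1 \<le> l" "c < snd (h i j (d - 1) l)"
      using a by (auto simp: resolving_quiver_def)
    then have "((i, j, d - 1, l), c) \<in> (SIGMA (i, j, k, l) : hsupp. {..<snd (h i j k l)})"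
      by (auto simp: hsupp_def)
    moreover have "\<alpha> = (\<lambda>((i, j, k, l), c). QuotArrow i j (Suc k) l c) ((i, j, d - 1, l), c)" using QuotArrow k by simp
    ultimately show ?thesis by blast
  qed
  then have "arcs Q \<subseteq> (\<lambda>((i, j, k, l), c). SubArrow i j (Suc k) l c) ` (SIGMA (i, j, k, l) : hsupp. {..<fst (h i j k l)})
        \<union> (\<lambda>((i, j, k, l), c). QuotArrow i j (Suc k) l c) ` (SIGMA (i, j, k, l) : hsupp. {..<snd (h i j k l)})" by blast
  moreover have "finite (SIGMA (i, j, k, l) : hsupp. {..<fst (h i j k l)})" "finite (SIGMA (i, j, k, l) : hsupp. {..<snd (h i j k l)})"
    using finite_hsupp by (auto intro!: finite_SigmaI)
  ultimately show ?thesis by (meson finite_Un finite_imageI finite_subset)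
qed

lemma arc_bounds: "\<alpha> \<in> arcs Q \<Longrightarrow> asrc \<alpha> \<le> N \<and> atgt \<alpha> \<le> N \<and> 2 \<le> adeg1 \<alpha>"
  by (auto simp: resolving_quiver_def)

abbreviation "SubA i k \<equiv> {\<alpha> \<in> Ar i k. is_SubArrow \<alpha>}"
abbreviation "QuotA i k \<equiv> {\<alpha> \<in> Ar i k. is_QuotArrow \<alpha>}"
abbreviation "Kz \<alpha> n \<equiv> \<zero>\<^bsub>mcomp (kosm (atgt \<alpha>) 0) (n - int (adeg2 \<alpha>))\<^esub>"

text \<open>The instance used from here on: \<open>Z/B\<close> is the homology of a Koszul complex
  in degree \<open>k\<close>, the submodule and quotient parts are the two kinds of arrows of first
  degree \<open>Suc k\<close>, and the kernels are the images of the first Koszul differentials of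
  the targets.\<close>

definition lifts where
  "lifts i k = lifting A (kosm i k) (koszul_cycles K V R (M i) k) (koszul_boundaries K V R (M i) k) (SubA i k) (QuotA i k)
    (\<lambda>\<alpha>. gmod_shift (kosm (atgt \<alpha>) 0) (- int (adeg2 \<alpha>))) Bd"

lemma SubA_bij:
  assumes "i \<le> N" "1 \<le> k"
  shows "bij_betw (\<lambda>\<alpha>. (atgt \<alpha>, adeg2 \<alpha>, anum \<alpha>)) (SubA i k) {(j, l, c). j \<le> N \<and> 1 \<le> l \<and> c < fst (h i j k l)}"
    "bij_betw (\<lambda>\<alpha>. (atgt \<alpha>, adeg2 \<alpha>, anum \<alpha>)) (QuotA i k) {(j, l, c). j \<le> N \<and> 1 \<le> l \<and> c < snd (h i j k l)}"
  by (rule bij_betw_byWitness[where f' = "\<lambda>(j, l, c). SubArrow i j (Suc k) l c"]; use assms in \<open>force simp: resolving_quiver_def\<close>)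
    (rule bij_betw_byWitness[where f' = "\<lambda>(j, l, c). QuotArrow i j (Suc k) l c"]; use assms in \<open>force simp: resolving_quiver_def\<close>)

lemma SubA_QuotA: "SubA i k \<union> QuotA i k = Ar i k" "SubA i k \<inter> QuotA i k = {}"
proof -
  have "is_SubArrow \<alpha> \<noteq> is_QuotArrow \<alpha>" for \<alpha> by (cases \<alpha>) simp_all
  then show "SubA i k \<union> QuotA i k = Ar i k" "SubA i k \<inter> QuotA i k = {}" by blast+
qed

text \<open>The augmentations of the targets provide the free covers, and their kernels are the
  images of the first Koszul differentials. Quadraticity of the modules and the exact sequences of
  the datum meet here.\<close>

lemma arrow_lifts:
  assumes i: "i \<le> N" and k: "1 \<le> k"
  shows "\<exists>g. lifts i k g"
proof -
  interpret i: quad_mod K V R "M i" using i by (rule quad)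
  let ?L = "kosm i k" and ?ix = "\<lambda>\<alpha>. (atgt \<alpha>, adeg2 \<alpha>, anum \<alpha>)"
  let ?F = "\<lambda>(j, l, c :: nat). gmod_shift (M j) (- int l)" and ?G = "\<lambda>\<alpha>. gmod_shift (M (atgt \<alpha>)) (- int (adeg2 \<alpha>))"
  let ?W = "\<lambda>\<alpha>. kos_coeff K V R (M (atgt \<alpha>)) 0" and ?s = "\<lambda>\<alpha>. - int (adeg2 \<alpha>)"
  let ?Z = "koszul_cycles K V R (M i) k" and ?B = "koszul_boundaries K V R (M i) k"
  have "\<exists>e. e \<in> hm A (kosm j 0) (M j) \<and> (\<forall>n. e n ` el (kosm j 0) n = el (M j) n) \<and>
     (\<forall>n. \<forall>x\<in>el (kosm j 0) n. e n x = \<zero>\<^bsub>mcomp (M j) n\<^esub> \<longleftrightarrow> x \<in> dkm j 0 n ` el (kosm j (Suc 0)) n)"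
    if "j \<le> N" for j
    using quad_mod.augmentation[OF quad[OF that]] by metis
  then obtain eps where eps: "\<And>j. j \<le> N \<Longrightarrow> eps j \<in> hm A (kosm j 0) (M j)"
    "\<And>j n. j \<le> N \<Longrightarrow> eps j n ` el (kosm j 0) n = el (M j) n"
    "\<And>j n x. j \<le> N \<Longrightarrow> x \<in> el (kosm j 0) n \<Longrightarrow>
       eps j n x = \<zero>\<^bsub>mcomp (M j) n\<^esub> \<longleftrightarrow> x \<in> dkm j 0 n ` el (kosm j (Suc 0)) n"
    by metis
  let ?e = "\<lambda>\<alpha> n. eps (atgt \<alpha>) (n - int (adeg2 \<alpha>))"
  have t: "atgt \<alpha> \<le> N" if "\<alpha> \<in> Ar i k" for \<alpha> using that arc_bounds by blast
  have P: "gmod_shift (gmod_free K (?W \<alpha>) A) (?s \<alpha>) = gmod_shift (kosm (atgt \<alpha>) 0) (- int (adeg2 \<alpha>))" if "\<alpha> \<in> Ar i k" for \<alpha>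
    using quad_mod.kos_0[OF quad[OF t[OF that]]] by simp
  have cover: "aug_cover A (Ar i k) ?G ?W ?s ?e"
    unfolding aug_cover_def
  proof (intro conjI ballI)
    show "finite (Ar i k)" using finite_arcs by simp
    fix \<alpha> assume a: "\<alpha> \<in> Ar i k"
    interpret j: quad_mod K V R "M (atgt \<alpha>)" using t[OF a] by (rule quad)
    show "gm A (?G \<alpha>)" by (rule gm_shift[OF j.M])
    show "VS (?W \<alpha>)" by (rule j.C_VS)
    show "?e \<alpha> \<in> hm A (gmod_shift (gmod_free K (?W \<alpha>) A) (?s \<alpha>)) (?G \<alpha>)"
      unfolding P[OF a] using hm_shift[OF eps(1)[OF t[OF a]], of "- int (adeg2 \<alpha>)"] by simp
    show "\<forall>n. ?e \<alpha> n ` el (gmod_shift (gmod_free K (?W \<alpha>) A) (?s \<alpha>)) n = el (?G \<alpha>) n"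
      unfolding P[OF a] using eps(2)[OF t[OF a]] by simp
  qed
  note L = i.kos_gm[of k]
  \<comment> \<open>Since \<open>k\<close> is positive the cycles are the kernel of the differential
    with index \<open>k - 1\<close>; index 0, where every element is a cycle, does not
    occur.\<close>
  have Zeq: "?Z = (\<lambda>n. {x \<in> el ?L n. dkm i (k - 1) n x = \<zero>\<^bsub>KV i (k - 1) n\<^esub>})"
    using k by (cases k) (auto simp: koszul_cycles_def a_kernel_iff)
  have Beq: "?B = (\<lambda>n. dkm i k n ` el (kosm i (Suc k)) n)"
    by (auto simp: koszul_boundaries_def)
  have dk1: "dkm i (k - 1) \<in> hm A (kosm i k) (kosm i (k - 1))" using i.dk_hm[of "k - 1"] k by simp
  have Z: "gsub A ?L ?Z" unfolding Zeq by (rule gsub_ker[OF L i.kos_gm A dk1])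
  have B: "gsub A ?L ?B" unfolding Beq by (rule gsub_image[OF i.kos_gm L i.dk_hm gsub_carrier[OF i.kos_gm]])
  have BZ: "?B n \<subseteq> ?Z n" for n
    unfolding Beq Zeq using hm_closed[OF i.dk_hm] i.dk_dk[of _ "k - 1" n] k by auto
  have "\<forall>i\<le>N. \<forall>k\<ge>1. \<exists>\<phi> \<psi>. short_exact K A (mult_sum N M (\<lambda>j l. fst (h i j k l))) (koszul_homology K V R (M i) k) (mult_sum N M (\<lambda>j l. snd (h i j k l))) \<phi> \<psi>"
    using datum unfolding resolving_datum_def Let_def by blast
  then obtain \<phi> \<psi> where ex: "short_exact K A (gmod_dirsum {(j, l, c). j \<le> N \<and> 1 \<le> l \<and> c < fst (h i j k l)} ?F) (gmod_quot (gmod_sub ?L ?Z) ?B)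
      (gmod_dirsum {(j, l, c). j \<le> N \<and> 1 \<le> l \<and> c < snd (h i j k l)} ?F) \<phi> \<psi>"
    using i k unfolding mult_sum_def koszul_homology_def by blast
  have fin: "finite {(j, l, c). j \<le> N \<and> 1 \<le> l \<and> c < fst (h i j k l)}" "finite {(j, l, c). j \<le> N \<and> 1 \<le> l \<and> c < snd (h i j k l)}"
    using bij_betw_finite[OF SubA_bij(1)[OF i k]] bij_betw_finite[OF SubA_bij(2)[OF i k]] finite_arcs by simp_all
  have F: "\<forall>t\<in>{(j, l, c). j \<le> N \<and> 1 \<le> l \<and> c < f j l}. gm A (?F t)" for f :: "nat \<Rightarrow> nat \<Rightarrow> nat"
    using gm_shift[OF quad_mod.M[OF quad]] by auto
  have BS: "gsub A (gmod_sub ?L ?Z) ?B"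
    using SUB_in_SUB[OF gsubD(1)[OF B] gsubD(1)[OF Z] gmD(1)[OF L] BZ] gsubD(2)[OF B] by (simp add: gsub_def)
  obtain \<phi> \<psi> where "short_exact K A (gmod_dirsum (SubA i k) ?G) (gmod_quot (gmod_sub ?L ?Z) ?B) (gmod_dirsum (QuotA i k) ?G) \<phi> \<psi>"
    using short_exact_reindex[OF A fin(1) F SubA_bij(1)[OF i k] fin(2) F SubA_bij(2)[OF i k] gm_quot[OF gm_sub[OF L Z] A BS] ex] by auto
  from ses_lift[OF A L Z B BZ _ SubA_QuotA(2) this, unfolded SubA_QuotA(1), OF cover]
  obtain g where g: "lifting A ?L ?Z ?B (SubA i k) (QuotA i k) (\<lambda>\<alpha>. gmod_shift (gmod_free K (?W \<alpha>) A) (?s \<alpha>))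
      (\<lambda>\<alpha> n. {p \<in> el (gmod_shift (gmod_free K (?W \<alpha>) A) (?s \<alpha>)) n. ?e \<alpha> n p = \<zero>\<^bsub>mcomp (?G \<alpha>) n\<^esub>}) g"
    by blast
  have D: "{p \<in> el (gmod_shift (gmod_free K (?W \<alpha>) A) (?s \<alpha>)) n. ?e \<alpha> n p = \<zero>\<^bsub>mcomp (?G \<alpha>) n\<^esub>} = Bd \<alpha> n" if a: "\<alpha> \<in> Ar i k" for \<alpha> n
    unfolding P[OF a] using eps(3)[OF t[OF a]] hm_closed[OF quad_mod.dk_hm[OF quad[OF t[OF a]]]] by auto
  have "lifts i k g"
    unfolding lifts_def by (rule lifting_cong[OF g], unfold SubA_QuotA(1)) (erule P[symmetric], erule D[symmetric])
  then show ?thesis by blast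
qed

text \<open>Unpacked for the construction, with cycles expressed by the vanishing of
  \<open>dkm i (k - 1)\<close> and the two index sets merged into \<open>Ar i k\<close>.\<close>

lemma liftsD:
  assumes k: "1 \<le> k" and l: "lifts i k g"
  shows "\<alpha> \<in> Ar i k \<Longrightarrow> g \<alpha> \<in> hm A (gmod_shift (kosm (atgt \<alpha>) 0) (- int (adeg2 \<alpha>))) (kosm i k)"
    "\<alpha> \<in> Ar i k \<Longrightarrow> p \<in> Ko \<alpha> n \<Longrightarrow> dkm i (k - 1) n (g \<alpha> n p) = \<zero>\<^bsub>KV i (k - 1) n\<^esub>"
    "z \<in> el (kosm i k) n \<Longrightarrow> dkm i (k - 1) n z = \<zero>\<^bsub>KV i (k - 1) n\<^esub> \<Longrightarrow>
      \<exists>u. \<exists>c\<in>el (kosm i (Suc k)) n. (\<forall>\<alpha>\<in>Ar i k. u \<alpha> \<in> Ko \<alpha> n) \<and>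
         z = dkm i k n c \<oplus>\<^bsub>KV i k n\<^esub> finsum (KV i k n) (\<lambda>\<alpha>. g \<alpha> n (u \<alpha>)) (Ar i k)"
    "\<forall>\<alpha>\<in>Ar i k. u \<alpha> \<in> Ko \<alpha> n \<Longrightarrow> \<alpha> \<in> Ar i k \<Longrightarrow>
      finsum (KV i k n) (\<lambda>\<alpha>. g \<alpha> n (u \<alpha>)) (Ar i k) \<in> dkm i k n ` el (kosm i (Suc k)) n \<Longrightarrow>
      is_QuotArrow \<alpha> \<or> (\<forall>\<beta>\<in>Ar i k. is_QuotArrow \<beta> \<longrightarrow> u \<beta> = Kz \<beta> n) \<Longrightarrow> u \<alpha> \<in> Bd \<alpha> n"
    "\<alpha> \<in> Ar i k \<Longrightarrow> w \<in> Bd \<alpha> n \<Longrightarrow> \<exists>u. \<exists>c\<in>el (kosm i (Suc k)) n. (\<forall>\<beta>\<in>Ar i k. u \<beta> \<in> Ko \<beta> n \<and>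
         (\<not> (is_QuotArrow \<alpha> \<and> is_SubArrow \<beta>) \<longrightarrow> u \<beta> = Kz \<beta> n)) \<and>
       g \<alpha> n w = dkm i k n c \<oplus>\<^bsub>KV i k n\<^esub> finsum (KV i k n) (\<lambda>\<beta>. g \<beta> n (u \<beta>)) (Ar i k)"
proof goal_cases
  have Z: "x \<in> koszul_cycles K V R (M i) k n \<longleftrightarrow> x \<in> el (kosm i k) n \<and> dkm i (k - 1) n x = \<zero>\<^bsub>KV i (k - 1) n\<^esub>" for x n
    using k by (cases k) (auto simp: koszul_cycles_def a_kernel_iff)
  note l' = l[unfolded lifts_def lifting_def SubA_QuotA(1) koszul_boundaries_def shift_simps, simplified add_uminus_conv_diff]
  note c1 = conjunct2[OF l'] note c2 = conjunct2[OF c1] note c3 = conjunct2[OF c2] note c4 = conjunct2[OF c3]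
  {
    case 1 then show ?case using conjunct1[OF l'] by blast
  next
    case 2 then show ?case using conjunct1[OF c1] Z by blast
  next
    case 3
    then have "z \<in> koszul_cycles K V R (M i) k n" by (simp only: Z)
    from bspec[OF spec[OF conjunct1[OF c2]] this] show ?case by blast
  next
    case 4 then show ?case using conjunct1[OF c3, rule_format, of u n \<alpha>] by blast
  next
    case 5 
    from bspec[OF spec[OF bspec[OF c4 5(1)]] 5(2)] show ?case using 5(1) by auto
  }
qed

end

lemma (in kfield) hm_zero_at: "gm A M \<Longrightarrow> gm A N \<Longrightarrow> \<phi> \<in> hm A M N \<Longrightarrow> \<phi> n \<zero>\<^bsub>mcomp M n\<^esub> = \<zero>\<^bsub>mcomp N n\<^esub>"
  using lin_zero[OF gmD(1) gmD(1) hm_lin] .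

lemma (in kfield) shift_dirsum: "gmod_shift (gmod_dirsum I F) s = gmod_dirsum I (\<lambda>i. gmod_shift (F i) s)"
  by (simp add: gmod_shift_def gmod_dirsum_def)

section \<open>Splitting off the first arrow of a path\<close>

context res_setting
begin

definition tgt :: "nat \<Rightarrow> arrow list \<Rightarrow> nat" where
  "tgt i p = path_target Q i p"

definition Ix :: "nat \<Rightarrow> nat \<Rightarrow> arrow list set" where
  "Ix i n = {p \<in> paths_from Q i. bideg1 p \<le> n}"

definition Fm where
  "Fm i n p = gmod_shift (kosm (tgt i p) (n - bideg1 p)) (- int (bideg2 p))"

definition Pt where
  "Pt i n = resolution_term K V R N M h i n"

abbreviation "PV i n j \<equiv> mcomp (Pt i n) j"

lemma Pt_eq: "Pt i n = gmod_dirsum (Ix i n) (Fm i n)"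
proof -
  have "Fm i n = (\<lambda>p. gmod_shift (kosm (tgt i p) (n - bideg1 p)) (- int (bideg2 p)))"
    by (rule ext) (rule Fm_def)
  then show ?thesis by (simp add: Pt_def resolution_term_def Ix_def tgt_def)
qed

lemma bideg_simps [simp]: "bideg1 [] = 0" "bideg2 [] = 0" "bideg1 (\<alpha> # p) = adeg1 \<alpha> + bideg1 p" "bideg2 (\<alpha> # p) = adeg2 \<alpha> + bideg2 p"
  by (simp_all add: bideg1_def bideg2_def)

lemma tgt_simps [simp]: "tgt i [] = i" "tgt i (\<alpha> # p) = tgt (atgt \<alpha>) p"
  by (cases p; simp add: tgt_def path_target_def pre_digraph.awalk_verts.simps resolving_quiver_def)+

lemma path_Nil: "i \<le> N \<Longrightarrow> [] \<in> paths_from Q i"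
  by (auto simp: paths_from_def pre_digraph.awalk_def pre_digraph.cas.simps resolving_quiver_def)

lemma path_Cons: "\<alpha> # p \<in> paths_from Q i \<longleftrightarrow> \<alpha> \<in> arcs Q \<and> asrc \<alpha> = i \<and> p \<in> paths_from Q (atgt \<alpha>)"
proof -
  have Q: "tail Q = asrc" "head Q = atgt" "verts Q = {..N}" by (simp_all add: resolving_quiver_def)
  show ?thesis unfolding paths_from_def mem_Collect_eq pre_digraph.awalk_def pre_digraph.cas.simps Q
    using arc_bounds by auto
qed

lemma path_tgt: "i \<le> N \<Longrightarrow> p \<in> paths_from Q i \<Longrightarrow> tgt i p \<le> N"
  by (induction p arbitrary: i) (auto simp: path_Cons dest: arc_bounds)

lemma path_arcs: "p \<in> paths_from Q i \<Longrightarrow> set p \<subseteq> arcs Q"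
  by (auto simp: paths_from_def pre_digraph.awalk_def)

text \<open>Every arrow has first degree at least 2, so the first degree of a path bounds its
  length, and there are finitely many arrows.\<close>

lemma finite_Ix: "finite (Ix i n)"
proof (rule finite_subset)
  have "length p \<le> bideg1 p" if "set p \<subseteq> arcs Q" for p
    using that by (induction p) (auto dest!: arc_bounds)
  then show "Ix i n \<subseteq> {p. set p \<subseteq> arcs Q \<and> length p \<le> n}" using path_arcs by (fastforce simp: Ix_def)
  show "finite {p. set p \<subseteq> arcs Q \<and> length p \<le> n}" using finite_arcs by (rule finite_lists_length_le)
qed

lemma Ix_Nil: "i \<le> N \<Longrightarrow> [] \<in> Ix i n"
  by (simp add: Ix_def path_Nil)

lemma Ix_Cons: "\<alpha> # p \<in> Ix i n \<longleftrightarrow> \<alpha> \<in> arcs Q \<and> asrc \<alpha> = i \<and> adeg1 \<alpha> \<le> n \<and> p \<in> Ix (atgt \<alpha>) (n - adeg1 \<alpha>)"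
  by (auto simp: Ix_def path_Cons)

lemma Fm_Nil: "Fm i n [] = kosm i n"
  by (simp add: Fm_def gmod_shift_def)

text \<open>The recursive structure of the resolution: removing the first arrow turns a summand for
  the source into a shifted summand of an earlier term for the target.\<close>

lemma Fm_Cons: "Fm i n (\<alpha> # p) = gmod_shift (Fm (atgt \<alpha>) (n - adeg1 \<alpha>) p) (- int (adeg2 \<alpha>))"
  by (simp add: Fm_def shift_shift diff_diff_left add.commute)

lemma kos_gm': "i \<le> N \<Longrightarrow> gm A (kosm i n)"
  using quad_mod.kos_gm[OF quad] .

lemma Fm_gm: "i \<le> N \<Longrightarrow> \<forall>p\<in>Ix i n. gm A (Fm i n p)"
  using gm_shift[OF kos_gm'[OF path_tgt]] by (auto simp: Fm_def Ix_def)

lemma Pt_gm: "i \<le> N \<Longrightarrow> gm A (Pt i n)"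
  unfolding Pt_eq by (rule gm_dirsum[OF finite_Ix A Fm_gm])

lemma Pt_VS: "i \<le> N \<Longrightarrow> VS (PV i n j)"
  by (rule gmD(1)[OF Pt_gm])

lemma kos_VS: "i \<le> N \<Longrightarrow> VS (KV i n j)"
  by (rule gmD(1)[OF kos_gm'])

text \<open>Freeness of the terms in the form needed: with a shift, since it is applied to blocks,
  and with containment of images, since \<open>g\<close> will be a differential restricted to part
  of the complex.\<close>

lemma Pt_lift:
  assumes i: "i \<le> N" and S: "gm A S" and T: "gm A T" and g: "g \<in> hm A S T" and f: "f \<in> hm A (gmod_shift (Pt i n) s) T"
    and im: "\<forall>j. \<forall>w\<in>el (gmod_shift (Pt i n) s) j. f j w \<in> g j ` el S j"
  shows "\<exists>l\<in>hm A (gmod_shift (Pt i n) s) S. \<forall>j. \<forall>w\<in>el (gmod_shift (Pt i n) s) j. g j (l j w) = f j w"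
proof -
  let ?F = "\<lambda>p. gmod_shift (Fm i n p) s"
  have P: "gmod_shift (Pt i n) s = gmod_dirsum (Ix i n) ?F" by (simp add: Pt_eq shift_dirsum)
  have F: "\<forall>p\<in>Ix i n. gm A (?F p)" using Fm_gm[OF i] gm_shift by blast
  show ?thesis
  proof (unfold P, rule dirsum_lift[OF finite_Ix A F S T g f[unfolded P]])
    fix p assume p: "p \<in> Ix i n"
    then have t: "tgt i p \<le> N" using path_tgt[OF i] by (simp add: Ix_def)
    interpret t: quad_mod K V R "M (tgt i p)" using t by (rule quad)
    have e: "?F p = gmod_shift (gmod_free K (t.C (n - bideg1 p)) A) (- int (n - bideg1 p) + - int (bideg2 p) + s)"
      by (simp add: Fm_def t.kos_eq shift_shift)
    have h: "(\<lambda>j x. f j (dinj (Ix i n) ?F p j x)) \<in> hm A (?F p) T"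
      by (rule hm_comp[OF hm_dinj[OF finite_Ix A F p] f[unfolded P]])
    show "\<exists>l\<in>hm A (?F p) S. \<forall>j. \<forall>w\<in>el (?F p) j. g j (l j w) = f j (dinj (Ix i n) ?F p j w)"
    proof (unfold e, rule free_lift[OF A t.C_VS S T g], fold e)
      show "(\<lambda>j x. f j (dinj (Ix i n) ?F p j x)) \<in> hm A (?F p) T" by (rule h)
      fix j x assume "x \<in> el (?F p) j"
      then have "dinj (Ix i n) ?F p j x \<in> el (gmod_shift (Pt i n) s) j"
        unfolding P by (rule hm_closed[OF hm_dinj[OF finite_Ix A F p]])
      then show "f j (dinj (Ix i n) ?F p j x) \<in> g j ` el S j" using im by blast
    qed
  qed
qed

lemma Pt_bounded: "i \<le> N \<Longrightarrow> bounded_below (Pt i n)"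
proof -
  assume i: "i \<le> N"
  have "bounded_below (Fm i n p)" if "p \<in> Ix i n" for p
  proof -
    have t: "tgt i p \<le> N" using that path_tgt[OF i] by (simp add: Ix_def)
    interpret t: quad_mod K V R "M (tgt i p)" using t by (rule quad)
    show ?thesis unfolding Fm_def t.kos_eq by (intro bounded_below_shift bounded_below_free A t.C_VS)
  qed
  then show ?thesis unfolding Pt_eq by (intro bounded_below_dirsum[OF finite_Ix A Fm_gm[OF i]]) blast
qed

abbreviation "Car i n j \<equiv> el (Pt i n) j"
abbreviation "Kar i n j \<equiv> el (kosm i n) j"
abbreviation "z\<^sub>P i n j \<equiv> \<zero>\<^bsub>PV i n j\<^esub>"
abbreviation "Out i \<equiv> {\<alpha> \<in> arcs Q. asrc \<alpha> = i}"
text \<open>\<open>Br i n\<close> lists the blocks present in the \<open>n\<close>-th term. Passing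
  to \<open>Suc n\<close> adds exactly \<open>Ar i n\<close>, whose blocks start there as shifted
  copies of the 0-th terms for their targets.\<close>

abbreviation "Br i n \<equiv> {\<alpha> \<in> arcs Q. asrc \<alpha> = i \<and> adeg1 \<alpha> \<le> n}"
abbreviation "Blk \<alpha> n \<equiv> gmod_shift (Pt (atgt \<alpha>) (n - adeg1 \<alpha>)) (- int (adeg2 \<alpha>))"
abbreviation "zB \<alpha> n j \<equiv> z\<^sub>P (atgt \<alpha>) (n - adeg1 \<alpha>) (j - int (adeg2 \<alpha>))"
abbreviation "BCar \<alpha> n j \<equiv> Car (atgt \<alpha>) (n - adeg1 \<alpha>) (j - int (adeg2 \<alpha>))"

text \<open>The root is the summand of the length-zero path; \<open>rin\<close> embeds it, and
  evaluation at \<open>[]\<close> projects to it. For the block of an arrow this is done by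
  \<open>bin\<close> and \<open>bout\<close>, which add or remove the arrow at the front of
  paths.\<close>

definition rin where
  "rin i n = dinj (Ix i n) (Fm i n) []"

definition bout where
  "bout \<alpha> n x = (\<lambda>p\<in>Ix (atgt \<alpha>) (n - adeg1 \<alpha>). x (\<alpha> # p))"

definition bin where
  "bin \<alpha> n j w = (\<lambda>p\<in>Ix (asrc \<alpha>) n. case p of [] \<Rightarrow> \<zero>\<^bsub>mcomp (Fm (asrc \<alpha>) n p) j\<^esub> |
     \<beta> # q \<Rightarrow> if \<beta> = \<alpha> then w q else \<zero>\<^bsub>mcomp (Fm (asrc \<alpha>) n p) j\<^esub>)"

lemma Pt_carrier: "Car i n j = (\<Pi>\<^sub>E p\<in>Ix i n. el (Fm i n p) j)"
  unfolding Pt_eq by (rule dirsum_carrier[OF finite_Ix])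

lemma Pt_simps:
  "z\<^sub>P i n j = (\<lambda>p\<in>Ix i n. \<zero>\<^bsub>mcomp (Fm i n p) j\<^esub>)"
  "f \<oplus>\<^bsub>PV i n j\<^esub> g = (\<lambda>p\<in>Ix i n. f p \<oplus>\<^bsub>mcomp (Fm i n p) j\<^esub> g p)"
  "c \<odot>\<^bsub>PV i n j\<^esub> f = (\<lambda>p\<in>Ix i n. c \<odot>\<^bsub>mcomp (Fm i n p) j\<^esub> f p)"
  "mact (Pt i n) j m f a = (\<lambda>p\<in>Ix i n. mact (Fm i n p) j m (f p) a)"
  unfolding Pt_eq by (rule dirsum_simps)+

lemma bin_apply: "p \<in> Ix (asrc \<alpha>) n \<Longrightarrow> bin \<alpha> n j w p = (case p of [] \<Rightarrow> \<zero>\<^bsub>mcomp (Fm (asrc \<alpha>) n p) j\<^esub> |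
     \<beta> # q \<Rightarrow> if \<beta> = \<alpha> then w q else \<zero>\<^bsub>mcomp (Fm (asrc \<alpha>) n p) j\<^esub>)"
  by (simp add: bin_def)

lemma rin_hm: "i \<le> N \<Longrightarrow> rin i n \<in> hm A (kosm i n) (Pt i n)"
  using hm_dinj[OF finite_Ix A Fm_gm Ix_Nil] by (simp add: rin_def Pt_eq Fm_Nil)

lemma rout_hm: "i \<le> N \<Longrightarrow> (\<lambda>j x. x []) \<in> hm A (Pt i n) (kosm i n)"
  using hm_proj[OF finite_Ix Ix_Nil, where F = "Fm i n"] by (simp add: Pt_eq Fm_Nil)

lemma bout_hm: assumes "\<alpha> \<in> Br i n" shows "(\<lambda>j. bout \<alpha> n) \<in> hm A (Pt i n) (Blk \<alpha> n)"
proof -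
  have I: "\<alpha> # p \<in> Ix i n" if "p \<in> Ix (atgt \<alpha>) (n - adeg1 \<alpha>)" for p using assms that by (auto simp: Ix_Cons)
  have f: "x p \<in> el (Fm i n p) j" if "x \<in> Car i n j" "p \<in> Ix i n" for x j p using that unfolding Pt_carrier by auto
  show ?thesis
  proof (rule hmI)
    fix j
    show "bout \<alpha> n \<in> lin (PV i n j) (mcomp (Blk \<alpha> n) j)"
    proof (rule linI)
      fix x assume "x \<in> Car i n j"
      from f[OF this I] show "bout \<alpha> n x \<in> el (Blk \<alpha> n) j"
        by (auto simp: Pt_carrier bout_def Fm_Cons)
    qed (auto simp: bout_def Pt_simps fun_eq_iff Fm_Cons I)
  qed (auto simp: bout_def Pt_simps fun_eq_iff Fm_Cons I)
qed

lemma bin_hm: assumes a: "\<alpha> \<in> Br i n" shows "bin \<alpha> n \<in> hm A (Blk \<alpha> n) (Pt i n)"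
proof -
  have s: "asrc \<alpha> = i" and iN: "i \<le> N" using a arc_bounds by auto
  have I: "p \<in> Ix (atgt \<alpha>) (n - adeg1 \<alpha>)" if "\<alpha> # p \<in> Ix i n" for p using that by (auto simp: Ix_Cons)
  have F: "VS (mcomp (Fm i n p) j)" "gm A (Fm i n p)" if "p \<in> Ix i n" for p j
    using Fm_gm[OF iN] gmD(1) that by blast+
  have FC: "VS (mcomp (Fm (atgt \<beta>) (n - adeg1 \<beta>) q) (j - int (adeg2 \<beta>)))" if "\<beta> # q \<in> Ix i n" for \<beta> q j
    using F(1)[OF that, of j] by (simp add: Fm_Cons)
  show ?thesis
  proof (rule hmI)
    fix j
    show "bin \<alpha> n j \<in> lin (mcomp (Blk \<alpha> n) j) (PV i n j)"
    proof (rule linI)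
      fix x assume "x \<in> el (Blk \<alpha> n) j"
      then have "x p \<in> el (Fm i n (\<alpha> # p)) j" if "\<alpha> # p \<in> Ix i n" for p
        using I[OF that] by (auto simp: Pt_carrier Fm_Cons)
      then show "bin \<alpha> n j x \<in> Car i n j"
        using F(1) by (auto simp: Pt_carrier bin_def s split: list.split)
    qed (auto simp: bin_def Pt_simps s Fm_Cons F FC I intro!: restrict_ext split: list.split)
  next
    fix m k x a assume "x \<in> el (Blk \<alpha> n) m" "a \<in> ael A k"
    then show "bin \<alpha> n (m + k) (mact (Blk \<alpha> n) m k x a) = mact (Pt i n) m k (bin \<alpha> n m x) a"
      using bilin_zero(1)[OF gmD(1)[OF F(2)] galgebraD(1)[OF A] gmD(1)[OF F(2)] gmD(2)[OF F(2)]]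
      by (auto simp: bin_def Pt_simps s Fm_Cons[of i n \<alpha>] I intro!: restrict_ext split: list.split)
  qed
qed

lemma rout_rin: "i \<le> N \<Longrightarrow> rin i n j c [] = c"
  by (simp add: rin_def dinj_apply Ix_Nil)

lemma rout_bin: "\<alpha> \<in> Br i n \<Longrightarrow> bin \<alpha> n j w [] = \<zero>\<^bsub>KV i n j\<^esub>"
  using arc_bounds by (auto simp: bin_apply Ix_Nil Fm_Nil)

lemma bout_rin: assumes "\<alpha> \<in> Br i n" shows "bout \<alpha> n (rin i n j c) = zB \<alpha> n j"
  using assms by (auto simp: bout_def rin_def dinj_apply Ix_Cons Pt_simps fun_eq_iff Fm_Cons)

lemma bout_bin: assumes "\<alpha> \<in> Br i n" "w \<in> BCar \<alpha> n j" shows "bout \<alpha> n (bin \<alpha> n j w) = w"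
proof
  fix p
  show "bout \<alpha> n (bin \<alpha> n j w) p = w p"
  proof (cases "p \<in> Ix (atgt \<alpha>) (n - adeg1 \<alpha>)")
    case True
    then have "\<alpha> # p \<in> Ix (asrc \<alpha>) n" using assms by (simp add: Ix_Cons)
    then show ?thesis using True by (simp add: bout_def bin_apply)
  next
    case False
    then show ?thesis using assms(2) by (auto simp: bout_def Pt_carrier PiE_def extensional_def)
  qed
qed

lemma bout_bin_diff: assumes "\<alpha> \<in> Br i n" "\<beta> \<in> Br i n" "\<beta> \<noteq> \<alpha>"
  shows "bout \<beta> n (bin \<alpha> n j w) = zB \<beta> n j"
  using assms by (auto simp: bout_def bin_def Ix_Cons Pt_simps fun_eq_iff Fm_Cons)

lemma Pt_ext:
  assumes x: "x \<in> Car i n j" "x' \<in> Car i n j" and r: "x [] = x' []" and b: "\<And>\<alpha>. \<alpha> \<in> Br i n \<Longrightarrow> bout \<alpha> n x = bout \<alpha> n x'"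
  shows "x = x'"
proof
  fix p
  show "x p = x' p"
  proof (cases "p \<in> Ix i n")
    case True
    show ?thesis
    proof (cases p)
      case (Cons \<alpha> q)
      then have q: "\<alpha> \<in> Br i n" "q \<in> Ix (atgt \<alpha>) (n - adeg1 \<alpha>)" using True by (auto simp: Ix_Cons)
      from b[OF q(1)] have "bout \<alpha> n x q = bout \<alpha> n x' q" by simp
      then show ?thesis using q(2) Cons by (simp add: bout_def)
    qed (use r in simp)
  next
    case False
    then show ?thesis using x by (auto simp: Pt_carrier PiE_def extensional_def)
  qed
qed

lemma Pt_decomp:
  assumes i: "i \<le> N" and x: "x \<in> Car i n j"
  shows "x = rin i n j (x []) \<oplus>\<^bsub>PV i n j\<^esub> finsum (PV i n j) (\<lambda>\<alpha>. bin \<alpha> n j (bout \<alpha> n x)) (Br i n)"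
proof -
  let ?U = "PV i n j"
  let ?f = "\<lambda>\<alpha>. bin \<alpha> n j (bout \<alpha> n x)"
  note U = Pt_VS[OF i, of n j]
  have fin: "finite (Br i n)" using finite_arcs by simp
  have bc: "bout \<alpha> n x \<in> BCar \<alpha> n j" if "\<alpha> \<in> Br i n" for \<alpha> using hm_closed[OF bout_hm[OF that] x] by simp
  have fc: "?f \<alpha> \<in> carrier ?U" if "\<alpha> \<in> Br i n" for \<alpha> using hm_closed[OF bin_hm[OF that], of _ j] bc[OF that] by simp
  have xr: "x [] \<in> Kar i n j" using hm_closed[OF rout_hm[OF i] x] by simp
  have rc: "rin i n j (x []) \<in> carrier ?U" by (rule hm_closed[OF rin_hm[OF i] xr])
  have sc: "finsum ?U ?f (Br i n) \<in> carrier ?U" using fc U by (intro VS_finsum_closed)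
  have tN: "\<beta> \<in> Br i n \<Longrightarrow> atgt \<beta> \<le> N" for \<beta> using arc_bounds by auto
  show ?thesis
  proof (rule Pt_ext[OF x])
    show "rin i n j (x []) \<oplus>\<^bsub>?U\<^esub> finsum ?U ?f (Br i n) \<in> carrier ?U" using rc sc U by simp
    have "(finsum ?U ?f (Br i n)) [] = finsum (KV i n j) (\<lambda>\<alpha>. ?f \<alpha> []) (Br i n)"
      by (rule lin_finsum[OF U kos_VS[OF i] hm_lin[OF rout_hm[OF i]] fin fc])
    also have "\<dots> = \<zero>\<^bsub>KV i n j\<^esub>" by (rule VS_finsum_zero[OF kos_VS[OF i]]) (rule rout_bin)
    finally have "(finsum ?U ?f (Br i n)) [] = \<zero>\<^bsub>KV i n j\<^esub>" .
    then show "x [] = (rin i n j (x []) \<oplus>\<^bsub>?U\<^esub> finsum ?U ?f (Br i n)) []"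
      using lin_add[OF hm_lin[OF rout_hm[OF i]] rc sc] rout_rin[OF i] xr kos_VS[OF i] by simp
    fix \<beta> assume b: "\<beta> \<in> Br i n"
    let ?W = "mcomp (Pt (atgt \<beta>) (n - adeg1 \<beta>)) (j - int (adeg2 \<beta>))"
    have W: "VS ?W" by (rule Pt_VS[OF tN[OF b]])
    have l: "bout \<beta> n \<in> lin ?U ?W" using hm_lin[OF bout_hm[OF b], of j] by simp
    have "bout \<beta> n (finsum ?U ?f (Br i n)) = finsum ?W (\<lambda>\<alpha>. bout \<beta> n (?f \<alpha>)) (Br i n)"
      by (rule lin_finsum[OF U W l fin fc])
    also have "\<dots> = bout \<beta> n (?f \<beta>)"
      by (rule VS_finsum_single[OF W fin b], rule lin_closed[OF l fc[OF b]], rule bout_bin_diff[OF _ b]) (assumption, blast)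
    also have "\<dots> = bout \<beta> n x" by (rule bout_bin[OF b bc[OF b]])
    finally show "bout \<beta> n x = bout \<beta> n (rin i n j (x []) \<oplus>\<^bsub>?U\<^esub> finsum ?U ?f (Br i n))"
      using lin_add[OF l rc sc] bout_rin[OF b] W bc[OF b] by simp
  qed
qed

text \<open>A numerical form of the comparison of first arrows in the order on paths: the first
  degree decides, and for equal first degree quotient arrows come below submodule arrows. Doubling
  leaves room for the second criterion.\<close>

definition rank :: "arrow \<Rightarrow> nat" where
  "rank \<alpha> = 2 * adeg1 \<alpha> + (if is_SubArrow \<alpha> then 1 else 0)"

text \<open>Elements supported on the root and the blocks of \<open>U\<close>. The root always
  belongs, since the differential of a block may have any component there; correspondingly the
  length-zero path is the greatest one.\<close>

definition Fil where
  "Fil U i n j = {x \<in> Car i n j. \<forall>\<beta>\<in>Br i n - U. bout \<beta> n x = zB \<beta> n j}"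

lemma Fil_gsub: assumes i: "i \<le> N" shows "gsub A (Pt i n) (Fil U i n)"
proof -
  have k: "gsub A (Pt i n) (\<lambda>j. {x \<in> Car i n j. bout \<beta> n x = zB \<beta> n j})" if b: "\<beta> \<in> Br i n" for \<beta>
  proof -
    have "atgt \<beta> \<le> N" using b arc_bounds by blast
    from gsub_ker[OF Pt_gm[OF i] gm_shift[OF Pt_gm[OF this]] A bout_hm[OF b]] show ?thesis by simp
  qed
  show ?thesis
    unfolding gsub_def
  proof (intro conjI allI ballI)
    fix j
    show "SUB (Fil U i n j) (PV i n j)"
    proof (rule SUB_I[OF Pt_VS[OF i]])
      show "Fil U i n j \<subseteq> Car i n j" by (auto simp: Fil_def)
      show "z\<^sub>P i n j \<in> Fil U i n j" 
        using SUB_zero[OF gsubD(1)[OF k, of _ j]] Pt_VS[OF i] by (simp add: Fil_def)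
      fix x x' assume "x \<in> Fil U i n j" "x' \<in> Fil U i n j"
      then show "x \<oplus>\<^bsub>PV i n j\<^esub> x' \<in> Fil U i n j" 
        using SUB_add[OF gsubD(1)[OF k, of _ j], of _ x x'] Pt_VS[OF i] by (simp add: Fil_def)
    next
      fix c x assume "c \<in> carrier K" "x \<in> Fil U i n j"
      then show "c \<odot>\<^bsub>PV i n j\<^esub> x \<in> Fil U i n j" 
        using SUB_smult[OF gsubD(1)[OF k, of _ j], of _ c x] Pt_VS[OF i] by (simp add: Fil_def)
    qed
  next
    fix j m x a assume "x \<in> Fil U i n j" "a \<in> ael A m"
    then show "mact (Pt i n) j m x a \<in> Fil U i n (j + m)"
      using gsubD(2)[OF k, of _ x j a m] gm_act_closed[OF Pt_gm[OF i], of x n j a m] by (simp add: Fil_def)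
  qed
qed

lemma mk_elem:
  assumes i: "i \<le> N" and c: "c \<in> Kar i n j" and u: "\<forall>\<alpha>\<in>Br i n. u \<alpha> \<in> BCar \<alpha> n j"
  obtains w where "w \<in> Car i n j" "w [] = c" "\<And>\<alpha>. \<alpha> \<in> Br i n \<Longrightarrow> bout \<alpha> n w = u \<alpha>"
proof
  let ?w = "\<lambda>p\<in>Ix i n. case p of [] \<Rightarrow> c | \<alpha> # q \<Rightarrow> u \<alpha> q"
  have "(case p of [] \<Rightarrow> c | \<alpha> # q \<Rightarrow> u \<alpha> q) \<in> el (Fm i n p) j" if p: "p \<in> Ix i n" for p
  proof (cases p)
    case Nil
    then show ?thesis using c by (simp add: Fm_Nil)
  next
    case (Cons \<alpha> q)
    then have "\<alpha> \<in> Br i n" "q \<in> Ix (atgt \<alpha>) (n - adeg1 \<alpha>)" using p by (auto simp: Ix_Cons)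
    then show ?thesis using u[rule_format, of \<alpha>] unfolding Cons Pt_carrier by (auto simp: Fm_Cons)
  qed
  then show "?w \<in> Car i n j" by (simp add: Pt_carrier)
  show "?w [] = c" using Ix_Nil[OF i] by simp
  fix \<alpha> assume a: "\<alpha> \<in> Br i n"
  show "bout \<alpha> n ?w = u \<alpha>"
  proof
    fix q
    show "bout \<alpha> n ?w q = u \<alpha> q"
      using a bspec[OF u a] by (cases "q \<in> Ix (atgt \<alpha>) (n - adeg1 \<alpha>)") (auto simp: bout_def Ix_Cons Pt_carrier PiE_def extensional_def)
  qed
qed

end

section \<open>Construction of the differentials\<close>

text \<open>The lifts are chosen once for all sources and degrees, because the differentials for
  different sources are built together.\<close>

locale res_lifts = res_setting K V R N M h for K :: "'k ring" (structure) and V :: "('k, 'v) module" and R N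
    and M :: "nat \<Rightarrow> ('k, ('v list \<Rightarrow> 'k) set set, 'm) gmod" and h +
  fixes G
  assumes G: "i \<le> N \<Longrightarrow> 1 \<le> k \<Longrightarrow> lifts i k (G i k)"
begin

text \<open>
  Triangularity: besides its diagonal block, the block of \<open>\<alpha>\<close> is only mapped to blocks of higher rank
  (the root summand is unconstrained when \<open>adeg1 \<alpha> \<le> m\<close>).
\<close>

definition block_map where
  "block_map d i m e \<longleftrightarrow> e \<in> hm A (Pt i (Suc m)) (Pt i m) \<and>
     (\<forall>j. \<forall>c\<in>Kar i (Suc m) j. e j (rin i (Suc m) j c) = rin i m j (dkm i m j c)) \<and>
     (\<forall>\<alpha>\<in>Br i m. \<forall>j. \<forall>w\<in>BCar \<alpha> (Suc m) j. bout \<alpha> m (e j (bin \<alpha> (Suc m) j w)) = d (atgt \<alpha>) (m - adeg1 \<alpha>) (j - int (adeg2 \<alpha>)) w) \<and>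
     (\<forall>\<alpha>\<in>Br i m. \<forall>j. \<forall>w\<in>BCar \<alpha> (Suc m) j. \<forall>\<beta>\<in>Br i m. \<beta> \<noteq> \<alpha> \<longrightarrow> \<not> rank \<alpha> < rank \<beta> \<longrightarrow>
       bout \<beta> m (e j (bin \<alpha> (Suc m) j w)) = zB \<beta> m j) \<and>
     (\<forall>\<alpha>\<in>Ar i m. \<forall>j. \<forall>w\<in>BCar \<alpha> (Suc m) j. e j (bin \<alpha> (Suc m) j w) = rin i m j (G i m \<alpha> j (w [])))"

text \<open>Covers the first \<open>n\<close> differentials for every source at once: a diagonal
  block of \<open>d i\<close> is an earlier differential for a target, so no single resolution can
  be built alone.\<close>

definition good where
  "good n d \<longleftrightarrow> (\<forall>i\<le>N. \<forall>m<n. block_map d i m (d i m) \<and>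
     (Suc m < n \<longrightarrow> (\<forall>j. \<forall>x\<in>Car i (Suc (Suc m)) j. d i m j (d i (Suc m) j x) = z\<^sub>P i m j)))"

lemma goodD:
  assumes "good n d" "i \<le> N" "m < n"
  shows "d i m \<in> hm A (Pt i (Suc m)) (Pt i m)"
    "c \<in> Kar i (Suc m) j \<Longrightarrow> d i m j (rin i (Suc m) j c) = rin i m j (dkm i m j c)"
    "\<alpha> \<in> Br i m \<Longrightarrow> w \<in> BCar \<alpha> (Suc m) j \<Longrightarrow> bout \<alpha> m (d i m j (bin \<alpha> (Suc m) j w)) = d (atgt \<alpha>) (m - adeg1 \<alpha>) (j - int (adeg2 \<alpha>)) w"
    "\<alpha> \<in> Br i m \<Longrightarrow> w \<in> BCar \<alpha> (Suc m) j \<Longrightarrow> \<beta> \<in> Br i m \<Longrightarrow> \<beta> \<noteq> \<alpha> \<Longrightarrow> \<not> rank \<alpha> < rank \<beta> \<Longrightarrow>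
       bout \<beta> m (d i m j (bin \<alpha> (Suc m) j w)) = zB \<beta> m j"
    "\<alpha> \<in> Ar i m \<Longrightarrow> w \<in> BCar \<alpha> (Suc m) j \<Longrightarrow> d i m j (bin \<alpha> (Suc m) j w) = rin i m j (G i m \<alpha> j (w []))"
    "Suc m < n \<Longrightarrow> x \<in> Car i (Suc (Suc m)) j \<Longrightarrow> d i m j (d i (Suc m) j x) = z\<^sub>P i m j"
proof goal_cases
  note g = assms(1)[unfolded good_def, rule_format, OF assms(2,3)]
  note c = conjunct1[OF g, unfolded block_map_def]
  note c1 = conjunct2[OF c] note c2 = conjunct2[OF c1] note c3 = conjunct2[OF c2]
  {
    case 1 show ?case by (rule conjunct1[OF c])
  next
    case 2 then show ?case by (rule conjunct1[OF c1, rule_format])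
  next
    case 3 then show ?case by (rule conjunct1[OF c2, rule_format])
  next
    case 4 then show ?case by (rule conjunct1[OF c3, rule_format])
  next
    case 5 then show ?case by (rule conjunct2[OF c3, rule_format])
  next
    case 6 then show ?case by (rule conjunct2[OF g, rule_format])
  }
qed

lemma tN: "\<beta> \<in> Br i n \<Longrightarrow> atgt \<beta> \<le> N" "\<beta> \<in> Ar i n \<Longrightarrow> atgt \<beta> \<le> N"
  using arc_bounds by auto

lemma bout_lin: "\<beta> \<in> Br i n \<Longrightarrow> bout \<beta> n \<in> lin (PV i n j) (mcomp (Pt (atgt \<beta>) (n - adeg1 \<beta>)) (j - int (adeg2 \<beta>)))"
  using hm_lin[OF bout_hm, of \<beta> i n j] by simp

lemma bin_lin: "\<beta> \<in> Br i n \<Longrightarrow> bin \<beta> n j \<in> lin (mcomp (Pt (atgt \<beta>) (n - adeg1 \<beta>)) (j - int (adeg2 \<beta>))) (PV i n j)"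
  using hm_lin[OF bin_hm, of \<beta> i n j] by simp

lemma rin_lin: "i \<le> N \<Longrightarrow> rin i n j \<in> lin (KV i n j) (PV i n j)"
  by (rule hm_lin[OF rin_hm])

lemma rout_lin: "i \<le> N \<Longrightarrow> (\<lambda>x. x []) \<in> lin (PV i n j) (KV i n j)"
  by (rule hm_lin[OF rout_hm])

lemma rout_closed: "i \<le> N \<Longrightarrow> x \<in> Car i n j \<Longrightarrow> x [] \<in> Kar i n j"
  by (rule lin_closed[OF rout_lin])

lemma dk_lin: "i \<le> N \<Longrightarrow> dkm i n j \<in> lin (KV i (Suc n) j) (KV i n j)"
  using hm_lin[OF quad_mod.dk_hm[OF quad]] .

lemma G_lin: "i \<le> N \<Longrightarrow> \<alpha> \<in> Ar i k \<Longrightarrow> G i k \<alpha> j \<in> lin (mcomp (kosm (atgt \<alpha>) 0) (j - int (adeg2 \<alpha>))) (KV i k j)"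
proof -
  assume i: "i \<le> N" and a: "\<alpha> \<in> Ar i k"
  then have k: "1 \<le> k" using arc_bounds[of \<alpha>] by auto
  show ?thesis using hm_lin[OF liftsD(1)[OF k G[OF i k] a], of j] by simp
qed

lemma d_expand:
  assumes i: "i \<le> N" and e: "\<phi> \<in> hm A (Pt i n) T" "gm A T" and z: "z \<in> Car i n j"
  shows "\<phi> j z = \<phi> j (rin i n j (z [])) \<oplus>\<^bsub>mcomp T j\<^esub> finsum (mcomp T j) (\<lambda>\<alpha>. \<phi> j (bin \<alpha> n j (bout \<alpha> n z))) (Br i n)"
proof -
  note U = Pt_VS[OF i, of n j]
  have fin: "finite (Br i n)" using finite_arcs by simp
  have b: "bin \<alpha> n j (bout \<alpha> n z) \<in> Car i n j" if "\<alpha> \<in> Br i n" for \<alpha>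
    by (rule lin_closed[OF bin_lin[OF that] lin_closed[OF bout_lin[OF that] z]])
  have r: "rin i n j (z []) \<in> Car i n j" by (rule lin_closed[OF rin_lin[OF i] rout_closed[OF i z]])
  have s: "finsum (PV i n j) (\<lambda>\<alpha>. bin \<alpha> n j (bout \<alpha> n z)) (Br i n) \<in> Car i n j"
    using b U by (intro VS_finsum_closed)
  show ?thesis
    by (subst Pt_decomp[OF i z], subst lin_add[OF hm_lin[OF e(1)] r s], subst lin_finsum[OF U gmD(1)[OF e(2)] hm_lin[OF e(1)] fin b])
      (assumption, rule refl)
qed

text \<open>The block of \<open>\<alpha>\<close> is reached only from itself and from blocks of
  strictly lower rank, while entering blocks and the root map into the root. With the lower
  components zero, the diagonal is all that is left.\<close>

lemma bout_d:
  assumes g: "good n d" "i \<le> N" "m < n" and a: "\<alpha> \<in> Br i m" and z: "z \<in> Car i (Suc m) j"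
    and low: "\<forall>\<beta>\<in>Br i (Suc m). rank \<beta> < rank \<alpha> \<longrightarrow> bout \<beta> (Suc m) z = zB \<beta> (Suc m) j"
  shows "bout \<alpha> m (d i m j z) = d (atgt \<alpha>) (m - adeg1 \<alpha>) (j - int (adeg2 \<alpha>)) (bout \<alpha> (Suc m) z)"
proof -
  note gd = goodD[OF g]
  let ?W = "mcomp (Pt (atgt \<alpha>) (m - adeg1 \<alpha>)) (j - int (adeg2 \<alpha>))"
  let ?\<phi> = "\<lambda>j x. bout \<alpha> m (d i m j x)"
  have e: "?\<phi> \<in> hm A (Pt i (Suc m)) (Blk \<alpha> m)" by (rule hm_comp[OF gd(1) bout_hm[OF a]])
  have T: "gm A (Blk \<alpha> m)" by (rule gm_shift[OF Pt_gm[OF tN(1)[OF a]]])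
  have W: "VS ?W" by (rule Pt_VS[OF tN(1)[OF a]])
  have a': "\<alpha> \<in> Br i (Suc m)" using a by auto
  have l: "?\<phi> j \<in> lin (PV i (Suc m) j) ?W" using hm_lin[OF e, of j] by simp
  have bc: "bout \<beta> (Suc m) z \<in> BCar \<beta> (Suc m) j" if "\<beta> \<in> Br i (Suc m)" for \<beta>
    by (rule lin_closed[OF bout_lin[OF that] z])
  have fin: "finite (Br i (Suc m))" using finite_arcs by simp
  have r: "?\<phi> j (rin i (Suc m) j (z [])) = \<zero>\<^bsub>?W\<^esub>"
    unfolding gd(2)[OF rout_closed[OF g(2) z]] by (rule bout_rin[OF a])
  have o: "?\<phi> j (bin \<beta> (Suc m) j (bout \<beta> (Suc m) z)) = \<zero>\<^bsub>?W\<^esub>" if b: "\<beta> \<in> Br i (Suc m)" "\<beta> \<noteq> \<alpha>" for \<beta>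
  proof (cases "adeg1 \<beta> = Suc m")
    case True
    then have bA: "\<beta> \<in> Ar i m" using b by auto
    show ?thesis unfolding gd(5)[OF bA bc[OF b(1)]] by (rule bout_rin[OF a])
  next
    case False
    then have b': "\<beta> \<in> Br i m" using b by auto
    show ?thesis
    proof (cases "rank \<beta> < rank \<alpha>")
      case True
      have "bin \<beta> (Suc m) j (bout \<beta> (Suc m) z) = z\<^sub>P i (Suc m) j"
        unfolding low[rule_format, OF b(1) True] by (rule lin_zero[OF Pt_VS[OF tN(1)[OF b(1)]] Pt_VS[OF g(2)] bin_lin[OF b(1)]])
      then show ?thesis using lin_zero[OF Pt_VS[OF g(2)] W l] by simp
    next
      case False
      show ?thesis using gd(4)[OF b' bc[OF b(1)] a _ False] b(2) by blast
    qed
  qed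
  have "?\<phi> j z = \<zero>\<^bsub>?W\<^esub> \<oplus>\<^bsub>?W\<^esub> finsum ?W (\<lambda>\<beta>. ?\<phi> j (bin \<beta> (Suc m) j (bout \<beta> (Suc m) z))) (Br i (Suc m))"
    using d_expand[OF g(2) e T z] unfolding r by simp
  also have "finsum ?W (\<lambda>\<beta>. ?\<phi> j (bin \<beta> (Suc m) j (bout \<beta> (Suc m) z))) (Br i (Suc m)) = ?\<phi> j (bin \<alpha> (Suc m) j (bout \<alpha> (Suc m) z))"
    by (rule VS_finsum_single[OF W fin a'], rule lin_closed[OF l lin_closed[OF bin_lin[OF a'] bc[OF a']]], rule o)
  also have "\<zero>\<^bsub>?W\<^esub> \<oplus>\<^bsub>?W\<^esub> \<dots> = \<dots>"
    by (rule VS_add(1)[OF W lin_closed[OF l lin_closed[OF bin_lin[OF a'] bc[OF a']]]])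
  finally show ?thesis using gd(3)[OF a bc[OF a']] by simp
qed

text \<open>Only the root and the entering blocks contribute, and both are mapped into the root; the
  resulting sum is of the form that \<open>lifts\<close> controls.\<close>

lemma root_d:
  assumes g: "good n d" "i \<le> N" "m < n" and z: "z \<in> Car i (Suc m) j"
    and low: "\<forall>\<beta>\<in>Br i m. bout \<beta> (Suc m) z = zB \<beta> (Suc m) j"
  shows "d i m j z = rin i m j (dkm i m j (z []) \<oplus>\<^bsub>KV i m j\<^esub> finsum (KV i m j) (\<lambda>\<alpha>. G i m \<alpha> j (bout \<alpha> (Suc m) z [])) (Ar i m))"
proof -
  note gd = goodD[OF g]
  let ?U = "PV i m j" and ?C = "KV i m j"
  let ?f = "\<lambda>\<alpha>. d i m j (bin \<alpha> (Suc m) j (bout \<alpha> (Suc m) z))"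
  have U: "VS ?U" by (rule Pt_VS[OF g(2)])
  have C: "VS ?C" by (rule kos_VS[OF g(2)])
  note l = hm_lin[OF gd(1), of j]
  have bc: "bout \<beta> (Suc m) z \<in> BCar \<beta> (Suc m) j" if "\<beta> \<in> Br i (Suc m)" for \<beta>
    by (rule lin_closed[OF bout_lin[OF that] z])
  have fin: "finite (Br i (Suc m))" "finite (Ar i m)" using finite_arcs by simp_all
  have AB: "Ar i m \<subseteq> Br i (Suc m)" by auto
  have fc: "?f \<beta> \<in> carrier ?U" if "\<beta> \<in> Br i (Suc m)" for \<beta>
    by (rule lin_closed[OF l lin_closed[OF bin_lin[OF that] bc[OF that]]])
  have gc: "G i m \<beta> j (bout \<beta> (Suc m) z []) \<in> carrier ?C" if "\<beta> \<in> Ar i m" for \<beta>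
  proof -
    have "bout \<beta> (Suc m) z \<in> Car (atgt \<beta>) 0 (j - int (adeg2 \<beta>))" using bc[of \<beta>] that by auto
    then show ?thesis by (rule lin_closed[OF G_lin[OF g(2) that] rout_closed[OF tN(2)[OF that]]])
  qed
  have "finsum ?U ?f (Br i (Suc m)) = finsum ?U ?f (Ar i m)"
  proof (rule VS_finsum_mono_neutral[OF U fin(1) AB fc])
    fix \<beta> assume b: "\<beta> \<in> Br i (Suc m)" "\<beta> \<notin> Ar i m"
    then have b': "\<beta> \<in> Br i m" by auto
    have "bin \<beta> (Suc m) j (bout \<beta> (Suc m) z) = z\<^sub>P i (Suc m) j"
      unfolding low[rule_format, OF b'] by (rule lin_zero[OF Pt_VS[OF tN(1)[OF b(1)]] Pt_VS[OF g(2)] bin_lin[OF b(1)]])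
    then show "?f \<beta> = \<zero>\<^bsub>?U\<^esub>" using lin_zero[OF Pt_VS[OF g(2)] U l] by simp
  qed
  also have "finsum ?U ?f (Ar i m) = finsum ?U (\<lambda>\<beta>. rin i m j (G i m \<beta> j (bout \<beta> (Suc m) z []))) (Ar i m)"
  proof (rule VS_finsum_cong[OF U refl])
    fix \<beta> assume b: "\<beta> \<in> Ar i m"
    show "rin i m j (G i m \<beta> j (bout \<beta> (Suc m) z [])) \<in> carrier ?U" by (rule lin_closed[OF rin_lin[OF g(2)] gc[OF b]])
    show "?f \<beta> = rin i m j (G i m \<beta> j (bout \<beta> (Suc m) z []))" using b AB by (intro gd(5) bc) auto
  qed
  also have "\<dots> = rin i m j (finsum ?C (\<lambda>\<beta>. G i m \<beta> j (bout \<beta> (Suc m) z [])) (Ar i m))"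
    by (rule lin_finsum[OF C U rin_lin[OF g(2)] fin(2) gc, symmetric])
  finally have s: "finsum ?U ?f (Br i (Suc m)) = rin i m j (finsum ?C (\<lambda>\<beta>. G i m \<beta> j (bout \<beta> (Suc m) z [])) (Ar i m))" .
  have sc: "finsum ?C (\<lambda>\<beta>. G i m \<beta> j (bout \<beta> (Suc m) z [])) (Ar i m) \<in> carrier ?C" using C gc by (rule VS_finsum_closed)
  note zr = rout_closed[OF g(2) z]
  show ?thesis
    unfolding lin_add[OF rin_lin[OF g(2)] lin_closed[OF dk_lin[OF g(2)] zr] sc]
    using d_expand[OF g(2) gd(1) Pt_gm[OF g(2)] z] unfolding s gd(2)[OF zr] .
qed

lemma adeg1_ge: "\<alpha> \<in> Br i n \<Longrightarrow> 2 \<le> adeg1 \<alpha>" "\<alpha> \<in> Ar i n \<Longrightarrow> 2 \<le> adeg1 \<alpha>"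
  using arc_bounds[of \<alpha>] by auto

lemma rout_zero: "i \<le> N \<Longrightarrow> z\<^sub>P i n j [] = \<zero>\<^bsub>KV i n j\<^esub>"
  by (rule lin_zero[OF Pt_VS kos_VS rout_lin])

lemma rin_zero: "i \<le> N \<Longrightarrow> rin i n j \<zero>\<^bsub>KV i n j\<^esub> = z\<^sub>P i n j"
  by (rule lin_zero[OF kos_VS Pt_VS rin_lin])

lemma rin_cancel: "i \<le> N \<Longrightarrow> rin i n j c = z\<^sub>P i n j \<Longrightarrow> c = \<zero>\<^bsub>KV i n j\<^esub>"
  using rout_rin rout_zero by metis

lemma Pt_root:
  assumes i: "i \<le> N" and x: "x \<in> Car i n j" and b: "\<And>\<beta>. \<beta> \<in> Br i n \<Longrightarrow> bout \<beta> n x = zB \<beta> n j"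
  shows "x = rin i n j (x [])"
proof (rule Pt_ext[OF x])
  show "rin i n j (x []) \<in> Car i n j" by (rule lin_closed[OF rin_lin[OF i] rout_closed[OF i x]])
  show "x [] = rin i n j (x []) []" by (rule rout_rin[OF i, symmetric])
  show "bout \<alpha> n x = bout \<alpha> n (rin i n j (x []))" if "\<alpha> \<in> Br i n" for \<alpha>
    unfolding b[OF that] bout_rin[OF that] ..
qed

text \<open>No arrow has first degree below 2, so the terms in degrees 0 and 1 are just the Koszul
  terms.\<close>

lemma Pt_small: "i \<le> N \<Longrightarrow> n < 2 \<Longrightarrow> x \<in> Car i n j \<Longrightarrow> x = rin i n j (x [])"
  by (rule Pt_root) (use adeg1_ge in fastforce)+

text \<open>Realises a Koszul boundary plus a combination of lifts as a value of the differential,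
  on an element supported on the root and the entering blocks.\<close>

lemma mk_root:
  assumes g: "good n d" "i \<le> N" "l < n" and c: "c \<in> Kar i (Suc l) j" and u: "\<forall>\<beta>\<in>Ar i l. u \<beta> \<in> Ko \<beta> j"
  obtains w where "w \<in> Car i (Suc l) j"
    "\<And>\<beta>. \<beta> \<in> Br i l \<Longrightarrow> bout \<beta> (Suc l) w = zB \<beta> (Suc l) j"
    "\<And>\<beta>. \<beta> \<in> Ar i l \<Longrightarrow> bout \<beta> (Suc l) w = rin (atgt \<beta>) 0 (j - int (adeg2 \<beta>)) (u \<beta>)"
    "d i l j w = rin i l j (dkm i l j c \<oplus>\<^bsub>KV i l j\<^esub> finsum (KV i l j) (\<lambda>\<beta>. G i l \<beta> j (u \<beta>)) (Ar i l))"
proof -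
  \<comment> \<open>The block of an entering arrow is a shifted 0-th term, which consists of its
    root alone, so \<open>u \<beta>\<close> determines the component there.\<close>
  define v where "v \<beta> = (if adeg1 \<beta> = Suc l then rin (atgt \<beta>) 0 (j - int (adeg2 \<beta>)) (u \<beta>)
    else zB \<beta> (Suc l) j)" for \<beta>
  have v1: "v \<beta> = zB \<beta> (Suc l) j" if "\<beta> \<in> Br i l" for \<beta>
    using that by (auto simp: v_def)
  have v2: "v \<beta> = rin (atgt \<beta>) 0 (j - int (adeg2 \<beta>)) (u \<beta>)" if "\<beta> \<in> Ar i l" for \<beta>
    using that by (auto simp: v_def)
  have split: "\<beta> \<in> Br i l \<or> \<beta> \<in> Ar i l" if "\<beta> \<in> Br i (Suc l)" for \<beta> using that by auto
  have B: "\<beta> \<in> Br i (Suc l)" if "\<beta> \<in> Br i l \<or> \<beta> \<in> Ar i l" for \<beta> using that by auto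
  have "\<forall>\<beta>\<in>Br i (Suc l). v \<beta> \<in> BCar \<beta> (Suc l) j"
  proof
    fix \<beta> assume b: "\<beta> \<in> Br i (Suc l)"
    from split[OF b] show "v \<beta> \<in> BCar \<beta> (Suc l) j"
    proof
      assume "\<beta> \<in> Br i l"
      from v1[OF this] show ?thesis using Pt_VS[OF tN(1)[OF b]] by simp
    next
      assume b': "\<beta> \<in> Ar i l"
      then have e: "Suc l - adeg1 \<beta> = 0" by simp
      show ?thesis unfolding v2[OF b'] e by (rule lin_closed[OF rin_lin[OF tN(1)[OF b]] u[rule_format, OF b']])
    qed
  qed
  from mk_elem[OF g(2) c this] obtain w where w: "w \<in> Car i (Suc l) j" "w [] = c" "\<And>\<beta>. \<beta> \<in> Br i (Suc l) \<Longrightarrow> bout \<beta> (Suc l) w = v \<beta>"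
    by blast
  have w1: "bout \<beta> (Suc l) w = zB \<beta> (Suc l) j" if "\<beta> \<in> Br i l" for \<beta>
    using w(3)[OF B] v1 that by simp
  have w2: "bout \<beta> (Suc l) w = rin (atgt \<beta>) 0 (j - int (adeg2 \<beta>)) (u \<beta>)" if "\<beta> \<in> Ar i l" for \<beta>
    using w(3)[OF B] v2 that by simp
  have "finsum (KV i l j) (\<lambda>\<beta>. G i l \<beta> j (bout \<beta> (Suc l) w [])) (Ar i l) = finsum (KV i l j) (\<lambda>\<beta>. G i l \<beta> j (u \<beta>)) (Ar i l)"
  proof (rule VS_finsum_cong[OF kos_VS[OF g(2)] refl])
    fix \<beta> assume b: "\<beta> \<in> Ar i l"
    show "G i l \<beta> j (u \<beta>) \<in> Kar i l j" by (rule lin_closed[OF G_lin[OF g(2) b] u[rule_format, OF b]])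
    show "G i l \<beta> j (bout \<beta> (Suc l) w []) = G i l \<beta> j (u \<beta>)" unfolding w2[OF b] rout_rin[OF tN(2)[OF b]] ..
  qed
  then have "d i l j w = rin i l j (dkm i l j c \<oplus>\<^bsub>KV i l j\<^esub> finsum (KV i l j) (\<lambda>\<beta>. G i l \<beta> j (u \<beta>)) (Ar i l))"
    using root_d[OF g w(1)] w1 w(2) by simp
  with w(1) w1 w2 show thesis by (rule that)
qed

text \<open>If the arrow of least rank was present one degree lower, its component is a cycle for
  the target by triangularity, and the induction hypothesis for the target applies. If it enters
  here, its component lies in the 0-th Koszul term of the target; the cycle condition in the root
  then makes a combination of lifts a Koszul boundary, and \<open>lifts\<close> forces the component
  to be a boundary as well.\<close>

lemma lift_min:
  assumes g: "good n d" "i \<le> N" "Suc l < n"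
    and IH: "\<forall>l'<l. \<forall>i'\<le>N. \<forall>j'. \<forall>z'\<in>Car i' (Suc l') j'. d i' l' j' z' = z\<^sub>P i' l' j' \<longrightarrow> (\<exists>w\<in>Car i' (Suc (Suc l')) j'. d i' (Suc l') j' w = z')"
    and a: "\<alpha> \<in> Br i (Suc l)" and min: "\<forall>\<beta>\<in>U \<inter> Br i (Suc l). rank \<alpha> \<le> rank \<beta>"
    and z: "z \<in> Fil U i (Suc l) j" "d i l j z = z\<^sub>P i l j"
  shows "\<exists>w\<in>BCar \<alpha> (Suc (Suc l)) j. d (atgt \<alpha>) (Suc l - adeg1 \<alpha>) (j - int (adeg2 \<alpha>)) w = bout \<alpha> (Suc l) z"
proof -
  let ?t = "atgt \<alpha>" and ?j = "j - int (adeg2 \<alpha>)"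
  have zC: "z \<in> Car i (Suc l) j" using z(1) by (simp add: Fil_def)
  have t: "?t \<le> N" by (rule tN(1)[OF a])
  have l: "l < n" using g(3) by simp
  have za: "bout \<alpha> (Suc l) z \<in> BCar \<alpha> (Suc l) j" by (rule lin_closed[OF bout_lin[OF a] zC])
  have low: "\<forall>\<beta>\<in>Br i (Suc l). rank \<beta> < rank \<alpha> \<longrightarrow> bout \<beta> (Suc l) z = zB \<beta> (Suc l) j"
  proof (intro ballI impI)
    fix \<beta> assume "\<beta> \<in> Br i (Suc l)" "rank \<beta> < rank \<alpha>"
    then have "\<beta> \<in> Br i (Suc l) - U" using bspec[OF min, of \<beta>] by auto
    then show "bout \<beta> (Suc l) z = zB \<beta> (Suc l) j" using z(1) unfolding Fil_def by blast
  qed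
  show ?thesis
  proof (cases "adeg1 \<alpha> \<le> l")
    case True
    then have a': "\<alpha> \<in> Br i l" using a by simp
    have s: "Suc l - adeg1 \<alpha> = Suc (l - adeg1 \<alpha>)" "Suc (Suc l) - adeg1 \<alpha> = Suc (Suc (l - adeg1 \<alpha>))" using True by simp_all
    have "d ?t (l - adeg1 \<alpha>) ?j (bout \<alpha> (Suc l) z) = bout \<alpha> l (d i l j z)"
      by (rule bout_d[OF g(1,2) l a' zC low, symmetric])
    also have "\<dots> = z\<^sub>P ?t (l - adeg1 \<alpha>) ?j"
      unfolding z(2) by (rule lin_zero[OF Pt_VS[OF g(2)] Pt_VS[OF t] bout_lin[OF a']])
    finally have "d ?t (l - adeg1 \<alpha>) ?j (bout \<alpha> (Suc l) z) = z\<^sub>P ?t (l - adeg1 \<alpha>) ?j" .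
    moreover have "l - adeg1 \<alpha> < l" using adeg1_ge(1)[OF a] True by simp
    ultimately show ?thesis using IH[rule_format, OF _ t za[unfolded s(1)]] unfolding s by blast
  next
    case False
    then have al: "\<alpha> \<in> Ar i l" and aS: "adeg1 \<alpha> = Suc l" using a by auto
    have l1: "1 \<le> l" using adeg1_ge(1)[OF a] aS by simp
    let ?C = "KV i l j"
    let ?u = "\<lambda>\<beta>. bout \<beta> (Suc l) z []"
    let ?s = "finsum ?C (\<lambda>\<beta>. G i l \<beta> j (?u \<beta>)) (Ar i l)"
    have C: "VS ?C" by (rule kos_VS[OF g(2)])
    have bc: "bout \<beta> (Suc l) z \<in> Car (atgt \<beta>) 0 (j - int (adeg2 \<beta>))" if "\<beta> \<in> Ar i l" for \<beta>
    proof -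
      have b: "\<beta> \<in> Br i (Suc l)" "Suc l - adeg1 \<beta> = 0" using that by auto
      show ?thesis using lin_closed[OF bout_lin[OF b(1)] zC] unfolding b(2) .
    qed
    have u: "\<forall>\<beta>\<in>Ar i l. ?u \<beta> \<in> Ko \<beta> j" using rout_closed[OF tN(2) bc] by blast
    have sc: "?s \<in> carrier ?C"
    proof (rule VS_finsum_closed[OF C])
      fix \<beta> assume b: "\<beta> \<in> Ar i l"
      show "G i l \<beta> j (?u \<beta>) \<in> carrier ?C" by (rule lin_closed[OF G_lin[OF g(2) b] bspec[OF u b]])
    qed
    have low': "\<forall>\<beta>\<in>Br i l. bout \<beta> (Suc l) z = zB \<beta> (Suc l) j"
    proof
      fix \<beta> assume "\<beta> \<in> Br i l"
      then have "\<beta> \<in> Br i (Suc l)" "rank \<beta> < rank \<alpha>" using aS by (auto simp: rank_def)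
      then show "bout \<beta> (Suc l) z = zB \<beta> (Suc l) j" using low by blast
    qed
    have zr: "z [] \<in> Kar i (Suc l) j" by (rule rout_closed[OF g(2) zC])
    have dz: "dkm i l j (z []) \<in> carrier ?C" by (rule lin_closed[OF dk_lin[OF g(2)] zr])
    have "dkm i l j (z []) \<oplus>\<^bsub>?C\<^esub> ?s = \<zero>\<^bsub>?C\<^esub>"
      by (rule rin_cancel[OF g(2)]) (use root_d[OF g(1,2) l zC low'] z(2) in simp)
    then have "dkm i l j (z []) = \<ominus>\<^bsub>?C\<^esub> ?s" using VS_cancel(5)[OF C dz sc] by simp
    then have "?s = \<ominus>\<^bsub>?C\<^esub> dkm i l j (z [])" using C sc by simp
    also have "\<dots> = dkm i l j (\<ominus>\<^bsub>KV i (Suc l) j\<^esub> z [])"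
      by (rule lin_neg[OF kos_VS[OF g(2)] C dk_lin[OF g(2)] zr, symmetric])
    finally have sB: "?s \<in> dkm i l j ` Kar i (Suc l) j" using zr kos_VS[OF g(2)] by simp
    have "?u \<alpha> \<in> Bd \<alpha> j"
    proof (rule liftsD(4)[OF l1 G[OF g(2) l1] u al sB])
      \<comment> \<open>For a submodule arrow, the quotient arrows of the same first degree have
        smaller rank, so their components vanish; this is where the order of the two kinds is
        used.\<close>
      show "is_QuotArrow \<alpha> \<or> (\<forall>\<beta>\<in>Ar i l. is_QuotArrow \<beta> \<longrightarrow> ?u \<beta> = \<zero>\<^bsub>mcomp (kosm (atgt \<beta>) 0) (j - int (adeg2 \<beta>))\<^esub>)"
      proof (cases "is_QuotArrow \<alpha>")
        case False
        have "?u \<beta> = \<zero>\<^bsub>mcomp (kosm (atgt \<beta>) 0) (j - int (adeg2 \<beta>))\<^esub>" if b: "\<beta> \<in> Ar i l" "is_QuotArrow \<beta>" for \<beta>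
        proof -
          have r: "\<beta> \<in> Br i (Suc l)" "rank \<beta> < rank \<alpha>" "Suc l - adeg1 \<beta> = 0"
            using b aS False by (auto simp: rank_def arrow.disc_eq_case split: arrow.splits)
          show ?thesis using low[rule_format, OF r(1,2)] rout_zero[OF tN(2)[OF b(1)], of 0] unfolding r(3) by simp
        qed
        then show ?thesis by blast
      qed simp
    qed
    then obtain c where c: "c \<in> Kar ?t (Suc 0) ?j" "?u \<alpha> = dkm ?t 0 ?j c" by blast
    have "rin ?t (Suc 0) ?j c \<in> Car ?t (Suc 0) ?j" by (rule lin_closed[OF rin_lin[OF t] c(1)])
    moreover have "d ?t 0 ?j (rin ?t (Suc 0) ?j c) = rin ?t 0 ?j (?u \<alpha>)"
      unfolding c(2) using g(3) by (intro goodD(2)[OF g(1) t _ c(1)]) simp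
    moreover have "bout \<alpha> (Suc l) z = rin ?t 0 ?j (?u \<alpha>)"
      by (rule Pt_small[OF t _ bc[OF al]]) simp
    moreover have "Suc l - adeg1 \<alpha> = 0" "Suc (Suc l) - adeg1 \<alpha> = Suc 0" using aS by simp_all
    ultimately show ?thesis by metis
  qed
qed

text \<open>A cycle is pushed to zero block by block, in increasing rank; what remains in the root is handled by the lifts.\<close>

lemma exact_Fil:
  assumes g: "good n d"
  shows "Suc l < n \<Longrightarrow> i \<le> N \<Longrightarrow> U \<subseteq> Out i \<Longrightarrow> \<forall>\<alpha>\<in>U. \<forall>\<beta>\<in>Out i. rank \<alpha> < rank \<beta> \<longrightarrow> \<beta> \<in> U \<Longrightarrow>
    \<forall>\<beta>\<in>Out i. Suc l < adeg1 \<beta> \<longrightarrow> \<beta> \<in> U \<Longrightarrow> z \<in> Fil U i (Suc l) j \<Longrightarrow> d i l j z = z\<^sub>P i l j \<Longrightarrow>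
    \<exists>w\<in>Fil U i (Suc (Suc l)) j. d i (Suc l) j w = z"
proof (induction l arbitrary: i U z j rule: less_induct)
  case outer: (less l)
  \<comment> \<open>With \<open>U\<close> consisting of all arrows out of the source,
    \<open>Fil\<close> is the whole term; in this form the outer hypothesis is applied to the
    targets.\<close>
  have IH: "\<forall>l'<l. \<forall>i'\<le>N. \<forall>j'. \<forall>z'\<in>Car i' (Suc l') j'. d i' l' j' z' = z\<^sub>P i' l' j' \<longrightarrow> (\<exists>w\<in>Car i' (Suc (Suc l')) j'. d i' (Suc l') j' w = z')"
  proof (intro allI impI ballI)
    fix l' i' j' z' assume h: "l' < l" "i' \<le> N" "z' \<in> Car i' (Suc l') j'" "d i' l' j' z' = z\<^sub>P i' l' j'"
    have F: "Fil (Out i') i' n j' = Car i' n j'" for n by (auto simp: Fil_def)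
    have "\<exists>w\<in>Fil (Out i') i' (Suc (Suc l')) j'. d i' (Suc l') j' w = z'"
      by (rule outer.IH[OF h(1) _ h(2) _ _ _ _ h(4)]) (use outer.prems(1) h(1,3) F in auto)
    then show "\<exists>w\<in>Car i' (Suc (Suc l')) j'. d i' (Suc l') j' w = z'" unfolding F .
  qed
  note l = outer.prems(1) and i = outer.prems(2)
  have l': "l < n" using l by simp
  note gl = goodD[OF g i l'] and gs = goodD[OF g i l]
  from outer.prems(3-7) show ?case
  \<comment> \<open>The inner induction removes from \<open>U\<close> a block of least rank among
    those present, which keeps \<open>U\<close> an upper set and leaves the arrows entering later in
    it.\<close>
  proof (induction "card (U \<inter> Br i (Suc l))" arbitrary: U z rule: less_induct)
    case (less U z)
    note U = less.prems(1-3) and z = less.prems(4,5)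
    have zC: "z \<in> Car i (Suc l) j" using z(1) by (simp add: Fil_def)
    have zF: "bout \<beta> (Suc l) z = zB \<beta> (Suc l) j" if "\<beta> \<in> Br i (Suc l)" "\<beta> \<notin> U" for \<beta>
      using z(1) that unfolding Fil_def by blast
    show ?case
    proof (cases "U \<inter> Br i (Suc l) = {}")
      case True
      \<comment> \<open>Only the root is left, and it is a Koszul cycle, hence a boundary modulo
        lifts. These lifts belong to arrows of first degree \<open>Suc (Suc l)\<close>, which lie in
        \<open>U\<close> by assumption.\<close>
      have zr: "z = rin i (Suc l) j (z [])" by (rule Pt_root[OF i zC], rule zF) (use True in blast)+
      have zk: "z [] \<in> Kar i (Suc l) j" by (rule rout_closed[OF i zC])
      have "rin i l j (dkm i l j (z [])) = z\<^sub>P i l j" using gl(2)[OF zk] zr z(2) by simp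
      then have dz: "dkm i (Suc l - 1) j (z []) = \<zero>\<^bsub>KV i (Suc l - 1) j\<^esub>" using rin_cancel[OF i] by simp
      have k: "1 \<le> Suc l" by simp
      obtain u c where uc: "c \<in> Kar i (Suc (Suc l)) j" "\<forall>\<alpha>\<in>Ar i (Suc l). u \<alpha> \<in> Ko \<alpha> j"
        "z [] = dkm i (Suc l) j c \<oplus>\<^bsub>KV i (Suc l) j\<^esub> finsum (KV i (Suc l) j) (\<lambda>\<alpha>. G i (Suc l) \<alpha> j (u \<alpha>)) (Ar i (Suc l))"
        using liftsD(3)[OF k G[OF i k] zk dz] by (elim exE bexE conjE)
      obtain w where w: "w \<in> Car i (Suc (Suc l)) j"
        "\<And>\<beta>. \<beta> \<in> Br i (Suc l) \<Longrightarrow> bout \<beta> (Suc (Suc l)) w = zB \<beta> (Suc (Suc l)) j"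
        "d i (Suc l) j w = rin i (Suc l) j (z [])"
        by (rule mk_root[OF g i l uc(1,2)]) (simp only: uc(3))
      have "w \<in> Fil U i (Suc (Suc l)) j"
        unfolding Fil_def
      proof (intro CollectI conjI ballI w(1))
        fix \<beta> assume b: "\<beta> \<in> Br i (Suc (Suc l)) - U"
        then have "\<beta> \<in> Br i (Suc l)" using U(3) by fastforce
        then show "bout \<beta> (Suc (Suc l)) w = zB \<beta> (Suc (Suc l)) j" by (rule w(2))
      qed
      then show ?thesis using w(3) zr by metis
    next
      case False
      then obtain \<alpha> where a: "\<alpha> \<in> U \<inter> Br i (Suc l)" and min: "\<forall>\<beta>\<in>U \<inter> Br i (Suc l). rank \<alpha> \<le> rank \<beta>"
        using ex_has_least_nat[of "\<lambda>\<alpha>. \<alpha> \<in> U \<inter> Br i (Suc l)" _ rank] by blast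
      have aU: "\<alpha> \<in> U" and aB: "\<alpha> \<in> Br i (Suc l)" and aB2: "\<alpha> \<in> Br i (Suc (Suc l))" using a by auto
      have t: "atgt \<alpha> \<le> N" by (rule tN(1)[OF aB])
      obtain wa where wa: "wa \<in> BCar \<alpha> (Suc (Suc l)) j" "d (atgt \<alpha>) (Suc l - adeg1 \<alpha>) (j - int (adeg2 \<alpha>)) wa = bout \<alpha> (Suc l) z"
        using lift_min[OF g i l IH aB min z] by blast
      let ?P = "PV i (Suc l) j"
      have P: "VS ?P" by (rule Pt_VS[OF i])
      \<comment> \<open>Subtracting the image of \<open>b\<close> cancels the component at
        \<open>\<alpha>\<close> and, by triangularity, otherwise disturbs only the root and blocks
        of higher rank, all of which lie in \<open>U\<close>.\<close>
      define b where "b = bin \<alpha> (Suc (Suc l)) j wa"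
      have bC: "b \<in> Car i (Suc (Suc l)) j" unfolding b_def by (rule lin_closed[OF bin_lin[OF aB2] wa(1)])
      note ls = hm_lin[OF gs(1), of j] and ll = hm_lin[OF gl(1), of j]
      have db: "d i (Suc l) j b \<in> carrier ?P" by (rule lin_closed[OF ls bC])
      define z' where "z' = z \<ominus>\<^bsub>?P\<^esub> d i (Suc l) j b"
      have z'C: "z' \<in> carrier ?P" unfolding z'_def using P zC db by simp
      have bz: "bout \<beta> (Suc l) z' = bout \<beta> (Suc l) z \<ominus>\<^bsub>mcomp (Pt (atgt \<beta>) (Suc l - adeg1 \<beta>)) (j - int (adeg2 \<beta>))\<^esub> bout \<beta> (Suc l) (d i (Suc l) j b)"
        if "\<beta> \<in> Br i (Suc l)" for \<beta>
        unfolding z'_def by (rule lin_minus[OF P Pt_VS[OF tN(1)[OF that]] bout_lin[OF that] zC db])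
      have z'F: "z' \<in> Fil (U - {\<alpha>}) i (Suc l) j"
        unfolding Fil_def
      proof (intro CollectI conjI ballI z'C)
        fix \<beta> assume b: "\<beta> \<in> Br i (Suc l) - (U - {\<alpha>})"
        then have bB: "\<beta> \<in> Br i (Suc l)" by simp
        have W: "VS (mcomp (Pt (atgt \<beta>) (Suc l - adeg1 \<beta>)) (j - int (adeg2 \<beta>)))" by (rule Pt_VS[OF tN(1)[OF bB]])
        show "bout \<beta> (Suc l) z' = zB \<beta> (Suc l) j"
        proof (cases "\<beta> = \<alpha>")
          case True
          have "bout \<alpha> (Suc l) (d i (Suc l) j b) = bout \<alpha> (Suc l) z"
            unfolding b_def gs(3)[OF aB wa(1)] by (rule wa(2))
          then show ?thesis using bz[OF bB] W lin_closed[OF bout_lin[OF bB] zC] unfolding True by simp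
        next
          case False
          then have bU: "\<beta> \<notin> U" using b by simp
          have "\<not> rank \<alpha> < rank \<beta>" using U(2) aU bU bB by blast
          then have "bout \<beta> (Suc l) (d i (Suc l) j b) = zB \<beta> (Suc l) j"
            unfolding b_def by (intro gs(4)[OF aB wa(1) bB False])
          then show ?thesis using bz[OF bB] zF[OF bB bU] W by simp
        qed
      qed
      have z'd: "d i l j z' = z\<^sub>P i l j"
        unfolding z'_def lin_minus[OF P Pt_VS[OF i] ll zC db] z(2) gl(6)[OF l bC] using Pt_VS[OF i] by simp
      have U1: "U - {\<alpha>} \<subseteq> Out i" using U(1) by blast
      have U2: "\<forall>\<alpha>'\<in>U - {\<alpha>}. \<forall>\<beta>\<in>Out i. rank \<alpha>' < rank \<beta> \<longrightarrow> \<beta> \<in> U - {\<alpha>}"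
      proof (intro ballI impI)
        fix \<alpha>' \<beta> assume h: "\<alpha>' \<in> U - {\<alpha>}" "\<beta> \<in> Out i" "rank \<alpha>' < rank \<beta>"
        have "\<beta> \<noteq> \<alpha>"
        proof
          assume "\<beta> = \<alpha>"
          then have r: "rank \<alpha>' < rank \<alpha>" using h(3) by simp
          then have "adeg1 \<alpha>' \<le> adeg1 \<alpha>" by (auto simp: rank_def split: if_splits)
          then have "\<alpha>' \<in> U \<inter> Br i (Suc l)" using h(1) U(1) aB by auto
          then show False using bspec[OF min, of \<alpha>'] r by simp
        qed
        then show "\<beta> \<in> U - {\<alpha>}" using U(2) h by blast
      qed
      have U3: "\<forall>\<beta>\<in>Out i. Suc l < adeg1 \<beta> \<longrightarrow> \<beta> \<in> U - {\<alpha>}" using U(3) aB by auto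
      have "(U - {\<alpha>}) \<inter> Br i (Suc l) \<subset> U \<inter> Br i (Suc l)" using a by blast
      then have "card ((U - {\<alpha>}) \<inter> Br i (Suc l)) < card (U \<inter> Br i (Suc l))"
        using finite_arcs by (intro psubset_card_mono) auto
      from less.hyps[OF this U1 U2 U3 z'F z'd] obtain w' where w': "w' \<in> Fil (U - {\<alpha>}) i (Suc (Suc l)) j" "d i (Suc l) j w' = z'"
        by blast
      have w'C: "w' \<in> Car i (Suc (Suc l)) j" using w'(1) by (simp add: Fil_def)
      have "w' \<in> Fil U i (Suc (Suc l)) j" using w'(1) unfolding Fil_def by blast
      moreover have "b \<in> Fil U i (Suc (Suc l)) j"
        unfolding Fil_def
      proof (intro CollectI conjI ballI bC)
        fix \<beta> assume "\<beta> \<in> Br i (Suc (Suc l)) - U"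
        then show "bout \<beta> (Suc (Suc l)) b = zB \<beta> (Suc (Suc l)) j"
          unfolding b_def using aU by (intro bout_bin_diff[OF aB2]) auto
      qed
      ultimately have "w' \<oplus>\<^bsub>mcomp (Pt i (Suc (Suc l))) j\<^esub> b \<in> Fil U i (Suc (Suc l)) j"
        by (rule SUB_add[OF gsubD(1)[OF Fil_gsub[OF i]]])
      moreover have "d i (Suc l) j (w' \<oplus>\<^bsub>mcomp (Pt i (Suc (Suc l))) j\<^esub> b) = z"
        unfolding lin_add[OF ls w'C bC] w'(2) z'_def by (rule VS_cancel(2)[OF P zC db])
      ultimately show ?thesis by blast
    qed
  qed
qed

end

lemma bchoice_bex: "\<forall>x\<in>S. \<exists>y\<in>T x. P x y \<Longrightarrow> \<exists>f. \<forall>x\<in>S. f x \<in> T x \<and> P x (f x)"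
  by metis

context res_lifts
begin

text \<open>Using only the differential of the target on the block of \<open>\<alpha>\<close> leaves
  the defect on the right-hand side. As this defect is also the image of an element supported on
  arrows of strictly higher rank, it can be cancelled there without touching the diagonal.\<close>

lemma lift_target:
  assumes g: "good (Suc l) d" "i \<le> N" and a: "\<alpha> \<in> Br i (Suc l)" and w: "w \<in> BCar \<alpha> (Suc (Suc l)) j"
  defines "x \<equiv> d (atgt \<alpha>) (Suc l - adeg1 \<alpha>) (j - int (adeg2 \<alpha>)) w"
  shows "\<exists>y'\<in>Fil {\<beta> \<in> Out i. rank \<alpha> < rank \<beta>} i (Suc l) j. d i l j y' = d i l j (bin \<alpha> (Suc l) j x)"
proof -
  let ?t = "atgt \<alpha>" and ?j = "j - int (adeg2 \<alpha>)" and ?U = "{\<beta> \<in> Out i. rank \<alpha> < rank \<beta>}"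
  have t: "?t \<le> N" by (rule tN(1)[OF a])
  have l: "l < Suc l" by simp
  have a2: "2 \<le> adeg1 \<alpha>" by (rule adeg1_ge(1)[OF a])
  note gd = goodD[OF g l]
  have s2: "Suc (Suc l) - adeg1 \<alpha> = Suc (Suc l - adeg1 \<alpha>)" using a by auto
  have gt: "Suc l - adeg1 \<alpha> < Suc l" using a2 by simp
  have xC: "x \<in> BCar \<alpha> (Suc l) j"
    unfolding x_def by (rule hm_closed[OF goodD(1)[OF g(1) t gt] w[unfolded s2]])
  have bx: "bin \<alpha> (Suc l) j x \<in> Car i (Suc l) j" by (rule lin_closed[OF bin_lin[OF a] xC])
  show ?thesis
  proof (cases "adeg1 \<alpha> \<le> l")
    case True
    then have a': "\<alpha> \<in> Br i l" using a by simp
    obtain l' where l': "l = Suc l'" using a2 True by (cases l) auto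
    have s: "Suc l - adeg1 \<alpha> = Suc (l - adeg1 \<alpha>)" using True by simp
    let ?v = "d i l j (bin \<alpha> (Suc l) j x)"
    have vC: "?v \<in> Car i l j" by (rule hm_closed[OF gd(1) bx])
    have v0: "bout \<alpha> l ?v = z\<^sub>P ?t (l - adeg1 \<alpha>) ?j"
    proof -
      have "bout \<alpha> l ?v = d ?t (l - adeg1 \<alpha>) ?j x" by (rule gd(3)[OF a' xC])
      also have "\<dots> = z\<^sub>P ?t (l - adeg1 \<alpha>) ?j"
        unfolding x_def s by (rule goodD(6)[OF g(1) t _ _ w[unfolded s2 s]]) (use a2 True in simp_all)
      finally show ?thesis .
    qed
    \<comment> \<open>The component at \<open>\<alpha>\<close> dies because the differentials for
      the target square to zero. The defect is thus a cycle supported on an upper set, where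
      exactness one degree lower applies.\<close>
    have "?v \<in> Fil ?U i (Suc l') j"
      unfolding Fil_def l'[symmetric]
    proof (intro CollectI conjI ballI vC)
      fix \<beta> assume b: "\<beta> \<in> Br i l - ?U"
      show "bout \<beta> l ?v = zB \<beta> l j"
      proof (cases "\<beta> = \<alpha>")
        case False
        then show ?thesis using b by (intro gd(4)[OF a' xC]) auto
      qed (use v0 in simp)
    qed
    moreover have "d i l' j ?v = z\<^sub>P i l' j"
      using goodD(6)[OF g, of l' "bin \<alpha> (Suc l) j x" j] bx unfolding l' by simp
    ultimately have "\<exists>y'\<in>Fil ?U i (Suc (Suc l')) j. d i (Suc l') j y' = ?v"
      by (intro exact_Fil[OF g(1)]) (use True g(2) in \<open>auto simp: l' rank_def\<close>)
    then show ?thesis by (simp add: l')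
  next
    case False
    then have aS: "adeg1 \<alpha> = Suc l" and al: "\<alpha> \<in> Ar i l" using a by auto
    have l1: "1 \<le> l" using a2 aS by simp
    have e: "Suc l - adeg1 \<alpha> = 0" "Suc (Suc l) - adeg1 \<alpha> = Suc 0" using aS by simp_all
    have w1: "w \<in> Car ?t (Suc 0) ?j" using w unfolding e .
    have wk: "w [] \<in> Kar ?t (Suc 0) ?j" by (rule rout_closed[OF t w1])
    have "x = d ?t 0 ?j (rin ?t (Suc 0) ?j (w []))" using Pt_small[OF t _ w1] unfolding x_def e by simp
    also have "\<dots> = rin ?t 0 ?j (dkm ?t 0 ?j (w []))" by (rule goodD(2)[OF g(1) t _ wk]) simp
    finally have x: "x [] = dkm ?t 0 ?j (w [])" using rout_rin[OF t] by simp
    \<comment> \<open>The root component of \<open>x\<close> is in the image of the first Koszul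
      differential of the target. Its lift is a boundary plus lifts for submodule arrows, the latter
      only when \<open>\<alpha>\<close> is a quotient arrow, so they have higher rank.\<close>
    obtain u c where uc: "c \<in> Kar i (Suc l) j"
        "\<forall>\<beta>\<in>Ar i l. u \<beta> \<in> Ko \<beta> j \<and> (\<not> (is_QuotArrow \<alpha> \<and> is_SubArrow \<beta>) \<longrightarrow> u \<beta> = \<zero>\<^bsub>mcomp (kosm (atgt \<beta>) 0) (j - int (adeg2 \<beta>))\<^esub>)"
        "G i l \<alpha> j (x []) = dkm i l j c \<oplus>\<^bsub>KV i l j\<^esub> finsum (KV i l j) (\<lambda>\<beta>. G i l \<beta> j (u \<beta>)) (Ar i l)"
      using liftsD(5)[OF l1 G[OF g(2) l1] al imageI[OF wk]] unfolding x by (elim exE bexE conjE)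
    have u: "\<forall>\<beta>\<in>Ar i l. u \<beta> \<in> Ko \<beta> j" using uc(2) by blast
    obtain y' where y': "y' \<in> Car i (Suc l) j"
      "\<And>\<beta>. \<beta> \<in> Br i l \<Longrightarrow> bout \<beta> (Suc l) y' = zB \<beta> (Suc l) j"
      "\<And>\<beta>. \<beta> \<in> Ar i l \<Longrightarrow> bout \<beta> (Suc l) y' = rin (atgt \<beta>) 0 (j - int (adeg2 \<beta>)) (u \<beta>)"
      "d i l j y' = rin i l j (G i l \<alpha> j (x []))"
      by (rule mk_root[OF g l uc(1) u]) (simp only: uc(3))
    have "y' \<in> Fil ?U i (Suc l) j"
      unfolding Fil_def
    proof (intro CollectI conjI ballI y'(1))
      fix \<beta> assume b: "\<beta> \<in> Br i (Suc l) - ?U"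
      show "bout \<beta> (Suc l) y' = zB \<beta> (Suc l) j"
      proof (cases "adeg1 \<beta> = Suc l")
        case True
        then have bl: "\<beta> \<in> Ar i l" and be: "Suc l - adeg1 \<beta> = 0" using b by auto
        have "\<not> (is_QuotArrow \<alpha> \<and> is_SubArrow \<beta>)" using b bl aS by (auto simp: rank_def arrow.disc_eq_case split: arrow.splits)
        then have "u \<beta> = \<zero>\<^bsub>mcomp (kosm (atgt \<beta>) 0) (j - int (adeg2 \<beta>))\<^esub>" using uc(2) bl by blast
        then show ?thesis unfolding y'(3)[OF bl] be by (simp only: rin_zero[OF tN(2)[OF bl]])
      next
        case False
        then show ?thesis using b by (intro y'(2)) auto
      qed
    qed
    moreover have "d i l j y' = d i l j (bin \<alpha> (Suc l) j x)" unfolding y'(4) gd(5)[OF al xC] ..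
    ultimately show ?thesis by blast
  qed
qed

text \<open>The map is the diagonal part plus a correction \<open>k\<close>. Freeness of the block
  gives \<open>k\<close> as a lift of minus the defect along the differential restricted to the
  higher blocks.\<close>

lemma step_block:
  assumes g: "good (Suc l) d" "i \<le> N" and a: "\<alpha> \<in> Br i (Suc l)"
  shows "\<exists>H\<in>hm A (Blk \<alpha> (Suc (Suc l))) (Pt i (Suc l)). \<forall>j. \<forall>w\<in>BCar \<alpha> (Suc (Suc l)) j.
     bout \<alpha> (Suc l) (H j w) = d (atgt \<alpha>) (Suc l - adeg1 \<alpha>) (j - int (adeg2 \<alpha>)) w \<and>
     (\<forall>\<beta>\<in>Br i (Suc l). \<beta> \<noteq> \<alpha> \<longrightarrow> \<not> rank \<alpha> < rank \<beta> \<longrightarrow> bout \<beta> (Suc l) (H j w) = zB \<beta> (Suc l) j) \<and>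
     d i l j (H j w) = z\<^sub>P i l j"
proof -
  let ?t = "atgt \<alpha>" and ?U = "{\<beta> \<in> Out i. rank \<alpha> < rank \<beta>}"
  let ?D = "\<lambda>j w. d ?t (Suc l - adeg1 \<alpha>) (j - int (adeg2 \<alpha>)) w"
  let ?b = "\<lambda>j w. bin \<alpha> (Suc l) j (?D j w)"
  let ?F = "Fil ?U i (Suc l)" and ?S = "gmod_sub (Pt i (Suc l)) (Fil ?U i (Suc l))"
  let ?P = "\<lambda>j. PV i (Suc l) j"
  have t: "?t \<le> N" by (rule tN(1)[OF a])
  have a2: "2 \<le> adeg1 \<alpha>" by (rule adeg1_ge(1)[OF a])
  have l: "l < Suc l" by simp
  note gd = goodD[OF g l]
  have s2: "Suc (Suc l) - adeg1 \<alpha> = Suc (Suc l - adeg1 \<alpha>)" using a by auto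
  have gt: "Suc l - adeg1 \<alpha> < Suc l" using a2 by simp
  have D: "?D \<in> hm A (Blk \<alpha> (Suc (Suc l))) (Blk \<alpha> (Suc l))"
    using hm_shift[OF goodD(1)[OF g(1) t gt], of "- int (adeg2 \<alpha>)"] by (simp add: s2)
  have b: "?b \<in> hm A (Blk \<alpha> (Suc (Suc l))) (Pt i (Suc l))" by (rule hm_comp[OF D bin_hm[OF a]])
  have Bg: "gm A (Blk \<alpha> (Suc (Suc l)))" by (rule gm_shift[OF Pt_gm[OF t]])
  have db: "(\<lambda>j w. d i l j (?b j w)) \<in> hm A (Blk \<alpha> (Suc (Suc l))) (Pt i l)" by (rule hm_comp[OF b gd(1)])
  have f: "(\<lambda>j w. \<ominus>\<^bsub>PV i l j\<^esub> d i l j (?b j w)) \<in> hm A (Blk \<alpha> (Suc (Suc l))) (Pt i l)"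
    by (rule hm_neg[OF Bg Pt_gm[OF g(2)] db])
  have Fs: "gsub A (Pt i (Suc l)) ?F" by (rule Fil_gsub[OF g(2)])
  have S: "gm A ?S" by (rule gm_sub[OF Pt_gm[OF g(2)] Fs])
  have gg: "d i l \<in> hm A ?S (Pt i l)" using hm_comp[OF hm_sub_incl[OF Fs] gd(1)] .
  have im: "\<forall>j. \<forall>w\<in>el (Blk \<alpha> (Suc (Suc l))) j. \<ominus>\<^bsub>PV i l j\<^esub> d i l j (?b j w) \<in> d i l j ` el ?S j"
  proof (intro allI ballI)
    fix j w assume "w \<in> el (Blk \<alpha> (Suc (Suc l))) j"
    then have "w \<in> BCar \<alpha> (Suc (Suc l)) j" by simp
    from lift_target[OF g a this] obtain y' where y': "y' \<in> ?F j" "d i l j y' = d i l j (?b j w)" by blast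
    have yC: "y' \<in> carrier (?P j)" using y'(1) by (simp add: Fil_def)
    have 1: "\<ominus>\<^bsub>?P j\<^esub> y' \<in> ?F j" by (rule SUB_neg[OF Pt_VS[OF g(2)] gsubD(1)[OF Fs] y'(1)])
    have 2: "d i l j (\<ominus>\<^bsub>?P j\<^esub> y') = \<ominus>\<^bsub>PV i l j\<^esub> d i l j (?b j w)"
      unfolding lin_neg[OF Pt_VS[OF g(2)] Pt_VS[OF g(2)] hm_lin[OF gd(1)] yC] y'(2) ..
    show "\<ominus>\<^bsub>PV i l j\<^esub> d i l j (?b j w) \<in> d i l j ` el ?S j"
    proof (rule image_eqI)
      show "\<ominus>\<^bsub>PV i l j\<^esub> d i l j (?b j w) = d i l j (\<ominus>\<^bsub>?P j\<^esub> y')" by (rule 2[symmetric])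
      show "\<ominus>\<^bsub>?P j\<^esub> y' \<in> el ?S j" using 1 by simp
    qed
  qed
  obtain k where k: "k \<in> hm A (Blk \<alpha> (Suc (Suc l))) ?S"
    "\<forall>j. \<forall>w\<in>el (Blk \<alpha> (Suc (Suc l))) j. d i l j (k j w) = \<ominus>\<^bsub>PV i l j\<^esub> d i l j (?b j w)"
    using Pt_lift[OF t S Pt_gm[OF g(2)] gg f im] by blast
  have k': "k \<in> hm A (Blk \<alpha> (Suc (Suc l))) (Pt i (Suc l))" using hm_comp[OF k(1) hm_sub_incl[OF Fs]] .
  let ?H = "\<lambda>j w. ?b j w \<oplus>\<^bsub>?P j\<^esub> k j w"
  show ?thesis
  proof (intro bexI[of _ ?H] allI ballI)
    show "?H \<in> hm A (Blk \<alpha> (Suc (Suc l))) (Pt i (Suc l))" by (rule hm_plus[OF Bg Pt_gm[OF g(2)] b k'])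
    fix j w assume w: "w \<in> BCar \<alpha> (Suc (Suc l)) j"
    then have w': "w \<in> el (Blk \<alpha> (Suc (Suc l))) j" by simp
    have Dc: "?D j w \<in> BCar \<alpha> (Suc l) j" using hm_closed[OF D w'] by simp
    have bc: "?b j w \<in> carrier (?P j)" by (rule hm_closed[OF b w'])
    have kc: "k j w \<in> carrier (?P j)" by (rule hm_closed[OF k' w'])
    have kF: "k j w \<in> ?F j" using hm_closed[OF k(1) w'] by simp
    have kz: "bout \<beta> (Suc l) (k j w) = zB \<beta> (Suc l) j" if "\<beta> \<in> Br i (Suc l)" "\<not> rank \<alpha> < rank \<beta>" for \<beta>
      using kF that unfolding Fil_def by blast
    note ab = lin_add[OF bout_lin bc kc]
    show "bout \<alpha> (Suc l) (?H j w) = ?D j w \<and>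
      (\<forall>\<beta>\<in>Br i (Suc l). \<beta> \<noteq> \<alpha> \<longrightarrow> \<not> rank \<alpha> < rank \<beta> \<longrightarrow> bout \<beta> (Suc l) (?H j w) = zB \<beta> (Suc l) j) \<and>
      d i l j (?H j w) = z\<^sub>P i l j"
    proof (intro conjI ballI impI)
      show "bout \<alpha> (Suc l) (?H j w) = ?D j w"
        unfolding ab[OF a] bout_bin[OF a Dc] kz[OF a less_irrefl] by (rule VS_add(2)[OF Pt_VS[OF t] Dc])
      show "d i l j (?H j w) = z\<^sub>P i l j"
        unfolding lin_add[OF hm_lin[OF gd(1)] bc kc] using k(2) w' hm_closed[OF db w'] Pt_VS[OF g(2)] by simp
      fix \<beta> assume b: "\<beta> \<in> Br i (Suc l)" "\<beta> \<noteq> \<alpha>" "\<not> rank \<alpha> < rank \<beta>"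
      show "bout \<beta> (Suc l) (?H j w) = zB \<beta> (Suc l) j"
        unfolding ab[OF b(1)] bout_bin_diff[OF a b(1,2)] kz[OF b(1,3)] using Pt_VS[OF tN(1)[OF b(1)]] by simp
    qed
  qed
qed

lemma step_blocks:
  assumes g: "good n d" "i \<le> N" and a: "\<alpha> \<in> Br i (Suc n)"
  shows "\<exists>H\<in>hm A (Blk \<alpha> (Suc n)) (Pt i n). \<forall>j. \<forall>w\<in>BCar \<alpha> (Suc n) j.
     (\<alpha> \<in> Br i n \<longrightarrow> bout \<alpha> n (H j w) = d (atgt \<alpha>) (n - adeg1 \<alpha>) (j - int (adeg2 \<alpha>)) w \<and>
       (\<forall>\<beta>\<in>Br i n. \<beta> \<noteq> \<alpha> \<longrightarrow> \<not> rank \<alpha> < rank \<beta> \<longrightarrow> bout \<beta> n (H j w) = zB \<beta> n j)) \<and>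
     (\<alpha> \<in> Ar i n \<longrightarrow> H j w = rin i n j (G i n \<alpha> j (w []))) \<and>
     (\<forall>l. n = Suc l \<longrightarrow> d i l j (H j w) = z\<^sub>P i l j)"
proof (cases "adeg1 \<alpha> \<le> n")
  case True
  then have a': "\<alpha> \<in> Br i n" "\<alpha> \<notin> Ar i n" using a by auto
  obtain l where l: "n = Suc l" using adeg1_ge(1)[OF a'(1)] True by (cases n) auto
  from step_block[OF g(1)[unfolded l] g(2) a'(1)[unfolded l]]
  show ?thesis using a' unfolding l by (elim bexE) (rule bexI, auto)
next
  case False
  then have aN: "\<alpha> \<in> Ar i n" "\<alpha> \<notin> Br i n" and e: "Suc n - adeg1 \<alpha> = 0" using a by auto
  let ?t = "atgt \<alpha>" and ?H = "\<lambda>j w. rin i n j (G i n \<alpha> j (w []))"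
  have t: "?t \<le> N" by (rule tN(1)[OF a])
  have n: "1 \<le> n" using adeg1_ge(2)[OF aN(1)] aN(1) by auto
  have r: "(\<lambda>j w. w []) \<in> hm A (Blk \<alpha> (Suc n)) (gmod_shift (kosm ?t 0) (- int (adeg2 \<alpha>)))"
    using hm_shift[OF rout_hm[OF t, of 0], of "- int (adeg2 \<alpha>)"] unfolding e .
  have H: "?H \<in> hm A (Blk \<alpha> (Suc n)) (Pt i n)"
    by (rule hm_comp[OF hm_comp[OF r liftsD(1)[OF n G[OF g(2) n] aN(1)]] rin_hm[OF g(2)]])
  have z: "d i l j (?H j w) = z\<^sub>P i l j" if l: "n = Suc l" and w: "w \<in> BCar \<alpha> (Suc n) j" for l j w
  proof -
    have wk: "w [] \<in> Ko \<alpha> j" using rout_closed[OF t w] unfolding e .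
    have ll: "l < n" using l by simp
    have "G i n \<alpha> j (w []) \<in> Kar i (Suc l) j" unfolding l[symmetric] by (rule lin_closed[OF G_lin[OF g(2) aN(1)] wk])
    from goodD(2)[OF g ll this] show ?thesis
      using liftsD(2)[OF n G[OF g(2) n] aN(1) wk] rin_zero[OF g(2)] unfolding l by simp
  qed
  show ?thesis
    by (intro bexI[of _ ?H] allI ballI conjI impI H) (use aN z in blast)+
qed

text \<open>The root carries the Koszul differential and each block its own map; a map on the direct
  sum is obtained by adding these after projection, and every condition is tested on one
  summand.\<close>

lemma step:
  assumes g: "good n d" and i: "i \<le> N"
  shows "\<exists>e. block_map d i n e \<and> (\<forall>l. n = Suc l \<longrightarrow> (\<forall>j. \<forall>x\<in>Car i (Suc n) j. d i l j (e j x) = z\<^sub>P i l j))"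
proof -
  obtain H where H: "\<forall>\<alpha>\<in>Br i (Suc n). H \<alpha> \<in> hm A (Blk \<alpha> (Suc n)) (Pt i n) \<and> (\<forall>j. \<forall>w\<in>BCar \<alpha> (Suc n) j.
     (\<alpha> \<in> Br i n \<longrightarrow> bout \<alpha> n (H \<alpha> j w) = d (atgt \<alpha>) (n - adeg1 \<alpha>) (j - int (adeg2 \<alpha>)) w \<and>
       (\<forall>\<beta>\<in>Br i n. \<beta> \<noteq> \<alpha> \<longrightarrow> \<not> rank \<alpha> < rank \<beta> \<longrightarrow> bout \<beta> n (H \<alpha> j w) = zB \<beta> n j)) \<and>
     (\<alpha> \<in> Ar i n \<longrightarrow> H \<alpha> j w = rin i n j (G i n \<alpha> j (w []))) \<and>
     (\<forall>l. n = Suc l \<longrightarrow> d i l j (H \<alpha> j w) = z\<^sub>P i l j))"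
    by (rule exE[OF bchoice_bex], rule ballI, rule step_blocks[OF g i], assumption, erule that)
  have Hh: "\<And>\<alpha>. \<alpha> \<in> Br i (Suc n) \<Longrightarrow> H \<alpha> \<in> hm A (Blk \<alpha> (Suc n)) (Pt i n)" using H by blast
  let ?h = "\<lambda>j x. rin i n j (dkm i n j (x []))"
  let ?f = "\<lambda>\<alpha> j x. H \<alpha> j (bout \<alpha> (Suc n) x)"
  let ?s = "\<lambda>j x. finsum (PV i n j) (\<lambda>\<alpha>. ?f \<alpha> j x) (Br i (Suc n))"
  define e where "e = (\<lambda>j x. ?h j x \<oplus>\<^bsub>PV i n j\<^esub> ?s j x)"
  have fin: "finite (Br i (Suc n))" using finite_arcs by simp
  note P1 = Pt_gm[OF i, of "Suc n"] and P0 = Pt_gm[OF i, of n]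
  note U = Pt_VS[OF i, of n]
  have h: "?h \<in> hm A (Pt i (Suc n)) (Pt i n)"
    by (rule hm_comp[OF hm_comp[OF rout_hm[OF i] quad_mod.dk_hm[OF quad[OF i]]] rin_hm[OF i]])
  have fh: "?f \<alpha> \<in> hm A (Pt i (Suc n)) (Pt i n)" if "\<alpha> \<in> Br i (Suc n)" for \<alpha>
    by (rule hm_comp[OF bout_hm[OF that] Hh[OF that]])
  have s: "?s \<in> hm A (Pt i (Suc n)) (Pt i n)" by (rule hm_sum[OF P1 P0 fin]) (use fh in blast)
  have eh: "e \<in> hm A (Pt i (Suc n)) (Pt i n)" unfolding e_def by (rule hm_plus[OF P1 P0 h s])
  have H0: "H \<alpha> j (zB \<alpha> (Suc n) j) = z\<^sub>P i n j" if "\<alpha> \<in> Br i (Suc n)" for \<alpha> j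
    using hm_zero_at[OF gm_shift[OF Pt_gm[OF tN(1)[OF that]]] P0 Hh[OF that], of j] by simp
  have er: "e j (rin i (Suc n) j c) = rin i n j (dkm i n j c)" if c: "c \<in> Kar i (Suc n) j" for j c
  proof -
    have "?s j (rin i (Suc n) j c) = z\<^sub>P i n j"
    proof (rule VS_finsum_zero[OF U])
      fix \<alpha> assume a: "\<alpha> \<in> Br i (Suc n)"
      show "?f \<alpha> j (rin i (Suc n) j c) = z\<^sub>P i n j" unfolding bout_rin[OF a] by (rule H0[OF a])
    qed
    then show ?thesis
      unfolding e_def rout_rin[OF i] using U lin_closed[OF rin_lin[OF i] lin_closed[OF dk_lin[OF i] c]] by simp
  qed
  have eb: "e j (bin \<alpha> (Suc n) j w) = H \<alpha> j w" if a: "\<alpha> \<in> Br i (Suc n)" and w: "w \<in> BCar \<alpha> (Suc n) j" for \<alpha> j w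
  proof -
    have Hw: "H \<alpha> j w \<in> Car i n j" using hm_closed[OF Hh[OF a], of w j] w by simp
    have "?s j (bin \<alpha> (Suc n) j w) = ?f \<alpha> j (bin \<alpha> (Suc n) j w)"
    proof (rule VS_finsum_single[OF U fin a])
      show "?f \<alpha> j (bin \<alpha> (Suc n) j w) \<in> Car i n j" unfolding bout_bin[OF a w] by (rule Hw)
      fix \<beta> assume b: "\<beta> \<in> Br i (Suc n)" "\<beta> \<noteq> \<alpha>"
      show "?f \<beta> j (bin \<alpha> (Suc n) j w) = z\<^sub>P i n j" unfolding bout_bin_diff[OF a b] by (rule H0[OF b(1)])
    qed
    moreover have "?h j (bin \<alpha> (Suc n) j w) = z\<^sub>P i n j"
      unfolding rout_bin[OF a] lin_zero[OF kos_VS[OF i] kos_VS[OF i] dk_lin[OF i]] by (rule rin_zero[OF i])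
    ultimately show ?thesis unfolding e_def using bout_bin[OF a w] Hw U by simp
  qed
  have B: "\<alpha> \<in> Br i (Suc n)" if "\<alpha> \<in> Br i n \<or> \<alpha> \<in> Ar i n" for \<alpha> using that by auto
  have e0: "d i l j (e j x) = z\<^sub>P i l j" if l: "n = Suc l" and x: "x \<in> Car i (Suc n) j" for l j x
  proof -
    have ll: "l < n" using l by simp
    note gd = goodD[OF g i ll]
    have dl: "d i l j \<in> lin (PV i n j) (PV i l j)" unfolding l by (rule hm_lin[OF gd(1)])
    have U': "VS (PV i l j)" by (rule Pt_VS[OF i])
    have xk: "x [] \<in> Kar i (Suc n) j" by (rule rout_closed[OF i x])
    have dk: "dkm i n j (x []) \<in> Kar i (Suc l) j" unfolding l[symmetric] by (rule lin_closed[OF dk_lin[OF i] xk])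
    have "dkm i l j (dkm i n j (x [])) = \<zero>\<^bsub>KV i l j\<^esub>"
      using quad_mod.dk_dk[OF quad[OF i], of _ l j] xk unfolding l by simp
    then have 1: "d i l j (?h j x) = z\<^sub>P i l j" using gd(2)[OF dk] rin_zero[OF i] unfolding l by simp
    have bx: "bout \<alpha> (Suc n) x \<in> BCar \<alpha> (Suc n) j" if "\<alpha> \<in> Br i (Suc n)" for \<alpha> by (rule lin_closed[OF bout_lin[OF that] x])
    have fc: "?f \<alpha> j x \<in> Car i n j" if "\<alpha> \<in> Br i (Suc n)" for \<alpha> by (rule hm_closed[OF fh[OF that] x])
    have "d i l j (?s j x) = finsum (PV i l j) (\<lambda>\<alpha>. d i l j (?f \<alpha> j x)) (Br i (Suc n))"
      by (rule lin_finsum[OF U U' dl fin fc])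
    also have "\<dots> = z\<^sub>P i l j"
    proof (rule VS_finsum_zero[OF U'])
      fix \<alpha> assume a: "\<alpha> \<in> Br i (Suc n)"
      show "d i l j (?f \<alpha> j x) = z\<^sub>P i l j" using bspec[OF H a] bx[OF a] l by blast
    qed
    finally show ?thesis
      unfolding e_def lin_add[OF dl hm_closed[OF h x] hm_closed[OF s x]] 1 using U' by simp
  qed
  show ?thesis
    unfolding block_map_def
  proof (intro exI[of _ e] eh conjI allI ballI impI)
    show "e j (rin i (Suc n) j c) = rin i n j (dkm i n j c)" if "c \<in> Kar i (Suc n) j" for j c by (rule er[OF that])
    show "bout \<alpha> n (e j (bin \<alpha> (Suc n) j w)) = d (atgt \<alpha>) (n - adeg1 \<alpha>) (j - int (adeg2 \<alpha>)) w"
      if a: "\<alpha> \<in> Br i n" and w: "w \<in> BCar \<alpha> (Suc n) j" for \<alpha> j w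
      unfolding eb[OF B[OF disjI1[OF a]] w] using bspec[OF H B[OF disjI1[OF a]]] a w by blast
    show "bout \<beta> n (e j (bin \<alpha> (Suc n) j w)) = zB \<beta> n j"
      if a: "\<alpha> \<in> Br i n" and w: "w \<in> BCar \<alpha> (Suc n) j" and b: "\<beta> \<in> Br i n" "\<beta> \<noteq> \<alpha>" "\<not> rank \<alpha> < rank \<beta>" for \<alpha> j w \<beta>
      unfolding eb[OF B[OF disjI1[OF a]] w] using bspec[OF H B[OF disjI1[OF a]]] a w b by blast
    show "e j (bin \<alpha> (Suc n) j w) = rin i n j (G i n \<alpha> j (w []))" if a: "\<alpha> \<in> Ar i n" and w: "w \<in> BCar \<alpha> (Suc n) j" for \<alpha> j w
      unfolding eb[OF B[OF disjI2[OF a]] w] using bspec[OF H B[OF disjI2[OF a]]] a w by blast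
    show "d i l j (e j x) = z\<^sub>P i l j" if "n = Suc l" "x \<in> Car i (Suc n) j" for l j x by (rule e0[OF that])
  qed
qed

text \<open>\<open>good n\<close> refers to \<open>d\<close> only below \<open>n\<close>, also
  through the targets, which makes it stable when \<open>d\<close> is extended.\<close>

lemma good_cong:
  assumes g: "good n d" and e: "\<And>i m. i \<le> N \<Longrightarrow> m < n \<Longrightarrow> d' i m = d i m"
  shows "good n d'"
proof -
  have t: "d' (atgt \<alpha>) (m - adeg1 \<alpha>) = d (atgt \<alpha>) (m - adeg1 \<alpha>)" if "\<alpha> \<in> Br i m" "m < n" for \<alpha> i m
    using tN(1)[OF that(1)] that(2) by (intro e) auto
  show ?thesis using g unfolding good_def by (auto simp: e t block_map_def)
qed

lemma good_Suc:
  assumes g: "good n d"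
  shows "\<exists>e. good (Suc n) (\<lambda>i m. if m = n then e i else d i m)"
proof -
  obtain e where e: "\<And>i. i \<le> N \<Longrightarrow> block_map d i n (e i)"
    "\<And>i l j x. i \<le> N \<Longrightarrow> n = Suc l \<Longrightarrow> x \<in> Car i (Suc n) j \<Longrightarrow> d i l j (e i j x) = z\<^sub>P i l j"
    using step[OF g] by metis
  let ?d = "\<lambda>i m. if m = n then e i else d i m"
  have gn: "good n ?d" by (rule good_cong[OF g]) simp
  have lt: "?d (atgt \<alpha>) (n - adeg1 \<alpha>) = d (atgt \<alpha>) (n - adeg1 \<alpha>)" if "\<alpha> \<in> Br i n" for \<alpha> i
    using adeg1_ge(1)[OF that] that by auto
  have "good (Suc n) ?d"
    unfolding good_def
  proof (intro allI impI conjI ballI)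
    fix i m assume im: "i \<le> N" "m < Suc n"
    show "block_map ?d i m (?d i m)"
    proof (cases "m = n")
      case True
      then show ?thesis using e(1)[OF im(1)] lt by (simp add: block_map_def)
    next
      case False
      then show ?thesis using gn im unfolding good_def by auto
    qed
    fix j x assume mn: "Suc m < Suc n" and x: "x \<in> Car i (Suc (Suc m)) j"
    show "?d i m j (?d i (Suc m) j x) = z\<^sub>P i m j"
    proof (cases "Suc m = n")
      case True
      then show ?thesis using e(2)[OF im(1), of m x j] x by auto
    next
      case False
      then show ?thesis using goodD(6)[OF gn im(1), of m x j] mn x by simp
    qed
  qed
  then show ?thesis by blast
qed

text \<open>Dependent choice: each stage extends the previous family, entries already fixed never
  change again, and the diagonal of the stages is good for every \<open>n\<close>.\<close>

lemma good_all: "\<exists>d. \<forall>n. good n d"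
proof -
  have g0: "good 0 d" for d by (simp add: good_def)
  define E where "E = (\<lambda>n d. SOME e. good (Suc n) (\<lambda>i m. if m = n then e i else d i m))"
  define D where "D = rec_nat (\<lambda>i m. undefined) (\<lambda>n d i m. if m = n then E n d i else d i m)"
  have D: "D (Suc n) = (\<lambda>i m. if m = n then E n (D n) i else D n i m)" for n unfolding D_def by simp
  have good: "good n (D n)" for n
  proof (induction n)
    case (Suc n)
    show ?case unfolding D using someI_ex[OF good_Suc[OF Suc]] unfolding E_def .
  qed (rule g0)
  have st: "m < n \<Longrightarrow> D n i m = D (Suc m) i m" for n m i
    by (induction n) (auto simp: D less_Suc_eq)
  have "good n (\<lambda>i m. D (Suc m) i m)" for n
    by (rule good_cong[OF good[of n]]) (rule st[symmetric])
  then show ?thesis by blast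
qed

section \<open>Exactness and minimality\<close>

lemma shift_0: "gmod_shift L 0 = L"
  by (simp add: gmod_shift_def)

lemma Pt_projective: "i \<le> N \<Longrightarrow> projective TYPE('x) TYPE('y) K A (Pt i n)"
  unfolding projective_def
proof (intro allI impI ballI)
  fix S :: "('k, ('v list \<Rightarrow> 'k) set set, 'x) gmod" and T :: "('k, ('v list \<Rightarrow> 'k) set set, 'y) gmod" and g f
  assume i: "i \<le> N" and ST: "gm A S \<and> bounded_below S \<and> gm A T \<and> bounded_below T" and g: "g \<in> hm A S T"
    and f: "f \<in> hm A (Pt i n) T" and surj: "\<forall>n. g n ` el S n = el T n"
  have f0: "f \<in> hm A (gmod_shift (Pt i n) 0) T" using f by (simp only: shift_0)
  have "\<forall>j. \<forall>w\<in>el (gmod_shift (Pt i n) 0) j. f j w \<in> g j ` el S j"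
    using hm_closed[OF f] surj by (simp only: shift_0) blast
  from Pt_lift[OF i _ _ g f0 this] ST show "\<exists>l\<in>hm A (Pt i n) S. \<forall>n'. \<forall>p\<in>el (Pt i n) n'. g n' (l n' p) = f n' p"
    by (simp only: shift_0)
qed

text \<open>The terms in degrees 0 and 1 consist of the root only, so the start of the complex is
  the Koszul augmentation; everywhere else exactness is the upper set statement for the set of all
  arrows.\<close>

lemma resolution:
  assumes g: "\<forall>n. good n d" and i: "i \<le> N"
  shows "\<exists>\<epsilon>. projective_resolution TYPE('x) TYPE('y) K A (M i) (Pt i) (d i) \<epsilon>"
proof -
  interpret i: quad_mod K V R "M i" using i by (rule quad)
  obtain eps where eps: "eps \<in> hm A (kosm i 0) (M i)" "\<forall>j. eps j ` Kar i 0 j = el (M i) j"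
    "\<forall>j. \<forall>x\<in>Kar i 0 j. eps j x = \<zero>\<^bsub>mcomp (M i) j\<^esub> \<longleftrightarrow> x \<in> dkm i 0 j ` Kar i (Suc 0) j"
    by (rule i.augmentation)
  have gd: "good n d" for n using g by blast
  note gdD = goodD[OF gd i lessI]
  let ?\<epsilon> = "\<lambda>j x. eps j (x [])"
  have rc: "rin i n j c \<in> Car i n j" if "c \<in> Kar i n j" for n j c by (rule lin_closed[OF rin_lin[OF i] that])
  have surj: "?\<epsilon> j ` Car i 0 j = el (M i) j" for j
  proof
    show "?\<epsilon> j ` Car i 0 j \<subseteq> el (M i) j" using rout_closed[OF i] eps(2) by blast
    show "el (M i) j \<subseteq> ?\<epsilon> j ` Car i 0 j"
    proof
      fix m assume "m \<in> el (M i) j"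
      then obtain c where c: "c \<in> Kar i 0 j" "m = eps j c" using eps(2) by blast
      show "m \<in> ?\<epsilon> j ` Car i 0 j" by (rule image_eqI[of _ _ "rin i 0 j c"]) (simp_all only: rout_rin[OF i] c(2) rc[OF c(1)])
    qed
  qed
  have k0: "d i 0 j ` Car i 1 j = a_kernel (PV i 0 j) (mcomp (M i) j) (?\<epsilon> j)" for j
  proof (rule Set.set_eqI)
    fix x
    have "x \<in> d i 0 j ` Car i 1 j \<longleftrightarrow> (\<exists>c\<in>Kar i (Suc 0) j. x = rin i 0 j (dkm i 0 j c))"
    proof
      assume "x \<in> d i 0 j ` Car i 1 j"
      then obtain w where w: "w \<in> Car i (Suc 0) j" "x = d i 0 j w" by auto
      have wr: "w = rin i (Suc 0) j (w [])" by (rule Pt_small[OF i _ w(1)]) simp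
      have "x = rin i 0 j (dkm i 0 j (w []))" using gdD(2)[OF rout_closed[OF i w(1)]] wr w(2) by simp
      then show "\<exists>c\<in>Kar i (Suc 0) j. x = rin i 0 j (dkm i 0 j c)" using rout_closed[OF i w(1)] by blast
    next
      assume "\<exists>c\<in>Kar i (Suc 0) j. x = rin i 0 j (dkm i 0 j c)"
      then obtain c where c: "c \<in> Kar i (Suc 0) j" "x = rin i 0 j (dkm i 0 j c)" by blast
      have "x = d i 0 j (rin i (Suc 0) j c)" using gdD(2)[OF c(1)] c(2) by simp
      then show "x \<in> d i 0 j ` Car i 1 j" using rc[OF c(1)] by simp
    qed
    also have "\<dots> \<longleftrightarrow> x \<in> Car i 0 j \<and> x [] \<in> dkm i 0 j ` Kar i (Suc 0) j"
    proof
      assume "\<exists>c\<in>Kar i (Suc 0) j. x = rin i 0 j (dkm i 0 j c)"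
      then obtain c where c: "c \<in> Kar i (Suc 0) j" "x = rin i 0 j (dkm i 0 j c)" by blast
      show "x \<in> Car i 0 j \<and> x [] \<in> dkm i 0 j ` Kar i (Suc 0) j"
        unfolding c(2) rout_rin[OF i] using c(1) rc[OF lin_closed[OF dk_lin[OF i] c(1)]] by blast
    next
      assume "x \<in> Car i 0 j \<and> x [] \<in> dkm i 0 j ` Kar i (Suc 0) j"
      then obtain c where c: "x \<in> Car i 0 j" "c \<in> Kar i (Suc 0) j" "x [] = dkm i 0 j c" by blast
      have "x = rin i 0 j (x [])" by (rule Pt_small[OF i _ c(1)]) simp
      then show "\<exists>c\<in>Kar i (Suc 0) j. x = rin i 0 j (dkm i 0 j c)" using c(2) unfolding c(3) by blast
    qed
    also have "\<dots> \<longleftrightarrow> x \<in> a_kernel (PV i 0 j) (mcomp (M i) j) (?\<epsilon> j)"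
      unfolding a_kernel_iff using eps(3) rout_closed[OF i] by blast
    finally show "x \<in> d i 0 j ` Car i 1 j \<longleftrightarrow> x \<in> a_kernel (PV i 0 j) (mcomp (M i) j) (?\<epsilon> j)" .
  qed
  have ks: "d i (Suc n) j ` Car i (Suc (Suc n)) j = a_kernel (PV i (Suc n) j) (PV i n j) (d i n j)" for n j
  proof
    have "Suc n < Suc (Suc n)" by simp
    note g6 = goodD(6)[OF gd i _ this] 
    show "d i (Suc n) j ` Car i (Suc (Suc n)) j \<subseteq> a_kernel (PV i (Suc n) j) (PV i n j) (d i n j)"
      using hm_closed[OF gdD(1)] g6 by (auto simp: a_kernel_iff)
    show "a_kernel (PV i (Suc n) j) (PV i n j) (d i n j) \<subseteq> d i (Suc n) j ` Car i (Suc (Suc n)) j"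
    proof
      fix x assume "x \<in> a_kernel (PV i (Suc n) j) (PV i n j) (d i n j)"
      then have x: "x \<in> Car i (Suc n) j" "d i n j x = z\<^sub>P i n j" by (simp_all add: a_kernel_iff)
      have F: "Fil (Out i) i m j = Car i m j" for m by (auto simp: Fil_def)
      have "\<exists>w\<in>Fil (Out i) i (Suc (Suc n)) j. d i (Suc n) j w = x"
        by (rule exact_Fil[OF gd lessI i _ _ _ _ x(2)]) (use x(1) F in auto)
      then show "x \<in> d i (Suc n) j ` Car i (Suc (Suc n)) j" unfolding F by blast
    qed
  qed
  have bM: "bounded_below (M i)" unfolding bounded_below_def using i.M_neg by blast
  have "projective_resolution TYPE('x) TYPE('y) K A (M i) (Pt i) (d i) ?\<epsilon>"
    unfolding projective_resolution_def
    by (intro conjI allI i.M bM Pt_gm[OF i] Pt_bounded[OF i] Pt_projective[OF i] gdD(1) hm_comp[OF rout_hm[OF i] eps(1)] surj k0 ks)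
  then show ?thesis by blast
qed

section \<open>The order on paths and minimality\<close>

lemma path_lessI:
  assumes "p \<noteq> []" "q \<noteq> []" "k \<le> min (length p) (length q)" "take k p = take k q"
    "k < length p \<and> k < length q \<and> adeg1 (p ! k) = adeg1 (q ! k) \<and> arrow_less (p ! k) (q ! k) \<or>
      k < length p \<and> k < length q \<and> adeg1 (p ! k) < adeg1 (q ! k) \<or> k = length q \<and> length q < length p"
  shows "path_less p q"
  using assms unfolding path_less_def by blast

lemma path_less_Cons: "path_less p q \<Longrightarrow> path_less (\<alpha> # p) (\<alpha> # q)"
proof (cases "q = []")
  case True
  assume "path_less p q"
  then have "p \<noteq> []" using True by (auto simp: path_less_def)
  then show ?thesis using True by (intro path_lessI[of _ _ 1]) (auto simp: Suc_le_eq)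
next
  case False
  assume "path_less p q"
  then obtain k where k: "k \<le> min (length p) (length q)" "take k p = take k q"
    "k < length p \<and> k < length q \<and> adeg1 (p ! k) = adeg1 (q ! k) \<and> arrow_less (p ! k) (q ! k) \<or>
         k < length p \<and> k < length q \<and> adeg1 (p ! k) < adeg1 (q ! k) \<or> k = length q \<and> length q < length p"
    using False unfolding path_less_def by blast
  show ?thesis by (rule path_lessI[of _ _ "Suc k"]) (use k in auto)
qed

text \<open>Connects the construction with the order in the statement: a smaller rank means a
  smaller first degree, or equal first degrees and \<open>arrow_less\<close>, and either decides the
  comparison at the first arrow.\<close>

lemma path_less_rank:
  assumes "asrc \<alpha> = asrc \<beta>" "rank \<alpha> < rank \<beta>"
  shows "path_less (\<alpha> # p) (\<beta> # q)"
proof -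
  have "adeg1 \<alpha> = adeg1 \<beta> \<and> arrow_less \<alpha> \<beta> \<or> adeg1 \<alpha> < adeg1 \<beta>"
    using assms by (auto simp: rank_def arrow_less_def arrow.disc_eq_case split: if_splits arrow.splits)
  then show ?thesis by (intro path_lessI[of _ _ 0]) auto
qed

text \<open>The inclusion of a path summand factors through the block of its first arrow, as the
  recursion along paths requires.\<close>

lemma dinj_Cons:
  assumes p: "\<alpha> # p \<in> Ix i n"
  shows "dinj (Ix i n) (Fm i n) (\<alpha> # p) j c = bin \<alpha> n j (dinj (Ix (atgt \<alpha>) (n - adeg1 \<alpha>)) (Fm (atgt \<alpha>) (n - adeg1 \<alpha>)) p (j - int (adeg2 \<alpha>)) c)"
proof
  fix q
  have a: "asrc \<alpha> = i" using p by (simp add: Ix_Cons)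
  show "dinj (Ix i n) (Fm i n) (\<alpha> # p) j c q = bin \<alpha> n j (dinj (Ix (atgt \<alpha>) (n - adeg1 \<alpha>)) (Fm (atgt \<alpha>) (n - adeg1 \<alpha>)) p (j - int (adeg2 \<alpha>)) c) q"
    by (cases "q \<in> Ix i n") (auto simp: bin_def a dinj_def Ix_Cons Fm_Cons split: list.split)
qed

text \<open>Triangularity for arrows becomes triangularity for paths by induction on the source
  path: within a diagonal block the differential for the target is used, and between different
  blocks the first arrows already decide.\<close>

lemma d_support:
  assumes g: "\<forall>n. good n d"
  shows "i \<le> N \<Longrightarrow> p \<in> Ix i (Suc n) \<Longrightarrow> c \<in> el (Fm i (Suc n) p) j \<Longrightarrow> q \<in> Ix i n \<Longrightarrow>
    d i n j (dinj (Ix i (Suc n)) (Fm i (Suc n)) p j c) q \<noteq> \<zero>\<^bsub>mcomp (Fm i n q) j\<^esub> \<Longrightarrow> p = q \<or> path_less p q"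
proof (induction p arbitrary: i n j c q)
  case Nil
  have gd: "good (Suc n) d" using g by blast
  have c: "c \<in> Kar i (Suc n) j" using Nil.prems(3) by (simp add: Fm_Nil)
  have "d i n j (dinj (Ix i (Suc n)) (Fm i (Suc n)) [] j c) = rin i n j (dkm i n j c)"
    unfolding rin_def[symmetric] by (rule goodD(2)[OF gd Nil.prems(1) lessI c])
  then show ?case using Nil.prems(4,5) by (auto simp: rin_def dinj_apply split: if_splits)
next
  case (Cons \<alpha> p)
  note i = Cons.prems(1)
  have gd: "good (Suc n) d" using g by blast
  note gD = goodD[OF gd i lessI]
  let ?t = "atgt \<alpha>" and ?j = "j - int (adeg2 \<alpha>)" and ?m = "Suc n - adeg1 \<alpha>"
  have a: "\<alpha> \<in> Br i (Suc n)" and p: "p \<in> Ix ?t ?m" using Cons.prems(2) by (auto simp: Ix_Cons)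
  have t: "?t \<le> N" by (rule tN(1)[OF a])
  have c: "c \<in> el (Fm ?t ?m p) ?j" using Cons.prems(3) by (simp add: Fm_Cons)
  let ?w = "dinj (Ix ?t ?m) (Fm ?t ?m) p ?j c"
  have w: "?w \<in> BCar \<alpha> (Suc n) j"
    unfolding Pt_eq by (rule hm_closed[OF hm_dinj[OF finite_Ix A Fm_gm[OF t] p] c])
  have ne: "d i n j (bin \<alpha> (Suc n) j ?w) q \<noteq> \<zero>\<^bsub>mcomp (Fm i n q) j\<^esub>"
    using Cons.prems(5) unfolding dinj_Cons[OF Cons.prems(2)] .
  show ?case
  proof (cases q)
    \<comment> \<open>The length-zero path exceeds every other path, so the unconstrained component
      in the root is harmless.\<close>
    case Nil
    then show ?thesis by (simp add: path_less_def)
  next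
    case q: (Cons \<beta> q')
    have b: "\<beta> \<in> Br i n" and q': "q' \<in> Ix (atgt \<beta>) (n - adeg1 \<beta>)" using Cons.prems(4) unfolding q by (auto simp: Ix_Cons)
    \<comment> \<open>An entering block maps into the root only, which is excluded here since
      \<open>q\<close> is nonempty.\<close>
    have an: "\<alpha> \<in> Br i n"
    proof (rule ccontr)
      assume "\<alpha> \<notin> Br i n"
      then have "\<alpha> \<in> Ar i n" using a by auto
      from gD(5)[OF this w] have "d i n j (bin \<alpha> (Suc n) j ?w) q = \<zero>\<^bsub>mcomp (Fm i n q) j\<^esub>"
        using Cons.prems(4) unfolding q by (simp add: rin_def dinj_apply)
      then show False using ne by contradiction
    qed
    have e: "d i n j (bin \<alpha> (Suc n) j ?w) q = bout \<beta> n (d i n j (bin \<alpha> (Suc n) j ?w)) q'"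
      using q' by (simp add: bout_def q)
    show ?thesis
    proof (cases "\<beta> = \<alpha>")
      case True
      have s: "?m = Suc (n - adeg1 \<alpha>)" using an by auto
      have q'': "q' \<in> Ix ?t (n - adeg1 \<alpha>)" using q' unfolding True .
      have "d ?t (n - adeg1 \<alpha>) ?j ?w q' \<noteq> \<zero>\<^bsub>mcomp (Fm ?t (n - adeg1 \<alpha>) q') ?j\<^esub>"
        using ne unfolding e True gD(3)[OF an w] unfolding q True by (simp add: Fm_Cons)
      then have "p = q' \<or> path_less p q'" using Cons.IH[OF t p[unfolded s] c[unfolded s] q''] unfolding s by blast
      then show ?thesis unfolding q True using path_less_Cons by blast
    next
      case False
      have "rank \<alpha> < rank \<beta>"
      proof (rule ccontr)
        assume r: "\<not> rank \<alpha> < rank \<beta>"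
        have "d i n j (bin \<alpha> (Suc n) j ?w) q = \<zero>\<^bsub>mcomp (Fm i n q) j\<^esub>"
          unfolding e gD(4)[OF an w b False r] using q' by (simp add: q Pt_simps Fm_Cons)
        then show False using ne by contradiction
      qed
      then show ?thesis unfolding q using a b by (intro disjI2 path_less_rank) auto
    qed
  qed
qed

text \<open>The internal degree in which the summand of the path \<open>p\<close> in the \<open>n\<close>-th term is generated.\<close>

definition gdeg :: "nat \<Rightarrow> arrow list \<Rightarrow> int" where
  "gdeg n p = int (n - bideg1 p) + int (bideg2 p)"

text \<open>Consequently generators for \<open>p\<close> in the next term and for \<open>q\<close>
  in the present one have equal internal degree exactly when \<open>dfdeg p = dfdeg q - 1\<close>,
  which explains the shift by one in the degree condition.\<close>

lemma gdeg_eq: "p \<in> Ix i n \<Longrightarrow> gdeg n p = int n + dfdeg p"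
  by (simp add: gdeg_def dfdeg_def Ix_def of_nat_diff)

lemma Fm_free:
  assumes "i \<le> N" "p \<in> Ix i n"
  shows "\<exists>C :: ('k, _) module. VS C \<and> Fm i n p = gmod_shift (gmod_free K C A) (- gdeg n p)"
proof -
  have t: "tgt i p \<le> N" using path_tgt assms by (simp add: Ix_def)
  interpret t: quad_mod K V R "M (tgt i p)" using t by (rule quad)
  show ?thesis
    by (rule exI[of _ "t.C (n - bideg1 p)"]) (use t.C_VS in \<open>simp add: Fm_def t.kos_eq shift_shift gdeg_def algebra_simps\<close>)
qed

lemma Fm_low:
  assumes "i \<le> N" "p \<in> Ix i n" "j < gdeg n p" "x \<in> el (Fm i n p) j"
  shows "x = \<zero>\<^bsub>mcomp (Fm i n p) j\<^esub>"
proof -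
  obtain C where C: "VS C" "Fm i n p = gmod_shift (gmod_free K C A) (- gdeg n p)" using Fm_free[OF assms(1,2)] by blast
  show ?thesis using free_neg[OF A C(1), of "j - gdeg n p"] assms(3,4) unfolding C(2) by (simp add: free_simps1)
qed

lemma Fm_gen:
  assumes i: "i \<le> N" and p: "p \<in> Ix i n" and T: "SUB T (mcomp (Fm i n p) j)" and x: "x \<in> el (Fm i n p) j"
    and g: "\<And>c a. c \<in> el (Fm i n p) (gdeg n p) \<Longrightarrow> a \<in> ael A (j - gdeg n p) \<Longrightarrow>
      mact (Fm i n p) (gdeg n p) (j - gdeg n p) c a \<in> T"
  shows "x \<in> T"
proof -
  obtain C where C: "VS C" and F: "Fm i n p = gmod_shift (gmod_free K C A) (- gdeg n p)" using Fm_free[OF i p] by blast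
  let ?W = "acomp A (j - gdeg n p)"
  have W: "VS ?W" by (rule galgebraD(1)[OF A])
  have e: "mcomp (Fm i n p) j = tensor K C ?W" unfolding F by (simp add: free_simps1)
  show ?thesis
  proof (rule tensor_SUB_all[OF C W T[unfolded e] _ x[unfolded e]])
    fix u a assume u: "u \<in> carrier C" and a: "a \<in> carrier ?W"
    have "tens K C (acomp A 0) u (aone A) \<in> el (Fm i n p) (gdeg n p)"
      unfolding F using bilin_closed[OF tens_bilin[OF C galgebraD(1)[OF A]] u galgebraD(4)[OF A]] by (simp add: free_simps1)
    from g[OF this a] show "tens K C ?W u a \<in> T" unfolding F tens_gen[OF A C u a] by simp
  qed
qed

text \<open>Above the generating degree of its summand, a component lies automatically in the part
  generated by the action in positive degrees, and below that degree it is zero. Only components in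
  the generating degree itself matter, and for images of the differential they vanish.\<close>

lemma minimal:
  assumes g: "\<forall>n. good n d" and i: "i \<le> N" and df: "dfdeg_condition Q i"
  shows "minimal_complex K A (Pt i) (d i)"
  unfolding minimal_complex_def
proof (intro allI subsetI)
  fix n j x assume "x \<in> d i n j ` Car i (Suc n) j"
  then obtain w where w: "w \<in> Car i (Suc n) j" and x: "x = d i n j w" by blast
  let ?P = "PV i n j"
  let ?S = "{mact (Pt i n) (j - m) m p a |m p a. 0 < m \<and> p \<in> Car i n (j - m) \<and> a \<in> ael A m}"
  have gd: "good (Suc n) d" using g by blast
  note dh = goodD(1)[OF gd i lessI]
  have P: "VS ?P" by (rule Pt_VS[OF i])
  have S: "?S \<subseteq> carrier ?P"
  proof
    fix y' assume "y' \<in> ?S"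
    then obtain m p a where "y' = mact (Pt i n) (j - m) m p a" "p \<in> Car i n (j - m)" "a \<in> ael A m" by blast
    then show "y' \<in> carrier ?P" using gm_act_closed[OF Pt_gm[OF i], of p n "j - m" a m] by simp
  qed
  have sp: "SUB (spn ?P ?S) ?P" using P S by (rule spn_SUB)
  have xC: "x \<in> carrier ?P" unfolding x by (rule hm_closed[OF dh w])
  have F: "VS (mcomp (Fm i m q) k)" "gm A (Fm i m q)" if "q \<in> Ix i m" for m q k
    using Fm_gm[OF i] gmD(1) that by blast+
  have inj: "dinj (Ix i m) (Fm i m) q \<in> hm A (Fm i m q) (Pt i m)" if "q \<in> Ix i m" for m q
    unfolding Pt_eq by (rule hm_dinj[OF finite_Ix A Fm_gm[OF i] that])
  have proj: "(\<lambda>j x. x q) \<in> hm A (Pt i m) (Fm i m q)" if "q \<in> Ix i m" for m q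
    unfolding Pt_eq by (rule hm_proj[OF finite_Ix that])
  have comp0: "d i n j (dinj (Ix i (Suc n)) (Fm i (Suc n)) p j c) q = \<zero>\<^bsub>mcomp (Fm i n q) j\<^esub>"
    if q: "q \<in> Ix i n" and jq: "j = gdeg n q" and p: "p \<in> Ix i (Suc n)" and c: "c \<in> el (Fm i (Suc n) p) j" for p q c
  proof -
    let ?\<phi> = "\<lambda>j c. d i n j (dinj (Ix i (Suc n)) (Fm i (Suc n)) p j c) q"
    have phi: "?\<phi> \<in> hm A (Fm i (Suc n) p) (Fm i n q)" by (rule hm_comp[OF hm_comp[OF inj[OF p] dh] proj[OF q]])
    \<comment> \<open>If the summand of \<open>p\<close> starts above \<open>j\<close>, it has
      nothing in degree \<open>j\<close>. If it starts below, its generators map to zero because the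
      summand of \<open>q\<close> starts at \<open>j\<close>. If it starts at \<open>j\<close>, a
      nonzero component would need \<open>p = q\<close> or \<open>p\<close> smaller than
      \<open>q\<close>; the degrees rule out the former, the degree condition the latter.\<close>
    consider "j < gdeg (Suc n) p" | "gdeg (Suc n) p < j" | "gdeg (Suc n) p = j" by linarith
    then show ?thesis
    proof cases
      case 1
      have "c = \<zero>\<^bsub>mcomp (Fm i (Suc n) p) j\<^esub>" by (rule Fm_low[OF i p 1 c])
      then show ?thesis using hm_zero_at[OF F(2)[OF p] F(2)[OF q] phi] by simp
    next
      case 2
      let ?s = "gdeg (Suc n) p"
      have "c \<in> {c \<in> el (Fm i (Suc n) p) j. ?\<phi> j c = \<zero>\<^bsub>mcomp (Fm i n q) j\<^esub>}"
      proof (rule Fm_gen[OF i p SUB_ker[OF F(1)[OF p] F(1)[OF q] hm_lin[OF phi]] c])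
        fix c a assume ca: "c \<in> el (Fm i (Suc n) p) ?s" "a \<in> ael A (j - ?s)"
        have 0: "?\<phi> ?s c = \<zero>\<^bsub>mcomp (Fm i n q) ?s\<^esub>"
          using 2 jq by (intro Fm_low[OF i q] hm_closed[OF phi ca(1)]) simp
        have "?\<phi> (?s + (j - ?s)) (mact (Fm i (Suc n) p) ?s (j - ?s) c a) = \<zero>\<^bsub>mcomp (Fm i n q) (?s + (j - ?s))\<^esub>"
          unfolding hm_act[OF phi ca] 0
          by (rule bilin_zero(1)[OF F(1)[OF q] galgebraD(1)[OF A] F(1)[OF q] gmD(2)[OF F(2)[OF q]] ca(2)])
        then show "mact (Fm i (Suc n) p) ?s (j - ?s) c a \<in> {c \<in> el (Fm i (Suc n) p) j. ?\<phi> j c = \<zero>\<^bsub>mcomp (Fm i n q) j\<^esub>}"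
          using gm_act_closed[OF F(2)[OF p] ca] by simp
      qed
      then show ?thesis by simp
    next
      case 3
      show ?thesis
      proof (rule ccontr)
        assume "\<not> ?thesis"
        then have pq: "p = q \<or> path_less p q" by (rule d_support[OF g i p c q])
        have e: "dfdeg p = dfdeg q - 1" using 3 jq gdeg_eq[OF p] gdeg_eq[OF q] by simp
        have "p \<in> paths_from Q i" "q \<in> paths_from Q i" using p q by (simp_all add: Ix_def)
        then show False using pq e df unfolding dfdeg_condition_def by auto
      qed
    qed
  qed
  have xq: "dinj (Ix i n) (Fm i n) q j (x q) \<in> spn ?P ?S" if q: "q \<in> Ix i n" for q
  proof -
    let ?s = "gdeg n q"
    have c: "x q \<in> el (Fm i n q) j" by (rule hm_closed[OF proj[OF q] xC])
    have z: "dinj (Ix i n) (Fm i n) q j \<zero>\<^bsub>mcomp (Fm i n q) j\<^esub> \<in> spn ?P ?S"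
      unfolding hm_zero_at[OF F(2)[OF q] Pt_gm[OF i] inj[OF q]] by (rule SUB_zero[OF sp])
    consider "j < ?s" | "?s < j" | "j = ?s" by linarith
    then show ?thesis
    proof cases
      case 1
      show ?thesis unfolding Fm_low[OF i q 1 c] by (rule z)
    next
      case 2
      have "x q \<in> {c \<in> el (Fm i n q) j. dinj (Ix i n) (Fm i n) q j c \<in> spn ?P ?S}"
      proof (rule Fm_gen[OF i q SUB_preimage[OF F(1)[OF q] P hm_lin[OF inj[OF q]] sp] c])
        fix c a assume ca: "c \<in> el (Fm i n q) ?s" "a \<in> ael A (j - ?s)"
        have "mact (Pt i n) ?s (j - ?s) (dinj (Ix i n) (Fm i n) q ?s c) a \<in> ?S"
          using 2 hm_closed[OF inj[OF q] ca(1)] ca(2)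
          by (intro CollectI exI[of _ "j - ?s"] exI[of _ "dinj (Ix i n) (Fm i n) q ?s c"] exI[of _ a]) simp
        from spn_incl[OF P S this]
        have "dinj (Ix i n) (Fm i n) q (?s + (j - ?s)) (mact (Fm i n q) ?s (j - ?s) c a) \<in> spn ?P ?S"
          unfolding hm_act[OF inj[OF q] ca] .
        then show "mact (Fm i n q) ?s (j - ?s) c a \<in> {c \<in> el (Fm i n q) j. dinj (Ix i n) (Fm i n) q j c \<in> spn ?P ?S}"
          using gm_act_closed[OF F(2)[OF q] ca] by simp
      qed
      then show ?thesis by simp
    next
      case 3
      let ?D = "\<lambda>p. dinj (Ix i (Suc n)) (Fm i (Suc n)) p j (w p)"
      have wp: "w p \<in> el (Fm i (Suc n) p) j" if "p \<in> Ix i (Suc n)" for p by (rule hm_closed[OF proj[OF that] w])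
      have "w = finsum (PV i (Suc n) j) ?D (Ix i (Suc n))"
        using dirsum_decomp[OF finite_Ix A Fm_gm[OF i] w[unfolded Pt_eq]] unfolding Pt_eq .
      then have "x q = d i n j (finsum (PV i (Suc n) j) ?D (Ix i (Suc n))) q" unfolding x by simp
      also have "\<dots> = finsum (mcomp (Fm i n q) j) (\<lambda>p. d i n j (?D p) q) (Ix i (Suc n))"
        by (rule lin_finsum[OF Pt_VS[OF i] F(1)[OF q] hm_lin[OF hm_comp[OF dh proj[OF q]]] finite_Ix hm_closed[OF inj wp]])
      also have "\<dots> = \<zero>\<^bsub>mcomp (Fm i n q) j\<^esub>"
        by (rule VS_finsum_zero[OF F(1)[OF q]]) (rule comp0[OF q 3 _ wp])
      finally show ?thesis using z by simp
    qed
  qed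
  have "x = finsum ?P (\<lambda>q. dinj (Ix i n) (Fm i n) q j (x q)) (Ix i n)"
    using dirsum_decomp[OF finite_Ix A Fm_gm[OF i] xC[unfolded Pt_eq]] unfolding Pt_eq .
  also have "\<dots> \<in> spn ?P ?S" by (rule SUB_finsum[OF P sp finite_Ix xq])
  finally show "x \<in> spn ?P ?S" .
qed

end

lemma (in res_setting) resolution_exists:
  assumes i: "i \<le> N"
  shows "\<exists>d \<epsilon>. projective_resolution TYPE('x) TYPE('y) K A (M i) (resolution_term K V R N M h i) d \<epsilon> \<and>
    (dfdeg_condition Q i \<longrightarrow> minimal_complex K A (resolution_term K V R N M h i) d)"
proof -
  have "\<exists>g. i \<le> N \<longrightarrow> 1 \<le> k \<longrightarrow> lifts i k g" for i k using arrow_lifts by blast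
  then obtain G where G: "\<And>i k. i \<le> N \<Longrightarrow> 1 \<le> k \<Longrightarrow> lifts i k (G i k)" by metis
  interpret res_lifts K V R N M h G
    by unfold_locales (rule G)
  obtain d where d: "\<forall>n. good n d" using good_all by blast
  have P: "resolution_term K V R N M h i = Pt i" by (rule ext) (simp add: Pt_def)
  show ?thesis unfolding P using resolution[OF d i] minimal[OF d i] by blast
qed

text \<open>\<open>dfdeg\<close> is additive along paths, so all its values are even and no two of
  them differ by 1.\<close>

lemma even_dfdeg_condition:
  assumes "\<forall>\<alpha>\<in>arcs Q. even (dfdeg [\<alpha>])"
  shows "dfdeg_condition Q i"
proof -
  have e: "even (dfdeg p)" if "set p \<subseteq> arcs Q" for p
    using that
  proof (induction p)
    case (Cons \<alpha> p)
    have "dfdeg (\<alpha> # p) = dfdeg [\<alpha>] + dfdeg p" by (simp add: dfdeg_def bideg1_def bideg2_def)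
    then show ?case using Cons assms by simp
  qed (simp add: dfdeg_def bideg1_def bideg2_def)
  have s: "set p \<subseteq> arcs Q" if "p \<in> paths_from Q i" for p
    using that by (auto simp: paths_from_def pre_digraph.awalk_def)
  show ?thesis
    unfolding dfdeg_condition_def
  proof (intro ballI impI notI)
    fix p q assume "p \<in> paths_from Q i" "q \<in> paths_from Q i" "dfdeg p = dfdeg q - 1"
    then show False using e[OF s, of p] e[OF s, of q] by presburger
  qed
qed

theorem theorem2p10:
  fixes K :: "'k ring"
    and V :: "('k, 'v) module"
    and R :: "('v list \<Rightarrow> 'k) set set"
    and N :: nat
    and M :: "nat \<Rightarrow> ('k, ('v list \<Rightarrow> 'k) set set, 'm) gmod"
    and h :: "nat \<Rightarrow> nat \<Rightarrow> nat \<Rightarrow> nat \<Rightarrow> nat \<times> nat"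
  assumes "field K"
    and "vectorspace K V" and "vectorspace.fin_dim K V"
    and "VectorSpace.subspace K R (tensor_power K V 2)"
    and "resolving_datum K V R N M h"
    and "Digraph_Component.connected (resolving_quiver N h)"
  shows "\<forall>i\<le>N.
    (\<exists>d \<epsilon>.
       projective_resolution TYPE('x) TYPE('y) K (quad_alg K V R) (M i)
         (resolution_term K V R N M h i) d \<epsilon> \<and>
       (dfdeg_condition (resolving_quiver N h) i \<longrightarrow>
          minimal_complex K (quad_alg K V R) (resolution_term K V R N M h i) d)) \<and>
    ((\<forall>\<alpha>\<in>arcs (resolving_quiver N h). even (dfdeg [\<alpha>])) \<longrightarrow>
       dfdeg_condition (resolving_quiver N h) i)"
proof (intro allI impI conjI)
  interpret kfield K by (rule kfield.intro) (rule assms(1))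
  interpret res_setting K V R N M h
    by (intro res_setting.intro quad_setting.intro quad_setting_axioms.intro res_setting_axioms.intro
        kfield_axioms assms(2,3,5) conjunct2[OF assms(4)[unfolded subspace_SUB]])
  show "\<exists>d \<epsilon>. projective_resolution TYPE('x) TYPE('y) K (quad_alg K V R) (M i) (resolution_term K V R N M h i) d \<epsilon> \<and>
      (dfdeg_condition (resolving_quiver N h) i \<longrightarrow> minimal_complex K (quad_alg K V R) (resolution_term K V R N M h i) d)"
    if "i \<le> N" for i
    using that by (rule resolution_exists)
  show "dfdeg_condition (resolving_quiver N h) i" if "\<forall>\<alpha>\<in>arcs (resolving_quiver N h). even (dfdeg [\<alpha>])" for i
    using that by (rule even_dfdeg_condition)
qed

end
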